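(* Let $\mathbb{K}$ be a commutative superring, $N\ge2$ an integer and $\varphi\in\mathbb{K}_0[t]/t^N$. The map $\Phi:\mathfrak{g}\ni a\mapsto\Phi^a\in Hom(S(\mathfrak{g}),S(\mathfrak{g}))$ is a representation by coderivations for every $N$-nilpotent Lie $\mathbb{K}$-superalgebra $\mathfrak{g}$ if and only if $$\varphi(u)\frac{\varphi(t+u)-\varphi(t)}{u}+\varphi(t)\frac{\varphi(t+u)-\varphi(u)}{t}=-\varphi(t+u)$$ in $\mathbb{K}_0[t,u]/I_N$, where $I_N$ is the ideal generated by $\{t^iu^j: i+j\ge N-1\}$.
   Context: Conventions. A commutative superring $\mathbb{K}=\mathbb{K}_0\oplus\mathbb{K}_1$ is a unital $\mathbb{Z}/2$-graded ring with $ab=(-1)^{p(a)p(b)}ba$ and $a^2=0$ for $a\in\mathbb{K}_1$; $p$ denotes parity, and formulas containing $p(\cdot)$ are written for nonzero homogeneous elements and extended by linearity. A $\mathbb{K}$-module $M=M_0\oplus M_1$ is a graded right module with $p(m\alpha)=p(m)+p(\alpha)$, and $\alpha m:=(-1)^{p(\alpha)p(m)}m\alpha$. $Hom(M,N)$ is the graded group of right $\mathbb{K}$-linear maps; $(F\otimes G)(v\otimes w)=(-1)^{p(G)p(v)}F(v)\otimes G(w)$; $[F,G]=F\circ G-(-1)^{p(F)p(G)}G\circ F$ on $Hom(M,M)$. A Lie $\mathbb{K}$-superalgebra is a $\mathbb{K}$-module $\mathfrak{g}$ with an even $\mathbb{K}$-bilinear bracket satisfying $[X,Y]=-(-1)^{p(X)p(Y)}[Y,X]$;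 $[X,X]=0$ for $X\in\mathfrak{g}_0$; $[[X,Y],Z]=[X,[Y,Z]]-(-1)^{p(X)p(Y)}[Y,[X,Z]]$; $[Y,[Y,Y]]=0$ for $Y\in\mathfrak{g}_1$. Write $\mathrm{ad}X=[X,\cdot]$. $\mathfrak{g}$ is $N$-nilpotent if $\mathrm{ad}X_1\circ\cdots\circ\mathrm{ad}X_N=0$ for all $X_1,\dots,X_N\in\mathfrak{g}$. $S(\mathfrak{g})$ is the quotient of the tensor algebra $T(\mathfrak{g})$ by the ideal generated by $v\otimes w-(-1)^{p(v)p(w)}w\otimes v$ ($v,w\in\mathfrak g$) and $u\otimes u$ ($u\in\mathfrak{g}_1$); $\Delta:S(\mathfrak{g})\to S(\mathfrak{g})\otimes S(\mathfrak{g})$ is the morphism of superalgebras with $\Delta(X)=X\otimes1+1\otimes X$ for $X\in\mathfrak{g}$. A coderivation of $S(\mathfrak{g})$ is a $\Phi\in Hom(S(\mathfrak g),S(\mathfrak g))$ with $\Delta\circ\Phi=(\Phi\otimes id+id\otimes\Phi)\circ\Delta$. For a truncated polynomial $\varphi=\sum_{n<N}c_nt^n\in\mathbb{K}_0[t]/t^N$ and $a$ in an $N$-nilpotent $\mathfrak{g}$, let $\varphi^a\in Hom(S(\mathfrak{g}),\mathfrak{g})$ be the map with $\varphi^a(1)=c_0a$, $$\varphi^a(X_1\cdots X_n)=(-1)^{p(a)(p(X_1)+\cdots+p(X_n))}\,c_n\sum_{s\in\Sigma_n}\alpha(X_{s(1)},\dots,X_{s(n)})\,\mathrm{ad}X_{s(1)}\circ\cdots\circ\mathrm{ad}X_{s(n)}(a)$$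 for $1\le n<N$, and $\varphi^a=0$ on products of $n\geq N$ elements, where $\alpha(X_{s(1)},\dots,X_{s(n)})=\pm1$ is the Koszul sign with $\alpha(X_{s(1)},\dots,X_{s(n)})X_{s(1)}\cdots X_{s(n)}=X_1\cdots X_n$ in $S(\mathfrak{g})$. Put $\Phi^a:=\mathrm{Mult}\circ(id\otimes\varphi^a)\circ\Delta$ with $\mathrm{Mult}$ the multiplication of $S(\mathfrak{g})$; it is a coderivation. "Representation by coderivations" means $[\Phi^a,\Phi^b]=\Phi^{[a,b]}$ for all $a,b\in\mathfrak{g}$, each $\Phi^a$ being a coderivation. Both sides of the displayed functional equation are well defined modulo $I_N$ for $\varphi$ given modulo $t^N$. *)

theory Defs
  imports
    "HOL-Algebra.UnivPoly"
    "HOL-Algebra.QuotRing"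
    "HOL-Algebra.Generated_Groups"
    "HOL-Algebra.Free_Abelian_Groups"
    "HOL-Combinatorics.Permutations"
    "HOL-Library.Z2"
begin

section \<open>Graded abelian groups and commutative superrings\<close>

text \<open>
  Parities are elements of the two-element field \<^typ>\<open>bit\<close>, so \<open>p(a) + p(b)\<close> and \<open>p(a) p(b)\<close> are
  sum and product in \<^typ>\<open>bit\<close>. Instead of a parity function, which is undefined on \<open>0\<close> and on
  inhomogeneous elements, the record carries the two homogeneous parts.
\<close>

record 'a superring = "'a ring" +
  grade :: "bit \<Rightarrow> 'a set"

definition ksgn :: "('a, 'x) ring_scheme \<Rightarrow> bit \<Rightarrow> 'a \<Rightarrow> 'a"
  where "ksgn R e x = (if e = 0 then x else \<ominus>\<^bsub>R\<^esub> x)"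
    \<comment> \<open>\<open>(-1)\<^sup>e x\<close>\<close>

definition hcomp :: "('a, 'x) superring_scheme \<Rightarrow> bit \<Rightarrow> 'a \<Rightarrow> 'a"
  where "hcomp M d m = (THE x. x \<in> grade M d \<and> m \<ominus>\<^bsub>M\<^esub> x \<in> grade M (d + 1))"
    \<comment> \<open>homogeneous component of parity \<open>d\<close>\<close>

locale graded_group = abelian_group M for M :: "('a, 'x) superring_scheme" (structure) +
  assumes grade_subgroup: "subgroup (grade M d) (add_monoid M)"
    and grade_sum: "carrier M = grade M 0 <+>\<^bsub>M\<^esub> grade M 1"
    and grade_Int: "grade M 0 \<inter> grade M 1 = {\<zero>\<^bsub>M\<^esub>}"

locale comm_superring = ring K + graded_group K for K :: "'a superring" (structure) +
  assumes one_even: "\<one> \<in> grade K 0"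
    and grade_mult: "\<lbrakk>a \<in> grade K p; b \<in> grade K q\<rbrakk> \<Longrightarrow> a \<otimes> b \<in> grade K (p + q)"
    and supercomm: "\<lbrakk>a \<in> grade K p; b \<in> grade K q\<rbrakk> \<Longrightarrow> a \<otimes> b = ksgn K (p * q) (b \<otimes> a)"
    and odd_square: "a \<in> grade K 1 \<Longrightarrow> a \<otimes> a = \<zero>"

definition even_ring :: "'a superring \<Rightarrow> 'a superring"
  where "even_ring K = K\<lparr>carrier := grade K 0\<rparr>"

section \<open>Supermodules and Lie superalgebras\<close>

text \<open>
  As in \<^locale>\<open>module\<close>, the fields \<^const>\<open>monoid.mult\<close> and \<^const>\<open>one\<close> are irrelevant for
  a mere module; they are used when the module is a superalgebra. The left action
  \<open>\<alpha> m = (-1)\<^bsup>p(\<alpha>)p(m)\<^esup> m \<alpha>\<close> is written out where it occurs. Identities involving signs are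
  imposed on homogeneous elements.
\<close>

record ('k, 'm) supermodule = "'m superring" +
  rsmult :: "'m \<Rightarrow> 'k \<Rightarrow> 'm"

locale supermodule = K: comm_superring K + graded_group M
  for K :: "'k superring" and M :: "('k, 'm, 'x) supermodule_scheme" (structure) +
  assumes rsmult_closed: "\<lbrakk>m \<in> carrier M; \<alpha> \<in> carrier K\<rbrakk> \<Longrightarrow> rsmult M m \<alpha> \<in> carrier M"
    and rsmult_grade:
      "\<lbrakk>m \<in> grade M p; \<alpha> \<in> grade K q\<rbrakk> \<Longrightarrow> rsmult M m \<alpha> \<in> grade M (p + q)"
    and rsmult_add_left: "\<lbrakk>m \<in> carrier M; n \<in> carrier M; \<alpha> \<in> carrier K\<rbrakk>
      \<Longrightarrow> rsmult M (m \<oplus> n) \<alpha> = rsmult M m \<alpha> \<oplus> rsmult M n \<alpha>"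
    and rsmult_add_right: "\<lbrakk>m \<in> carrier M; \<alpha> \<in> carrier K; \<beta> \<in> carrier K\<rbrakk>
      \<Longrightarrow> rsmult M m (\<alpha> \<oplus>\<^bsub>K\<^esub> \<beta>) = rsmult M m \<alpha> \<oplus> rsmult M m \<beta>"
    and rsmult_assoc: "\<lbrakk>m \<in> carrier M; \<alpha> \<in> carrier K; \<beta> \<in> carrier K\<rbrakk>
      \<Longrightarrow> rsmult M m (\<alpha> \<otimes>\<^bsub>K\<^esub> \<beta>) = rsmult M (rsmult M m \<alpha>) \<beta>"
    and rsmult_one: "m \<in> carrier M \<Longrightarrow> rsmult M m \<one>\<^bsub>K\<^esub> = m"

record ('k, 'm) lie_super = "('k, 'm) supermodule" +
  bracket :: "'m \<Rightarrow> 'm \<Rightarrow> 'm"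

text \<open>
  \<open>\<K>\<close>-bilinearity of the bracket is that of bimodules:
  \<open>[X \<alpha>, Y] = [X, \<alpha> Y]\<close> and \<open>[X, Y \<alpha>] = [X, Y] \<alpha>\<close>.
\<close>

locale lie_superalgebra = supermodule K \<gg>
  for K :: "'k superring" and \<gg> :: "('k, 'm, 'x) lie_super_scheme" (structure) +
  assumes bracket_closed: "\<lbrakk>X \<in> carrier \<gg>; Y \<in> carrier \<gg>\<rbrakk> \<Longrightarrow> bracket \<gg> X Y \<in> carrier \<gg>"
    and bracket_even:
      "\<lbrakk>X \<in> grade \<gg> p; Y \<in> grade \<gg> q\<rbrakk> \<Longrightarrow> bracket \<gg> X Y \<in> grade \<gg> (p + q)"
    and bracket_add_left: "\<lbrakk>X \<in> carrier \<gg>; X' \<in> carrier \<gg>; Y \<in> carrier \<gg>\<rbrakk>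
      \<Longrightarrow> bracket \<gg> (X \<oplus> X') Y = bracket \<gg> X Y \<oplus> bracket \<gg> X' Y"
    and bracket_add_right: "\<lbrakk>X \<in> carrier \<gg>; Y \<in> carrier \<gg>; Y' \<in> carrier \<gg>\<rbrakk>
      \<Longrightarrow> bracket \<gg> X (Y \<oplus> Y') = bracket \<gg> X Y \<oplus> bracket \<gg> X Y'"
    and bracket_rsmult_left: "\<lbrakk>X \<in> carrier \<gg>; \<alpha> \<in> grade K p; Y \<in> grade \<gg> q\<rbrakk>
      \<Longrightarrow> bracket \<gg> (rsmult \<gg> X \<alpha>) Y = bracket \<gg> X (ksgn \<gg> (p * q) (rsmult \<gg> Y \<alpha>))"
    and bracket_rsmult_right: "\<lbrakk>X \<in> carrier \<gg>; Y \<in> carrier \<gg>; \<alpha> \<in> carrier K\<rbrakk>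
      \<Longrightarrow> bracket \<gg> X (rsmult \<gg> Y \<alpha>) = rsmult \<gg> (bracket \<gg> X Y) \<alpha>"
    and super_antisym: "\<lbrakk>X \<in> grade \<gg> p; Y \<in> grade \<gg> q\<rbrakk>
      \<Longrightarrow> bracket \<gg> X Y = \<ominus> ksgn \<gg> (p * q) (bracket \<gg> Y X)"
    and bracket_even_self: "X \<in> grade \<gg> 0 \<Longrightarrow> bracket \<gg> X X = \<zero>"
    and super_jacobi: "\<lbrakk>X \<in> grade \<gg> p; Y \<in> grade \<gg> q; Z \<in> carrier \<gg>\<rbrakk>
      \<Longrightarrow> bracket \<gg> (bracket \<gg> X Y) Z
        = bracket \<gg> X (bracket \<gg> Y Z) \<ominus> ksgn \<gg> (p * q) (bracket \<gg> Y (bracket \<gg> X Z))"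
    and bracket_odd_cube: "Y \<in> grade \<gg> 1 \<Longrightarrow> bracket \<gg> Y (bracket \<gg> Y Y) = \<zero>"

text \<open>\<open>foldr (bracket \<gg>) [X\<^sub>1, \<dots>, X\<^sub>n]\<close> is \<open>ad X\<^sub>1 \<circ> \<dots> \<circ> ad X\<^sub>n\<close>.\<close>

definition lie_nilpotent :: "nat \<Rightarrow> ('k, 'm, 'x) lie_super_scheme \<Rightarrow> bool"
  where "lie_nilpotent N \<gg> \<longleftrightarrow>
    (\<forall>Xs Y. set Xs \<subseteq> carrier \<gg> \<and> length Xs = N \<and> Y \<in> carrier \<gg>
       \<longrightarrow> foldr (bracket \<gg>) Xs Y = \<zero>\<^bsub>\<gg>\<^esub>)"

section \<open>Homomorphisms\<close>

definition shom :: "'k superring \<Rightarrow> ('k, 'm, 'x) supermodule_scheme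
    \<Rightarrow> ('k, 'n, 'y) supermodule_scheme \<Rightarrow> ('m \<Rightarrow> 'n) set"
  where "shom K M N = {F \<in> carrier M \<rightarrow>\<^sub>E carrier N.
    (\<forall>v\<in>carrier M. \<forall>w\<in>carrier M. F (v \<oplus>\<^bsub>M\<^esub> w) = F v \<oplus>\<^bsub>N\<^esub> F w) \<and>
    (\<forall>v\<in>carrier M. \<forall>\<alpha>\<in>carrier K. F (rsmult M v \<alpha>) = rsmult N (F v) \<alpha>)}"

definition superalg_hom :: "'k superring \<Rightarrow> ('k, 'm, 'x) supermodule_scheme
    \<Rightarrow> ('k, 'n, 'y) supermodule_scheme \<Rightarrow> ('m \<Rightarrow> 'n) set"
  where "superalg_hom K A B =
    {F \<in> shom K A B \<inter> ring_hom A B. \<forall>d. F ` grade A d \<subseteq> grade B d}"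

text \<open>The component of parity \<open>d\<close> of a map \<open>F\<close>: it sends \<open>M\<^sub>j\<close> to \<open>N\<^sub>d\<^sub>+\<^sub>j\<close>.\<close>

definition hom_comp :: "('m, 'x) superring_scheme \<Rightarrow> ('n, 'y) superring_scheme
    \<Rightarrow> ('m \<Rightarrow> 'n) \<Rightarrow> bit \<Rightarrow> 'm \<Rightarrow> 'n"
  where "hom_comp M N F d =
    (\<lambda>v\<in>carrier M. \<Oplus>\<^bsub>N\<^esub>j\<in>{0, 1}. hcomp N (d + j) (F (hcomp M j v)))"

definition scomm :: "('m, 'x) superring_scheme \<Rightarrow> ('m \<Rightarrow> 'm) \<Rightarrow> ('m \<Rightarrow> 'm) \<Rightarrow> 'm \<Rightarrow> 'm"
  where "scomm M F G = (\<lambda>v\<in>carrier M. \<Oplus>\<^bsub>M\<^esub>i\<in>{0, 1}. \<Oplus>\<^bsub>M\<^esub>j\<in>{0, 1}.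
    hom_comp M M F i (hom_comp M M G j v)
      \<ominus>\<^bsub>M\<^esub> ksgn M (i * j) (hom_comp M M G j (hom_comp M M F i v)))"
    \<comment> \<open>\<open>[F, G]\<close>, extended bilinearly from homogeneous \<open>F\<close> and \<open>G\<close>\<close>

section \<open>Tensor products\<close>

text \<open>
  \<open>M \<otimes>\<^sub>\<K> N\<close> is the free abelian group on \<open>M \<times> N\<close> modulo the subgroup generated by the relations of
  biadditivity and balancing \<open>v \<alpha> \<otimes> w = v \<otimes> \<alpha> w\<close>.
\<close>

definition tensor_rel :: "'k superring \<Rightarrow> ('k, 'm, 'x) supermodule_scheme
    \<Rightarrow> ('k, 'n, 'y) supermodule_scheme \<Rightarrow> ('m \<times> 'n \<Rightarrow>\<^sub>0 int) set"
  where "tensor_rel K M N =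
    {frag_of (v \<oplus>\<^bsub>M\<^esub> v', w) - frag_of (v, w) - frag_of (v', w) |v v' w.
       v \<in> carrier M \<and> v' \<in> carrier M \<and> w \<in> carrier N}
    \<union> {frag_of (v, w \<oplus>\<^bsub>N\<^esub> w') - frag_of (v, w) - frag_of (v, w') |v w w'.
       v \<in> carrier M \<and> w \<in> carrier N \<and> w' \<in> carrier N}
    \<union> {frag_of (rsmult M v \<alpha>, w) - frag_of (v, ksgn N (p * q) (rsmult N w \<alpha>)) |v w \<alpha> p q.
       v \<in> carrier M \<and> \<alpha> \<in> grade K p \<and> w \<in> grade N q}"

definition tensor_sub :: "'k superring \<Rightarrow> ('k, 'm, 'x) supermodule_scheme
    \<Rightarrow> ('k, 'n, 'y) supermodule_scheme \<Rightarrow> ('m \<times> 'n \<Rightarrow>\<^sub>0 int) set"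
  where "tensor_sub K M N =
    generate (free_Abelian_group (carrier M \<times> carrier N)) (tensor_rel K M N)"

definition tensor_group :: "'k superring \<Rightarrow> ('k, 'm, 'x) supermodule_scheme
    \<Rightarrow> ('k, 'n, 'y) supermodule_scheme \<Rightarrow> ('m \<times> 'n \<Rightarrow>\<^sub>0 int) set monoid"
  where "tensor_group K M N =
    free_Abelian_group (carrier M \<times> carrier N) Mod tensor_sub K M N"

definition tens :: "'k superring \<Rightarrow> ('k, 'm, 'x) supermodule_scheme
    \<Rightarrow> ('k, 'n, 'y) supermodule_scheme \<Rightarrow> 'm \<Rightarrow> 'n \<Rightarrow> ('m \<times> 'n \<Rightarrow>\<^sub>0 int) set"
  where "tens K M N v w =
    tensor_sub K M N #>\<^bsub>free_Abelian_group (carrier M \<times> carrier N)\<^esub> frag_of (v, w)"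
    \<comment> \<open>the pure tensor \<open>v \<otimes> w\<close>\<close>

text \<open>
  The additive map \<open>M \<otimes>\<^sub>\<K> N \<rightarrow> P\<close> with \<open>v \<otimes> w \<mapsto> h v w\<close>, where \<open>P\<close> is an abelian group and \<open>h\<close>
  is biadditive and balanced; the value does not depend on the representative \<open>x\<close> of the coset.
\<close>

definition tensor_lift ::
    "('p, 'z) monoid_scheme \<Rightarrow> ('m \<Rightarrow> 'n \<Rightarrow> 'p) \<Rightarrow> ('m \<times> 'n \<Rightarrow>\<^sub>0 int) set \<Rightarrow> 'p"
  where "tensor_lift P h X = (let x = (SOME x. x \<in> X) in
    finprod P (\<lambda>(v, w). h v w [^]\<^bsub>P\<^esub> Poly_Mapping.lookup x (v, w)) (Poly_Mapping.keys x))"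

text \<open>
  The multiplication is \<open>(a \<otimes> b)(c \<otimes> d) = (-1)\<^bsup>p(b)p(c)\<^esup> ac \<otimes> bd\<close>, extended from homogeneous
  \<open>b\<close> and \<open>c\<close>; it is meaningful if \<open>M\<close> and \<open>N\<close> are superalgebras.
\<close>

definition tensor :: "'k superring \<Rightarrow> ('k, 'm, 'x) supermodule_scheme
    \<Rightarrow> ('k, 'n, 'y) supermodule_scheme \<Rightarrow> ('k, ('m \<times> 'n \<Rightarrow>\<^sub>0 int) set) supermodule"
  where "tensor K M N = \<lparr>
    carrier = carrier (tensor_group K M N),
    monoid.mult = (\<lambda>X Y. tensor_lift (tensor_group K M N) (\<lambda>a b.
        tensor_lift (tensor_group K M N) (\<lambda>c d.
          finprod (tensor_group K M N) (\<lambda>(i, j).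
            tens K M N (ksgn M (i * j) (a \<otimes>\<^bsub>M\<^esub> hcomp M j c)) (hcomp N i b \<otimes>\<^bsub>N\<^esub> d))
          ({0, 1} \<times> {0, 1})) Y) X),
    one = tens K M N \<one>\<^bsub>M\<^esub> \<one>\<^bsub>N\<^esub>,
    ring.zero = \<one>\<^bsub>tensor_group K M N\<^esub>,
    ring.add = monoid.mult (tensor_group K M N),
    grade = (\<lambda>d. generate (tensor_group K M N)
        {tens K M N v w |v w p q. v \<in> grade M p \<and> w \<in> grade N q \<and> p + q = d}),
    rsmult = (\<lambda>X \<alpha>. tensor_lift (tensor_group K M N) (\<lambda>v w. tens K M N v (rsmult N w \<alpha>)) X)\<rparr>"

text \<open>\<open>(F \<otimes> G)(v \<otimes> w) = (-1)\<^bsup>p(G)p(v)\<^esup> F(v) \<otimes> G(w)\<close>, extended from homogeneous \<open>G\<close> and \<open>v\<close>.\<close>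

definition tensor_map :: "'k superring
    \<Rightarrow> ('k, 'm, 'x) supermodule_scheme \<Rightarrow> ('k, 'n, 'y) supermodule_scheme
    \<Rightarrow> ('k, 'm2, 'x2) supermodule_scheme \<Rightarrow> ('k, 'n2, 'y2) supermodule_scheme
    \<Rightarrow> ('m \<Rightarrow> 'm2) \<Rightarrow> ('n \<Rightarrow> 'n2)
    \<Rightarrow> ('m \<times> 'n \<Rightarrow>\<^sub>0 int) set \<Rightarrow> ('m2 \<times> 'n2 \<Rightarrow>\<^sub>0 int) set"
  where "tensor_map K M N M' N' F G = (\<lambda>X\<in>carrier (tensor K M N).
    tensor_lift (tensor_group K M' N') (\<lambda>v w.
      finprod (tensor_group K M' N') (\<lambda>(i, j).
        tens K M' N' (ksgn M' (i * j) (F (hcomp M j v))) (hom_comp N N' G i w))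
      ({0, 1} \<times> {0, 1})) X)"

section \<open>The tensor algebra and the symmetric algebra\<close>

text \<open>
  Words with concatenation form the free monoid (written additively), so that the convolution
  product of \<open>'a fword \<Rightarrow>\<^sub>0 int\<close> is that of the free associative unital ring.
\<close>

datatype 'a fword = Word (letters: "'a list")

instantiation fword :: (type) monoid_add
begin

definition zero_fword :: "'a fword" where "0 = Word []"

definition plus_fword :: "'a fword \<Rightarrow> 'a fword \<Rightarrow> 'a fword"
  where "u + v = Word (letters u @ letters v)"

instance
  by standard (simp_all add: zero_fword_def plus_fword_def)

end

definition free_ring :: "'a set \<Rightarrow> ('a fword \<Rightarrow>\<^sub>0 int) ring"
  where "free_ring A = \<lparr>
    carrier = {x. \<forall>w\<in>Poly_Mapping.keys x. set (letters w) \<subseteq> A},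
    monoid.mult = (*), one = 1, ring.zero = 0, ring.add = (+)\<rparr>"

definition fmon :: "'a list \<Rightarrow> 'a fword \<Rightarrow>\<^sub>0 int"
  where "fmon xs = Poly_Mapping.single (Word xs) 1"

text \<open>
  The tensor algebra \<open>T(\<gg>) = \<K> \<oplus> \<gg> \<oplus> (\<gg> \<otimes>\<^sub>\<K> \<gg>) \<oplus> \<dots>\<close> of the \<open>\<K>\<close>-bimodule \<open>\<gg>\<close> is presented as the free
  ring on the disjoint union of \<open>\<K>\<close> and \<open>\<gg>\<close>, modulo the relations saying that \<open>\<K> \<rightarrow> T(\<gg>)\<close> is a ring
  homomorphism and that \<open>\<gg> \<rightarrow> T(\<gg>)\<close> is a homomorphism of \<open>\<K>\<close>-bimodules.
\<close>

definition tensor_alg_rel :: "'k superring \<Rightarrow> ('k, 'm, 'x) supermodule_scheme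
    \<Rightarrow> (('k + 'm) fword \<Rightarrow>\<^sub>0 int) set"
  where "tensor_alg_rel K M =
    {fmon [Inl (\<alpha> \<oplus>\<^bsub>K\<^esub> \<beta>)] - fmon [Inl \<alpha>] - fmon [Inl \<beta>] |\<alpha> \<beta>. \<alpha> \<in> carrier K \<and> \<beta> \<in> carrier K}
    \<union> {fmon [Inl (\<alpha> \<otimes>\<^bsub>K\<^esub> \<beta>)] - fmon [Inl \<alpha>, Inl \<beta>] |\<alpha> \<beta>. \<alpha> \<in> carrier K \<and> \<beta> \<in> carrier K}
    \<union> {fmon [Inl \<one>\<^bsub>K\<^esub>] - 1}
    \<union> {fmon [Inr (v \<oplus>\<^bsub>M\<^esub> w)] - fmon [Inr v] - fmon [Inr w] |v w. v \<in> carrier M \<and> w \<in> carrier M}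
    \<union> {fmon [Inr (rsmult M v \<alpha>)] - fmon [Inr v, Inl \<alpha>] |v \<alpha>. v \<in> carrier M \<and> \<alpha> \<in> carrier K}
    \<union> {fmon [Inr (ksgn M (p * q) (rsmult M v \<alpha>))] - fmon [Inl \<alpha>, Inr v] |v \<alpha> p q.
        \<alpha> \<in> grade K p \<and> v \<in> grade M q}"

abbreviation letter_ring :: "'k superring \<Rightarrow> ('k, 'm, 'x) supermodule_scheme
    \<Rightarrow> (('k + 'm) fword \<Rightarrow>\<^sub>0 int) ring"
  where "letter_ring K M \<equiv> free_ring (carrier K <+> carrier M)"

definition tensor_alg_ideal :: "'k superring \<Rightarrow> ('k, 'm, 'x) supermodule_scheme
    \<Rightarrow> (('k + 'm) fword \<Rightarrow>\<^sub>0 int) set"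
  where "tensor_alg_ideal K M = Idl\<^bsub>letter_ring K M\<^esub> (tensor_alg_rel K M)"

definition tmon :: "'k superring \<Rightarrow> ('k, 'm, 'x) supermodule_scheme
    \<Rightarrow> ('k + 'm) list \<Rightarrow> (('k + 'm) fword \<Rightarrow>\<^sub>0 int) set"
  where "tmon K M xs = tensor_alg_ideal K M +>\<^bsub>letter_ring K M\<^esub> fmon xs"

definition tensor_alg :: "'k superring \<Rightarrow> ('k, 'm, 'x) supermodule_scheme
    \<Rightarrow> ('k, (('k + 'm) fword \<Rightarrow>\<^sub>0 int) set) supermodule"
  where "tensor_alg K M = (let Q = letter_ring K M Quot tensor_alg_ideal K M in \<lparr>
    carrier = carrier Q, monoid.mult = monoid.mult Q, one = one Q, ring.zero = ring.zero Q, ring.add = ring.add Q,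
    grade = (\<lambda>d. generate (add_monoid Q) {tmon K M xs |xs ps.
        list_all2 (\<lambda>x p. x \<in> grade K p <+> grade M p) xs ps \<and> sum_list ps = d}),
    rsmult = (\<lambda>X \<alpha>. X \<otimes>\<^bsub>Q\<^esub> tmon K M [Inl \<alpha>])\<rparr>)"

definition sym_ideal :: "'k superring \<Rightarrow> ('k, 'm, 'x) supermodule_scheme
    \<Rightarrow> (('k + 'm) fword \<Rightarrow>\<^sub>0 int) set set"
  where "sym_ideal K M = (let T = tensor_alg K M; \<iota> = (\<lambda>v. tmon K M [Inr v]) in
    Idl\<^bsub>T\<^esub> ({\<iota> v \<otimes>\<^bsub>T\<^esub> \<iota> w \<ominus>\<^bsub>T\<^esub> ksgn T (p * q) (\<iota> w \<otimes>\<^bsub>T\<^esub> \<iota> v) |v w p q.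
               v \<in> grade M p \<and> w \<in> grade M q}
           \<union> {\<iota> u \<otimes>\<^bsub>T\<^esub> \<iota> u |u. u \<in> grade M 1}))"

text \<open>The right action on the quotient is multiplication by the class of \<open>1 \<alpha>\<close>.\<close>

definition sym_alg :: "'k superring \<Rightarrow> ('k, 'm, 'x) supermodule_scheme
    \<Rightarrow> ('k, (('k + 'm) fword \<Rightarrow>\<^sub>0 int) set set) supermodule"
  where "sym_alg K M = (let T = tensor_alg K M; J = sym_ideal K M; Q = T Quot J in \<lparr>
    carrier = carrier Q, monoid.mult = monoid.mult Q, one = one Q, ring.zero = ring.zero Q, ring.add = ring.add Q,
    grade = (\<lambda>d. (\<lambda>x. J +>\<^bsub>T\<^esub> x) ` grade T d),
    rsmult = (\<lambda>X \<alpha>. X \<otimes>\<^bsub>Q\<^esub> (J +>\<^bsub>T\<^esub> rsmult T \<one>\<^bsub>T\<^esub> \<alpha>))\<rparr>)"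

definition sym_of :: "'k superring \<Rightarrow> ('k, 'm, 'x) supermodule_scheme
    \<Rightarrow> 'm \<Rightarrow> (('k + 'm) fword \<Rightarrow>\<^sub>0 int) set set"
  where "sym_of K M v = sym_ideal K M +>\<^bsub>tensor_alg K M\<^esub> tmon K M [Inr v]"
    \<comment> \<open>the canonical map \<open>M \<rightarrow> S(M)\<close>\<close>

definition sym_prod :: "'k superring \<Rightarrow> ('k, 'm, 'x) supermodule_scheme
    \<Rightarrow> 'm list \<Rightarrow> (('k + 'm) fword \<Rightarrow>\<^sub>0 int) set set"
  where "sym_prod K M Xs =
    foldr (\<lambda>X y. sym_of K M X \<otimes>\<^bsub>sym_alg K M\<^esub> y) Xs \<one>\<^bsub>sym_alg K M\<^esub>"

section \<open>Coderivations\<close>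

abbreviation sym_alg2 :: "'k superring \<Rightarrow> ('k, 'm, 'x) supermodule_scheme
    \<Rightarrow> ('k, ((('k + 'm) fword \<Rightarrow>\<^sub>0 int) set set \<times> (('k + 'm) fword \<Rightarrow>\<^sub>0 int) set set \<Rightarrow>\<^sub>0 int) set)
       supermodule"
  where "sym_alg2 K M \<equiv> tensor K (sym_alg K M) (sym_alg K M)"

definition sym_coprod :: "'k superring \<Rightarrow> ('k, 'm, 'x) supermodule_scheme
    \<Rightarrow> (('k + 'm) fword \<Rightarrow>\<^sub>0 int) set set
    \<Rightarrow> ((('k + 'm) fword \<Rightarrow>\<^sub>0 int) set set \<times> (('k + 'm) fword \<Rightarrow>\<^sub>0 int) set set \<Rightarrow>\<^sub>0 int) set"
  where "sym_coprod K M = (let S = sym_alg K M in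
    THE D. D \<in> superalg_hom K S (sym_alg2 K M) \<and>
      (\<forall>X\<in>carrier M. D (sym_of K M X)
         = tens K S S (sym_of K M X) \<one>\<^bsub>S\<^esub> \<oplus>\<^bsub>sym_alg2 K M\<^esub> tens K S S \<one>\<^bsub>S\<^esub> (sym_of K M X)))"

definition coderivation :: "'k superring \<Rightarrow> ('k, 'm, 'x) supermodule_scheme
    \<Rightarrow> ((('k + 'm) fword \<Rightarrow>\<^sub>0 int) set set \<Rightarrow> (('k + 'm) fword \<Rightarrow>\<^sub>0 int) set set) \<Rightarrow> bool"
  where "coderivation K M F \<longleftrightarrow> (let S = sym_alg K M; I = (\<lambda>x\<in>carrier S. x) in
    F \<in> shom K S S \<and>
    (\<forall>x\<in>carrier S. sym_coprod K M (F x) =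
       tensor_map K S S S S F I (sym_coprod K M x)
         \<oplus>\<^bsub>sym_alg2 K M\<^esub> tensor_map K S S S S I F (sym_coprod K M x)))"

definition sym_mult :: "'k superring \<Rightarrow> ('k, 'm, 'x) supermodule_scheme
    \<Rightarrow> ((('k + 'm) fword \<Rightarrow>\<^sub>0 int) set set \<times> (('k + 'm) fword \<Rightarrow>\<^sub>0 int) set set \<Rightarrow>\<^sub>0 int) set
    \<Rightarrow> (('k + 'm) fword \<Rightarrow>\<^sub>0 int) set set"
  where "sym_mult K M = (\<lambda>X\<in>carrier (sym_alg2 K M).
    tensor_lift (add_monoid (sym_alg K M)) (\<lambda>x y. x \<otimes>\<^bsub>sym_alg K M\<^esub> y) X)"

section \<open>The maps attached to a truncated polynomial\<close>

text \<open>
  For homogeneous letters \<open>X\<^sub>0, \<dots>, X\<^sub>n\<^sub>-\<^sub>1\<close> of parities \<open>ps\<close>, the sign \<open>\<alpha>(X\<^bsub>s(0)\<^esub>, \<dots>, X\<^bsub>s(n-1)\<^esub>)\<close> is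
  \<open>(-1)\<^sup>e\<close> where \<open>e\<close> is the number of inversions of \<open>s\<close> between odd letters.
\<close>

definition koszul :: "bit list \<Rightarrow> (nat \<Rightarrow> nat) \<Rightarrow> bit"
  where "koszul ps s =
    (\<Sum>(i, j)\<in>{(i, j). i < j \<and> j < length ps \<and> s j < s i}. ps ! s i * ps ! s j)"

text \<open>
  \<open>c n\<close> is the coefficient of \<open>t\<^sup>n\<close>, an element of \<open>\<K>\<^sub>0\<close>. The defining formula is extended from
  homogeneous to arbitrary \<open>a\<close> by summing over the components \<open>a\<^sub>i\<close> of \<open>a\<close>.
\<close>

definition phi_map :: "'k superring \<Rightarrow> ('k, 'm, 'x) lie_super_scheme \<Rightarrow> nat \<Rightarrow> (nat \<Rightarrow> 'k)
    \<Rightarrow> 'm \<Rightarrow> (('k + 'm) fword \<Rightarrow>\<^sub>0 int) set set \<Rightarrow> 'm"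
  where "phi_map K \<gg> N c a = (THE f. f \<in> shom K (sym_alg K \<gg>) \<gg> \<and>
    f \<one>\<^bsub>sym_alg K \<gg>\<^esub> = rsmult \<gg> a (c 0) \<and>
    (\<forall>Xs ps. list_all2 (\<lambda>X p. X \<in> grade \<gg> p) Xs ps \<and> 1 \<le> length Xs \<and> length Xs < N \<longrightarrow>
       f (sym_prod K \<gg> Xs) =
         (\<Oplus>\<^bsub>\<gg>\<^esub>i\<in>{0, 1}. ksgn \<gg> (i * sum_list ps) (rsmult \<gg>
            (\<Oplus>\<^bsub>\<gg>\<^esub>s\<in>{s. s permutes {..<length Xs}}.
               ksgn \<gg> (koszul ps s)
                 (foldr (bracket \<gg>) (map (\<lambda>k. Xs ! s k) [0..<length Xs]) (hcomp \<gg> i a)))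
            (c (length Xs))))) \<and>
    (\<forall>Xs. set Xs \<subseteq> carrier \<gg> \<and> N \<le> length Xs \<longrightarrow> f (sym_prod K \<gg> Xs) = \<zero>\<^bsub>\<gg>\<^esub>))"

text \<open>In \<open>Mult \<circ> (id \<otimes> \<phi>\<^sup>a) \<circ> \<Delta>\<close> the values of \<open>\<phi>\<^sup>a\<close> are regarded as elements of \<open>S(\<gg>)\<close>.\<close>

definition Phi_map :: "'k superring \<Rightarrow> ('k, 'm, 'x) lie_super_scheme \<Rightarrow> nat \<Rightarrow> (nat \<Rightarrow> 'k)
    \<Rightarrow> 'm \<Rightarrow> (('k + 'm) fword \<Rightarrow>\<^sub>0 int) set set \<Rightarrow> (('k + 'm) fword \<Rightarrow>\<^sub>0 int) set set"
  where "Phi_map K \<gg> N c a = (let S = sym_alg K \<gg> in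
    compose (carrier S) (sym_mult K \<gg>)
      (compose (carrier S)
        (tensor_map K S S S S (\<lambda>x\<in>carrier S. x)
          (compose (carrier S) (sym_of K \<gg>) (phi_map K \<gg> N c a)))
        (sym_coprod K \<gg>)))"

definition rep_by_coderivations :: "'k superring \<Rightarrow> ('k, 'm, 'x) lie_super_scheme
    \<Rightarrow> ('m \<Rightarrow> (('k + 'm) fword \<Rightarrow>\<^sub>0 int) set set \<Rightarrow> (('k + 'm) fword \<Rightarrow>\<^sub>0 int) set set) \<Rightarrow> bool"
  where "rep_by_coderivations K \<gg> R \<longleftrightarrow>
    (\<forall>a\<in>carrier \<gg>. coderivation K \<gg> (R a)) \<and>
    (\<forall>a\<in>carrier \<gg>. \<forall>b\<in>carrier \<gg>. scomm (sym_alg K \<gg>) (R a) (R b) = R (bracket \<gg> a b))"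

section \<open>The functional equation\<close>

text \<open>
  \<open>\<K>\<^sub>0[t, u]\<close> is \<open>\<K>\<^sub>0[t][u]\<close>. The quotients \<open>(\<phi>(t+u) - \<phi>(t)) / u\<close> and \<open>(\<phi>(t+u) - \<phi>(u)) / t\<close> are
  exact quotients of polynomials, taken before reducing modulo \<open>I\<^sub>N\<close>.
\<close>

definition poly2 :: "'k superring \<Rightarrow> (nat \<Rightarrow> 'k, nat \<Rightarrow> nat \<Rightarrow> 'k) up_ring"
  where "poly2 K = UP (UP (even_ring K))"

definition const2 :: "'k superring \<Rightarrow> 'k \<Rightarrow> nat \<Rightarrow> nat \<Rightarrow> 'k"
  where "const2 K c = monom (poly2 K) (monom (UP (even_ring K)) c 0) 0"

definition var_t :: "'k superring \<Rightarrow> nat \<Rightarrow> nat \<Rightarrow> 'k"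
  where "var_t K = monom (poly2 K) (monom (UP (even_ring K)) \<one>\<^bsub>K\<^esub> 1) 0"

definition var_u :: "'k superring \<Rightarrow> nat \<Rightarrow> nat \<Rightarrow> 'k"
  where "var_u K = monom (poly2 K) \<one>\<^bsub>UP (even_ring K)\<^esub> 1"

definition subst2 :: "'k superring \<Rightarrow> (nat \<Rightarrow> 'k) \<Rightarrow> (nat \<Rightarrow> nat \<Rightarrow> 'k) \<Rightarrow> nat \<Rightarrow> nat \<Rightarrow> 'k"
  where "subst2 K P x = eval (even_ring K) (poly2 K) (const2 K) x P"
    \<comment> \<open>\<open>P(x)\<close>\<close>

definition exact_quot :: "('a, 'x) ring_scheme \<Rightarrow> 'a \<Rightarrow> 'a \<Rightarrow> 'a"
  where "exact_quot R p x = (THE q. q \<in> carrier R \<and> x \<otimes>\<^bsub>R\<^esub> q = p)"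

definition trunc_ideal :: "'k superring \<Rightarrow> nat \<Rightarrow> (nat \<Rightarrow> nat \<Rightarrow> 'k) set"
  where "trunc_ideal K N = Idl\<^bsub>poly2 K\<^esub>
    {var_t K [^]\<^bsub>poly2 K\<^esub> i \<otimes>\<^bsub>poly2 K\<^esub> var_u K [^]\<^bsub>poly2 K\<^esub> j |i j :: nat. i + j \<ge> N - 1}"

definition truncated_poly_ring :: "'k superring \<Rightarrow> nat \<Rightarrow> (nat \<Rightarrow> 'k) set ring"
  where "truncated_poly_ring K N = UP (even_ring K) Quot
    (Idl\<^bsub>UP (even_ring K)\<^esub> {monom (UP (even_ring K)) \<one>\<^bsub>K\<^esub> N})"

definition functional_equation :: "'k superring \<Rightarrow> nat \<Rightarrow> (nat \<Rightarrow> 'k) \<Rightarrow> bool"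
  where "functional_equation K N P \<longleftrightarrow>
    (let B = poly2 K; t = var_t K; u = var_u K; f = subst2 K P in
      trunc_ideal K N +>\<^bsub>B\<^esub>
        (f u \<otimes>\<^bsub>B\<^esub> exact_quot B (f (t \<oplus>\<^bsub>B\<^esub> u) \<ominus>\<^bsub>B\<^esub> f t) u
          \<oplus>\<^bsub>B\<^esub> f t \<otimes>\<^bsub>B\<^esub> exact_quot B (f (t \<oplus>\<^bsub>B\<^esub> u) \<ominus>\<^bsub>B\<^esub> f u) t)
      = trunc_ideal K N +>\<^bsub>B\<^esub> (\<ominus>\<^bsub>B\<^esub> f (t \<oplus>\<^bsub>B\<^esub> u)))"

text \<open>
  Quantification over all Lie \<open>\<K>\<close>-superalgebras inside one side of an equivalence has to fix the type
  of their elements. The type \<open>nat \<Rightarrow> 'k\<close> contains, up to isomorphism, every finitely or countably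
  generated module over a superring on \<open>'k\<close>, in particular the free \<open>N\<close>-nilpotent Lie superalgebras on
  finitely many generators, which detect the functional equation. A theorem should therefore quantify
  over Lie superalgebras on that type and on an arbitrary further type \<open>'g\<close>.
\<close>

end

theory Submission
  imports Defs
begin

text \<open>
  A coderivation \<open>Mult \<circ> (id \<otimes> f) \<circ> \<Delta>\<close> is determined by \<open>f : S(\<gg>) \<rightarrow> \<gg>\<close>, which is its composition with the
  projection \<open>\<pi> : S(\<gg>) \<rightarrow> \<gg>\<close>, so the commutation relations are identities between maps \<open>S(\<gg>) \<rightarrow> \<gg>\<close>. These
  maps form a Lie superalgebra under the convolution bracket, in which \<open>\<phi>\<^sup>a = \<phi>(ad \<pi>)(a \<epsilon>)\<close> with \<open>\<epsilon>\<close> the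
  augmentation. On the brackets of \<open>(ad \<pi>)\<^sup>r (a \<epsilon>)\<close> with \<open>(ad \<pi>)\<^sup>s (b \<epsilon>)\<close>, regarded as the monomials
  \<open>t\<^sup>r u\<^sup>s\<close>, the derivation \<open>ad \<pi>\<close> acts as multiplication by \<open>t + u\<close>. Hence \<open>\<Phi>\<^bsup>[a,b]\<^esup> - [\<Phi>\<^sup>a, \<Phi>\<^sup>b]\<close>
  corresponds to the sum of \<open>\<phi>(t + u)\<close> and the left hand side of the functional equation, and nilpotency
  annihilates the monomials with \<open>r + s \<ge> N - 1\<close>. Conversely, in the strictly upper triangular matrices of
  size \<open>N + 1\<close> all other monomials are detected one by one by products of matrix units.
\<close>

section \<open>Signs, additive maps and parity\<close>

text \<open>Nothing is free over the ground superring and 2 need not be invertible, so S(\<gg>)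
  offers no basis to compute with. Maps out of it are obtained by letting it act on an abelian
  group: only the defining relations have to be checked for the operators of scalars and letters.
  The coproduct, the augmentation, the projection and the directness of the grading all come from
  such actions. Identities between maps are proved by induction on the argument with the maps
  arbitrary: a letter v is primitive, so an identity at v x follows from the same identity at x with
  one of the maps f replaced by f(v -).

  The divided differences arise as follows. Composition with the coderivation of b is a derivation
  of the convolution bracket and sends \<pi> to the map of b. Applied to the n-th power of ad \<pi>
  on a, it inserts this map at each of n places. Up to sign this is \<phi>(u) times the sum of
  (t+u)^(n-1-k) t^k, that is, of ((t+u)^n - t^n)/u. The bound N - 1 in place of N is due to the
  bracket of a with b itself: t^r u^s stands for an element of depth r + s + 1 in the lower central
  series.\<close>

declare add_bit_eq_xor [simp del] mult_bit_eq_and [simp del]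

lemma Inl_Plus_iff [simp]: "Inl x \<in> A <+> B \<longleftrightarrow> x \<in> A"
  by auto

lemma Inr_Plus_iff [simp]: "Inr x \<in> A <+> B \<longleftrightarrow> x \<in> B"
  by auto

lemma bit_add_self [simp]: "(p::bit) + p = 0"
  by (cases p) simp_all

lemma bit_add_self2 [simp]: "(p::bit) + (p + q) = q"
  by (cases p; cases q) simp_all

lemma bit_mult_self [simp]: "(p::bit) * p = p"
  by (cases p) simp_all

lemma ksgn_0 [simp]: "ksgn R 0 x = x"
  by (simp add: ksgn_def)

lemma ksgn_1: "ksgn R 1 x = \<ominus>\<^bsub>R\<^esub> x"
  by (simp add: ksgn_def)

context abelian_group
begin

lemma ksgn_closed [simp, intro]: "x \<in> carrier G \<Longrightarrow> ksgn G e x \<in> carrier G"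
  by (simp add: ksgn_def)

lemma ksgn_ksgn [simp]: "x \<in> carrier G \<Longrightarrow> ksgn G e (ksgn G f x) = ksgn G (e + f) x"
  by (cases e; cases f) (simp_all add: ksgn_def)

lemma ksgn_add: "\<lbrakk>x \<in> carrier G; y \<in> carrier G\<rbrakk> \<Longrightarrow> ksgn G e (x \<oplus> y) = ksgn G e x \<oplus> ksgn G e y"
  by (simp add: ksgn_def minus_add)

lemma ksgn_zero [simp]: "ksgn G e \<zero> = \<zero>"
  by (simp add: ksgn_def)

lemma ksgn_neg: "x \<in> carrier G \<Longrightarrow> ksgn G e (\<ominus> x) = \<ominus> ksgn G e x"
  by (simp add: ksgn_def)

lemma neg_ksgn: "x \<in> carrier G \<Longrightarrow> \<ominus> ksgn G e x = ksgn G (e + 1) x"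
  by (cases e) (simp_all add: ksgn_def)

lemma add_cancel_neg:
  "\<lbrakk>x \<in> carrier G; y \<in> carrier G\<rbrakk> \<Longrightarrow> x \<oplus> (\<ominus> x \<oplus> y) = y"
  "\<lbrakk>x \<in> carrier G; y \<in> carrier G\<rbrakk> \<Longrightarrow> \<ominus> x \<oplus> (x \<oplus> y) = y"
  by (simp_all add: a_assoc[symmetric] r_neg l_neg)

lemma minus_eq_zero_iff:
  "\<lbrakk>x \<in> carrier G; y \<in> carrier G\<rbrakk> \<Longrightarrow> x \<ominus> y = \<zero> \<longleftrightarrow> x = y"
  by (metis a_minus_def minus_equality minus_minus a_inv_closed r_neg)

lemma add_minus_cancel:
  "\<lbrakk>x \<in> carrier G; y \<in> carrier G\<rbrakk> \<Longrightarrow> (x \<oplus> y) \<ominus> x = y"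
  "\<lbrakk>x \<in> carrier G; y \<in> carrier G\<rbrakk> \<Longrightarrow> (x \<oplus> y) \<ominus> y = x"
  by (simp_all add: a_minus_def a_assoc r_neg) (simp add: a_comm[of x] a_assoc r_neg l_neg)

lemma idem_zero: "\<lbrakk>x \<in> carrier G; x \<oplus> x = x\<rbrakk> \<Longrightarrow> x = \<zero>"
  using add.r_cancel_one by blast

lemma finsum_bits:
  "\<lbrakk>f 0 \<in> carrier G; f (1::bit) \<in> carrier G\<rbrakk> \<Longrightarrow> (\<Oplus>i\<in>{0, 1}. f i) = f 0 \<oplus> f 1"
  by (subst finsum_insert) (auto simp: finsum_insert)

end

text \<open>No group axioms are built in, so additive maps can be composed without regard to the
  structure on either side.\<close>

definition add_map :: "('a, 'x) ring_scheme \<Rightarrow> ('b, 'y) ring_scheme \<Rightarrow> ('a \<Rightarrow> 'b) \<Rightarrow> bool"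
  where "add_map A B f \<longleftrightarrow> f \<in> carrier A \<rightarrow> carrier B \<and>
    (\<forall>x\<in>carrier A. \<forall>y\<in>carrier A. f (x \<oplus>\<^bsub>A\<^esub> y) = f x \<oplus>\<^bsub>B\<^esub> f y)"

lemma add_mapI:
  "\<lbrakk>\<And>x. x \<in> carrier A \<Longrightarrow> f x \<in> carrier B;
    \<And>x y. \<lbrakk>x \<in> carrier A; y \<in> carrier A\<rbrakk> \<Longrightarrow> f (x \<oplus>\<^bsub>A\<^esub> y) = f x \<oplus>\<^bsub>B\<^esub> f y\<rbrakk> \<Longrightarrow> add_map A B f"
  by (simp add: add_map_def)

lemma add_map_closed: "\<lbrakk>add_map A B f; x \<in> carrier A\<rbrakk> \<Longrightarrow> f x \<in> carrier B"
  by (auto simp: add_map_def)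

lemma add_map_add:
  "\<lbrakk>add_map A B f; x \<in> carrier A; y \<in> carrier A\<rbrakk> \<Longrightarrow> f (x \<oplus>\<^bsub>A\<^esub> y) = f x \<oplus>\<^bsub>B\<^esub> f y"
  by (auto simp: add_map_def)

lemma add_map_comp: "\<lbrakk>add_map A B f; add_map B C g\<rbrakk> \<Longrightarrow> add_map A C (\<lambda>x. g (f x))"
  by (auto simp: add_map_def Pi_def)

lemma add_map_cong:
  "\<lbrakk>add_map A B f; abelian_group A; \<And>x. x \<in> carrier A \<Longrightarrow> f x = g x\<rbrakk> \<Longrightarrow> add_map A B g"
  by (rule add_mapI)
    (metis add_map_closed, metis add_map_add abelian_group.axioms(1) abelian_monoid.a_closed)

locale add_hom = A: abelian_group A + B: abelian_group B
  for A :: "('a, 'x) ring_scheme" and B :: "('b, 'y) ring_scheme" +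
  fixes f :: "'a \<Rightarrow> 'b"
  assumes add_map: "add_map A B f"
begin

lemma closed [simp, intro]: "x \<in> carrier A \<Longrightarrow> f x \<in> carrier B"
  by (rule add_map_closed[OF add_map])

lemma add [simp]: "\<lbrakk>x \<in> carrier A; y \<in> carrier A\<rbrakk> \<Longrightarrow> f (x \<oplus>\<^bsub>A\<^esub> y) = f x \<oplus>\<^bsub>B\<^esub> f y"
  by (rule add_map_add[OF add_map])

lemma zero [simp]: "f \<zero>\<^bsub>A\<^esub> = \<zero>\<^bsub>B\<^esub>"
  using add[of "\<zero>\<^bsub>A\<^esub>" "\<zero>\<^bsub>A\<^esub>"] by (intro B.idem_zero) (simp_all del: add)

lemma neg [simp]: "x \<in> carrier A \<Longrightarrow> f (\<ominus>\<^bsub>A\<^esub> x) = \<ominus>\<^bsub>B\<^esub> f x"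
  using add[of "\<ominus>\<^bsub>A\<^esub> x" x] by (intro B.minus_equality[symmetric]) (simp_all add: A.l_neg del: add)

lemma minus [simp]:
  "\<lbrakk>x \<in> carrier A; y \<in> carrier A\<rbrakk> \<Longrightarrow> f (x \<ominus>\<^bsub>A\<^esub> y) = f x \<ominus>\<^bsub>B\<^esub> f y"
  by (simp add: a_minus_def)

lemma ksgn [simp]: "x \<in> carrier A \<Longrightarrow> f (ksgn A e x) = ksgn B e (f x)"
  by (simp add: ksgn_def)

lemma finsum: "g \<in> I \<rightarrow> carrier A \<Longrightarrow> f (finsum A g I) = finsum B (\<lambda>i. f (g i)) I"
proof (induction I rule: infinite_finite_induct)
  case (insert i I)
  then show ?case by (simp add: Pi_def)
qed simp_all

end

lemmas add_hom_intro = add_hom.intro[OF _ _ add_hom_axioms.intro]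

lemma add_map_sum:
  "\<lbrakk>abelian_group B; add_map A B f; add_map A B g\<rbrakk> \<Longrightarrow> add_map A B (\<lambda>x. f x \<oplus>\<^bsub>B\<^esub> g x)"
  by (rule add_mapI)
    (simp_all add: add_map_closed add_map_add abelian_groupE abelian_group.axioms
      abelian_monoid.a_closed abelian_monoid.a_ac)

lemma add_map_zero: "abelian_group B \<Longrightarrow> add_map A B (\<lambda>x. \<zero>\<^bsub>B\<^esub>)"
  by (rule add_mapI) (simp_all add: abelian_group.axioms abelian_monoid.zero_closed abelian_monoid.l_zero)

lemma add_map_ksgn:
  "\<lbrakk>abelian_group B; add_map A B f\<rbrakk> \<Longrightarrow> add_map A B (\<lambda>x. ksgn B e (f x))"
  by (rule add_mapI)
    (simp_all add: add_map_closed add_map_add abelian_group.ksgn_closed abelian_group.ksgn_add)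

definition tw :: "('a, 'x) superring_scheme \<Rightarrow> bit \<Rightarrow> 'a \<Rightarrow> 'a"
  where "tw M p m = hcomp M 0 m \<oplus>\<^bsub>M\<^esub> ksgn M p (hcomp M 1 m)"
    \<comment> \<open>\<open>(-1)\<^bsup>p p(m)\<^esup> m\<close>, extended additively\<close>

context graded_group
begin

lemma grade_closed: "x \<in> grade M d \<Longrightarrow> x \<in> carrier M"
  using subgroup.subset[OF grade_subgroup[of d]] by auto

lemma grade_zero [simp, intro]: "\<zero> \<in> grade M d"
  using subgroup.one_closed[OF grade_subgroup[of d]] by simp

lemma grade_add [intro]: "\<lbrakk>x \<in> grade M d; y \<in> grade M d\<rbrakk> \<Longrightarrow> x \<oplus> y \<in> grade M d"
  using subgroup.m_closed[OF grade_subgroup[of d]] by simp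

lemma grade_neg [intro]: "x \<in> grade M d \<Longrightarrow> \<ominus> x \<in> grade M d"
  using subgroup.m_inv_closed[OF grade_subgroup[of d]] by (simp add: a_inv_def)

lemma grade_minus [intro]: "\<lbrakk>x \<in> grade M d; y \<in> grade M d\<rbrakk> \<Longrightarrow> x \<ominus> y \<in> grade M d"
  by (simp add: a_minus_def grade_add grade_neg)

lemma grade_ksgn [intro]: "x \<in> grade M d \<Longrightarrow> ksgn M e x \<in> grade M d"
  by (simp add: ksgn_def grade_neg)

lemma grade_disjoint: "\<lbrakk>x \<in> grade M d; x \<in> grade M (d + 1)\<rbrakk> \<Longrightarrow> x = \<zero>"
  using grade_Int by (cases d) auto

lemma grade_decomp:
  assumes "m \<in> carrier M"
  obtains x y where "x \<in> grade M d" "y \<in> grade M (d + 1)" "m = x \<oplus> y"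
proof -
  obtain x y where "x \<in> grade M 0" "y \<in> grade M 1" "m = x \<oplus> y"
    using assms grade_sum unfolding set_add_def set_mult_def by auto
  then show thesis using that[of x y] that[of y x] a_comm[OF grade_closed grade_closed]
    by (cases d) auto
qed

text \<open>Uniqueness for the definite description in \<open>hcomp\<close>: the difference of two
  candidates lies in both homogeneous parts.\<close>

lemma hcomp_sum_grades:
  assumes x: "x \<in> grade M d" and y: "y \<in> grade M (d + 1)"
  shows "hcomp M d (x \<oplus> y) = x"
  unfolding hcomp_def
proof (rule the_equality)
  have [simp]: "x \<in> carrier M" "y \<in> carrier M" using x y grade_closed by auto
  have "x \<oplus> y \<ominus> x = y"
    by (simp add: add_minus_cancel)
  with x y show "x \<in> grade M d \<and> x \<oplus> y \<ominus> x \<in> grade M (d + 1)" by simp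
  fix z assume z: "z \<in> grade M d \<and> x \<oplus> y \<ominus> z \<in> grade M (d + 1)"
  then have [simp]: "z \<in> carrier M" using grade_closed by auto
  have "x \<ominus> z = (x \<oplus> y \<ominus> z) \<ominus> y"
    by (simp add: a_minus_def a_ac r_neg) (simp add: a_assoc[symmetric] r_neg)
  then have "x \<ominus> z \<in> grade M (d + 1)" using z y grade_minus by metis
  moreover have "x \<ominus> z \<in> grade M d" using x z grade_minus by blast
  ultimately have "x \<ominus> z = \<zero>" using grade_disjoint by blast
  then show "z = x" by (simp add: minus_eq_zero_iff)
qed

lemma hcomp_grade [intro]: "m \<in> carrier M \<Longrightarrow> hcomp M d m \<in> grade M d"
  by (metis grade_decomp hcomp_sum_grades)

lemma hcomp_closed [simp, intro]: "m \<in> carrier M \<Longrightarrow> hcomp M d m \<in> carrier M"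
  using hcomp_grade grade_closed by blast

lemma hcomp_sum: "m \<in> carrier M \<Longrightarrow> hcomp M 0 m \<oplus> hcomp M 1 m = m"
proof -
  assume "m \<in> carrier M"
  then obtain x y where "x \<in> grade M 0" "y \<in> grade M (0 + 1)" "m = x \<oplus> y"
    using grade_decomp by blast
  then show ?thesis
    using hcomp_sum_grades[of x 0 y] hcomp_sum_grades[of y 1 x] a_comm[of x y] grade_closed by auto
qed

lemma hcomp_of_grade: "x \<in> grade M d \<Longrightarrow> hcomp M e x = (if e = d then x else \<zero>)"
proof (cases "e = d")
  case True
  then show "x \<in> grade M d \<Longrightarrow> ?thesis"
    using hcomp_sum_grades[of x d "\<zero>"] grade_closed by simp
next
  case False
  then have "d = e + 1" by (cases d; cases e) auto
  then show "x \<in> grade M d \<Longrightarrow> ?thesis"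
    using hcomp_sum_grades[of "\<zero>" e x] grade_closed False by simp
qed

lemma hcomp_add:
  assumes "x \<in> carrier M" "y \<in> carrier M"
  shows "hcomp M d (x \<oplus> y) = hcomp M d x \<oplus> hcomp M d y"
proof -
  obtain a b where ab: "a \<in> grade M d" "b \<in> grade M (d + 1)" "x = a \<oplus> b"
    using assms grade_decomp by blast
  obtain a' b' where ab': "a' \<in> grade M d" "b' \<in> grade M (d + 1)" "y = a' \<oplus> b'"
    using assms grade_decomp by blast
  have [simp]: "a \<in> carrier M" "a' \<in> carrier M" "b \<in> carrier M" "b' \<in> carrier M"
    using ab ab' grade_closed by auto
  have "x \<oplus> y = (a \<oplus> a') \<oplus> (b \<oplus> b')" by (simp add: ab ab' a_ac)
  then show ?thesis
    using hcomp_sum_grades[of "a \<oplus> a'" d "b \<oplus> b'"] hcomp_sum_grades[OF ab(1,2)]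
      hcomp_sum_grades[OF ab'(1,2)] ab ab' by auto
qed

lemma add_map_hcomp: "add_map M M (hcomp M d)"
  by (rule add_mapI) (simp_all add: hcomp_add)

lemma tw_of_grade: "x \<in> grade M d \<Longrightarrow> tw M p x = ksgn M (p * d) x"
  by (cases d) (simp_all add: tw_def hcomp_of_grade grade_closed)

lemma add_map_tw: "add_map M M (tw M p)"
  unfolding tw_def
  by (intro add_map_sum add_map_ksgn add_map_hcomp abelian_group_axioms)

lemma tw_closed [simp, intro]: "x \<in> carrier M \<Longrightarrow> tw M p x \<in> carrier M"
  by (rule add_map_closed[OF add_map_tw])

lemma tw_add: "\<lbrakk>x \<in> carrier M; y \<in> carrier M\<rbrakk> \<Longrightarrow> tw M p (x \<oplus> y) = tw M p x \<oplus> tw M p y"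
  by (rule add_map_add[OF add_map_tw])

lemma tw_0 [simp]: "x \<in> carrier M \<Longrightarrow> tw M 0 x = x"
  by (simp add: tw_def hcomp_sum)

lemma tw_grade [intro]: "x \<in> grade M d \<Longrightarrow> tw M p x \<in> grade M d"
  by (simp add: tw_of_grade grade_ksgn)

lemma grade_induct [consumes 1, case_names grade add]:
  assumes "x \<in> carrier M" and "\<And>d x. x \<in> grade M d \<Longrightarrow> P x"
    and "\<And>x y. \<lbrakk>x \<in> carrier M; y \<in> carrier M; P x; P y\<rbrakk> \<Longrightarrow> P (x \<oplus> y)"
  shows "P x"
  using assms by (metis grade_decomp grade_closed)

text \<open>Signs can be written down only for homogeneous elements. Identities with signs are
  reduced to that case by additivity in each variable.\<close>

lemma add_map_eq_grade:
  assumes "add_map M B f" "add_map M B g" "\<And>d x. x \<in> grade M d \<Longrightarrow> f x = g x" "x \<in> carrier M"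
  shows "f x = g x"
  using assms(4) by (induction rule: grade_induct) (simp_all add: assms(3) add_map_add[OF assms(1)] add_map_add[OF assms(2)])

lemma tw_tw [simp]: "x \<in> carrier M \<Longrightarrow> tw M p (tw M q x) = tw M (p + q) x"
  by (rule add_map_eq_grade[OF add_map_comp[OF add_map_tw add_map_tw] add_map_tw])
    (cases p; cases q; simp add: tw_of_grade tw_of_grade[OF grade_ksgn] grade_closed)

end

section \<open>Additive extension from a basis of a free abelian group\<close>

text \<open>Shared by two constructions: \<open>tensor_lift\<close> is an instance, and so is the
  action of the free ring through its words.\<close>

definition ext :: "('p, 'z) monoid_scheme \<Rightarrow> ('a \<Rightarrow> 'p) \<Rightarrow> ('a \<Rightarrow>\<^sub>0 int) \<Rightarrow> 'p"
  where "ext G f x = finprod G (\<lambda>k. f k [^]\<^bsub>G\<^esub> Poly_Mapping.lookup x k) (Poly_Mapping.keys x)"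

context comm_group
begin

text \<open>Elements have different supports; over a common finite superset their products become
  comparable.\<close>

lemma ext_superset:
  assumes "finite B" "Poly_Mapping.keys x \<subseteq> B" "f \<in> B \<rightarrow> carrier G"
  shows "ext G f x = finprod G (\<lambda>k. f k [^] Poly_Mapping.lookup x k) B"
  unfolding ext_def using assms
  by (intro finprod_mono_neutral_cong_left) (auto simp: in_keys_iff)

lemma ext_closed [simp, intro]:
  "\<lbrakk>Poly_Mapping.keys x \<subseteq> U; f \<in> U \<rightarrow> carrier G\<rbrakk> \<Longrightarrow> ext G f x \<in> carrier G"
  unfolding ext_def by (intro finprod_closed) auto

lemma ext_add:
  assumes "Poly_Mapping.keys x \<subseteq> U" "Poly_Mapping.keys y \<subseteq> U" and f: "f \<in> U \<rightarrow> carrier G"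
  shows "ext G f (x + y) = ext G f x \<otimes> ext G f y"
proof -
  let ?B = "Poly_Mapping.keys x \<union> Poly_Mapping.keys y"
  have fB: "f \<in> ?B \<rightarrow> carrier G" using assms by auto
  have "ext G f (x + y) = finprod G (\<lambda>k. f k [^] Poly_Mapping.lookup (x + y) k) ?B"
    using fB Poly_Mapping.keys_add[of x y] by (intro ext_superset) auto
  also have "\<dots> = finprod G (\<lambda>k. f k [^] Poly_Mapping.lookup x k \<otimes> f k [^] Poly_Mapping.lookup y k) ?B"
    using fB by (intro finprod_cong') (auto simp: lookup_add int_pow_mult Pi_def)
  also have "\<dots> = ext G f x \<otimes> ext G f y"
    using fB by (subst finprod_multf) (auto simp: ext_superset[of ?B])
  finally show ?thesis .
qed

lemma ext_zero [simp]: "ext G f 0 = \<one>"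
  by (simp add: ext_def)

lemma ext_frag_of [simp]: "f k \<in> carrier G \<Longrightarrow> ext G f (frag_of k) = f k"
  by (simp add: ext_def)

lemma ext_uminus:
  assumes "Poly_Mapping.keys x \<subseteq> U" and f: "f \<in> U \<rightarrow> carrier G"
  shows "ext G f (- x) = inv (ext G f x)"
proof -
  have "ext G f (- x) \<otimes> ext G f x = \<one>"
    using ext_add[of "- x" U x f] assms by simp
  then show ?thesis
    using assms by (intro inv_equality[symmetric]) (auto intro!: ext_closed[of _ U])
qed

lemma ext_diff:
  assumes "Poly_Mapping.keys x \<subseteq> U" "Poly_Mapping.keys y \<subseteq> U" and f: "f \<in> U \<rightarrow> carrier G"
  shows "ext G f (x - y) = ext G f x \<otimes> inv (ext G f y)"
  using ext_add[of x U "- y" f] ext_uminus[of y U f] assms by simp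

end

lemma tensor_lift_ext: "tensor_lift P h X = ext P (\<lambda>(v, w). h v w) (SOME x. x \<in> X)"
  by (simp add: tensor_lift_def ext_def Let_def case_prod_unfold)

section \<open>The symmetric algebra and its universal action\<close>

lemma generate_induct [consumes 2, case_names one incl inv mult]:
  assumes "x \<in> generate G H" "comm_group G"
    and "P \<one>\<^bsub>G\<^esub>" "\<And>h. h \<in> H \<Longrightarrow> P h" "\<And>h. h \<in> H \<Longrightarrow> P (inv\<^bsub>G\<^esub> h)"
    and "\<And>x y. \<lbrakk>x \<in> generate G H; y \<in> generate G H; P x; P y\<rbrakk> \<Longrightarrow> P (x \<otimes>\<^bsub>G\<^esub> y)"
  shows "P x"
  using assms(1) by (induction rule: generate.induct) (use assms(3-) in auto)

text \<open>Quotient groups and rings reappear as different records with equal fields. Since the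
  hypotheses are symmetric, the inclusion gives equality of the generated subgroups.\<close>

lemma generate_same_fields:
  assumes "carrier G = carrier H" "monoid.mult G = monoid.mult H" "one G = one H"
  shows "generate G E \<subseteq> generate H E"
proof
  have inv: "inv\<^bsub>G\<^esub> h = inv\<^bsub>H\<^esub> h" for h by (simp add: m_inv_def assms)
  fix x assume "x \<in> generate G E"
  then show "x \<in> generate H E"
    by (induction rule: generate.induct) (auto simp: inv assms intro: generate.intros)
qed

lemma ring_same_fields:
  assumes "ring R"
    and "carrier R' = carrier R" "monoid.mult R' = monoid.mult R" "one R' = one R" "ring.zero R' = ring.zero R" "ring.add R' = ring.add R"
  shows "ring R'"
proof -
  interpret ring R by fact
  show ?thesis
    by (intro ringI abelian_groupI monoidI)
      (auto simp: assms(2-) a_assoc a_comm m_assoc l_distr r_distr a_lcomm intro: l_neg a_inv_closed)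
qed

section \<open>Free rings on words\<close>

lemma free_ring_ring: "ring (free_ring A)"
proof (rule ringI)
  have mult_keys: "set (letters w) \<subseteq> A"
    if "w \<in> Poly_Mapping.keys (x * y)" "\<forall>w\<in>Poly_Mapping.keys x. set (letters w) \<subseteq> A"
      "\<forall>w\<in>Poly_Mapping.keys y. set (letters w) \<subseteq> A" for w x and y :: "'a fword \<Rightarrow>\<^sub>0 int"
    using that keys_mult[of x y] by (force simp: plus_fword_def)
  have add_keys: "set (letters w) \<subseteq> A"
    if "w \<in> Poly_Mapping.keys (x + y)" "\<forall>w\<in>Poly_Mapping.keys x. set (letters w) \<subseteq> A"
      "\<forall>w\<in>Poly_Mapping.keys y. set (letters w) \<subseteq> A" for w x and y :: "'a fword \<Rightarrow>\<^sub>0 int"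
    using that Poly_Mapping.keys_add[of x y] by blast
  show "abelian_group (free_ring A)"
  proof (rule abelian_groupI)
    fix x assume "x \<in> carrier (free_ring A)"
    then show "\<exists>y\<in>carrier (free_ring A). y \<oplus>\<^bsub>free_ring A\<^esub> x = \<zero>\<^bsub>free_ring A\<^esub>"
      by (intro bexI[of _ "- x"]) (auto simp: free_ring_def)
  qed (auto simp: free_ring_def algebra_simps dest: add_keys)
  have one: "Poly_Mapping.keys (1 :: 'a fword \<Rightarrow>\<^sub>0 int) = {0}"
    by simp
  show "Group.monoid (free_ring A)"
    by (rule monoidI) (auto simp: free_ring_def mult.assoc one zero_fword_def dest: mult_keys)
qed (auto simp: free_ring_def algebra_simps)

lemma free_ring_simps [simp]:
  "monoid.mult (free_ring A) = (*)" "one (free_ring A) = 1" "ring.zero (free_ring A) = 0" "ring.add (free_ring A) = (+)"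
  by (simp_all add: free_ring_def)

definition word_set :: "'a set \<Rightarrow> 'a fword set"
  where "word_set A = {w. set (letters w) \<subseteq> A}"

lemma carrier_free_ring: "x \<in> carrier (free_ring A) \<longleftrightarrow> Poly_Mapping.keys x \<subseteq> word_set A"
  by (auto simp: free_ring_def word_set_def)

lemma neg_free_ring: "x \<in> carrier (free_ring A) \<Longrightarrow> \<ominus>\<^bsub>free_ring A\<^esub> x = - x"
proof -
  interpret ring "free_ring A" by (rule free_ring_ring)
  show "x \<in> carrier (free_ring A) \<Longrightarrow> ?thesis"
    by (rule minus_equality) (simp_all add: carrier_free_ring)
qed

lemma minus_free_ring:
  "\<lbrakk>x \<in> carrier (free_ring A); y \<in> carrier (free_ring A)\<rbrakk> \<Longrightarrow> x \<ominus>\<^bsub>free_ring A\<^esub> y = x - y"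
  by (simp add: a_minus_def neg_free_ring)

lemma fmon_carrier [simp]: "fmon xs \<in> carrier (free_ring A) \<longleftrightarrow> set xs \<subseteq> A"
  by (simp add: carrier_free_ring fmon_def word_set_def)

lemma fmon_append: "fmon (xs @ ys) = fmon xs * fmon ys"
  by (simp add: fmon_def mult_single plus_fword_def)

lemma fmon_Cons: "fmon (x # xs) = fmon [x] * fmon xs"
  using fmon_append[of "[x]" xs] by simp

lemma fmon_Nil: "fmon [] = 1"
  by (simp add: fmon_def flip: zero_fword_def single_one)

lemma free_ring_diff:
  "\<lbrakk>x \<in> carrier (free_ring A); y \<in> carrier (free_ring A)\<rbrakk> \<Longrightarrow> x - y \<in> carrier (free_ring A)"
  by (metis abelian_group.minus_closed free_ring_ring minus_free_ring ring_def)

lemma free_ring_induct [consumes 1, case_names word diff]: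
  assumes "x \<in> carrier (free_ring A)"
    and word: "\<And>xs. set xs \<subseteq> A \<Longrightarrow> P (fmon xs)"
    and diff: "\<And>x y. \<lbrakk>x \<in> carrier (free_ring A); y \<in> carrier (free_ring A); P x; P y\<rbrakk> \<Longrightarrow> P (x - y)"
  shows "P x"
proof -
  have "x \<in> carrier (free_ring A) \<and> P x"
    using assms(1)[unfolded carrier_free_ring]
  proof (induction rule: frag_induction)
    case zero
    have "P (fmon [] - fmon [])" by (intro diff word) simp_all
    then show ?case by (simp add: carrier_free_ring)
  next
    case (one w)
    then show ?case
      using word[of "letters w"] by (simp add: carrier_free_ring fmon_def word_set_def)
  next
    case (diff a b)
    then show ?case using assms(3) free_ring_diff by blast
  qed
  then show ?thesis by blast
qed

lemma ideal_image:
  assumes h: "h \<in> ring_hom R R'" and sur: "h ` carrier R = carrier R'"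
    and R: "ring R" and R': "ring R'" and I: "ideal I R"
  shows "ideal (h ` I) R'"
proof -
  interpret R: ring R by fact
  interpret R': ring R' by fact
  interpret ideal I R by fact
  interpret h: ring_hom_ring R R' h using h R R' by (simp add: ring_hom_ringI2)
  show ?thesis
  proof (rule idealI[OF R'])
    have "subgroup (h ` I) (add_monoid R')"
      by (rule group_hom.subgroup_img_is_subgroup[OF h.a_group_hom a_subgroup])
    then show "subgroup (h ` I) (add_monoid R')" .
    fix a x assume a: "a \<in> h ` I" and "x \<in> carrier R'"
    then obtain b y where "b \<in> I" "a = h b" "y \<in> carrier R" "x = h y"
      using sur by (metis imageE)
    then show "x \<otimes>\<^bsub>R'\<^esub> a \<in> h ` I" "a \<otimes>\<^bsub>R'\<^esub> x \<in> h ` I"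
      using I_l_closed I_r_closed a_Hcarr by (force simp flip: h.hom_mult)+
  qed
qed

lemma Idl_coset_zero:
  assumes "ring R" "E \<subseteq> carrier R" "ideal H R" "E \<subseteq> H" "x \<in> carrier R"
    "Idl\<^bsub>R\<^esub> E +>\<^bsub>R\<^esub> x = Idl\<^bsub>R\<^esub> E"
  shows "x \<in> H"
proof -
  interpret ring R by fact
  interpret ideal "Idl\<^bsub>R\<^esub> E" R using assms(2) by (rule genideal_ideal)
  have "x \<in> Idl\<^bsub>R\<^esub> E" using assms(5,6) rcos_const_imp_mem by blast
  then show ?thesis using genideal_minimal[OF assms(3,4)] by blast
qed

context comm_superring
begin

lemma one_grade [simp, intro]: "\<one> \<in> grade K 0"
  by (rule one_even)

lemma ksgn_one_grade [intro]: "ksgn K e \<one> \<in> grade K 0"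
  by (intro grade_ksgn one_grade)

end

section \<open>The symmetric algebra as a quotient of the free ring\<close>

locale sym_base = supermodule K M
  for K :: "'k superring" and M :: "('k, 'm, 'x) supermodule_scheme" (structure)
begin

abbreviation "F \<equiv> letter_ring K M"
abbreviation "T \<equiv> tensor_alg K M"
abbreviation "S \<equiv> sym_alg K M"

sublocale F: ring F by (rule free_ring_ring)

lemma tensor_alg_rel_carrier: "tensor_alg_rel K M \<subseteq> carrier F"
  unfolding tensor_alg_rel_def fmon_Nil[symmetric]
  by (auto intro!: free_ring_diff rsmult_closed ksgn_closed dest: grade_closed K.grade_closed)

sublocale I: ideal "tensor_alg_ideal K M" F
  unfolding tensor_alg_ideal_def by (rule F.genideal_ideal[OF tensor_alg_rel_carrier])

abbreviation pT where "pT x \<equiv> tensor_alg_ideal K M +>\<^bsub>F\<^esub> x"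

lemma T_fields:
  "carrier T = carrier (F Quot tensor_alg_ideal K M)" "monoid.mult T = monoid.mult (F Quot tensor_alg_ideal K M)"
  "one T = one (F Quot tensor_alg_ideal K M)" "ring.zero T = ring.zero (F Quot tensor_alg_ideal K M)"
  "ring.add T = ring.add (F Quot tensor_alg_ideal K M)"
  by (simp_all add: tensor_alg_def Let_def)

sublocale T: ring T
  by (rule ring_same_fields[OF I.quotient_is_ring T_fields])

lemma pT_hom: "pT \<in> ring_hom F T"
  using I.rcos_ring_hom by (auto simp: ring_hom_def T_fields)

lemma pT_surj: "pT ` carrier F = carrier T"
  by (auto simp: T_fields FactRing_def A_RCOSETS_def' )

text \<open>Lifts to the free ring of the generators of \<open>sym_ideal\<close>. They allow S, a
  quotient of a quotient, to be treated as a quotient in one step.\<close>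

definition sym_rel :: "(('k + 'm) fword \<Rightarrow>\<^sub>0 int) set"
  where "sym_rel = {fmon [Inr v, Inr w] - ksgn F (p * q) (fmon [Inr w, Inr v]) |v w p q.
               v \<in> grade M p \<and> w \<in> grade M q} \<union> {fmon [Inr u, Inr u] |u. u \<in> grade M 1}"

lemma sym_rel_carrier: "sym_rel \<subseteq> carrier F"
  unfolding sym_rel_def by (auto intro!: free_ring_diff F.ksgn_closed dest: grade_closed)

sublocale pT: ring_hom_ring F T pT
  by (rule ring_hom_ringI2[OF F.ring_axioms T.ring_axioms pT_hom])

lemma sym_ideal_eq: "sym_ideal K M = Idl\<^bsub>T\<^esub> (pT ` sym_rel)"
proof -
  interpret h: add_hom F T pT
    by (intro add_hom_intro F.abelian_group_axioms T.abelian_group_axioms add_mapI)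
      (use pT.hom_add in simp_all)
  have mult: "tmon K M [Inr v] \<otimes>\<^bsub>T\<^esub> tmon K M [Inr w] = pT (fmon [Inr v, Inr w])"
    if "v \<in> carrier M" "w \<in> carrier M" for v w
  proof -
    have "pT (fmon [Inr v] \<otimes>\<^bsub>F\<^esub> fmon [Inr w]) = pT (fmon [Inr v]) \<otimes>\<^bsub>T\<^esub> pT (fmon [Inr w])"
      using that by (intro pT.hom_mult) simp_all
    then show ?thesis by (simp add: tmon_def fmon_Cons[of "Inr v" "[Inr w]"])
  qed
  have rel: "pT (fmon [Inr v, Inr w] - ksgn F e (fmon [Inr w, Inr v]))
      = tmon K M [Inr v] \<otimes>\<^bsub>T\<^esub> tmon K M [Inr w] \<ominus>\<^bsub>T\<^esub> ksgn T e (tmon K M [Inr w] \<otimes>\<^bsub>T\<^esub> tmon K M [Inr v])"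
    if "v \<in> carrier M" "w \<in> carrier M" for v w e
    using h.minus[of "fmon [Inr v, Inr w]" "ksgn F e (fmon [Inr w, Inr v])"] that
    by (simp add: minus_free_ring F.ksgn_closed h.ksgn mult)
  have "pT ` sym_rel = {tmon K M [Inr v] \<otimes>\<^bsub>T\<^esub> tmon K M [Inr w]
        \<ominus>\<^bsub>T\<^esub> ksgn T (p * q) (tmon K M [Inr w] \<otimes>\<^bsub>T\<^esub> tmon K M [Inr v]) |v w p q.
          v \<in> grade M p \<and> w \<in> grade M q}
      \<union> {tmon K M [Inr u] \<otimes>\<^bsub>T\<^esub> tmon K M [Inr u] |u. u \<in> grade M 1}" (is "_ = ?A \<union> ?B")
  proof (intro equalityI subsetI)
    fix x assume "x \<in> pT ` sym_rel"
    then show "x \<in> ?A \<union> ?B"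
      unfolding sym_rel_def
    proof (elim imageE UnE)
      fix y assume "x = pT y" "y \<in> {fmon [Inr v, Inr w] - ksgn F (p * q) (fmon [Inr w, Inr v]) |v w p q.
               v \<in> grade M p \<and> w \<in> grade M q}"
      then have "x \<in> ?A" using rel grade_closed by blast
      then show ?thesis ..
    next
      fix y assume "x = pT y" "y \<in> {fmon [Inr u, Inr u] |u. u \<in> grade M 1}"
      then have "x \<in> ?B" using mult grade_closed by blast
      then show ?thesis ..
    qed
  next
    fix x assume "x \<in> ?A \<union> ?B"
    then show "x \<in> pT ` sym_rel"
    proof
      assume "x \<in> ?A"
      then obtain v w p q where "v \<in> grade M p" "w \<in> grade M q"
        "x = tmon K M [Inr v] \<otimes>\<^bsub>T\<^esub> tmon K M [Inr w]
          \<ominus>\<^bsub>T\<^esub> ksgn T (p * q) (tmon K M [Inr w] \<otimes>\<^bsub>T\<^esub> tmon K M [Inr v])" by blast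
      then show ?thesis
        using rel[of v w "p * q"] grade_closed unfolding sym_rel_def by blast
    next
      assume "x \<in> ?B"
      then obtain u where "u \<in> grade M 1" "x = tmon K M [Inr u] \<otimes>\<^bsub>T\<^esub> tmon K M [Inr u]" by blast
      then show ?thesis using mult[of u u] grade_closed unfolding sym_rel_def by blast
    qed
  qed
  then show ?thesis unfolding sym_ideal_def Let_def by simp
qed

sublocale J: ideal "sym_ideal K M" T
  unfolding sym_ideal_eq by (rule T.genideal_ideal) (use sym_rel_carrier pT_surj in blast)

definition pS :: "(('k + 'm) fword \<Rightarrow>\<^sub>0 int) \<Rightarrow> (('k + 'm) fword \<Rightarrow>\<^sub>0 int) set set"
  where "pS x = sym_ideal K M +>\<^bsub>T\<^esub> pT x"

definition sc :: "'k \<Rightarrow> (('k + 'm) fword \<Rightarrow>\<^sub>0 int) set set"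
  where "sc \<alpha> = pS (fmon [Inl \<alpha>])"

lemma S_fields:
  "carrier S = carrier (T Quot sym_ideal K M)" "monoid.mult S = monoid.mult (T Quot sym_ideal K M)"
  "one S = one (T Quot sym_ideal K M)" "ring.zero S = ring.zero (T Quot sym_ideal K M)"
  "ring.add S = ring.add (T Quot sym_ideal K M)"
  by (simp_all add: sym_alg_def Let_def)

sublocale S: ring S
  by (rule ring_same_fields[OF J.quotient_is_ring S_fields])

lemma pS_hom: "pS \<in> ring_hom F S"
proof -
  have "(\<lambda>X. sym_ideal K M +>\<^bsub>T\<^esub> X) \<in> ring_hom T S"
    using J.rcos_ring_hom by (auto simp: ring_hom_def S_fields)
  from ring_hom_trans[OF pT_hom this] show ?thesis
    by (simp add: comp_def pS_def[abs_def])
qed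

sublocale pS: ring_hom_ring F S pS
  by (rule ring_hom_ringI2[OF F.ring_axioms S.ring_axioms pS_hom])

lemma pS_surj: "pS ` carrier F = carrier S"
  unfolding pS_def[abs_def] image_comp[symmetric, unfolded comp_def]
  by (auto simp: S_fields FactRing_def A_RCOSETS_def' pT_surj[symmetric])

text \<open>The universal property of S in terms of ideals, which avoids the construction of a
  target ring. The image of H in T is an ideal because \<open>pT\<close> is onto; it contains the
  symmetric relations, and the kernel of \<open>pT\<close> lies in H as well.\<close>

lemma pS_kernel:
  assumes H: "ideal H F" and "tensor_alg_rel K M \<subseteq> H" "sym_rel \<subseteq> H"
    and x: "x \<in> carrier F" "pS x = \<zero>\<^bsub>S\<^esub>"
  shows "x \<in> H"
proof -
  interpret H: ideal H F by fact
  have "pT x \<in> pT ` H"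
  proof (rule Idl_coset_zero[OF T.ring_axioms])
    show "pT ` sym_rel \<subseteq> carrier T" using sym_rel_carrier pT_surj by blast
    show "ideal (pT ` H) T"
      by (rule ideal_image[OF pT_hom pT_surj F.ring_axioms T.ring_axioms H])
    show "pT ` sym_rel \<subseteq> pT ` H" using assms by blast
    show "pT x \<in> carrier T" using x by simp
    show "Idl\<^bsub>T\<^esub> (pT ` sym_rel) +>\<^bsub>T\<^esub> pT x = Idl\<^bsub>T\<^esub> (pT ` sym_rel)"
      using x(2) unfolding pS_def S_fields sym_ideal_eq[symmetric] by (simp add: FactRing_def)
  qed
  then obtain h where h: "h \<in> H" "pT x = pT h" by blast
  then have hF: "h \<in> carrier F" using H.a_Hcarr by blast
  \<comment> \<open>Two elements with the same class in T differ by a consequence of the tensor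
    algebra relations, which again belongs to H.\<close>
  have "x \<ominus>\<^bsub>F\<^esub> h \<in> tensor_alg_ideal K M"
    using F.quotient_eq_iff_same_a_r_cos[OF I.is_ideal x(1) hF] h(2) by simp
  also have "\<dots> \<subseteq> H"
    unfolding tensor_alg_ideal_def by (rule F.genideal_minimal[OF H assms(2)])
  finally have "x \<ominus>\<^bsub>F\<^esub> h \<oplus>\<^bsub>F\<^esub> h \<in> H" using h(1) by (rule H.a_closed)
  then show ?thesis using x(1) hF by (simp add: minus_free_ring)
qed

lemma pS_add: "\<lbrakk>x \<in> carrier F; y \<in> carrier F\<rbrakk> \<Longrightarrow> pS (x + y) = pS x \<oplus>\<^bsub>S\<^esub> pS y"
  using pS.hom_add[of x y] by simp

lemma pS_add_hom: "add_hom F S pS"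
  by (intro add_hom_intro F.abelian_group_axioms S.abelian_group_axioms add_mapI) (simp_all add: pS_add)

lemma pS_diff: "\<lbrakk>x \<in> carrier F; y \<in> carrier F\<rbrakk> \<Longrightarrow> pS (x - y) = pS x \<ominus>\<^bsub>S\<^esub> pS y"
  using add_hom.minus[OF pS_add_hom, of x y] by (simp add: minus_free_ring)

lemma pS_mult: "\<lbrakk>x \<in> carrier F; y \<in> carrier F\<rbrakk> \<Longrightarrow> pS (x * y) = pS x \<otimes>\<^bsub>S\<^esub> pS y"
  using pS.hom_mult[of x y] by simp

lemma pS_one: "pS 1 = \<one>\<^bsub>S\<^esub>"
  using pS.hom_one by simp

lemma pS_tensor_alg_rel: "x \<in> tensor_alg_rel K M \<Longrightarrow> pS x = \<zero>\<^bsub>S\<^esub>"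
proof -
  assume "x \<in> tensor_alg_rel K M"
  then have "x \<in> tensor_alg_ideal K M"
    unfolding tensor_alg_ideal_def using F.genideal_self[OF tensor_alg_rel_carrier] by blast
  then have "pT x = \<zero>\<^bsub>T\<^esub>"
    using F.a_rcos_zero[OF I.is_ideal] by (simp add: T_fields FactRing_def)
  then have "pS x = sym_ideal K M"
    using T.a_rcos_zero[OF J.is_ideal] J.zero_closed by (simp add: pS_def)
  then show ?thesis by (simp add: S_fields FactRing_def)
qed

lemma pS_sym_rel: "x \<in> sym_rel \<Longrightarrow> pS x = \<zero>\<^bsub>S\<^esub>"
proof -
  assume x: "x \<in> sym_rel"
  then have "pT x \<in> sym_ideal K M"
    unfolding sym_ideal_eq using T.genideal_self[of "pT ` sym_rel"] sym_rel_carrier pT_surj by blast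
  then show ?thesis using T.a_rcos_zero[OF J.is_ideal] by (simp add: pS_def S_fields FactRing_def)
qed

lemma sym_of_pS: "sym_of K M v = pS (fmon [Inr v])"
  by (simp add: sym_of_def pS_def tmon_def)

lemma sym_of_closed [simp, intro]: "v \<in> carrier M \<Longrightarrow> sym_of K M v \<in> carrier S"
  unfolding sym_of_pS by (intro pS.hom_closed) simp

lemma sc_closed [simp, intro]: "\<alpha> \<in> carrier K \<Longrightarrow> sc \<alpha> \<in> carrier S"
  unfolding sc_def by (intro pS.hom_closed) simp

lemma pS_diff_eq:
  "\<lbrakk>x - y \<in> tensor_alg_rel K M; x \<in> carrier F; y \<in> carrier F\<rbrakk> \<Longrightarrow> pS x = pS y"
  using pS_tensor_alg_rel[of "x - y"] pS_diff[of x y] by (simp add: S.minus_eq_zero_iff)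

lemma pS_diff2_eq:
  "\<lbrakk>x - y - z \<in> tensor_alg_rel K M; x \<in> carrier F; y \<in> carrier F; z \<in> carrier F\<rbrakk>
    \<Longrightarrow> pS x = pS y \<oplus>\<^bsub>S\<^esub> pS z"
  using pS_tensor_alg_rel[of "x - y - z"] pS_diff[of x "y + z"]
  by (simp add: S.minus_eq_zero_iff pS_add diff_diff_eq)
    (metis F.add.m_closed S.minus_eq_zero_iff free_ring_simps(4) pS.hom_closed pS_add)

lemma pS_Cons2: "\<lbrakk>x \<in> carrier K <+> carrier M; y \<in> carrier K <+> carrier M\<rbrakk>
    \<Longrightarrow> pS (fmon [x, y]) = pS (fmon [x]) \<otimes>\<^bsub>S\<^esub> pS (fmon [y])"
  by (subst fmon_Cons) (simp add: pS_mult)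

lemma sc_add: "\<lbrakk>\<alpha> \<in> carrier K; \<beta> \<in> carrier K\<rbrakk> \<Longrightarrow> sc (\<alpha> \<oplus>\<^bsub>K\<^esub> \<beta>) = sc \<alpha> \<oplus>\<^bsub>S\<^esub> sc \<beta>"
  unfolding sc_def by (rule pS_diff2_eq, unfold tensor_alg_rel_def, blast) simp_all

lemma sc_mult: "\<lbrakk>\<alpha> \<in> carrier K; \<beta> \<in> carrier K\<rbrakk> \<Longrightarrow> sc (\<alpha> \<otimes>\<^bsub>K\<^esub> \<beta>) = sc \<alpha> \<otimes>\<^bsub>S\<^esub> sc \<beta>"
  unfolding sc_def
proof -
  assume *: "\<alpha> \<in> carrier K" "\<beta> \<in> carrier K"
  then have "fmon [Inl (\<alpha> \<otimes>\<^bsub>K\<^esub> \<beta>)] - fmon [Inl \<alpha>, Inl \<beta>] \<in> tensor_alg_rel K M"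
    unfolding tensor_alg_rel_def by blast
  from pS_diff_eq[OF this] * show "pS (fmon [Inl (\<alpha> \<otimes>\<^bsub>K\<^esub> \<beta>)]) = pS (fmon [Inl \<alpha>]) \<otimes>\<^bsub>S\<^esub> pS (fmon [Inl \<beta>])"
    by (simp add: pS_Cons2)
qed

lemma sc_one [simp]: "sc \<one>\<^bsub>K\<^esub> = \<one>\<^bsub>S\<^esub>"
  unfolding sc_def pS_one[symmetric]
proof (rule pS_diff_eq)
  show "fmon [Inl \<one>\<^bsub>K\<^esub>] - 1 \<in> tensor_alg_rel K M" unfolding tensor_alg_rel_def by blast
qed (simp_all flip: fmon_Nil)

lemma sym_of_add:
  "\<lbrakk>v \<in> carrier M; w \<in> carrier M\<rbrakk> \<Longrightarrow> sym_of K M (v \<oplus> w) = sym_of K M v \<oplus>\<^bsub>S\<^esub> sym_of K M w"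
  unfolding sym_of_pS by (rule pS_diff2_eq, unfold tensor_alg_rel_def, blast) simp_all

lemma sym_of_rsmult:
  "\<lbrakk>v \<in> carrier M; \<alpha> \<in> carrier K\<rbrakk> \<Longrightarrow> sym_of K M (rsmult M v \<alpha>) = sym_of K M v \<otimes>\<^bsub>S\<^esub> sc \<alpha>"
  unfolding sym_of_pS sc_def
proof -
  assume *: "v \<in> carrier M" "\<alpha> \<in> carrier K"
  then have "fmon [Inr (rsmult M v \<alpha>)] - fmon [Inr v, Inl \<alpha>] \<in> tensor_alg_rel K M"
    unfolding tensor_alg_rel_def by blast
  from pS_diff_eq[OF this] * show "pS (fmon [Inr (rsmult M v \<alpha>)]) = pS (fmon [Inr v]) \<otimes>\<^bsub>S\<^esub> pS (fmon [Inl \<alpha>])"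
    by (simp add: pS_Cons2 rsmult_closed)
qed

lemma sc_sym_of:
  "\<lbrakk>\<alpha> \<in> grade K p; v \<in> grade M q\<rbrakk>
    \<Longrightarrow> sc \<alpha> \<otimes>\<^bsub>S\<^esub> sym_of K M v = sym_of K M (ksgn M (p * q) (rsmult M v \<alpha>))"
  unfolding sym_of_pS sc_def
proof -
  assume *: "\<alpha> \<in> grade K p" "v \<in> grade M q"
  then have "fmon [Inr (ksgn M (p * q) (rsmult M v \<alpha>))] - fmon [Inl \<alpha>, Inr v] \<in> tensor_alg_rel K M"
    unfolding tensor_alg_rel_def by blast
  from pS_diff_eq[OF this] *
  show "pS (fmon [Inl \<alpha>]) \<otimes>\<^bsub>S\<^esub> pS (fmon [Inr v]) = pS (fmon [Inr (ksgn M (p * q) (rsmult M v \<alpha>))])"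
    by (simp add: pS_Cons2 rsmult_closed K.grade_closed grade_closed)
qed

lemma add_map_sym_of: "add_map M S (sym_of K M)"
  by (rule add_mapI) (simp_all add: sym_of_add)

sublocale sym_of: add_hom M S "sym_of K M"
  by (rule add_hom_intro[OF abelian_group_axioms S.abelian_group_axioms add_map_sym_of])

sublocale sc: add_hom K S sc
  by (intro add_hom_intro K.abelian_group_axioms S.abelian_group_axioms add_mapI) (simp_all add: sc_add)

lemma sym_of_comm:
  "\<lbrakk>v \<in> grade M p; w \<in> grade M q\<rbrakk>
    \<Longrightarrow> sym_of K M v \<otimes>\<^bsub>S\<^esub> sym_of K M w = ksgn S (p * q) (sym_of K M w \<otimes>\<^bsub>S\<^esub> sym_of K M v)"
proof -
  interpret h: add_hom F S pS by (rule pS_add_hom)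
  assume vw: "v \<in> grade M p" "w \<in> grade M q"
  then have [simp]: "v \<in> carrier M" "w \<in> carrier M" using grade_closed by auto
  have "pS (fmon [Inr v, Inr w] - ksgn F (p * q) (fmon [Inr w, Inr v])) = \<zero>\<^bsub>S\<^esub>"
    using vw by (intro pS_sym_rel) (unfold sym_rel_def, blast)
  then have "pS (fmon [Inr v, Inr w]) = ksgn S (p * q) (pS (fmon [Inr w, Inr v]))"
    by (subst (asm) pS_diff) (simp_all add: F.ksgn_closed S.minus_eq_zero_iff h.ksgn)
  then show ?thesis by (simp add: sym_of_pS pS_Cons2)
qed

lemma sym_of_odd_square: "u \<in> grade M 1 \<Longrightarrow> sym_of K M u \<otimes>\<^bsub>S\<^esub> sym_of K M u = \<zero>\<^bsub>S\<^esub>"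
proof -
  assume u: "u \<in> grade M 1"
  then have "fmon [Inr u, Inr u] \<in> sym_rel" unfolding sym_rel_def by blast
  from pS_sym_rel[OF this] show ?thesis using u by (simp add: sym_of_pS pS_Cons2 grade_closed)
qed

lemma S_rsmult: "\<alpha> \<in> carrier K \<Longrightarrow> rsmult S x \<alpha> = x \<otimes>\<^bsub>S\<^esub> sc \<alpha>"
proof -
  assume a: "\<alpha> \<in> carrier K"
  have "rsmult T \<one>\<^bsub>T\<^esub> \<alpha> = \<one>\<^bsub>T\<^esub> \<otimes>\<^bsub>T\<^esub> pT (fmon [Inl \<alpha>])"
    by (simp add: tensor_alg_def Let_def tmon_def)
  also have "\<dots> = pT (fmon [Inl \<alpha>])" using a by (intro T.l_one pT.hom_closed) simp
  finally have "sym_ideal K M +>\<^bsub>T\<^esub> rsmult T \<one>\<^bsub>T\<^esub> \<alpha> = sc \<alpha>" by (simp add: sc_def pS_def)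
  then show ?thesis by (simp add: sym_alg_def Let_def)
qed

lemma letters_carrier:
  "list_all2 (\<lambda>x p. x \<in> grade K p <+> grade M p) xs ps \<Longrightarrow> set xs \<subseteq> carrier K <+> carrier M"
  by (induction rule: list_all2_induct) (auto dest: grade_closed K.grade_closed)

text \<open>The grading is defined as an image of the grading of T. Expressed by homogeneous words
  of the free ring it becomes accessible to induction.\<close>

lemma S_grade:
  "grade S d = generate (add_monoid S) {pS (fmon xs) |xs ps.
     list_all2 (\<lambda>x p. x \<in> grade K p <+> grade M p) xs ps \<and> sum_list ps = d}"
proof -
  let ?G = "{xs. \<exists>ps. list_all2 (\<lambda>x p. x \<in> grade K p <+> grade M p) xs ps \<and> sum_list ps = d}"
  have G: "set xs \<subseteq> carrier K <+> carrier M" if "xs \<in> ?G" for xs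
    using that letters_carrier by blast
  have addT: "generate (add_monoid T) E = generate (add_monoid (F Quot tensor_alg_ideal K M)) E" for E
    by (intro equalityI generate_same_fields) (simp_all add: T_fields)
  have h: "(\<lambda>X. sym_ideal K M +>\<^bsub>T\<^esub> X) \<in> ring_hom T S"
    using J.rcos_ring_hom by (auto simp: ring_hom_def S_fields)
  interpret h: ring_hom_ring T S "\<lambda>X. sym_ideal K M +>\<^bsub>T\<^esub> X"
    by (rule ring_hom_ringI2[OF T.ring_axioms S.ring_axioms h])
  have GT: "(\<lambda>xs. pT (fmon xs)) ` ?G \<subseteq> carrier T"
  proof (rule image_subsetI)
    fix xs assume "xs \<in> ?G"
    from G[OF this] show "pT (fmon xs) \<in> carrier T" by simp
  qed
  have "grade S d = (\<lambda>X. sym_ideal K M +>\<^bsub>T\<^esub> X) ` generate (add_monoid T) ((\<lambda>xs. pT (fmon xs)) ` ?G)"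
    unfolding addT
    by (simp add: sym_alg_def tensor_alg_def Let_def tmon_def image_def setcompr_eq_image)
  also have "\<dots> = generate (add_monoid S) ((\<lambda>X. sym_ideal K M +>\<^bsub>T\<^esub> X) ` (\<lambda>xs. pT (fmon xs)) ` ?G)"
    using GT by (intro group_hom.generate_img[OF h.a_group_hom, symmetric]) simp
  also have "(\<lambda>X. sym_ideal K M +>\<^bsub>T\<^esub> X) ` (\<lambda>xs. pT (fmon xs)) ` ?G = {pS (fmon xs) |xs ps.
     list_all2 (\<lambda>x p. x \<in> grade K p <+> grade M p) xs ps \<and> sum_list ps = d}"
    by (auto simp: pS_def)
  finally show ?thesis .
qed

end

section \<open>Actions of the symmetric algebra on abelian groups\<close>

locale sym_action = sym_base K M + W: abelian_group W
  for K :: "'k superring" and M :: "('k, 'm, 'x) supermodule_scheme" (structure)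
    and W :: "('w, 'z) ring_scheme" +
  fixes opK :: "'k \<Rightarrow> 'w \<Rightarrow> 'w" and opM :: "'m \<Rightarrow> 'w \<Rightarrow> 'w"
  assumes opK_map: "\<alpha> \<in> carrier K \<Longrightarrow> add_map W W (opK \<alpha>)"
    and opM_map: "v \<in> carrier M \<Longrightarrow> add_map W W (opM v)"
    and opK_add: "\<lbrakk>\<alpha> \<in> carrier K; \<beta> \<in> carrier K; w \<in> carrier W\<rbrakk>
      \<Longrightarrow> opK (\<alpha> \<oplus>\<^bsub>K\<^esub> \<beta>) w = opK \<alpha> w \<oplus>\<^bsub>W\<^esub> opK \<beta> w"
    and opK_mult_grade: "\<lbrakk>\<alpha> \<in> grade K p; \<beta> \<in> grade K q; w \<in> carrier W\<rbrakk>
      \<Longrightarrow> opK (\<alpha> \<otimes>\<^bsub>K\<^esub> \<beta>) w = opK \<alpha> (opK \<beta> w)"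
    and opK_one: "w \<in> carrier W \<Longrightarrow> opK \<one>\<^bsub>K\<^esub> w = w"
    and opM_add: "\<lbrakk>u \<in> carrier M; v \<in> carrier M; w \<in> carrier W\<rbrakk>
      \<Longrightarrow> opM (u \<oplus> v) w = opM u w \<oplus>\<^bsub>W\<^esub> opM v w"
    and opM_rsmult_grade: "\<lbrakk>v \<in> grade M q; \<alpha> \<in> grade K p; w \<in> carrier W\<rbrakk>
      \<Longrightarrow> opM (rsmult M v \<alpha>) w = opM v (opK \<alpha> w)"
    and opK_opM: "\<lbrakk>\<alpha> \<in> grade K p; v \<in> grade M q; w \<in> carrier W\<rbrakk>
      \<Longrightarrow> opK \<alpha> (opM v w) = opM (ksgn M (p * q) (rsmult M v \<alpha>)) w"
    and opM_comm: "\<lbrakk>u \<in> grade M p; v \<in> grade M q; w \<in> carrier W\<rbrakk>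
      \<Longrightarrow> opM u (opM v w) = ksgn W (p * q) (opM v (opM u w))"
    and opM_square: "\<lbrakk>u \<in> grade M 1; w \<in> carrier W\<rbrakk> \<Longrightarrow> opM u (opM u w) = \<zero>\<^bsub>W\<^esub>"
begin

lemma op_closed [simp]:
  "\<lbrakk>\<alpha> \<in> carrier K; w \<in> carrier W\<rbrakk> \<Longrightarrow> opK \<alpha> w \<in> carrier W"
  "\<lbrakk>v \<in> carrier M; w \<in> carrier W\<rbrakk> \<Longrightarrow> opM v w \<in> carrier W"
  by (auto intro: add_map_closed[OF opK_map] add_map_closed[OF opM_map])

text \<open>The locale asks for this on homogeneous scalars, where an action is checked with
  explicit signs. Additivity in both scalars gives the general case.\<close>

lemma opK_mult:
  assumes "\<alpha> \<in> carrier K" "\<beta> \<in> carrier K" and w: "w \<in> carrier W"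
  shows "opK (\<alpha> \<otimes>\<^bsub>K\<^esub> \<beta>) w = opK \<alpha> (opK \<beta> w)"
proof (rule K.add_map_eq_grade[OF _ _ _ assms(1)])
  show "add_map K W (\<lambda>\<alpha>. opK (\<alpha> \<otimes>\<^bsub>K\<^esub> \<beta>) w)" "add_map K W (\<lambda>\<alpha>. opK \<alpha> (opK \<beta> w))"
    using assms by (auto intro!: add_mapI simp: K.l_distr opK_add)
  fix d \<alpha> assume a: "\<alpha> \<in> grade K d"
  show "opK (\<alpha> \<otimes>\<^bsub>K\<^esub> \<beta>) w = opK \<alpha> (opK \<beta> w)"
  proof (rule K.add_map_eq_grade[OF _ _ _ assms(2)])
    show "add_map K W (\<lambda>\<beta>. opK (\<alpha> \<otimes>\<^bsub>K\<^esub> \<beta>) w)" "add_map K W (\<lambda>\<beta>. opK \<alpha> (opK \<beta> w))"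
      using a[THEN K.grade_closed] w
      by (auto intro!: add_mapI simp: K.r_distr opK_add add_map_add[OF opK_map])
  qed (rule opK_mult_grade[OF a _ w])
qed

lemma opM_rsmult:
  assumes "v \<in> carrier M" "\<alpha> \<in> carrier K" and w: "w \<in> carrier W"
  shows "opM (rsmult M v \<alpha>) w = opM v (opK \<alpha> w)"
proof (rule add_map_eq_grade[OF _ _ _ assms(1)])
  show "add_map M W (\<lambda>v. opM (rsmult M v \<alpha>) w)" "add_map M W (\<lambda>v. opM v (opK \<alpha> w))"
    using assms by (auto intro!: add_mapI simp: rsmult_add_left rsmult_closed opM_add)
  fix d v assume v: "v \<in> grade M d"
  show "opM (rsmult M v \<alpha>) w = opM v (opK \<alpha> w)"
  proof (rule K.add_map_eq_grade[OF _ _ _ assms(2)])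
    show "add_map K W (\<lambda>\<alpha>. opM (rsmult M v \<alpha>) w)" "add_map K W (\<lambda>\<alpha>. opM v (opK \<alpha> w))"
      using v[THEN grade_closed] w
      by (auto intro!: add_mapI simp: rsmult_add_right rsmult_closed opM_add opK_add add_map_add[OF opM_map])
  qed (rule opM_rsmult_grade[OF v _ w])
qed

definition letter_op :: "'k + 'm \<Rightarrow> 'w \<Rightarrow> 'w"
  where "letter_op = case_sum opK opM"

definition pre_act :: "(('k + 'm) fword \<Rightarrow>\<^sub>0 int) \<Rightarrow> 'w \<Rightarrow> 'w"
  where "pre_act x w = ext (add_monoid W) (\<lambda>u. foldr letter_op (letters u) w) x"

lemma letter_op_simps [simp]: "letter_op (Inl \<alpha>) = opK \<alpha>" "letter_op (Inr v) = opM v"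
  by (simp_all add: letter_op_def)

lemma foldr_letter_op_map:
  "set xs \<subseteq> carrier K <+> carrier M \<Longrightarrow> add_map W W (foldr letter_op xs)"
proof (induction xs)
  case (Cons x xs)
  then have "add_map W W (letter_op x)" by (auto simp: opK_map opM_map)
  with Cons show ?case by (simp add: comp_def add_map_comp)
qed (simp add: add_map_def id_def)

lemma foldr_closed [simp]:
  "\<lbrakk>set xs \<subseteq> carrier K <+> carrier M; w \<in> carrier W\<rbrakk> \<Longrightarrow> foldr letter_op xs w \<in> carrier W"
  by (rule add_map_closed[OF foldr_letter_op_map])
lemma foldr_Pi: "w \<in> carrier W \<Longrightarrow>
    (\<lambda>u. foldr letter_op (letters u) w) \<in> word_set (carrier K <+> carrier M) \<rightarrow> carrier (add_monoid W)"
  by (auto simp: word_set_def)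

lemma pre_act_closed [simp]: "\<lbrakk>x \<in> carrier F; w \<in> carrier W\<rbrakk> \<Longrightarrow> pre_act x w \<in> carrier W"
  unfolding pre_act_def using comm_group.ext_closed[OF W.a_comm_group _ foldr_Pi] by (simp add: carrier_free_ring)

lemma pre_act_diff:
  "\<lbrakk>x \<in> carrier F; y \<in> carrier F; w \<in> carrier W\<rbrakk>
    \<Longrightarrow> pre_act (x - y) w = pre_act x w \<ominus>\<^bsub>W\<^esub> pre_act y w"
  unfolding pre_act_def using comm_group.ext_diff[OF W.a_comm_group _ _ foldr_Pi, of x y w]
  by (simp add: carrier_free_ring a_minus_def a_inv_def)

lemma pre_act_add:
  "\<lbrakk>x \<in> carrier F; y \<in> carrier F; w \<in> carrier W\<rbrakk>
    \<Longrightarrow> pre_act (x + y) w = pre_act x w \<oplus>\<^bsub>W\<^esub> pre_act y w"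
  unfolding pre_act_def using comm_group.ext_add[OF W.a_comm_group _ _ foldr_Pi, of x y w]
  by (simp add: carrier_free_ring)

lemma pre_act_fmon:
  "\<lbrakk>set xs \<subseteq> carrier K <+> carrier M; w \<in> carrier W\<rbrakk> \<Longrightarrow> pre_act (fmon xs) w = foldr letter_op xs w"
  unfolding pre_act_def fmon_def using comm_group.ext_frag_of[OF W.a_comm_group, of "\<lambda>u. foldr letter_op (letters u) w"]
  by simp

lemma pre_act_map: "x \<in> carrier F \<Longrightarrow> add_map W W (pre_act x)"
proof (induction rule: free_ring_induct)
  case (word xs)
  show ?case
    by (rule add_map_cong[OF foldr_letter_op_map[OF word] W.abelian_group_axioms])
      (simp add: pre_act_fmon word)
next
  case (diff x y)
  have "add_map W W (\<lambda>w. pre_act x w \<oplus>\<^bsub>W\<^esub> ksgn W 1 (pre_act y w))"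
    using diff by (intro add_map_sum add_map_ksgn W.abelian_group_axioms)
  then show ?case
    by (rule add_map_cong[OF _ W.abelian_group_axioms]) (simp add: pre_act_diff diff a_minus_def ksgn_1)
qed

lemma pre_act_mult:
  assumes x: "x \<in> carrier F" and y: "y \<in> carrier F" and w: "w \<in> carrier W"
  shows "pre_act (x * y) w = pre_act x (pre_act y w)"
  using x
proof (induction rule: free_ring_induct)
  case (word xs)
  interpret h: add_hom W W "foldr letter_op xs"
    by (rule add_hom_intro[OF W.abelian_group_axioms W.abelian_group_axioms foldr_letter_op_map[OF word]])
  show ?case
    using y
  proof (induction rule: free_ring_induct)
    case (word ys)
    then show ?case using \<open>set xs \<subseteq> _\<close> w by (simp add: pre_act_fmon flip: fmon_append)
  next
    case (diff y z)
    have "fmon xs * y \<in> carrier F" "fmon xs * z \<in> carrier F"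
      using F.m_closed[of "fmon xs"] word diff by simp_all
    then show ?case
      using diff w word free_ring_diff by (simp add: right_diff_distrib pre_act_diff h.minus pre_act_fmon)
  qed
next
  case (diff x z)
  have "x * y \<in> carrier F" "z * y \<in> carrier F" using F.m_closed[of _ y] diff y by simp_all
  then show ?case using diff w y by (simp add: left_diff_distrib pre_act_diff)
qed

text \<open>The annihilator of W in the free ring. It is an ideal containing all relations, so
  \<open>pS_kernel\<close> makes the action descend to S.\<close>

definition null :: "(('k + 'm) fword \<Rightarrow>\<^sub>0 int) set"
  where "null = {x \<in> carrier F. \<forall>w\<in>carrier W. pre_act x w = \<zero>\<^bsub>W\<^esub>}"

lemma null_ideal: "ideal null F"
proof (rule idealI[OF F.ring_axioms])
  have zero: "pre_act x \<zero>\<^bsub>W\<^esub> = \<zero>\<^bsub>W\<^esub>" if "x \<in> carrier F" for x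
    using add_hom.zero[OF add_hom_intro[OF W.abelian_group_axioms W.abelian_group_axioms pre_act_map[OF that]]] .
  have sub: "x - y \<in> null" if "x \<in> null" "y \<in> null" for x y
    using that free_ring_diff by (auto simp: null_def pre_act_diff a_minus_def)
  have z: "0 \<in> null"
    using pre_act_diff[of 0 0] F.zero_closed by (auto simp: null_def a_minus_def W.r_neg)
  show "subgroup null (add_monoid F)"
  proof
    show "null \<subseteq> carrier (add_monoid F)" by (auto simp: null_def)
    show "\<one>\<^bsub>add_monoid F\<^esub> \<in> null" using z by simp
    fix x y assume "x \<in> null" "y \<in> null"
    then show "x \<otimes>\<^bsub>add_monoid F\<^esub> y \<in> null"
      using sub[of x "0 - y"] sub[OF z] by simp
  next
    fix x assume "x \<in> null"
    moreover then have "inv\<^bsub>add_monoid F\<^esub> x = - x"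
      using neg_free_ring[of x] by (simp add: null_def a_inv_def)
    ultimately show "inv\<^bsub>add_monoid F\<^esub> x \<in> null" using sub[OF z, of x] by simp
  qed
  fix a x assume "a \<in> null" "x \<in> carrier F"
  then show "x \<otimes>\<^bsub>F\<^esub> a \<in> null" "a \<otimes>\<^bsub>F\<^esub> x \<in> null"
    using F.m_closed[of a x] F.m_closed[of x a] by (auto simp: null_def pre_act_mult zero)
qed

lemma null_diffI:
  "\<lbrakk>x \<in> carrier F; y \<in> carrier F; \<And>w. w \<in> carrier W \<Longrightarrow> pre_act x w = pre_act y w\<rbrakk> \<Longrightarrow> x - y \<in> null"
  by (simp add: null_def free_ring_diff pre_act_diff a_minus_def W.r_neg)

lemma tensor_alg_rel_null: "tensor_alg_rel K M \<subseteq> null"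
proof -
  have 1: "x - y - z \<in> null" if "x \<in> carrier F" "y \<in> carrier F" "z \<in> carrier F"
    "\<And>w. w \<in> carrier W \<Longrightarrow> pre_act x w = pre_act y w \<oplus>\<^bsub>W\<^esub> pre_act z w" for x y z
  proof -
    have "x - (y + z) \<in> null"
      using that F.a_closed[of y z] by (intro null_diffI) (simp_all add: pre_act_add)
    then show ?thesis by (simp add: diff_diff_eq)
  qed
  have m0: "fmon [Inl \<one>\<^bsub>K\<^esub>] - 1 \<in> null"
    by (intro null_diffI) (simp_all add: pre_act_fmon opK_one flip: fmon_Nil)
  have m1: "fmon [Inl (\<alpha> \<oplus>\<^bsub>K\<^esub> \<beta>)] - fmon [Inl \<alpha>] - fmon [Inl \<beta>] \<in> null"
    if "\<alpha> \<in> carrier K" "\<beta> \<in> carrier K" for \<alpha> \<beta>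
    using that by (intro 1) (simp_all add: pre_act_fmon opK_add)
  have m2: "fmon [Inr (u \<oplus> v)] - fmon [Inr u] - fmon [Inr v] \<in> null"
    if "u \<in> carrier M" "v \<in> carrier M" for u v
    using that by (intro 1) (simp_all add: pre_act_fmon opM_add)
  have m3: "fmon [Inl (\<alpha> \<otimes>\<^bsub>K\<^esub> \<beta>)] - fmon [Inl \<alpha>, Inl \<beta>] \<in> null"
    if "\<alpha> \<in> carrier K" "\<beta> \<in> carrier K" for \<alpha> \<beta>
    using that by (intro null_diffI) (simp_all add: pre_act_fmon opK_mult)
  have m4: "fmon [Inr (rsmult M v \<alpha>)] - fmon [Inr v, Inl \<alpha>] \<in> null"
    if "v \<in> carrier M" "\<alpha> \<in> carrier K" for v \<alpha>
    using that by (intro null_diffI) (simp_all add: pre_act_fmon opM_rsmult rsmult_closed)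
  have m5: "fmon [Inr (ksgn M (p * q) (rsmult M v \<alpha>))] - fmon [Inl \<alpha>, Inr v] \<in> null"
    if "\<alpha> \<in> grade K p" "v \<in> grade M q" for v \<alpha> p q
    using that K.grade_closed grade_closed
    by (intro null_diffI) (simp_all add: pre_act_fmon opK_opM rsmult_closed)
  show ?thesis unfolding tensor_alg_rel_def
    by (intro Un_least subsetI; elim CollectE exE conjE singletonE; simp only: m0 m1 m2 m3 m4 m5)
qed

lemma sym_rel_null: "sym_rel \<subseteq> null"
proof -
  have sgn: "pre_act (ksgn F e x) w = ksgn W e (pre_act x w)"
    if "x \<in> carrier F" "w \<in> carrier W" for e x w
    using pre_act_diff[of 0 x w] pre_act_diff[of 0 0 w] F.zero_closed that
    by (simp add: ksgn_def neg_free_ring a_minus_def W.r_neg)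
  have "fmon [Inr u, Inr v] - ksgn F (p * q) (fmon [Inr v, Inr u]) \<in> null"
    if "u \<in> grade M p" "v \<in> grade M q" for u v p q
    using that grade_closed F.ksgn_closed opM_comm[OF that]
    by (intro null_diffI) (simp_all add: sgn pre_act_fmon)
  moreover have "fmon [Inr u, Inr u] \<in> null" if "u \<in> grade M 1" for u
    using that grade_closed by (simp add: null_def pre_act_fmon opM_square)
  ultimately show ?thesis unfolding sym_rel_def by blast
qed

text \<open>An element of S is a class of classes, and some representative in the free ring has to
  be picked; by \<open>act_pS\<close> the choice does not matter.\<close>

definition act :: "(('k + 'm) fword \<Rightarrow>\<^sub>0 int) set set \<Rightarrow> 'w \<Rightarrow> 'w"
  where "act X w = pre_act (SOME x. x \<in> carrier F \<and> pS x = X) w"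

lemma act_pS:
  assumes "x \<in> carrier F" "w \<in> carrier W"
  shows "act (pS x) w = pre_act x w"
proof -
  define y where "y = (SOME y. y \<in> carrier F \<and> pS y = pS x)"
  have y: "y \<in> carrier F \<and> pS y = pS x"
    unfolding y_def by (rule someI[where x = x]) (simp add: assms)
  then have "pS (y - x) = \<zero>\<^bsub>S\<^esub>" using assms by (simp add: pS_diff S.minus_eq_zero_iff)
  then have "y - x \<in> null"
    using pS_kernel[OF null_ideal tensor_alg_rel_null sym_rel_null] y assms free_ring_diff by blast
  then have "pre_act y w = pre_act x w"
    using y assms by (simp add: null_def pre_act_diff W.minus_eq_zero_iff)
  then show ?thesis by (simp add: act_def y_def)
qed

lemma S_cases: "X \<in> carrier S \<Longrightarrow> (\<And>x. \<lbrakk>x \<in> carrier F; X = pS x\<rbrakk> \<Longrightarrow> P) \<Longrightarrow> P"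
  using pS_surj by blast

lemma act_closed [simp]: "\<lbrakk>X \<in> carrier S; w \<in> carrier W\<rbrakk> \<Longrightarrow> act X w \<in> carrier W"
  by (elim S_cases) (simp add: act_pS)

lemma act_add: "\<lbrakk>X \<in> carrier S; Y \<in> carrier S; w \<in> carrier W\<rbrakk>
    \<Longrightarrow> act (X \<oplus>\<^bsub>S\<^esub> Y) w = act X w \<oplus>\<^bsub>W\<^esub> act Y w"
  using F.a_closed by (elim S_cases) (simp add: act_pS pre_act_add flip: pS_add)

lemma act_mult: "\<lbrakk>X \<in> carrier S; Y \<in> carrier S; w \<in> carrier W\<rbrakk> \<Longrightarrow> act (X \<otimes>\<^bsub>S\<^esub> Y) w = act X (act Y w)"
  using F.m_closed by (elim S_cases) (simp add: act_pS pre_act_mult flip: pS_mult)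

lemma act_one: "w \<in> carrier W \<Longrightarrow> act \<one>\<^bsub>S\<^esub> w = w"
  unfolding pS_one[symmetric] fmon_Nil[symmetric] by (simp add: act_pS pre_act_fmon)

lemma act_sc: "\<lbrakk>\<alpha> \<in> carrier K; w \<in> carrier W\<rbrakk> \<Longrightarrow> act (sc \<alpha>) w = opK \<alpha> w"
  unfolding sc_def by (simp add: act_pS pre_act_fmon)

lemma act_sym_of: "\<lbrakk>v \<in> carrier M; w \<in> carrier W\<rbrakk> \<Longrightarrow> act (sym_of K M v) w = opM v w"
  unfolding sym_of_pS by (simp add: act_pS pre_act_fmon)

end

section \<open>Induction over the symmetric algebra\<close>

context sym_base
begin

text \<open>Negatives need no case of their own, since they are products with the scalar -1.\<close>

lemma S_induct [consumes 1, case_names one sc sym add]: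
  assumes X: "X \<in> carrier S" and one: "P \<one>\<^bsub>S\<^esub>"
    and sc: "\<And>\<alpha> p X. \<lbrakk>\<alpha> \<in> grade K p; X \<in> carrier S; P X\<rbrakk> \<Longrightarrow> P (sc \<alpha> \<otimes>\<^bsub>S\<^esub> X)"
    and sym: "\<And>v p X. \<lbrakk>v \<in> grade M p; X \<in> carrier S; P X\<rbrakk> \<Longrightarrow> P (sym_of K M v \<otimes>\<^bsub>S\<^esub> X)"
    and add: "\<And>X Y. \<lbrakk>X \<in> carrier S; Y \<in> carrier S; P X; P Y\<rbrakk> \<Longrightarrow> P (X \<oplus>\<^bsub>S\<^esub> Y)"
  shows "P X"
proof -
  obtain x where x: "x \<in> carrier F" "X = pS x" using X pS_surj by blast
  have neg: "P (\<ominus>\<^bsub>S\<^esub> X)" if "X \<in> carrier S" "P X" for X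
  proof -
    have "\<ominus>\<^bsub>K\<^esub> \<one>\<^bsub>K\<^esub> \<in> grade K 0" by (simp add: K.grade_neg)
    from sc[OF this that] show ?thesis using that by (simp add: sc.neg S.l_minus)
  qed
  have "P (pS x)"
    using x(1)
  proof (induction rule: free_ring_induct)
    case (word xs)
    then show ?case
    proof (induction xs)
      case Nil
      show ?case using one by (simp add: fmon_Nil pS_one)
    next
      case (Cons x xs)
      then have xs: "pS (fmon xs) \<in> carrier S" "P (pS (fmon xs))" by (auto intro!: pS.hom_closed)
      have split: "pS (fmon (x # xs)) = pS (fmon [x]) \<otimes>\<^bsub>S\<^esub> pS (fmon xs)"
        using Cons by (subst fmon_Cons) (simp add: pS_mult)
      show ?case
      proof (cases x)
        case (Inl \<alpha>)
        then have "\<alpha> \<in> carrier K" using Cons by auto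
        then obtain a b where "a \<in> grade K 0" "b \<in> grade K (0 + 1)" "\<alpha> = a \<oplus>\<^bsub>K\<^esub> b"
          by (rule K.grade_decomp)
        then have ab: "a \<in> grade K 0" "b \<in> grade K (0 + 1)" "\<alpha> = a \<oplus>\<^bsub>K\<^esub> b"
          "a \<in> carrier K" "b \<in> carrier K" using K.grade_closed by auto
        have "pS (fmon (x # xs)) = sc a \<otimes>\<^bsub>S\<^esub> pS (fmon xs) \<oplus>\<^bsub>S\<^esub> sc b \<otimes>\<^bsub>S\<^esub> pS (fmon xs)"
          unfolding split using ab xs by (simp add: Inl S.l_distr flip: sc_def)
        then show ?thesis using ab xs sc add by (simp del: add_0)
      next
        case (Inr v)
        then have "v \<in> carrier M" using Cons by auto
        then obtain a b where "a \<in> grade M 0" "b \<in> grade M (0 + 1)" "v = a \<oplus> b"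
          by (rule grade_decomp)
        then have ab: "a \<in> grade M 0" "b \<in> grade M (0 + 1)" "v = a \<oplus> b"
          "a \<in> carrier M" "b \<in> carrier M" using grade_closed by auto
        have "pS (fmon (x # xs)) = sym_of K M a \<otimes>\<^bsub>S\<^esub> pS (fmon xs) \<oplus>\<^bsub>S\<^esub> sym_of K M b \<otimes>\<^bsub>S\<^esub> pS (fmon xs)"
          unfolding split using ab xs by (simp add: Inr S.l_distr flip: sym_of_pS)
        then show ?thesis using ab xs sym add by (simp del: add_0)
      qed
    qed
  next
    case (diff x y)
    then show ?case using add[of "pS x" "\<ominus>\<^bsub>S\<^esub> pS y"] neg by (simp add: pS_diff a_minus_def)
  qed
  then show ?thesis using x by simp
qed

lemma sc_commute_sym:
  assumes "\<alpha> \<in> grade K p" "v \<in> grade M q"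
  shows "sc \<alpha> \<otimes>\<^bsub>S\<^esub> sym_of K M v = ksgn S (p * q) (sym_of K M v \<otimes>\<^bsub>S\<^esub> sc \<alpha>)"
  using assms K.grade_closed grade_closed
  by (simp add: sc_sym_of sym_of.ksgn rsmult_closed sym_of_rsmult)

lemma ksgn_S_mult:
  "\<lbrakk>X \<in> carrier S; Y \<in> carrier S\<rbrakk> \<Longrightarrow> ksgn S e X \<otimes>\<^bsub>S\<^esub> Y = ksgn S e (X \<otimes>\<^bsub>S\<^esub> Y)"
  "\<lbrakk>X \<in> carrier S; Y \<in> carrier S\<rbrakk> \<Longrightarrow> X \<otimes>\<^bsub>S\<^esub> ksgn S e Y = ksgn S e (X \<otimes>\<^bsub>S\<^esub> Y)"
  by (simp_all add: ksgn_def S.l_minus S.r_minus)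

text \<open>Scalars are pushed to the right past the letters at the cost of a sign. All maps
  considered are right linear, so the scalar case becomes routine.\<close>

lemma S_induct_right [consumes 1, case_names one sym rsmult add]:
  assumes X: "X \<in> carrier S" and one: "P \<one>\<^bsub>S\<^esub>"
    and sym: "\<And>v p X. \<lbrakk>v \<in> grade M p; X \<in> carrier S; P X\<rbrakk> \<Longrightarrow> P (sym_of K M v \<otimes>\<^bsub>S\<^esub> X)"
    and rs: "\<And>\<alpha> p X. \<lbrakk>\<alpha> \<in> grade K p; X \<in> carrier S; P X\<rbrakk> \<Longrightarrow> P (X \<otimes>\<^bsub>S\<^esub> sc \<alpha>)"
    and add: "\<And>X Y. \<lbrakk>X \<in> carrier S; Y \<in> carrier S; P X; P Y\<rbrakk> \<Longrightarrow> P (X \<oplus>\<^bsub>S\<^esub> Y)"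
  shows "P X"
proof -
  have neg: "P (ksgn S e X)" if "X \<in> carrier S" "P X" for e X
  proof -
    have "ksgn K e \<one>\<^bsub>K\<^esub> \<in> grade K 0" by (rule K.ksgn_one_grade)
    from rs[OF this that] show ?thesis using that by (simp add: sc.ksgn ksgn_S_mult)
  qed
  \<comment> \<open>The second conjunct lets a scalar that stands in front pass through the next
    letter.\<close>
  have "P X \<and> (\<forall>\<alpha> p. \<alpha> \<in> grade K p \<longrightarrow> P (sc \<alpha> \<otimes>\<^bsub>S\<^esub> X))"
    using X
  proof (induction rule: S_induct)
    case one
    then show ?case using assms(2) rs[of _ _ "\<one>\<^bsub>S\<^esub>"] K.grade_closed by auto
  next
    case (sc \<alpha> p X)
    then have "P (sc (\<beta> \<otimes>\<^bsub>K\<^esub> \<alpha>) \<otimes>\<^bsub>S\<^esub> X)" if "\<beta> \<in> grade K q" for \<beta> q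
      using K.grade_mult[OF that sc(1)] by blast
    then show ?case using sc K.grade_closed by (auto simp: sc_mult S.m_assoc)
  next
    case (sym v p X)
    have "P (sc \<alpha> \<otimes>\<^bsub>S\<^esub> (sym_of K M v \<otimes>\<^bsub>S\<^esub> X))" if "\<alpha> \<in> grade K q" for \<alpha> q
    proof -
      have [simp]: "\<alpha> \<in> carrier K" "v \<in> carrier M" using that sym K.grade_closed grade_closed by auto
      have "sc \<alpha> \<otimes>\<^bsub>S\<^esub> (sym_of K M v \<otimes>\<^bsub>S\<^esub> X) = ksgn S (q * p) (sym_of K M v \<otimes>\<^bsub>S\<^esub> (sc \<alpha> \<otimes>\<^bsub>S\<^esub> X))"
        using sym that by (simp add: sc_commute_sym ksgn_S_mult S.m_assoc flip: S.m_assoc[of "sc \<alpha>"])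
      then show ?thesis using sym that assms(3) by (auto intro!: neg)
    qed
    then show ?case using sym assms(3) by blast
  next
    case (add X Y)
    show ?case
    proof (intro conjI allI impI)
      show "P (X \<oplus>\<^bsub>S\<^esub> Y)" using add assms(5) by blast
      fix \<alpha> p assume "\<alpha> \<in> grade K p"
      then have \<alpha>: "\<alpha> \<in> carrier K" "P (sc \<alpha> \<otimes>\<^bsub>S\<^esub> X)" "P (sc \<alpha> \<otimes>\<^bsub>S\<^esub> Y)"
        using add K.grade_closed by blast+
      have "P (sc \<alpha> \<otimes>\<^bsub>S\<^esub> X \<oplus>\<^bsub>S\<^esub> sc \<alpha> \<otimes>\<^bsub>S\<^esub> Y)"
        by (rule assms(5)[OF _ _ \<alpha>(2,3)]) (simp_all add: add \<alpha>(1))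
      then show "P (sc \<alpha> \<otimes>\<^bsub>S\<^esub> (X \<oplus>\<^bsub>S\<^esub> Y))" by (simp add: add \<alpha>(1) S.r_distr)
    qed
  qed
  then show ?thesis by blast
qed

lemma S_grade_induct [consumes 1, case_names one sc sym add]:
  assumes X: "X \<in> grade S d" and one: "P 0 \<one>\<^bsub>S\<^esub>"
    and sc: "\<And>\<alpha> p d X. \<lbrakk>\<alpha> \<in> grade K p; X \<in> grade S d; X \<in> carrier S; P d X\<rbrakk> \<Longrightarrow> P (p + d) (sc \<alpha> \<otimes>\<^bsub>S\<^esub> X)"
    and sym: "\<And>v p d X. \<lbrakk>v \<in> grade M p; X \<in> grade S d; X \<in> carrier S; P d X\<rbrakk> \<Longrightarrow> P (p + d) (sym_of K M v \<otimes>\<^bsub>S\<^esub> X)"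
    and add: "\<And>d X Y. \<lbrakk>X \<in> carrier S; Y \<in> carrier S; P d X; P d Y\<rbrakk> \<Longrightarrow> P d (X \<oplus>\<^bsub>S\<^esub> Y)"
  shows "P d X"
proof -
  have mon: "pS (fmon xs) \<in> grade S (sum_list ps) \<and> pS (fmon xs) \<in> carrier S \<and> P (sum_list ps) (pS (fmon xs))"
    if "list_all2 (\<lambda>x p. x \<in> grade K p <+> grade M p) xs ps" for xs ps
    using that
  proof (induction rule: list_all2_induct)
    case Nil
    have "pS (fmon []) \<in> grade S (sum_list [])"
      unfolding S_grade by (rule generate.incl) (auto intro: list_all2_Nil2)
    then show ?case using one by (simp add: fmon_Nil pS_one)
  next
    case (Cons x xs p ps)
    have set: "set (x # xs) \<subseteq> carrier K <+> carrier M"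
      by (rule letters_carrier[of _ "p # ps"]) (simp add: Cons)
    have g: "pS (fmon (x # xs)) \<in> grade S (sum_list (p # ps))"
      unfolding S_grade using Cons by (intro generate.incl) (auto intro!: exI[of _ "x # xs"] exI[of _ "p # ps"])
    have split: "pS (fmon (x # xs)) = pS (fmon [x]) \<otimes>\<^bsub>S\<^esub> pS (fmon xs)"
      using set by (subst fmon_Cons) (simp add: pS_mult)
    show ?case
    proof (cases x)
      case (Inl \<alpha>)
      then show ?thesis using Cons g sc[of \<alpha> p "pS (fmon xs)" "sum_list ps"] K.grade_closed split
        by (auto simp flip: sc_def)
    next
      case (Inr v)
      then show ?thesis using Cons g sym[of v p "pS (fmon xs)" "sum_list ps"] grade_closed split
        by (auto simp flip: sym_of_pS)
    qed
  qed
  have neg: "P d (ksgn S e X)" if "X \<in> carrier S" "X \<in> grade S d" "P d X" for e X d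
    using sc[OF K.ksgn_one_grade that(2,1,3), of e] that by (simp add: sc.ksgn ksgn_S_mult)
  have "X \<in> carrier S \<and> P d X"
    using X[unfolded S_grade] S.a_comm_group
  proof (induction rule: generate_induct)
    case one
    \<comment> \<open>Zero in degree d is x - x for a monomial x of degree d. The one-letter word of
      the zero scalar serves as x, zero being homogeneous of both parities.\<close>
    have "P d (\<zero>\<^bsub>S\<^esub>)"
    proof -
      obtain xs :: "('k + 'm) list" and ps where xs: "list_all2 (\<lambda>x p. x \<in> grade K p <+> grade M p) xs ps" "sum_list ps = d"
        using that[of "[Inl \<zero>\<^bsub>K\<^esub>]" "[d]"] by auto
      from mon[OF xs(1)] have "pS (fmon xs) \<in> grade S d" "pS (fmon xs) \<in> carrier S" "P d (pS (fmon xs))" by (auto simp: xs)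
      from add[OF this(2) S.ksgn_closed[OF this(2)] this(3) neg[OF this(2,1,3)], of 1]
      show ?thesis using \<open>pS (fmon xs) \<in> carrier S\<close> by (simp add: ksgn_1 S.r_neg)
    qed
    then show ?case by simp
  next
    case (incl h)
    then show ?case using mon by blast
  next
    case (inv h)
    then obtain xs ps where xs: "h = pS (fmon xs)" "list_all2 (\<lambda>x p. x \<in> grade K p <+> grade M p) xs ps" "sum_list ps = d"
      by blast
    have "P d (ksgn S 1 h)" using mon[OF xs(2)] xs neg by blast
    then show ?case using mon[OF xs(2)] xs by (simp add: ksgn_1 a_inv_def)
  next
    case (mult x y)
    then show ?case using add by simp
  qed
  then show ?thesis by blast
qed

end

definition prod_grp :: "('a, 'x) ring_scheme \<Rightarrow> ('b, 'y) ring_scheme \<Rightarrow> ('a \<times> 'b) ring"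
  where "prod_grp A B = \<lparr>carrier = carrier A \<times> carrier B, monoid.mult = (\<lambda>x y. x), one = (\<zero>\<^bsub>A\<^esub>, \<zero>\<^bsub>B\<^esub>),
    ring.zero = (\<zero>\<^bsub>A\<^esub>, \<zero>\<^bsub>B\<^esub>), ring.add = (\<lambda>x y. (fst x \<oplus>\<^bsub>A\<^esub> fst y, snd x \<oplus>\<^bsub>B\<^esub> snd y))\<rparr>"

lemma prod_grp_simps [simp]:
  "carrier (prod_grp A B) = carrier A \<times> carrier B"
  "\<zero>\<^bsub>prod_grp A B\<^esub> = (\<zero>\<^bsub>A\<^esub>, \<zero>\<^bsub>B\<^esub>)"
  "x \<oplus>\<^bsub>prod_grp A B\<^esub> y = (fst x \<oplus>\<^bsub>A\<^esub> fst y, snd x \<oplus>\<^bsub>B\<^esub> snd y)"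
  by (simp_all add: prod_grp_def)

lemma abelian_group_prod_grp:
  assumes "abelian_group A" "abelian_group B"
  shows "abelian_group (prod_grp A B)"
proof -
  interpret A: abelian_group A by fact
  interpret B: abelian_group B by fact
  show ?thesis
  proof (rule abelian_groupI)
    fix x assume "x \<in> carrier (prod_grp A B)"
    then show "\<exists>y\<in>carrier (prod_grp A B). y \<oplus>\<^bsub>prod_grp A B\<^esub> x = \<zero>\<^bsub>prod_grp A B\<^esub>"
      by (intro bexI[of _ "(\<ominus>\<^bsub>A\<^esub> fst x, \<ominus>\<^bsub>B\<^esub> snd x)"]) (auto simp: A.l_neg B.l_neg)
  qed (auto simp: A.a_ac B.a_ac)
qed

lemma ksgn_prod_grp:
  assumes "abelian_group A" "abelian_group B" "x \<in> carrier A" "y \<in> carrier B"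
  shows "ksgn (prod_grp A B) e (x, y) = (ksgn A e x, ksgn B e y)"
proof -
  interpret A: abelian_group A by fact
  interpret B: abelian_group B by fact
  interpret abelian_group "prod_grp A B" by (intro abelian_group_prod_grp assms)
  have "\<ominus>\<^bsub>prod_grp A B\<^esub> (x, y) = (\<ominus>\<^bsub>A\<^esub> x, \<ominus>\<^bsub>B\<^esub> y)"
    using assms by (intro minus_equality) (simp_all add: A.l_neg B.l_neg)
  then show ?thesis by (simp add: ksgn_def)
qed

section \<open>The left action of scalars on a supermodule\<close>

context supermodule
begin

lemma rsmult_zero [simp]: "\<alpha> \<in> carrier K \<Longrightarrow> rsmult M \<zero> \<alpha> = \<zero>"
  "m \<in> carrier M \<Longrightarrow> rsmult M m \<zero>\<^bsub>K\<^esub> = \<zero>"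
proof -
  assume "\<alpha> \<in> carrier K"
  then show "rsmult M \<zero> \<alpha> = \<zero>"
    using rsmult_add_left[of "\<zero>" "\<zero>" \<alpha>] by (intro idem_zero) (simp_all add: rsmult_closed)
next
  assume "m \<in> carrier M"
  then show "rsmult M m \<zero>\<^bsub>K\<^esub> = \<zero>"
    using rsmult_add_right[of m "\<zero>\<^bsub>K\<^esub>" "\<zero>\<^bsub>K\<^esub>"] by (intro idem_zero) (simp_all add: rsmult_closed)
qed

lemma add_map_rsmult: "\<alpha> \<in> carrier K \<Longrightarrow> add_map M M (\<lambda>m. rsmult M m \<alpha>)"
  "m \<in> carrier M \<Longrightarrow> add_map K M (rsmult M m)"
  by (simp_all add: add_mapI rsmult_closed rsmult_add_left rsmult_add_right)

lemma rsmult_ksgn: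
  "\<lbrakk>m \<in> carrier M; \<alpha> \<in> carrier K\<rbrakk> \<Longrightarrow> rsmult M (ksgn M e m) \<alpha> = ksgn M e (rsmult M m \<alpha>)"
  "\<lbrakk>m \<in> carrier M; \<alpha> \<in> carrier K\<rbrakk> \<Longrightarrow> rsmult M m (ksgn K e \<alpha>) = ksgn M e (rsmult M m \<alpha>)"
  using add_hom.ksgn[OF add_hom_intro[OF abelian_group_axioms abelian_group_axioms add_map_rsmult(1)]]
    add_hom.ksgn[OF add_hom_intro[OF K.abelian_group_axioms abelian_group_axioms add_map_rsmult(2)]]
  by simp_all

lemma tw_rsmult:
  assumes "m \<in> carrier M" and a: "\<alpha> \<in> grade K q"
  shows "tw M p (rsmult M m \<alpha>) = ksgn M (p * q) (rsmult M (tw M p m) \<alpha>)"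
proof (rule add_map_eq_grade[OF _ _ _ assms(1)])
  show "add_map M M (\<lambda>m. tw M p (rsmult M m \<alpha>))"
    "add_map M M (\<lambda>m. ksgn M (p * q) (rsmult M (tw M p m) \<alpha>))"
    using a K.grade_closed
    by (auto intro!: add_map_comp[OF add_map_rsmult(1) add_map_tw]
        add_map_ksgn add_map_comp[OF add_map_tw add_map_rsmult(1)] abelian_group_axioms)
  fix d m assume "m \<in> grade M d"
  then show "tw M p (rsmult M m \<alpha>) = ksgn M (p * q) (rsmult M (tw M p m) \<alpha>)"
    using a rsmult_grade[of m d \<alpha> q] grade_closed K.grade_closed
    by (cases p; cases q; cases d) (simp_all add: tw_of_grade rsmult_ksgn rsmult_closed)
qed

definition lact :: "'k \<Rightarrow> 'm \<Rightarrow> 'm"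
  where "lact \<alpha> m = rsmult M m (hcomp K 0 \<alpha>) \<oplus> rsmult M (tw M 1 m) (hcomp K 1 \<alpha>)"
    \<comment> \<open>the left action \<open>\<alpha> m\<close>\<close>

lemma lact_grade: "\<lbrakk>\<alpha> \<in> grade K p; m \<in> carrier M\<rbrakk> \<Longrightarrow> lact \<alpha> m = rsmult M (tw M p m) \<alpha>"
  by (cases p) (simp_all add: lact_def K.hcomp_of_grade rsmult_closed K.grade_closed)

lemma lact_closed [simp]: "\<lbrakk>\<alpha> \<in> carrier K; m \<in> carrier M\<rbrakk> \<Longrightarrow> lact \<alpha> m \<in> carrier M"
  by (simp add: lact_def rsmult_closed)

lemma lact_add:
  "\<lbrakk>\<alpha> \<in> carrier K; \<beta> \<in> carrier K; m \<in> carrier M\<rbrakk> \<Longrightarrow> lact (\<alpha> \<oplus>\<^bsub>K\<^esub> \<beta>) m = lact \<alpha> m \<oplus> lact \<beta> m"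
  "\<lbrakk>\<alpha> \<in> carrier K; m \<in> carrier M; n \<in> carrier M\<rbrakk> \<Longrightarrow> lact \<alpha> (m \<oplus> n) = lact \<alpha> m \<oplus> lact \<alpha> n"
  by (simp_all add: lact_def K.hcomp_add rsmult_add_right rsmult_add_left tw_add rsmult_closed a_ac)

text \<open>The order of the factors is reversed by the right action and restored by
  supercommutativity of the scalars, whose sign is the one produced by the two twists.\<close>

lemma lact_mult:
  assumes "\<alpha> \<in> grade K p" "\<beta> \<in> grade K q" "m \<in> carrier M"
  shows "lact (\<alpha> \<otimes>\<^bsub>K\<^esub> \<beta>) m = lact \<alpha> (lact \<beta> m)"
proof -
  note g = lact_grade[OF assms(1)] lact_grade[OF assms(2)] lact_grade[OF K.grade_mult[OF assms(1,2)]]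
  have [simp]: "\<alpha> \<in> carrier K" "\<beta> \<in> carrier K" using assms K.grade_closed by auto
  have "lact (\<alpha> \<otimes>\<^bsub>K\<^esub> \<beta>) m = rsmult M (tw M (p + q) m) (ksgn K (p * q) (\<beta> \<otimes>\<^bsub>K\<^esub> \<alpha>))"
    unfolding g(3)[OF assms(3)] using K.supercomm[OF assms(1,2)] by simp
  also have "\<dots> = lact \<alpha> (lact \<beta> m)"
    using assms by (simp add: g rsmult_closed tw_rsmult[OF _ assms(2)] rsmult_ksgn rsmult_assoc)
  finally show ?thesis .
qed

lemma lact_one: "m \<in> carrier M \<Longrightarrow> lact \<one>\<^bsub>K\<^esub> m = m"
  by (simp add: lact_grade[OF K.one_even] rsmult_one)

end

section \<open>The grading of the symmetric algebra\<close>

context sym_base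
begin

lemma S_grade_subgroup: "subgroup (grade S d) (add_monoid S)"
proof -
  have "{pS (fmon xs) |xs ps. list_all2 (\<lambda>x p. x \<in> grade K p <+> grade M p) xs ps \<and> sum_list ps = d}
      \<subseteq> carrier S"
    using letters_carrier by (auto intro!: pS.hom_closed)
  from S.add.generate_is_subgroup[OF this] show ?thesis by (simp add: S_grade)
qed

lemma S_grade_closed: "X \<in> grade S d \<Longrightarrow> X \<in> carrier S"
  using subgroup.subset[OF S_grade_subgroup[of d]] by auto

lemma S_grade_zero: "\<zero>\<^bsub>S\<^esub> \<in> grade S d"
  using subgroup.one_closed[OF S_grade_subgroup[of d]] by simp

lemma S_grade_add: "\<lbrakk>X \<in> grade S d; Y \<in> grade S d\<rbrakk> \<Longrightarrow> X \<oplus>\<^bsub>S\<^esub> Y \<in> grade S d"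
  using subgroup.m_closed[OF S_grade_subgroup[of d]] by simp

lemma S_grade_mon:
  "list_all2 (\<lambda>x p. x \<in> grade K p <+> grade M p) xs ps \<Longrightarrow> pS (fmon xs) \<in> grade S (sum_list ps)"
  unfolding S_grade by (rule generate.incl) blast

lemma S_grade_letter:
  assumes x: "x \<in> grade K p <+> grade M p" and X: "X \<in> grade S d"
  shows "pS (fmon [x]) \<otimes>\<^bsub>S\<^esub> X \<in> grade S (p + d)"
proof -
  have x': "x \<in> carrier K <+> carrier M" using x K.grade_closed grade_closed by auto
  then have xS: "pS (fmon [x]) \<in> carrier S" by (intro pS.hom_closed) simp
  have mon: "pS (fmon [x]) \<otimes>\<^bsub>S\<^esub> pS (fmon xs) \<in> grade S (p + sum_list ps)"
    if "list_all2 (\<lambda>x p. x \<in> grade K p <+> grade M p) xs ps" for xs ps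
  proof -
    have "pS (fmon (x # xs)) \<in> grade S (sum_list (p # ps))"
      by (rule S_grade_mon) (use that x in simp)
    moreover have "pS (fmon (x # xs)) = pS (fmon [x]) \<otimes>\<^bsub>S\<^esub> pS (fmon xs)"
      using letters_carrier[OF that] x' by (subst fmon_Cons) (simp add: pS_mult)
    ultimately show ?thesis by simp
  qed
  show ?thesis
    using X[unfolded S_grade] S.a_comm_group
  proof (induction rule: generate_induct)
    case one
    then show ?case using xS S_grade_zero by simp
  next
    case (incl h)
    then show ?case using mon by blast
  next
    case (inv h)
    then obtain xs ps where xs: "h = pS (fmon xs)" "list_all2 (\<lambda>x p. x \<in> grade K p <+> grade M p) xs ps" "d = sum_list ps"
      by blast
    then have "h \<in> carrier S" using S_grade_mon S_grade_closed by blast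
    then have "pS (fmon [x]) \<otimes>\<^bsub>S\<^esub> inv\<^bsub>add_monoid S\<^esub> h = inv\<^bsub>add_monoid S\<^esub> (pS (fmon [x]) \<otimes>\<^bsub>S\<^esub> h)"
      using xS by (simp add: S.r_minus flip: a_inv_def)
    then show ?case
      using subgroup.m_inv_closed[OF S_grade_subgroup mon[OF xs(2)]] xs by simp
  next
    case (mult y z)
    then have "y \<in> carrier S" "z \<in> carrier S" using S_grade_closed unfolding S_grade by blast+
    then show ?case using mult xS S_grade_add by (simp add: S.r_distr)
  qed
qed

lemma S_grade_sc: "\<lbrakk>\<alpha> \<in> grade K p; X \<in> grade S d\<rbrakk> \<Longrightarrow> sc \<alpha> \<otimes>\<^bsub>S\<^esub> X \<in> grade S (p + d)"
  unfolding sc_def by (rule S_grade_letter) auto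

lemma S_grade_sym: "\<lbrakk>v \<in> grade M p; X \<in> grade S d\<rbrakk> \<Longrightarrow> sym_of K M v \<otimes>\<^bsub>S\<^esub> X \<in> grade S (p + d)"
  unfolding sym_of_pS by (rule S_grade_letter) auto

lemma one_S_grade [simp, intro]: "\<one>\<^bsub>S\<^esub> \<in> grade S 0"
  using S_grade_mon[of "[]" "[]"] by (simp add: fmon_Nil pS_one)

lemma sc_grade [intro]: "\<alpha> \<in> grade K p \<Longrightarrow> sc \<alpha> \<in> grade S p"
  using S_grade_sc[OF _ one_S_grade] K.grade_closed by fastforce

lemma sym_of_grade [intro]: "v \<in> grade M p \<Longrightarrow> sym_of K M v \<in> grade S p"
  using S_grade_sym[OF _ one_S_grade] grade_closed by fastforce

lemma S_grade_mult:
  assumes "X \<in> grade S d" "Y \<in> grade S e" shows "X \<otimes>\<^bsub>S\<^esub> Y \<in> grade S (d + e)"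
  using assms(1)
proof (induction rule: S_grade_induct)
  case (sc \<alpha> p d X)
  then show ?case using S_grade_sc[OF sc(1,4)] assms(2) S_grade_closed K.grade_closed
    by (simp add: S.m_assoc add.assoc)
next
  case (sym v p d X)
  then show ?case using S_grade_sym[OF sym(1,4)] assms(2) S_grade_closed grade_closed
    by (simp add: S.m_assoc add.assoc)
next
  case (add d X Y)
  then show ?case using assms(2) S_grade_add S_grade_closed by (simp add: S.l_distr)
qed (use assms(2) S_grade_closed in simp)

lemma S_grade_sum: "X \<in> carrier S \<Longrightarrow> \<exists>a\<in>grade S 0. \<exists>b\<in>grade S 1. X = a \<oplus>\<^bsub>S\<^esub> b"
proof (induction rule: S_induct)
  case one
  show ?case using one_S_grade S_grade_zero by (metis S.one_closed S.r_zero)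
next
  case (sc \<alpha> p X)
  then obtain a b where ab: "a \<in> grade S 0" "b \<in> grade S 1" "X = a \<oplus>\<^bsub>S\<^esub> b" by blast
  then have "sc \<alpha> \<otimes>\<^bsub>S\<^esub> X = sc \<alpha> \<otimes>\<^bsub>S\<^esub> a \<oplus>\<^bsub>S\<^esub> sc \<alpha> \<otimes>\<^bsub>S\<^esub> b" "sc \<alpha> \<otimes>\<^bsub>S\<^esub> X = sc \<alpha> \<otimes>\<^bsub>S\<^esub> b \<oplus>\<^bsub>S\<^esub> sc \<alpha> \<otimes>\<^bsub>S\<^esub> a"
    using sc K.grade_closed S_grade_closed by (simp_all add: S.r_distr S.a_comm)
  moreover have "sc \<alpha> \<otimes>\<^bsub>S\<^esub> a \<in> grade S (p + 0)" "sc \<alpha> \<otimes>\<^bsub>S\<^esub> b \<in> grade S (p + 1)"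
    using ab sc S_grade_sc by blast+
  ultimately show ?case by (cases p) auto
next
  case (sym v p X)
  then obtain a b where ab: "a \<in> grade S 0" "b \<in> grade S 1" "X = a \<oplus>\<^bsub>S\<^esub> b" by blast
  then have "sym_of K M v \<otimes>\<^bsub>S\<^esub> X = sym_of K M v \<otimes>\<^bsub>S\<^esub> a \<oplus>\<^bsub>S\<^esub> sym_of K M v \<otimes>\<^bsub>S\<^esub> b"
      "sym_of K M v \<otimes>\<^bsub>S\<^esub> X = sym_of K M v \<otimes>\<^bsub>S\<^esub> b \<oplus>\<^bsub>S\<^esub> sym_of K M v \<otimes>\<^bsub>S\<^esub> a"
    using sym grade_closed S_grade_closed by (simp_all add: S.r_distr S.a_comm)
  moreover have "sym_of K M v \<otimes>\<^bsub>S\<^esub> a \<in> grade S (p + 0)" "sym_of K M v \<otimes>\<^bsub>S\<^esub> b \<in> grade S (p + 1)"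
    using ab sym S_grade_sym by blast+
  ultimately show ?case by (cases p) auto
next
  case (add X Y)
  then obtain a b a' b' where "a \<in> grade S 0" "b \<in> grade S 1" "X = a \<oplus>\<^bsub>S\<^esub> b"
    "a' \<in> grade S 0" "b' \<in> grade S 1" "Y = a' \<oplus>\<^bsub>S\<^esub> b'" by blast
  then show ?case
    using S_grade_add S_grade_closed
    by (intro bexI[of _ "a \<oplus>\<^bsub>S\<^esub> a'"] bexI[of _ "b \<oplus>\<^bsub>S\<^esub> b'"]) (auto simp: S.a_ac)
qed

text \<open>
  The coaction \<open>S \<rightarrow> S[\<int>/2]\<close> sending a homogeneous letter \<open>x\<close> of parity \<open>p\<close> to \<open>x\<close> times the group
  element \<open>p\<close> separates the two homogeneous parts, also in characteristic two.
\<close>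

definition shift :: "_ \<Rightarrow> _ \<Rightarrow> (('k + 'm) fword \<Rightarrow>\<^sub>0 int) set set \<times> (('k + 'm) fword \<Rightarrow>\<^sub>0 int) set set \<Rightarrow>
    (('k + 'm) fword \<Rightarrow>\<^sub>0 int) set set \<times> (('k + 'm) fword \<Rightarrow>\<^sub>0 int) set set"
  where "shift a b y = (a \<otimes>\<^bsub>S\<^esub> fst y \<oplus>\<^bsub>S\<^esub> b \<otimes>\<^bsub>S\<^esub> snd y, b \<otimes>\<^bsub>S\<^esub> fst y \<oplus>\<^bsub>S\<^esub> a \<otimes>\<^bsub>S\<^esub> snd y)"

lemma shift_map:
  "\<lbrakk>a \<in> carrier S; b \<in> carrier S\<rbrakk> \<Longrightarrow> add_map (prod_grp S S) (prod_grp S S) (shift a b)"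
  by (rule add_mapI) (auto simp: shift_def S.r_distr S.a_ac)

definition coopK where "coopK \<alpha> = shift (sc (hcomp K 0 \<alpha>)) (sc (hcomp K 1 \<alpha>))"
definition coopM where "coopM v = shift (sym_of K M (hcomp M 0 v)) (sym_of K M (hcomp M 1 v))"

lemma coopK_grade: "\<alpha> \<in> grade K p \<Longrightarrow> coopK \<alpha> = shift (if p = 0 then sc \<alpha> else \<zero>\<^bsub>S\<^esub>) (if p = 1 then sc \<alpha> else \<zero>\<^bsub>S\<^esub>)"
  by (cases p) (simp_all add: coopK_def K.hcomp_of_grade)

lemma coopM_grade: "v \<in> grade M p \<Longrightarrow> coopM v = shift (if p = 0 then sym_of K M v else \<zero>\<^bsub>S\<^esub>) (if p = 1 then sym_of K M v else \<zero>\<^bsub>S\<^esub>)"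
  by (cases p) (simp_all add: coopM_def hcomp_of_grade)

lemma coaction: "sym_action K M (prod_grp S S) coopK coopM"
proof -
  interpret SS: abelian_group "prod_grp S S"
    by (intro abelian_group_prod_grp S.abelian_group_axioms)
  note ks = ksgn_prod_grp[OF S.abelian_group_axioms S.abelian_group_axioms]
  show ?thesis
  proof (unfold_locales)
    fix \<alpha> \<beta> w assume "\<alpha> \<in> carrier K" "\<beta> \<in> carrier K" "w \<in> carrier (prod_grp S S)"
    then show "coopK (\<alpha> \<oplus>\<^bsub>K\<^esub> \<beta>) w = coopK \<alpha> w \<oplus>\<^bsub>prod_grp S S\<^esub> coopK \<beta> w"
      by (auto simp: coopK_def shift_def K.hcomp_add sc_add S.l_distr S.a_ac)
  next
    fix u v w assume "u \<in> carrier M" "v \<in> carrier M" "w \<in> carrier (prod_grp S S)"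
    then show "coopM (u \<oplus> v) w = coopM u w \<oplus>\<^bsub>prod_grp S S\<^esub> coopM v w"
      by (auto simp: coopM_def shift_def hcomp_add sym_of_add S.l_distr S.a_ac)
  next
    fix \<alpha> \<beta> p q w assume *: "\<alpha> \<in> grade K p" "\<beta> \<in> grade K q" "w \<in> carrier (prod_grp S S)"
    show "coopK (\<alpha> \<otimes>\<^bsub>K\<^esub> \<beta>) w = coopK \<alpha> (coopK \<beta> w)"
      using * K.grade_closed
      by (cases p; cases q) (auto simp: coopK_grade[OF K.grade_mult[OF *(1,2)]] coopK_grade[OF *(1)] coopK_grade[OF *(2)] shift_def sc_mult S.m_assoc)
  next
    fix v \<alpha> q p w assume *: "v \<in> grade M q" "\<alpha> \<in> grade K p" "w \<in> carrier (prod_grp S S)"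
    show "coopM (rsmult M v \<alpha>) w = coopM v (coopK \<alpha> w)"
      using * K.grade_closed grade_closed
      by (cases p; cases q) (auto simp: coopM_grade[OF rsmult_grade[OF *(1,2)]] coopK_grade[OF *(2)] coopM_grade[OF *(1)] shift_def sym_of_rsmult S.m_assoc)
  next
    fix \<alpha> p v q w assume *: "\<alpha> \<in> grade K p" "v \<in> grade M q" "w \<in> carrier (prod_grp S S)"
    have "ksgn M (p * q) (rsmult M v \<alpha>) \<in> grade M (q + p)" using * rsmult_grade by blast
    note g = coopM_grade[OF this]
    have s: "sym_of K M (ksgn M (p * q) (rsmult M v \<alpha>)) = sc \<alpha> \<otimes>\<^bsub>S\<^esub> sym_of K M v"
      using sc_sym_of[OF *(1,2)] by simp
    show "coopK \<alpha> (coopM v w) = coopM (ksgn M (p * q) (rsmult M v \<alpha>)) w"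
      unfolding g s coopK_grade[OF *(1)] coopM_grade[OF *(2)]
      using * K.grade_closed grade_closed
      by (cases p; cases q) (auto simp: shift_def S.m_assoc)
  next
    fix u p v q w assume *: "u \<in> grade M p" "v \<in> grade M q" "w \<in> carrier (prod_grp S S)"
    have c: "sym_of K M u \<otimes>\<^bsub>S\<^esub> (sym_of K M v \<otimes>\<^bsub>S\<^esub> y) = ksgn S (p * q) (sym_of K M v \<otimes>\<^bsub>S\<^esub> (sym_of K M u \<otimes>\<^bsub>S\<^esub> y))"
      if "y \<in> carrier S" for y
      using that * grade_closed sym_of_comm[OF *(1,2)] by (simp add: ksgn_S_mult flip: S.m_assoc)
    show "coopM u (coopM v w) = ksgn (prod_grp S S) (p * q) (coopM v (coopM u w))"
      using * grade_closed
      by (cases p; cases q) (auto simp: coopM_grade[OF *(1)] coopM_grade[OF *(2)] shift_def c ks)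
  next
    fix u w assume *: "u \<in> grade M 1" "w \<in> carrier (prod_grp S S)"
    then show "coopM u (coopM u w) = \<zero>\<^bsub>prod_grp S S\<^esub>"
      using grade_closed by (auto simp: coopM_grade[OF *(1)] shift_def sym_of_odd_square simp flip: S.m_assoc)
  next
    fix \<alpha> assume "\<alpha> \<in> carrier K"
    then show "add_map (prod_grp S S) (prod_grp S S) (coopK \<alpha>)" unfolding coopK_def by (intro shift_map) auto
  next
    fix v assume "v \<in> carrier M"
    then show "add_map (prod_grp S S) (prod_grp S S) (coopM v)" unfolding coopM_def by (intro shift_map) auto
  next
    fix w assume "w \<in> carrier (prod_grp S S)"
    then show "coopK \<one>\<^bsub>K\<^esub> w = w" by (auto simp: coopK_grade[OF K.one_even] shift_def)
  qed
qed

text \<open>Acting on (1, 0), a homogeneous X appears in the component of its own parity and leaves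
  zero in the other, so an element of both parities vanishes.\<close>

lemma S_grade_Int: "grade S 0 \<inter> grade S 1 = {\<zero>\<^bsub>S\<^esub>}"
proof -
  interpret co: sym_action K M "prod_grp S S" coopK coopM by (rule coaction)
  have co: "co.act X (\<one>\<^bsub>S\<^esub>, \<zero>\<^bsub>S\<^esub>) = (if d = 0 then (X, \<zero>\<^bsub>S\<^esub>) else (\<zero>\<^bsub>S\<^esub>, X))" if "X \<in> grade S d" for X d
    using that
  proof (induction rule: S_grade_induct)
    case (sc \<alpha> p d X)
    then show ?case
      using K.grade_closed by (cases p; cases d) (auto simp: co.act_mult co.act_sc coopK_grade shift_def)
  next
    case (sym v p d X)
    then show ?case
      using grade_closed by (cases p; cases d) (auto simp: co.act_mult co.act_sym_of coopM_grade shift_def)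
  next
    case (add d X Y)
    then show ?case by (auto simp: co.act_add)
  qed (simp add: co.act_one)
  have "X = \<zero>\<^bsub>S\<^esub>" if "X \<in> grade S 0" "X \<in> grade S 1" for X
  proof -
    have "co.act X (\<one>\<^bsub>S\<^esub>, \<zero>\<^bsub>S\<^esub>) = (X, \<zero>\<^bsub>S\<^esub>)" using co[OF that(1)] by simp
    moreover have "co.act X (\<one>\<^bsub>S\<^esub>, \<zero>\<^bsub>S\<^esub>) = (\<zero>\<^bsub>S\<^esub>, X)" using co[OF that(2)] by simp
    ultimately show ?thesis by (metis prod.inject)
  qed
  then show ?thesis using S_grade_zero by blast
qed

lemma S_carrier_sum: "carrier S = grade S 0 <+>\<^bsub>S\<^esub> grade S 1"
proof -
  have "grade S 0 <+>\<^bsub>S\<^esub> grade S 1 = (\<Union>a\<in>grade S 0. \<Union>b\<in>grade S 1. {a \<oplus>\<^bsub>S\<^esub> b})"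
    unfolding set_add_def set_mult_def by simp
  also have "\<dots> = carrier S"
  proof (intro equalityI subsetI)
    fix X assume "X \<in> carrier S"
    then obtain a b where "a \<in> grade S 0" "b \<in> grade S 1" "X = a \<oplus>\<^bsub>S\<^esub> b" using S_grade_sum by blast
    then show "X \<in> (\<Union>a\<in>grade S 0. \<Union>b\<in>grade S 1. {a \<oplus>\<^bsub>S\<^esub> b})" by blast
  next
    fix X assume "X \<in> (\<Union>a\<in>grade S 0. \<Union>b\<in>grade S 1. {a \<oplus>\<^bsub>S\<^esub> b})"
    then obtain a b where "a \<in> grade S 0" "b \<in> grade S 1" "X = a \<oplus>\<^bsub>S\<^esub> b" by blast
    then show "X \<in> carrier S" using S_grade_closed[of a 0] S_grade_closed[of b 1] by simp
  qed
  finally show ?thesis by simp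
qed

lemma S_graded_group: "graded_group S"
  by (intro graded_group.intro graded_group_axioms.intro S.abelian_group_axioms
      S_grade_subgroup S_carrier_sum S_grade_Int)

sublocale S: graded_group S
  by (rule S_graded_group)

sublocale S: supermodule K S
proof
  fix m n \<alpha> assume "m \<in> carrier S" "n \<in> carrier S" "\<alpha> \<in> carrier K"
  then show "rsmult S (m \<oplus>\<^bsub>S\<^esub> n) \<alpha> = rsmult S m \<alpha> \<oplus>\<^bsub>S\<^esub> rsmult S n \<alpha>" by (simp add: S_rsmult S.l_distr)
next
  fix m p \<alpha> q assume "m \<in> grade S p" "\<alpha> \<in> grade K q"
  then show "rsmult S m \<alpha> \<in> grade S (p + q)" using K.grade_closed S_grade_mult sc_grade by (simp add: S_rsmult)
next
  fix m \<alpha> \<beta> assume "m \<in> carrier S" "\<alpha> \<in> carrier K" "\<beta> \<in> carrier K"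
  then show "rsmult S m (\<alpha> \<oplus>\<^bsub>K\<^esub> \<beta>) = rsmult S m \<alpha> \<oplus>\<^bsub>S\<^esub> rsmult S m \<beta>"
    "rsmult S m (\<alpha> \<otimes>\<^bsub>K\<^esub> \<beta>) = rsmult S (rsmult S m \<alpha>) \<beta>"
    by (simp_all add: S_rsmult sc_add sc_mult S.r_distr S.m_assoc)
qed (simp_all add: S_rsmult)

lemma tw_S_mult:
  assumes "X \<in> carrier S" "Y \<in> carrier S"
  shows "tw S p (X \<otimes>\<^bsub>S\<^esub> Y) = tw S p X \<otimes>\<^bsub>S\<^esub> tw S p Y"
proof (rule S.add_map_eq_grade[OF _ _ _ assms(1)])
  show "add_map S S (\<lambda>X. tw S p (X \<otimes>\<^bsub>S\<^esub> Y))" "add_map S S (\<lambda>X. tw S p X \<otimes>\<^bsub>S\<^esub> tw S p Y)"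
    using assms by (auto intro!: add_mapI simp: S.tw_add S.l_distr)
  fix d X assume X: "X \<in> grade S d"
  show "tw S p (X \<otimes>\<^bsub>S\<^esub> Y) = tw S p X \<otimes>\<^bsub>S\<^esub> tw S p Y"
  proof (rule S.add_map_eq_grade[OF _ _ _ assms(2)])
    show "add_map S S (\<lambda>Y. tw S p (X \<otimes>\<^bsub>S\<^esub> Y))" "add_map S S (\<lambda>Y. tw S p X \<otimes>\<^bsub>S\<^esub> tw S p Y)"
      using X[THEN S.grade_closed] by (auto intro!: add_mapI simp: S.tw_add S.r_distr)
    fix e Y assume "Y \<in> grade S e"
    then show "tw S p (X \<otimes>\<^bsub>S\<^esub> Y) = tw S p X \<otimes>\<^bsub>S\<^esub> tw S p Y"
      using X S.grade_closed S.tw_of_grade[OF S_grade_mult[OF X \<open>Y \<in> grade S e\<close>]]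
      by (simp add: S.tw_of_grade ksgn_S_mult distrib_left add.commute)
  qed
qed

text \<open>The relations state this for single letters; the twist is multiplicative, so it extends
  to all products.\<close>

lemma S_supercomm_sc:
  assumes a: "\<alpha> \<in> grade K p" and "X \<in> carrier S"
  shows "sc \<alpha> \<otimes>\<^bsub>S\<^esub> X = tw S p X \<otimes>\<^bsub>S\<^esub> sc \<alpha>"
  using assms(2)
proof (induction rule: S_induct_right)
  case one
  then show ?case using K.grade_closed[OF a] by (simp add: S.tw_of_grade[OF one_S_grade])
next
  case (sym v q X)
  have [simp]: "\<alpha> \<in> carrier K" "v \<in> carrier M" using a sym K.grade_closed grade_closed by auto
  have "sc \<alpha> \<otimes>\<^bsub>S\<^esub> (sym_of K M v \<otimes>\<^bsub>S\<^esub> X) = ksgn S (p * q) (sym_of K M v \<otimes>\<^bsub>S\<^esub> (sc \<alpha> \<otimes>\<^bsub>S\<^esub> X))"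
    using sym sc_commute_sym[OF a sym(1)] by (simp add: ksgn_S_mult S.m_assoc flip: S.m_assoc[of "sc \<alpha>"])
  also have "\<dots> = tw S p (sym_of K M v \<otimes>\<^bsub>S\<^esub> X) \<otimes>\<^bsub>S\<^esub> sc \<alpha>"
    using sym by (simp add: tw_S_mult S.tw_of_grade[OF sym_of_grade] ksgn_S_mult S.m_assoc)
  finally show ?case .
next
  case (rsmult \<beta> q X)
  have [simp]: "\<alpha> \<in> carrier K" "\<beta> \<in> carrier K" using a rsmult K.grade_closed by auto
  have "sc \<alpha> \<otimes>\<^bsub>S\<^esub> (X \<otimes>\<^bsub>S\<^esub> sc \<beta>) = tw S p X \<otimes>\<^bsub>S\<^esub> sc (\<alpha> \<otimes>\<^bsub>K\<^esub> \<beta>)"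
    using rsmult by (simp add: sc_mult S.m_assoc[symmetric])
  also have "\<alpha> \<otimes>\<^bsub>K\<^esub> \<beta> = ksgn K (p * q) (\<beta> \<otimes>\<^bsub>K\<^esub> \<alpha>)"
    using a rsmult by (intro K.supercomm)
  also have "tw S p X \<otimes>\<^bsub>S\<^esub> sc \<dots> = tw S p (X \<otimes>\<^bsub>S\<^esub> sc \<beta>) \<otimes>\<^bsub>S\<^esub> sc \<alpha>"
    using rsmult by (simp add: tw_S_mult S.tw_of_grade[OF sc_grade] ksgn_S_mult sc.ksgn sc_mult S.m_assoc)
  finally show ?case .
next
  case (add X Y)
  then show ?case using K.grade_closed[OF a] by (simp add: S.r_distr S.l_distr S.tw_add)
qed

text \<open>
  The augmentation and the projection to \<open>M\<close> come from the action of \<open>S\<close> on \<open>K \<oplus> M\<close> in which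
  \<open>M\<close> sends \<open>K\<close> to \<open>M\<close> and annihilates \<open>M\<close>.
\<close>

definition dualK where "dualK \<alpha> w = (\<alpha> \<otimes>\<^bsub>K\<^esub> fst w, lact \<alpha> (snd w))"
definition dualM where "dualM v w = (\<zero>\<^bsub>K\<^esub>, rsmult M v (fst w))"

lemma dual_action: "sym_action K M (prod_grp K M) dualK dualM"
proof -
  interpret KM: abelian_group "prod_grp K M"
    by (intro abelian_group_prod_grp K.abelian_group_axioms abelian_group_axioms)
  note ks = ksgn_prod_grp[OF K.abelian_group_axioms abelian_group_axioms]
  have l: "lact \<alpha> (rsmult M v \<beta>) = rsmult M (ksgn M (p * q) (rsmult M v \<alpha>)) \<beta>"
    if *: "\<alpha> \<in> grade K p" "v \<in> grade M q" and b: "\<beta> \<in> carrier K" for \<alpha> v \<beta> p q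
  proof (rule K.add_map_eq_grade[OF _ _ _ b])
    have [simp]: "\<alpha> \<in> carrier K" "v \<in> carrier M" using * K.grade_closed grade_closed by auto
    show "add_map K M (\<lambda>\<beta>. lact \<alpha> (rsmult M v \<beta>))"
      "add_map K M (\<lambda>\<beta>. rsmult M (ksgn M (p * q) (rsmult M v \<alpha>)) \<beta>)"
      by (auto intro!: add_mapI simp: rsmult_add_right lact_add rsmult_closed)
    fix r \<beta> assume b: "\<beta> \<in> grade K r"
    then have [simp]: "\<beta> \<in> carrier K" by (rule K.grade_closed)
    have "lact \<alpha> (rsmult M v \<beta>) = ksgn M (p * q) (rsmult M v (ksgn K (p * r) (\<beta> \<otimes>\<^bsub>K\<^esub> \<alpha>)))"
      using * b by (simp add: lact_grade rsmult_closed tw_rsmult tw_of_grade rsmult_ksgn rsmult_assoc add.commute)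
    also have "ksgn K (p * r) (\<beta> \<otimes>\<^bsub>K\<^esub> \<alpha>) = \<alpha> \<otimes>\<^bsub>K\<^esub> \<beta>" using K.supercomm[OF *(1) b] by simp
    finally show "lact \<alpha> (rsmult M v \<beta>) = rsmult M (ksgn M (p * q) (rsmult M v \<alpha>)) \<beta>"
      by (simp add: rsmult_ksgn rsmult_assoc rsmult_closed)
  qed
  show ?thesis
    by unfold_locales
      (auto intro!: add_mapI simp: dualK_def dualM_def K.l_distr K.r_distr lact_add K.m_assoc lact_mult lact_one
        rsmult_closed rsmult_add_left rsmult_add_right rsmult_assoc l ks K.grade_closed grade_closed)
qed

end

section \<open>Tensor products\<close>

lemma ext_same_fields:
  assumes "carrier P = carrier Q" "monoid.mult P = monoid.mult Q" "one P = one Q"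
  shows "ext P f x = ext Q f x"
proof -
  have pow: "y [^]\<^bsub>P\<^esub> (n :: int) = y [^]\<^bsub>Q\<^esub> n" for y n
  proof -
    have "y [^]\<^bsub>P\<^esub> (n :: nat) = y [^]\<^bsub>Q\<^esub> n" for n by (simp add: nat_pow_def assms)
    then show ?thesis by (simp add: int_pow_def m_inv_def assms Let_def)
  qed
  show ?thesis by (simp add: ext_def finprod_def pow assms)
qed

lemma finprod_same_fields:
  assumes "carrier P = carrier Q" "monoid.mult P = monoid.mult Q" "one P = one Q"
  shows "finprod P f A = finprod Q f A"
  by (simp add: finprod_def assms)

locale tensor_pair = M: supermodule K M + N: supermodule K N
  for K :: "'k superring" and M :: "('k, 'm, 'x) supermodule_scheme"
    and N :: "('k, 'n, 'y) supermodule_scheme"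
begin

abbreviation "E \<equiv> tensor K M N"
abbreviation "FA \<equiv> free_Abelian_group (carrier M \<times> carrier N)"

lemma FA_comm_group: "comm_group FA"
  by (rule abelian_free_Abelian_group)

sublocale FA: comm_group FA by (rule FA_comm_group)

lemma tensor_rel_carrier: "tensor_rel K M N \<subseteq> carrier FA"
proof -
  have d: "x - y \<in> carrier FA" if "x \<in> carrier FA" "y \<in> carrier FA" for x y
    using that keys_diff[of x y] by auto
  have o: "frag_of (v, w) \<in> carrier FA" if "v \<in> carrier M" "w \<in> carrier N" for v w
    using that by simp
  show ?thesis
    unfolding tensor_rel_def
    by (auto intro!: d o simp del: carrier_free_Abelian_group_iff
        intro: M.rsmult_closed N.rsmult_closed N.ksgn_closed dest: M.K.grade_closed N.grade_closed)
qed

lemma tensor_sub_subgroup: "subgroup (tensor_sub K M N) FA"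
  unfolding tensor_sub_def by (rule FA.generate_is_subgroup[OF tensor_rel_carrier])

lemma tensor_group_comm: "comm_group (tensor_group K M N)"
  unfolding tensor_group_def by (rule FA.abelian_FactGroup[OF tensor_sub_subgroup])

lemma E_fields [simp]:
  "carrier E = carrier (tensor_group K M N)" "ring.zero E = \<one>\<^bsub>tensor_group K M N\<^esub>"
  "ring.add E = monoid.mult (tensor_group K M N)"
  by (simp_all add: tensor_def)

lemma E_abelian_group: "abelian_group E"
proof (rule comm_group_abelian_groupI)
  interpret comm_group "tensor_group K M N" by (rule tensor_group_comm)
  show "comm_group (add_monoid E)"
    by (rule comm_groupI) (auto simp: m_ac intro: l_inv_ex)
qed

sublocale E: abelian_group E by (rule E_abelian_group)

lemma tensor_group_ext: "ext (tensor_group K M N) f x = ext (add_monoid E) f x"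
  by (rule ext_same_fields) simp_all

lemma tensor_group_finprod: "finprod (tensor_group K M N) f A = finsum E f A"
  unfolding finsum_def by (rule finprod_same_fields) simp_all

lemma tensor_lift_E: "tensor_lift (tensor_group K M N) h = tensor_lift (add_monoid E) h"
  by (rule ext) (simp add: tensor_lift_ext tensor_group_ext)

definition cl :: "('m \<times> 'n \<Rightarrow>\<^sub>0 int) \<Rightarrow> ('m \<times> 'n \<Rightarrow>\<^sub>0 int) set"
  where "cl x = tensor_sub K M N #>\<^bsub>FA\<^esub> x"

lemma tens_cl: "tens K M N v w = cl (frag_of (v, w))"
  by (simp add: tens_def cl_def)

lemma cl_hom: "group_hom FA (tensor_group K M N) cl"
proof -
  have "(\<lambda>x. tensor_sub K M N #>\<^bsub>FA\<^esub> x) \<in> hom FA (FA Mod tensor_sub K M N)"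
    by (rule normal.r_coset_hom_Mod[OF FA.subgroup_imp_normal[OF tensor_sub_subgroup]])
  then show ?thesis
    unfolding tensor_group_def group_hom_def group_hom_axioms_def cl_def[abs_def]
    using FA.group_axioms comm_group.axioms(2)[OF tensor_group_comm[unfolded tensor_group_def]] by simp
qed

sublocale cl: group_hom FA "tensor_group K M N" cl by (rule cl_hom)

lemma cl_surj: "X \<in> carrier E \<Longrightarrow> \<exists>x\<in>carrier FA. X = cl x"
  by (auto simp: tensor_group_def FactGroup_def RCOSETS_def cl_def)

lemma cl_add: "\<lbrakk>x \<in> carrier FA; y \<in> carrier FA\<rbrakk> \<Longrightarrow> cl (x + y) = cl x \<oplus>\<^bsub>E\<^esub> cl y"
  using cl.hom_mult[of x y] by simp

lemma cl_closed [simp]: "x \<in> carrier FA \<Longrightarrow> cl x \<in> carrier E"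
  using cl.hom_closed by simp

lemma FA_diff: "\<lbrakk>x \<in> carrier FA; y \<in> carrier FA\<rbrakk> \<Longrightarrow> x - y \<in> carrier FA"
  using keys_diff[of x y] by auto

lemma cl_diff: "\<lbrakk>x \<in> carrier FA; y \<in> carrier FA\<rbrakk> \<Longrightarrow> cl (x - y) = cl x \<ominus>\<^bsub>E\<^esub> cl y"
  using cl_add[of "x - y" y] FA_diff[of x y] E.add_minus_cancel(2)[of "cl (x - y)" "cl y"]
  by (simp del: carrier_free_Abelian_group_iff E_fields)

lemma cl_rel: "x \<in> tensor_rel K M N \<Longrightarrow> cl x = \<zero>\<^bsub>E\<^esub>"
proof -
  assume "x \<in> tensor_rel K M N"
  then have "x \<in> tensor_sub K M N" unfolding tensor_sub_def by (rule generate.incl)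
  then show ?thesis
    using FA.coset_join2[OF _ tensor_sub_subgroup, of x] subgroup.subset[OF tensor_sub_subgroup]
    by (auto simp: cl_def tensor_group_def FactGroup_def simp del: carrier_free_Abelian_group_iff)
qed

lemma frag_of_FA: "\<lbrakk>v \<in> carrier M; w \<in> carrier N\<rbrakk> \<Longrightarrow> frag_of (v, w) \<in> carrier FA"
  by simp

lemma tens_closed [simp, intro]: "\<lbrakk>v \<in> carrier M; w \<in> carrier N\<rbrakk> \<Longrightarrow> tens K M N v w \<in> carrier E"
  unfolding tens_cl by (intro cl_closed frag_of_FA)

lemma cl_eqI: "\<lbrakk>x - y \<in> tensor_rel K M N; x \<in> carrier FA; y \<in> carrier FA\<rbrakk> \<Longrightarrow> cl x = cl y"
  using cl_rel[of "x - y"] cl_diff[of x y] E.minus_eq_zero_iff by (simp del: carrier_free_Abelian_group_iff E_fields)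

lemma cl_eq_addI:
  assumes "x - y - z \<in> tensor_rel K M N" "x \<in> carrier FA" "y \<in> carrier FA" "z \<in> carrier FA"
  shows "cl x = cl y \<oplus>\<^bsub>E\<^esub> cl z"
proof -
  have "y + z \<in> carrier FA" using FA.m_closed[of y z] assms by simp
  then show ?thesis
    using cl_eqI[of x "y + z"] assms cl_add[of y z] by (simp add: diff_diff_eq del: carrier_free_Abelian_group_iff E_fields)
qed

lemma tens_add_left:
  assumes "v \<in> carrier M" "v' \<in> carrier M" "w \<in> carrier N"
  shows "tens K M N (v \<oplus>\<^bsub>M\<^esub> v') w = tens K M N v w \<oplus>\<^bsub>E\<^esub> tens K M N v' w"
  unfolding tens_cl
  by (rule cl_eq_addI, unfold tensor_rel_def, use assms in blast) (intro frag_of_FA M.a_closed assms)+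

lemma tens_add_right:
  assumes "v \<in> carrier M" "w \<in> carrier N" "w' \<in> carrier N"
  shows "tens K M N v (w \<oplus>\<^bsub>N\<^esub> w') = tens K M N v w \<oplus>\<^bsub>E\<^esub> tens K M N v w'"
  unfolding tens_cl
  by (rule cl_eq_addI, unfold tensor_rel_def, use assms in blast) (intro frag_of_FA N.a_closed assms)+

lemma tens_balanced:
  assumes "v \<in> carrier M" "\<alpha> \<in> grade K p" "w \<in> grade N q"
  shows "tens K M N (rsmult M v \<alpha>) w = tens K M N v (ksgn N (p * q) (rsmult N w \<alpha>))"
  unfolding tens_cl
  by (rule cl_eqI, unfold tensor_rel_def, use assms in blast)
    (intro frag_of_FA M.rsmult_closed N.ksgn_closed N.rsmult_closed assms M.K.grade_closed[OF assms(2)]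
      N.grade_closed[OF assms(3)])+

lemma tens_ksgn:
  assumes "v \<in> carrier M" "w \<in> carrier N"
  shows "tens K M N (ksgn M e v) w = ksgn E e (tens K M N v w)"
    "tens K M N v (ksgn N e w) = ksgn E e (tens K M N v w)"
proof -
  interpret l: add_hom M E "\<lambda>v. tens K M N v w"
    using assms by (intro add_hom_intro M.abelian_group_axioms E.abelian_group_axioms add_mapI)
      (simp_all add: tens_add_left del: E_fields)
  interpret r: add_hom N E "tens K M N v"
    using assms by (intro add_hom_intro N.abelian_group_axioms E.abelian_group_axioms add_mapI)
      (simp_all add: tens_add_right del: E_fields)
  show "tens K M N (ksgn M e v) w = ksgn E e (tens K M N v w)"
    "tens K M N v (ksgn N e w) = ksgn E e (tens K M N v w)"
    using assms by simp_all
qed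

lemma tens_zero:
  "w \<in> carrier N \<Longrightarrow> tens K M N \<zero>\<^bsub>M\<^esub> w = \<zero>\<^bsub>E\<^esub>"
  "v \<in> carrier M \<Longrightarrow> tens K M N v \<zero>\<^bsub>N\<^esub> = \<zero>\<^bsub>E\<^esub>"
  using tens_add_left[of "\<zero>\<^bsub>M\<^esub>" "\<zero>\<^bsub>M\<^esub>" w] tens_add_right[of v "\<zero>\<^bsub>N\<^esub>" "\<zero>\<^bsub>N\<^esub>"]
  by (auto intro!: E.idem_zero simp del: E_fields)

text \<open>Asked for homogeneous v as well, to ease the verification; \<open>h_balanced\<close>
  removes the restriction by additivity.\<close>

definition balanced :: "('p, 'z) ring_scheme \<Rightarrow> ('m \<Rightarrow> 'n \<Rightarrow> 'p) \<Rightarrow> bool"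
  where "balanced X h \<longleftrightarrow>
    (\<forall>v\<in>carrier M. \<forall>w\<in>carrier N. h v w \<in> carrier X) \<and>
    (\<forall>v\<in>carrier M. \<forall>v'\<in>carrier M. \<forall>w\<in>carrier N. h (v \<oplus>\<^bsub>M\<^esub> v') w = h v w \<oplus>\<^bsub>X\<^esub> h v' w) \<and>
    (\<forall>v\<in>carrier M. \<forall>w\<in>carrier N. \<forall>w'\<in>carrier N. h v (w \<oplus>\<^bsub>N\<^esub> w') = h v w \<oplus>\<^bsub>X\<^esub> h v w') \<and>
    (\<forall>p q r. \<forall>v\<in>grade M r. \<forall>\<alpha>\<in>grade K p. \<forall>w\<in>grade N q.
      h (rsmult M v \<alpha>) w = h v (ksgn N (p * q) (rsmult N w \<alpha>)))"

lemma balancedI: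
  assumes "\<And>v w. \<lbrakk>v \<in> carrier M; w \<in> carrier N\<rbrakk> \<Longrightarrow> h v w \<in> carrier X"
    and "\<And>v v' w. \<lbrakk>v \<in> carrier M; v' \<in> carrier M; w \<in> carrier N\<rbrakk> \<Longrightarrow> h (v \<oplus>\<^bsub>M\<^esub> v') w = h v w \<oplus>\<^bsub>X\<^esub> h v' w"
    and "\<And>v w w'. \<lbrakk>v \<in> carrier M; w \<in> carrier N; w' \<in> carrier N\<rbrakk> \<Longrightarrow> h v (w \<oplus>\<^bsub>N\<^esub> w') = h v w \<oplus>\<^bsub>X\<^esub> h v w'"
    and "\<And>p q r v w \<alpha>. \<lbrakk>v \<in> grade M r; \<alpha> \<in> grade K p; w \<in> grade N q; v \<in> carrier M; w \<in> carrier N; \<alpha> \<in> carrier K\<rbrakk>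
      \<Longrightarrow> h (rsmult M v \<alpha>) w = h v (ksgn N (p * q) (rsmult N w \<alpha>))"
  shows "balanced X h"
  unfolding balanced_def
  by (intro conjI ballI allI assms) (assumption | erule M.grade_closed N.grade_closed M.K.grade_closed)+

end

section \<open>The universal property of the tensor product\<close>

locale tensor_universal = tensor_pair K M N + X: abelian_group X
  for K :: "'k superring" and M :: "('k, 'm, 'x) supermodule_scheme"
    and N :: "('k, 'n, 'y) supermodule_scheme" and X :: "('p, 'z) ring_scheme" +
  fixes h :: "'m \<Rightarrow> 'n \<Rightarrow> 'p"
  assumes bal: "balanced X h"
begin

abbreviation "hx \<equiv> ext (add_monoid X) (\<lambda>(v, w). h v w)"

lemma h_closed [simp]: "\<lbrakk>v \<in> carrier M; w \<in> carrier N\<rbrakk> \<Longrightarrow> h v w \<in> carrier X"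
  using bal by (simp add: balanced_def)

lemma h_add_left: "\<lbrakk>v \<in> carrier M; v' \<in> carrier M; w \<in> carrier N\<rbrakk> \<Longrightarrow> h (v \<oplus>\<^bsub>M\<^esub> v') w = h v w \<oplus>\<^bsub>X\<^esub> h v' w"
  using bal by (simp add: balanced_def)

lemma h_add_right: "\<lbrakk>v \<in> carrier M; w \<in> carrier N; w' \<in> carrier N\<rbrakk> \<Longrightarrow> h v (w \<oplus>\<^bsub>N\<^esub> w') = h v w \<oplus>\<^bsub>X\<^esub> h v w'"
  using bal by (simp add: balanced_def)

lemma h_balanced:
  assumes "v \<in> carrier M" and a: "\<alpha> \<in> grade K p" and w: "w \<in> grade N q"
  shows "h (rsmult M v \<alpha>) w = h v (ksgn N (p * q) (rsmult N w \<alpha>))"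
proof (rule M.add_map_eq_grade[OF _ _ _ assms(1)])
  have [simp]: "\<alpha> \<in> carrier K" "w \<in> carrier N" using a w M.K.grade_closed N.grade_closed by auto
  show "add_map M X (\<lambda>v. h (rsmult M v \<alpha>) w)" "add_map M X (\<lambda>v. h v (ksgn N (p * q) (rsmult N w \<alpha>)))"
    by (auto intro!: add_mapI simp: M.rsmult_add_left M.rsmult_closed N.rsmult_closed h_add_left)
qed (use bal a w in \<open>simp add: balanced_def\<close>)

lemma h_Pi: "(\<lambda>(v, w). h v w) \<in> carrier M \<times> carrier N \<rightarrow> carrier (add_monoid X)"
  by auto

lemma hx_closed: "x \<in> carrier FA \<Longrightarrow> hx x \<in> carrier X"
  using comm_group.ext_closed[OF X.a_comm_group _ h_Pi, of x] by simp

lemma hx_diff: "\<lbrakk>x \<in> carrier FA; y \<in> carrier FA\<rbrakk> \<Longrightarrow> hx (x - y) = hx x \<ominus>\<^bsub>X\<^esub> hx y"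
  using comm_group.ext_diff[OF X.a_comm_group _ _ h_Pi, of x y] by (simp add: a_minus_def a_inv_def)

lemma hx_add: "\<lbrakk>x \<in> carrier FA; y \<in> carrier FA\<rbrakk> \<Longrightarrow> hx (x + y) = hx x \<oplus>\<^bsub>X\<^esub> hx y"
  using comm_group.ext_add[OF X.a_comm_group _ _ h_Pi, of x y] by simp

lemma hx_frag_of: "\<lbrakk>v \<in> carrier M; w \<in> carrier N\<rbrakk> \<Longrightarrow> hx (frag_of (v, w)) = h v w"
  using comm_group.ext_frag_of[OF X.a_comm_group, of "\<lambda>(v, w). h v w" "(v, w)"] by simp

lemma hx_rel: "x \<in> tensor_rel K M N \<Longrightarrow> hx x = \<zero>\<^bsub>X\<^esub>"
proof -
  note d = FA_diff frag_of_FA hx_diff hx_frag_of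
  assume "x \<in> tensor_rel K M N"
  then consider
    (1) v v' w where "x = frag_of (v \<oplus>\<^bsub>M\<^esub> v', w) - frag_of (v, w) - frag_of (v', w)"
      "v \<in> carrier M" "v' \<in> carrier M" "w \<in> carrier N"
    | (2) v w w' where "x = frag_of (v, w \<oplus>\<^bsub>N\<^esub> w') - frag_of (v, w) - frag_of (v, w')"
      "v \<in> carrier M" "w \<in> carrier N" "w' \<in> carrier N"
    | (3) v w \<alpha> p q where "x = frag_of (rsmult M v \<alpha>, w) - frag_of (v, ksgn N (p * q) (rsmult N w \<alpha>))"
      "v \<in> carrier M" "\<alpha> \<in> grade K p" "w \<in> grade N q"
    unfolding tensor_rel_def by blast
  then show ?thesis
  proof cases
    case 1
    then show ?thesis
      by (simp add: d h_add_left X.add_minus_cancel a_minus_def X.r_neg X.a_ac X.r_neg1 X.r_neg2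
          del: carrier_free_Abelian_group_iff)
  next
    case 2
    then show ?thesis
      by (simp add: d h_add_right X.add_minus_cancel a_minus_def X.r_neg X.a_ac X.r_neg1 X.r_neg2
          del: carrier_free_Abelian_group_iff)
  next
    case 3
    then have "\<alpha> \<in> carrier K" "w \<in> carrier N" using M.K.grade_closed N.grade_closed by auto
    then show ?thesis
      using 3 h_balanced[OF 3(2-4)]
      by (simp add: d M.rsmult_closed N.rsmult_closed a_minus_def X.r_neg del: carrier_free_Abelian_group_iff)
  qed
qed

lemma hx_sub:
  assumes "x \<in> tensor_sub K M N" shows "hx x = \<zero>\<^bsub>X\<^esub>"
  using assms[unfolded tensor_sub_def] FA.comm_group_axioms
proof (induction rule: generate_induct)
  case one
  then show ?case using hx_diff[of 0 0] FA.one_closed X.r_neg by (simp add: a_minus_def hx_closed)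
next
  case (incl x)
  then show ?case by (rule hx_rel)
next
  case (inv x)
  then have x: "x \<in> carrier FA" using tensor_rel_carrier by blast
  then have "inv\<^bsub>FA\<^esub> x = 0 - x" by simp
  then show ?case
    using hx_diff[of 0 x] hx_diff[of 0 0] FA.one_closed x inv hx_rel by (simp add: a_minus_def X.r_neg hx_closed)
next
  case (mult x y)
  then have "x \<in> carrier FA" "y \<in> carrier FA"
    using FA.generate_incl[OF tensor_rel_carrier] by blast+
  then show ?case using mult hx_add[of x y] by simp
qed

text \<open>The representative chosen by \<open>tensor_lift\<close> differs from x by an element of
  the relation subgroup, on which the additive extension vanishes.\<close>

lemma lift_cl: "x \<in> carrier FA \<Longrightarrow> tensor_lift (add_monoid X) h (cl x) = hx x"
proof -
  assume x: "x \<in> carrier FA"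
  define y where "y = (SOME y. y \<in> cl x)"
  have "x \<in> cl x" unfolding cl_def by (rule FA.rcos_self[OF x tensor_sub_subgroup])
  then have "y \<in> cl x" unfolding y_def by (rule someI)
  then obtain z where z: "z \<in> tensor_sub K M N" "y = z + x"
    unfolding cl_def r_coset_def by auto
  then have "z \<in> carrier FA" using subgroup.subset[OF tensor_sub_subgroup] by blast
  then have "hx y = hx x" using z x by (simp add: hx_add hx_sub hx_closed del: carrier_free_Abelian_group_iff)
  then show ?thesis by (simp add: tensor_lift_ext y_def)
qed

abbreviation "L \<equiv> tensor_lift (add_monoid X) h"

lemma lift_tens: "\<lbrakk>v \<in> carrier M; w \<in> carrier N\<rbrakk> \<Longrightarrow> L (tens K M N v w) = h v w"
  unfolding tens_cl using lift_cl[OF frag_of_FA] hx_frag_of by simp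

lemma lift_map: "add_map E X L"
proof (rule add_mapI)
  fix x assume "x \<in> carrier E"
  then show "L x \<in> carrier X" using cl_surj lift_cl hx_closed by metis
next
  fix x y assume "x \<in> carrier E" "y \<in> carrier E"
  then obtain a b where ab: "a \<in> carrier FA" "b \<in> carrier FA" "x = cl a" "y = cl b" using cl_surj by metis
  have "a + b \<in> carrier FA" using FA.m_closed[of a b] ab by simp
  then have "L (cl (a + b)) = L (cl a) \<oplus>\<^bsub>X\<^esub> L (cl b)" using ab by (simp only: lift_cl hx_add)
  then show "L (x \<oplus>\<^bsub>E\<^esub> y) = L x \<oplus>\<^bsub>X\<^esub> L y" using cl_add[OF ab(1,2)] ab(3,4) by metis
qed

end

context tensor_pair
begin

text \<open>Sums suffice, because the negative of a pure tensor is again a pure tensor.\<close>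

lemma tensor_induct [consumes 1, case_names tens add]:
  assumes Z: "Z \<in> carrier E"
    and tens: "\<And>p q v w. \<lbrakk>v \<in> grade M p; w \<in> grade N q; v \<in> carrier M; w \<in> carrier N\<rbrakk> \<Longrightarrow> P (tens K M N v w)"
    and add: "\<And>Y Z. \<lbrakk>Y \<in> carrier E; Z \<in> carrier E; P Y; P Z\<rbrakk> \<Longrightarrow> P (Y \<oplus>\<^bsub>E\<^esub> Z)"
  shows "P Z"
proof -
  have t: "P (tens K M N v w)" if "v \<in> carrier M" "w \<in> carrier N" for v w
    using that
  proof (induction v rule: M.grade_induct)
    case (grade d v)
    from grade(2) show ?case
    proof (induction w rule: N.grade_induct)
      case (grade e w)
      then show ?case using tens \<open>v \<in> grade M d\<close> M.grade_closed N.grade_closed by blast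
    next
      case (add w w')
      then show ?case using assms(3) \<open>v \<in> grade M d\<close> M.grade_closed by (metis tens_add_right tens_closed)
    qed
  next
    case (add v v')
    then show ?case using assms(3) by (metis tens_add_left tens_closed)
  qed
  obtain z where z: "z \<in> carrier FA" "Z = cl z" using cl_surj[OF Z] by blast
  have "Poly_Mapping.keys z \<subseteq> carrier M \<times> carrier N" using z by simp
  \<comment> \<open>Induction over a free abelian group proceeds by differences, whereas P is stable
    under sums only. Hence P is carried along for both signs.\<close>
  then have "z \<in> carrier FA \<and> P (cl z) \<and> P (cl (- z))"
  proof (induction rule: frag_induction)
    case zero
    have "P (tens K M N \<zero>\<^bsub>M\<^esub> \<zero>\<^bsub>N\<^esub>)" by (intro t) simp_all
    moreover have "cl 0 = \<zero>\<^bsub>E\<^esub>" using cl.hom_one by simp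
    ultimately show ?case by (simp add: tens_zero)
  next
    case (one x)
    then obtain v w where x: "x = (v, w)" "v \<in> carrier M" "w \<in> carrier N" by auto
    have "cl (0 - frag_of x) = cl 0 \<ominus>\<^bsub>E\<^esub> cl (frag_of x)"
      by (rule cl_diff) (use x in auto)
    then have "cl (- frag_of x) = tens K M N (ksgn M 1 v) w"
      using x cl.hom_one tens_ksgn(1)[of v w 1] by (simp add: tens_cl a_minus_def ksgn_1)
        (metis E.a_inv_closed E.l_zero E_fields(2) E_fields(3) frag_of_FA cl_closed)
    moreover have "P (tens K M N (ksgn M 1 v) w)" "P (tens K M N v w)" using x t by blast+
    ultimately show ?case using x by (simp add: tens_cl)
  next
    case (diff a b)
    have n: "- a \<in> carrier FA" "- b \<in> carrier FA" using diff by auto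
    have "cl (a - b) = cl a \<oplus>\<^bsub>E\<^esub> cl (- b)" "cl (- (a - b)) = cl (- a) \<oplus>\<^bsub>E\<^esub> cl b"
      using cl_add[of a "- b"] cl_add[of "- a" b] diff n by simp_all
    then show ?case using diff n add FA_diff[of a b] by (simp del: carrier_free_Abelian_group_iff E_fields)
  qed
  then show ?thesis using z by simp
qed

lemma tensor_eqI:
  assumes "add_map E X f" "add_map E X g" "Z \<in> carrier E"
    and "\<And>p q v w. \<lbrakk>v \<in> grade M p; w \<in> grade N q; v \<in> carrier M; w \<in> carrier N\<rbrakk>
      \<Longrightarrow> f (tens K M N v w) = g (tens K M N v w)"
  shows "f Z = g Z"
  using assms(3)
  by (induction rule: tensor_induct)
    (simp_all add: assms(4) add_map_add[OF assms(1)] add_map_add[OF assms(2)] del: E_fields)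

lemma lift_map:
  assumes "abelian_group X" "balanced X h"
  shows "add_map E X (tensor_lift (add_monoid X) h)"
proof -
  interpret tensor_universal K M N X h
    by (intro tensor_universal.intro tensor_universal_axioms.intro tensor_pair_axioms assms)
  show ?thesis by (rule lift_map)
qed

lemma lift_tens:
  assumes "abelian_group X" "balanced X h" "v \<in> carrier M" "w \<in> carrier N"
  shows "tensor_lift (add_monoid X) h (tens K M N v w) = h v w"
proof -
  interpret tensor_universal K M N X h
    by (intro tensor_universal.intro tensor_universal_axioms.intro tensor_pair_axioms assms)
  show ?thesis using assms by (intro lift_tens)
qed

lemma rsmult_balanced: "\<alpha> \<in> carrier K \<Longrightarrow> balanced E (\<lambda>v w. tens K M N v (rsmult N w \<alpha>))"
proof (rule balancedI)
  fix p q r v w \<beta> assume a: "\<alpha> \<in> carrier K" and *: "v \<in> grade M r" "\<beta> \<in> grade K p" "w \<in> grade N q"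
    "v \<in> carrier M" "w \<in> carrier N" "\<beta> \<in> carrier K"
  have "tens K M N (rsmult M v \<beta>) (rsmult N w \<alpha>) = tens K M N v (rsmult N (ksgn N (p * q) (rsmult N w \<beta>)) \<alpha>)"
  proof (rule M.K.add_map_eq_grade[OF _ _ _ a])
    show "add_map K E (\<lambda>\<alpha>. tens K M N (rsmult M v \<beta>) (rsmult N w \<alpha>))"
      "add_map K E (\<lambda>\<alpha>. tens K M N v (rsmult N (ksgn N (p * q) (rsmult N w \<beta>)) \<alpha>))"
      using * by (auto intro!: add_mapI simp: N.rsmult_add_right tens_add_right N.rsmult_closed M.rsmult_closed simp del: E_fields)
    fix d \<alpha> assume d: "\<alpha> \<in> grade K d"
    then have [simp]: "\<alpha> \<in> carrier K" by (rule M.K.grade_closed)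
    have "tens K M N (rsmult M v \<beta>) (rsmult N w \<alpha>) = tens K M N v (ksgn N (p * (q + d)) (rsmult N (rsmult N w \<alpha>) \<beta>))"
      using tens_balanced[OF *(4,2) N.rsmult_grade[OF *(3) d]] .
    also have "rsmult N (rsmult N w \<alpha>) \<beta> = ksgn N (d * p) (rsmult N (rsmult N w \<beta>) \<alpha>)"
      using * M.K.supercomm[OF d *(2)] by (simp add: N.rsmult_ksgn flip: N.rsmult_assoc)
    finally show "tens K M N (rsmult M v \<beta>) (rsmult N w \<alpha>) = tens K M N v (rsmult N (ksgn N (p * q) (rsmult N w \<beta>)) \<alpha>)"
      using * by (simp add: N.rsmult_ksgn N.rsmult_closed distrib_left mult.commute add.assoc)
  qed
  then show "tens K M N (rsmult M v \<beta>) (rsmult N w \<alpha>) = tens K M N v (rsmult N (ksgn N (p * q) (rsmult N w \<beta>)) \<alpha>)" .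
qed (simp_all add: N.rsmult_closed tens_add_left tens_add_right N.rsmult_add_left del: E_fields)

lemma rsmult_E: "rsmult E X \<alpha> = tensor_lift (add_monoid E) (\<lambda>v w. tens K M N v (rsmult N w \<alpha>)) X"
  by (subst tensor_lift_E[symmetric]) (simp add: tensor_def)

lemma rsmult_tens:
  "\<lbrakk>\<alpha> \<in> carrier K; v \<in> carrier M; w \<in> carrier N\<rbrakk> \<Longrightarrow> rsmult E (tens K M N v w) \<alpha> = tens K M N v (rsmult N w \<alpha>)"
  unfolding rsmult_E by (rule lift_tens[OF E.abelian_group_axioms rsmult_balanced])

lemma rsmult_E_map: "\<alpha> \<in> carrier K \<Longrightarrow> add_map E E (\<lambda>X. rsmult E X \<alpha>)"
  unfolding rsmult_E by (rule lift_map[OF E.abelian_group_axioms rsmult_balanced])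

lemma tens_grade: "\<lbrakk>v \<in> grade M p; w \<in> grade N q\<rbrakk> \<Longrightarrow> tens K M N v w \<in> grade E (p + q)"
  unfolding tensor_def by (auto intro!: generate.incl)

end

section \<open>The coproduct\<close>

definition lin_map :: "'k superring \<Rightarrow> ('k, 'm, 'x) supermodule_scheme \<Rightarrow> ('k, 'n, 'y) supermodule_scheme
    \<Rightarrow> ('m \<Rightarrow> 'n) \<Rightarrow> bool"
  where "lin_map K A B f \<longleftrightarrow> add_map A B f \<and>
    (\<forall>x\<in>carrier A. \<forall>\<alpha>\<in>carrier K. f (rsmult A x \<alpha>) = rsmult B (f x) \<alpha>)"

text \<open>The parity is a parameter because it cannot be read off from the map: the zero map has
  both. A general map is treated as the sum of an even and an odd one.\<close>

definition par_map :: "'k superring \<Rightarrow> ('k, 'm, 'x) supermodule_scheme \<Rightarrow> ('k, 'n, 'y) supermodule_scheme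
    \<Rightarrow> bit \<Rightarrow> ('m \<Rightarrow> 'n) \<Rightarrow> bool"
  where "par_map K A B p f \<longleftrightarrow> lin_map K A B f \<and> (\<forall>d. \<forall>x\<in>grade A d. f x \<in> grade B (p + d))"

lemma lin_mapD:
  assumes "lin_map K A B f"
  shows "add_map A B f" "x \<in> carrier A \<Longrightarrow> f x \<in> carrier B"
    "\<lbrakk>x \<in> carrier A; y \<in> carrier A\<rbrakk> \<Longrightarrow> f (x \<oplus>\<^bsub>A\<^esub> y) = f x \<oplus>\<^bsub>B\<^esub> f y"
    "\<lbrakk>x \<in> carrier A; \<alpha> \<in> carrier K\<rbrakk> \<Longrightarrow> f (rsmult A x \<alpha>) = rsmult B (f x) \<alpha>"
  using assms by (auto simp: lin_map_def add_map_def)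

lemma par_mapD:
  assumes "par_map K A B p f"
  shows "lin_map K A B f" "x \<in> grade A d \<Longrightarrow> f x \<in> grade B (p + d)"
    "add_map A B f" "x \<in> carrier A \<Longrightarrow> f x \<in> carrier B"
    "\<lbrakk>x \<in> carrier A; y \<in> carrier A\<rbrakk> \<Longrightarrow> f (x \<oplus>\<^bsub>A\<^esub> y) = f x \<oplus>\<^bsub>B\<^esub> f y"
    "\<lbrakk>x \<in> carrier A; \<alpha> \<in> carrier K\<rbrakk> \<Longrightarrow> f (rsmult A x \<alpha>) = rsmult B (f x) \<alpha>"
  using assms lin_mapD by (auto simp: par_map_def)

lemma lin_map_comp: "\<lbrakk>lin_map K A B f; lin_map K B C g\<rbrakk> \<Longrightarrow> lin_map K A C (\<lambda>x. g (f x))"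
  unfolding lin_map_def using add_map_comp add_map_closed by fastforce

lemma par_map_comp:
  "\<lbrakk>par_map K A B p f; par_map K B C q g\<rbrakk> \<Longrightarrow> par_map K A C (q + p) (\<lambda>x. g (f x))"
  unfolding par_map_def using lin_map_comp by (metis add.assoc)

context supermodule
begin

lemma lin_map_id: "lin_map K M M (\<lambda>x. x)"
  by (simp add: lin_map_def add_mapI)

lemma par_map_id: "par_map K M M 0 (\<lambda>x. x)"
  by (simp add: par_map_def lin_map_id)

lemma par_map_zero: "par_map K A M p (\<lambda>x. \<zero>)"
  by (simp add: par_map_def lin_map_def add_mapI)

lemma lin_map_add: "\<lbrakk>lin_map K A M f; lin_map K A M g\<rbrakk> \<Longrightarrow> lin_map K A M (\<lambda>x. f x \<oplus> g x)"
  unfolding lin_map_def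
  by (auto intro!: add_map_sum abelian_group_axioms simp: rsmult_add_left add_map_closed)

lemma par_map_add: "\<lbrakk>par_map K A M p f; par_map K A M p g\<rbrakk> \<Longrightarrow> par_map K A M p (\<lambda>x. f x \<oplus> g x)"
  unfolding par_map_def using lin_map_add by blast

lemma lin_map_ksgn: "lin_map K A M f \<Longrightarrow> lin_map K A M (\<lambda>x. ksgn M e (f x))"
  unfolding lin_map_def
  by (auto intro!: add_map_ksgn abelian_group_axioms simp: rsmult_ksgn add_map_closed)

lemma par_map_ksgn: "par_map K A M p f \<Longrightarrow> par_map K A M p (\<lambda>x. ksgn M e (f x))"
  unfolding par_map_def using lin_map_ksgn by blast

end

lemma par_map_tw:
  assumes "supermodule K A" "supermodule K B" and f: "par_map K A B p f" and x: "x \<in> carrier A"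
  shows "tw B q (f x) = ksgn B (q * p) (f (tw A q x))"
proof -
  interpret A: supermodule K A by fact
  interpret B: supermodule K B by fact
  interpret f: add_hom A B f
    by (intro add_hom_intro A.abelian_group_axioms B.abelian_group_axioms par_mapD(3)[OF f])
  show ?thesis
  proof (rule A.add_map_eq_grade[OF _ _ _ x])
    show "add_map A B (\<lambda>x. tw B q (f x))" "add_map A B (\<lambda>x. ksgn B (q * p) (f (tw A q x)))"
      by (intro add_map_comp[OF f.add_map B.add_map_tw] add_map_ksgn B.abelian_group_axioms
          add_map_comp[OF A.add_map_tw f.add_map])+
    fix d x assume x: "x \<in> grade A d"
    show "tw B q (f x) = ksgn B (q * p) (f (tw A q x))"
      using x A.grade_closed B.tw_of_grade[OF par_mapD(2)[OF f x]]
      by (simp add: A.tw_of_grade distrib_left)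
  qed
qed

text \<open>The homogeneous part of the tensor product is generated as a group, so membership of
  values in a subgroup needs checking on homogeneous pure tensors only.\<close>

lemma (in tensor_pair) grade_E_induct:
  assumes Z: "Z \<in> grade E d" and f: "add_map E X f" "abelian_group X" and H: "subgroup H (add_monoid X)"
    and tens: "\<And>p q v w. \<lbrakk>v \<in> grade M p; w \<in> grade N q; p + q = d\<rbrakk> \<Longrightarrow> f (tens K M N v w) \<in> H"
  shows "f Z \<in> H"
proof -
  interpret f: add_hom E X f by (intro add_hom_intro E_abelian_group f)
  let ?g = "{tens K M N v w |v w p q. v \<in> grade M p \<and> w \<in> grade N q \<and> p + q = d}"
  have sub: "?g \<subseteq> carrier E" using tens_closed M.grade_closed N.grade_closed by blast
  have "Z \<in> generate (add_monoid E) ?g"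
  proof (rule subsetD[OF generate_same_fields])
    show "Z \<in> generate (tensor_group K M N) ?g" using Z by (simp add: tensor_def)
  qed simp_all
  then have "Z \<in> carrier E \<and> f Z \<in> H"
    using E.a_comm_group
  proof (induction rule: generate_induct)
    case one
    then show ?case using subgroup.one_closed[OF H] f.zero E.zero_closed by simp
  next
    case (incl h)
    then show ?case using sub tens by blast
  next
    case (inv h)
    then have "h \<in> carrier E" "f h \<in> H" using sub tens by blast+
    then have "\<ominus>\<^bsub>E\<^esub> h \<in> carrier E" "f (\<ominus>\<^bsub>E\<^esub> h) \<in> H"
      using subgroup.m_inv_closed[OF H] f.neg E.a_inv_closed by (auto simp: a_inv_def[of X])
    then show ?case by (simp add: a_inv_def)
  next
    case (mult x y)
    then show ?case using subgroup.m_closed[OF H] f.add[of x y] E.a_closed[of x y] by simp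
  qed
  then show ?thesis by blast
qed

lemma (in tensor_pair) grade_E_subgroup: "subgroup (grade E d) (add_monoid E)"
proof -
  let ?g = "{tens K M N v w |v w p q. v \<in> grade M p \<and> w \<in> grade N q \<and> p + q = d}"
  have sub: "?g \<subseteq> carrier E" using tens_closed M.grade_closed N.grade_closed by blast
  have "grade E d = generate (tensor_group K M N) ?g" by (simp add: tensor_def)
  also have "\<dots> = generate (add_monoid E) ?g"
    by (intro equalityI generate_same_fields) simp_all
  finally show ?thesis using E.add.generate_is_subgroup[of ?g] sub by simp
qed

lemma (in abelian_group) ksgn_l_neg: "x \<in> carrier G \<Longrightarrow> ksgn G 1 x \<oplus> x = \<zero>"
  by (simp add: ksgn_1 l_neg)

section \<open>Maps on the tensor square and the construction of the coproduct\<close>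

context sym_base
begin

sublocale SS: tensor_pair K S S
  by unfold_locales

declare SS.E_fields [simp del]

abbreviation "tt \<equiv> tens K S S"
abbreviation "E \<equiv> tensor K S S"

text \<open>The sign in the balancing relation is the one for exchanging \<alpha> with Y, so with
  the scalar written on the left of Y no sign remains.\<close>

lemma tt_sc:
  assumes a: "\<alpha> \<in> grade K p" and X: "X \<in> carrier S" and Y: "Y \<in> carrier S"
  shows "tt (X \<otimes>\<^bsub>S\<^esub> sc \<alpha>) Y = tt X (sc \<alpha> \<otimes>\<^bsub>S\<^esub> Y)"
proof (rule S.add_map_eq_grade[OF _ _ _ Y])
  have [simp]: "\<alpha> \<in> carrier K" using a by (rule K.grade_closed)
  show "add_map S E (tt (X \<otimes>\<^bsub>S\<^esub> sc \<alpha>))" "add_map S E (\<lambda>Y. tt X (sc \<alpha> \<otimes>\<^bsub>S\<^esub> Y))"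
    using X by (auto intro!: add_mapI simp: SS.tens_add_right S.r_distr)
  fix d Y assume Y: "Y \<in> grade S d"
  then have "Y \<in> carrier S" by (rule S.grade_closed)
  then show "tt (X \<otimes>\<^bsub>S\<^esub> sc \<alpha>) Y = tt X (sc \<alpha> \<otimes>\<^bsub>S\<^esub> Y)"
    using SS.tens_balanced[OF X a Y] S_supercomm_sc[OF a, of Y] Y
    by (simp add: S_rsmult S.tw_of_grade ksgn_S_mult)
qed

definition tf :: "bit \<Rightarrow> _ \<Rightarrow> _ \<Rightarrow>
    ((('k + 'm) fword \<Rightarrow>\<^sub>0 int) set set \<times> (('k + 'm) fword \<Rightarrow>\<^sub>0 int) set set \<Rightarrow>\<^sub>0 int) set \<Rightarrow>
    ((('k + 'm) fword \<Rightarrow>\<^sub>0 int) set set \<times> (('k + 'm) fword \<Rightarrow>\<^sub>0 int) set set \<Rightarrow>\<^sub>0 int) set"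
  where "tf p f g = tensor_lift (add_monoid E) (\<lambda>x y. tt (f (tw S p x)) (g y))"
    \<comment> \<open>\<open>f \<otimes> g\<close> for \<open>g\<close> of parity \<open>p\<close>\<close>

lemma tf_balanced:
  assumes f: "lin_map K S S f" and g: "par_map K S S p g"
  shows "SS.balanced E (\<lambda>x y. tt (f (tw S p x)) (g y))"
proof (rule SS.balancedI)
  note f = lin_mapD[OF f] and g = par_mapD[OF g]
  fix r q s x y \<alpha> assume *: "x \<in> grade S s" "\<alpha> \<in> grade K r" "y \<in> grade S q" "x \<in> carrier S" "y \<in> carrier S" "\<alpha> \<in> carrier K"
  interpret f: add_hom S S f by (intro add_hom_intro S.abelian_group_axioms f)
  interpret g: add_hom S S g by (intro add_hom_intro S.abelian_group_axioms g)
  \<comment> \<open>The sign from twisting the scalar on x cancels the sign from moving it past g;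
    the sign for y is left.\<close>
  have 1: "ksgn S (r * (p + q)) (ksgn S (p * r) (rsmult S (g y) \<alpha>)) = ksgn S (r * q) (rsmult S (g y) \<alpha>)"
    using * g by (simp add: distrib_left add.commute add.assoc mult.commute S.rsmult_closed)
  have "tt (f (tw S p (rsmult S x \<alpha>))) (g y) = tt (ksgn S (p * r) (rsmult S (f (tw S p x)) \<alpha>)) (g y)"
    using * f by (simp add: S.tw_rsmult S.rsmult_closed)
  also have "\<dots> = tt (rsmult S (f (tw S p x)) \<alpha>) (ksgn S (p * r) (g y))"
    using * f g by (simp add: SS.tens_ksgn S.rsmult_closed)
  also have "\<dots> = tt (f (tw S p x)) (ksgn S (r * (p + q)) (ksgn S (p * r) (rsmult S (g y) \<alpha>)))"
    using * f g by (subst SS.tens_balanced[OF _ *(2), of _ _ "p + q"]) (auto simp: S.rsmult_ksgn)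
  also have "\<dots> = tt (f (tw S p x)) (g (ksgn S (r * q) (rsmult S y \<alpha>)))"
    unfolding 1 using * g by (simp add: S.rsmult_closed)
  finally show "tt (f (tw S p (rsmult S x \<alpha>))) (g y) = tt (f (tw S p x)) (g (ksgn S (r * q) (rsmult S y \<alpha>)))" .
qed (simp_all add: lin_mapD[OF f] par_mapD[OF g] S.tw_add SS.tens_add_left SS.tens_add_right SS.tens_closed)

lemma tf_map: "\<lbrakk>lin_map K S S f; par_map K S S p g\<rbrakk> \<Longrightarrow> add_map E E (tf p f g)"
  unfolding tf_def by (rule SS.lift_map[OF SS.E_abelian_group tf_balanced])

lemma tf_closed [simp]:
  "\<lbrakk>lin_map K S S f; par_map K S S p g; Z \<in> carrier E\<rbrakk> \<Longrightarrow> tf p f g Z \<in> carrier E"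
  by (rule add_map_closed[OF tf_map])

lemma tf_tens:
  "\<lbrakk>lin_map K S S f; par_map K S S p g; x \<in> carrier S; y \<in> carrier S\<rbrakk>
    \<Longrightarrow> tf p f g (tt x y) = tt (f (tw S p x)) (g y)"
  unfolding tf_def by (rule SS.lift_tens[OF SS.E_abelian_group tf_balanced])

lemma tf_rsmult:
  assumes f: "lin_map K S S f" and g: "par_map K S S p g" and Z: "Z \<in> carrier E" and a: "\<alpha> \<in> carrier K"
  shows "tf p f g (rsmult E Z \<alpha>) = rsmult E (tf p f g Z) \<alpha>"
proof (rule SS.tensor_eqI[OF _ _ Z])
  show "add_map E E (\<lambda>Z. tf p f g (rsmult E Z \<alpha>))" "add_map E E (\<lambda>Z. rsmult E (tf p f g Z) \<alpha>)"
    by (rule add_map_comp[OF SS.rsmult_E_map tf_map] add_map_comp[OF tf_map SS.rsmult_E_map], rule f g a,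
        rule f g a, rule f g a)+
qed (simp add: tf_tens[OF f g] SS.rsmult_tens a S.rsmult_closed lin_mapD[OF f] par_mapD[OF g])

abbreviation (input) "Lm a \<equiv> (\<lambda>x. a \<otimes>\<^bsub>S\<^esub> x)"

lemma lin_Lm: "a \<in> carrier S \<Longrightarrow> lin_map K S S (Lm a)"
  by (auto simp: lin_map_def S.r_distr S_rsmult S.m_assoc intro!: add_mapI)

lemma par_Lm: "a \<in> grade S p \<Longrightarrow> par_map K S S p (Lm a)"
  using lin_Lm S.grade_closed S_grade_mult by (auto simp: par_map_def)

abbreviation (input) "idS \<equiv> (\<lambda>x. x)"

text \<open>Left multiplication by \<open>a \<otimes> 1 + 1 \<otimes> a\<close>, the coproduct of a
  primitive element a of parity p. Writing it through \<open>tf\<close> makes it available before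
  the product on the tensor square is analysed; the link is \<open>L2_eq_mult\<close>.\<close>

definition L2 where "L2 p a Z = tf 0 (Lm a) idS Z \<oplus>\<^bsub>E\<^esub> tf p idS (Lm a) Z"

lemma L2_map: "a \<in> grade S p \<Longrightarrow> add_map E E (L2 p a)"
  unfolding L2_def
  by (intro add_map_sum SS.E_abelian_group tf_map lin_Lm par_Lm S.par_map_id S.lin_map_id) (auto dest: S.grade_closed)

lemma L2_closed [simp]: "\<lbrakk>a \<in> grade S p; Z \<in> carrier E\<rbrakk> \<Longrightarrow> L2 p a Z \<in> carrier E"
  by (rule add_map_closed[OF L2_map])

lemma L2_tens:
  "\<lbrakk>a \<in> grade S p; x \<in> carrier S; y \<in> carrier S\<rbrakk>
    \<Longrightarrow> L2 p a (tt x y) = tt (a \<otimes>\<^bsub>S\<^esub> x) y \<oplus>\<^bsub>E\<^esub> tt (tw S p x) (a \<otimes>\<^bsub>S\<^esub> y)"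
  by (simp add: L2_def tf_tens lin_Lm par_Lm S.par_map_id S.lin_map_id S.grade_closed)

lemma L2_add:
  assumes "a \<in> grade S p" "b \<in> grade S p" "Z \<in> carrier E"
  shows "L2 p (a \<oplus>\<^bsub>S\<^esub> b) Z = L2 p a Z \<oplus>\<^bsub>E\<^esub> L2 p b Z"
proof (rule SS.tensor_eqI[OF _ _ assms(3)])
  show "add_map E E (L2 p (a \<oplus>\<^bsub>S\<^esub> b))" using assms by (intro L2_map) auto
  show "add_map E E (\<lambda>Z. L2 p a Z \<oplus>\<^bsub>E\<^esub> L2 p b Z)"
    using assms by (intro add_map_sum SS.E_abelian_group L2_map)
  fix r q x y assume "x \<in> carrier S" "y \<in> carrier S"
  then show "L2 p (a \<oplus>\<^bsub>S\<^esub> b) (tt x y) = L2 p a (tt x y) \<oplus>\<^bsub>E\<^esub> L2 p b (tt x y)"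
    using assms S.grade_closed S.grade_add[of a p b]
    by (simp add: L2_tens S.l_distr SS.tens_add_left SS.tens_add_right SS.E.a_ac)
qed

definition deltaK where "deltaK \<alpha> = tf 0 (Lm (sc \<alpha>)) idS"
definition deltaM where "deltaM v Z = L2 0 (sym_of K M (hcomp M 0 v)) Z \<oplus>\<^bsub>E\<^esub> L2 1 (sym_of K M (hcomp M 1 v)) Z"

lemma deltaK_map: "\<alpha> \<in> carrier K \<Longrightarrow> add_map E E (deltaK \<alpha>)"
  unfolding deltaK_def by (intro tf_map lin_Lm S.par_map_id) simp

lemma deltaK_tens: "\<lbrakk>\<alpha> \<in> carrier K; x \<in> carrier S; y \<in> carrier S\<rbrakk> \<Longrightarrow> deltaK \<alpha> (tt x y) = tt (sc \<alpha> \<otimes>\<^bsub>S\<^esub> x) y"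
  by (simp add: deltaK_def tf_tens lin_Lm S.par_map_id)

lemma deltaM_map: "v \<in> carrier M \<Longrightarrow> add_map E E (deltaM v)"
  unfolding deltaM_def by (intro add_map_sum SS.E_abelian_group L2_map) auto

lemma L2_zero: "Z \<in> carrier E \<Longrightarrow> L2 p \<zero>\<^bsub>S\<^esub> Z = \<zero>\<^bsub>E\<^esub>"
  using L2_add[of "\<zero>\<^bsub>S\<^esub>" p "\<zero>\<^bsub>S\<^esub>" Z] by (intro SS.E.idem_zero) simp_all

lemma deltaM_grade: "\<lbrakk>v \<in> grade M p; Z \<in> carrier E\<rbrakk> \<Longrightarrow> deltaM v Z = L2 p (sym_of K M v) Z"
  by (cases p) (simp_all add: deltaM_def hcomp_of_grade L2_zero sym_of_grade)

lemma E_eqI: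
  assumes "add_map E E f" "add_map E E g" "Z \<in> carrier E"
    and "\<And>p q x y. \<lbrakk>x \<in> grade S p; y \<in> grade S q; x \<in> carrier S; y \<in> carrier S\<rbrakk> \<Longrightarrow> f (tt x y) = g (tt x y)"
  shows "f Z = g Z"
  using SS.tensor_eqI[OF assms(1-3)] assms(4) by blast

text \<open>Scalars act on the left factor, letters by what has to become their coproduct. That
  these operators satisfy the relations of S is precisely the well-definedness of the
  coproduct.\<close>

lemma delta_action: "sym_action K M E deltaK deltaM"
proof (intro sym_action.intro sym_action_axioms.intro sym_base_axioms SS.E_abelian_group)
  fix \<alpha> assume "\<alpha> \<in> carrier K" then show "add_map E E (deltaK \<alpha>)" by (rule deltaK_map)
next
  fix v assume "v \<in> carrier M" then show "add_map E E (deltaM v)" by (rule deltaM_map)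
next
  fix \<alpha> \<beta> Z assume *: "\<alpha> \<in> carrier K" "\<beta> \<in> carrier K" "Z \<in> carrier E"
  show "deltaK (\<alpha> \<oplus>\<^bsub>K\<^esub> \<beta>) Z = deltaK \<alpha> Z \<oplus>\<^bsub>E\<^esub> deltaK \<beta> Z"
    by (rule E_eqI[OF _ _ *(3)])
      (use * in \<open>auto intro!: deltaK_map add_map_sum SS.E_abelian_group simp: deltaK_tens sc_add S.l_distr SS.tens_add_left\<close>)
next
  fix \<alpha> \<beta> p q Z assume *: "\<alpha> \<in> grade K p" "\<beta> \<in> grade K q" "Z \<in> carrier E"
  then have ab: "\<alpha> \<in> carrier K" "\<beta> \<in> carrier K" using K.grade_closed by auto
  show "deltaK (\<alpha> \<otimes>\<^bsub>K\<^esub> \<beta>) Z = deltaK \<alpha> (deltaK \<beta> Z)"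
    by (rule E_eqI[OF _ _ *(3)])
      (use ab in \<open>auto intro!: deltaK_map add_map_comp[OF deltaK_map deltaK_map] simp: deltaK_tens sc_mult S.m_assoc\<close>)
next
  fix Z assume *: "Z \<in> carrier E"
  show "deltaK \<one>\<^bsub>K\<^esub> Z = Z"
    by (rule E_eqI[OF _ _ *]) (auto intro!: deltaK_map add_mapI simp: deltaK_tens)
next
  fix u v Z assume *: "u \<in> carrier M" "v \<in> carrier M" "Z \<in> carrier E"
  then show "deltaM (u \<oplus> v) Z = deltaM u Z \<oplus>\<^bsub>E\<^esub> deltaM v Z"
    by (simp add: deltaM_def hcomp_add sym_of_add L2_add[OF sym_of_grade sym_of_grade] hcomp_grade
        L2_closed[OF sym_of_grade] SS.E.a_ac)
next
  fix v \<alpha> q p Z assume *: "v \<in> grade M q" "\<alpha> \<in> grade K p" "Z \<in> carrier E"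
  then have [simp]: "v \<in> carrier M" "\<alpha> \<in> carrier K" using K.grade_closed grade_closed by auto
  have va: "rsmult M v \<alpha> \<in> grade M (q + p)" using * by (intro rsmult_grade)
  have v: "sym_of K M v \<in> grade S q" and vS: "sym_of K M (rsmult M v \<alpha>) \<in> grade S (q + p)" using * va by blast+
  have "L2 (q + p) (sym_of K M (rsmult M v \<alpha>)) Z = L2 q (sym_of K M v) (deltaK \<alpha> Z)"
  proof (rule E_eqI[OF _ _ *(3)])
    show "add_map E E (L2 (q + p) (sym_of K M (rsmult M v \<alpha>)))" using vS by (rule L2_map)
    show "add_map E E (\<lambda>Z. L2 q (sym_of K M v) (deltaK \<alpha> Z))"
      using * by (intro add_map_comp[OF deltaK_map L2_map] v) simp
    fix r s x y assume [simp]: "x \<in> carrier S" "y \<in> carrier S"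
    \<comment> \<open>The twist by v gives \<alpha> a sign, which is undone when \<alpha> has moved
      to the right factor and passes v there.\<close>
    have "tt (tw S q (sc \<alpha> \<otimes>\<^bsub>S\<^esub> x)) (sym_of K M v \<otimes>\<^bsub>S\<^esub> y)
        = ksgn E (q * p) (tt (tw S (q + p) x \<otimes>\<^bsub>S\<^esub> sc \<alpha>) (sym_of K M v \<otimes>\<^bsub>S\<^esub> y))"
      using *(2) by (simp add: tw_S_mult S.tw_of_grade[OF sc_grade] ksgn_S_mult SS.tens_ksgn S_supercomm_sc[OF *(2)] add.commute)
    also have "\<dots> = ksgn E (q * p) (tt (tw S (q + p) x) (sc \<alpha> \<otimes>\<^bsub>S\<^esub> sym_of K M v \<otimes>\<^bsub>S\<^esub> y))"
      by (simp add: tt_sc[OF *(2)] S.m_assoc)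
    also have "\<dots> = tt (tw S (q + p) x) (sym_of K M v \<otimes>\<^bsub>S\<^esub> sc \<alpha> \<otimes>\<^bsub>S\<^esub> y)"
      using sc_commute_sym[OF *(2,1)] by (simp add: ksgn_S_mult SS.tens_ksgn mult.commute)
    finally show "L2 (q + p) (sym_of K M (rsmult M v \<alpha>)) (tt x y) = L2 q (sym_of K M v) (deltaK \<alpha> (tt x y))"
      unfolding L2_tens[OF vS \<open>x \<in> carrier S\<close> \<open>y \<in> carrier S\<close>]
      by (simp add: L2_tens[OF v] deltaK_tens sym_of_rsmult S.m_assoc)
  qed
  then show "deltaM (rsmult M v \<alpha>) Z = deltaM v (deltaK \<alpha> Z)"
    using deltaM_grade[OF va] deltaM_grade[OF *(1)] * add_map_closed[OF deltaK_map] by simp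
next
  fix \<alpha> p v q Z assume *: "\<alpha> \<in> grade K p" "v \<in> grade M q" "Z \<in> carrier E"
  then have [simp]: "v \<in> carrier M" "\<alpha> \<in> carrier K" using K.grade_closed grade_closed by auto
  have av: "ksgn M (p * q) (rsmult M v \<alpha>) \<in> grade M (p + q)"
    using rsmult_grade[OF *(2,1)] by (auto simp: add.commute)
  have v: "sym_of K M v \<in> grade S q" and avS: "sym_of K M (ksgn M (p * q) (rsmult M v \<alpha>)) \<in> grade S (p + q)"
    using * av by blast+
  have s: "sym_of K M (ksgn M (p * q) (rsmult M v \<alpha>)) = sc \<alpha> \<otimes>\<^bsub>S\<^esub> sym_of K M v"
    using sc_sym_of[OF *(1,2)] by simp
  have "deltaK \<alpha> (L2 q (sym_of K M v) Z) = L2 (p + q) (sym_of K M (ksgn M (p * q) (rsmult M v \<alpha>))) Z"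
  proof (rule E_eqI[OF _ _ *(3)])
    show "add_map E E (\<lambda>Z. deltaK \<alpha> (L2 q (sym_of K M v) Z))"
      by (intro add_map_comp[OF L2_map deltaK_map] v) simp
    show "add_map E E (L2 (p + q) (sym_of K M (ksgn M (p * q) (rsmult M v \<alpha>))))" using avS by (rule L2_map)
    fix r s x y assume [simp]: "x \<in> carrier S" "y \<in> carrier S"
    have "tt (sc \<alpha> \<otimes>\<^bsub>S\<^esub> tw S q x) (sym_of K M v \<otimes>\<^bsub>S\<^esub> y) = tt (tw S (p + q) x) (sc \<alpha> \<otimes>\<^bsub>S\<^esub> (sym_of K M v \<otimes>\<^bsub>S\<^esub> y))"
      by (simp add: S_supercomm_sc[OF *(1)] tt_sc[OF *(1)])
    then show "deltaK \<alpha> (L2 q (sym_of K M v) (tt x y)) = L2 (p + q) (sym_of K M (ksgn M (p * q) (rsmult M v \<alpha>))) (tt x y)"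
      unfolding L2_tens[OF avS \<open>x \<in> carrier S\<close> \<open>y \<in> carrier S\<close>]
      by (simp add: L2_tens[OF v] add_map_add[OF deltaK_map] deltaK_tens s S.m_assoc)
  qed
  then show "deltaK \<alpha> (deltaM v Z) = deltaM (ksgn M (p * q) (rsmult M v \<alpha>)) Z"
    using deltaM_grade[OF av] deltaM_grade[OF *(2)] * by simp
next
  fix u p v q Z assume *: "u \<in> grade M p" "v \<in> grade M q" "Z \<in> carrier E"
  then have [simp]: "u \<in> carrier M" "v \<in> carrier M" using grade_closed by auto
  have uv: "sym_of K M u \<in> grade S p" "sym_of K M v \<in> grade S q" using * by blast+
  have "L2 p (sym_of K M u) (L2 q (sym_of K M v) Z) = ksgn E (p * q) (L2 q (sym_of K M v) (L2 p (sym_of K M u) Z))"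
  proof (rule E_eqI[OF _ _ *(3)])
    show "add_map E E (\<lambda>Z. L2 p (sym_of K M u) (L2 q (sym_of K M v) Z))"
      "add_map E E (\<lambda>Z. ksgn E (p * q) (L2 q (sym_of K M v) (L2 p (sym_of K M u) Z)))"
      by (rule add_map_comp[OF L2_map[OF uv(2)] L2_map[OF uv(1)]])
        (rule add_map_ksgn[OF SS.E_abelian_group add_map_comp[OF L2_map[OF uv(1)] L2_map[OF uv(2)]]])
    fix r s x y assume [simp]: "x \<in> carrier S" "y \<in> carrier S"
    show "L2 p (sym_of K M u) (L2 q (sym_of K M v) (tt x y)) = ksgn E (p * q) (L2 q (sym_of K M v) (L2 p (sym_of K M u) (tt x y)))"
      using sym_of_comm[OF *(1,2)]
      by (simp add: L2_tens[OF uv(1)] L2_tens[OF uv(2)] add_map_add[OF L2_map[OF uv(1)]] add_map_add[OF L2_map[OF uv(2)]]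
          tw_S_mult S.tw_of_grade[OF uv(1)] S.tw_of_grade[OF uv(2)] ksgn_S_mult SS.tens_ksgn SS.E.ksgn_add
          add.commute mult.commute S.m_assoc[symmetric] SS.E.a_ac)
  qed
  then show "deltaM u (deltaM v Z) = ksgn E (p * q) (deltaM v (deltaM u Z))"
    using deltaM_grade[OF *(1)] deltaM_grade[OF *(2)] * uv by simp
next
  fix u Z assume *: "u \<in> grade M 1" "Z \<in> carrier E"
  then have [simp]: "u \<in> carrier M" using grade_closed by auto
  have u: "sym_of K M u \<in> grade S 1" using * by blast
  have "L2 1 (sym_of K M u) (L2 1 (sym_of K M u) Z) = \<zero>\<^bsub>E\<^esub>"
  proof (rule E_eqI[OF _ _ *(2)])
    show "add_map E E (\<lambda>Z. L2 1 (sym_of K M u) (L2 1 (sym_of K M u) Z))"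
      using u by (intro add_map_comp[OF L2_map L2_map])
    show "add_map E E (\<lambda>Z. \<zero>\<^bsub>E\<^esub>)" by (rule add_map_zero[OF SS.E_abelian_group])
    fix r s x y assume [simp]: "x \<in> carrier S" "y \<in> carrier S"
    \<comment> \<open>The two mixed terms cancel because u is odd, and the other two contain the
      square of u, which is zero by a separate relation even if 2 is not invertible.\<close>
    show "L2 1 (sym_of K M u) (L2 1 (sym_of K M u) (tt x y)) = \<zero>\<^bsub>E\<^esub>"
      using sym_of_odd_square[OF *(1)]
      by (simp add: L2_tens[OF u] add_map_add[OF L2_map[OF u]] tw_S_mult S.tw_of_grade[OF u] ksgn_S_mult
          SS.tens_ksgn S.m_assoc[symmetric] SS.tens_zero SS.E.ksgn_l_neg)
  qed
  then show "deltaM u (deltaM u Z) = \<zero>\<^bsub>E\<^esub>"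
    using deltaM_grade[OF *(1)] * u by simp
qed

sublocale delta: sym_action K M E deltaK deltaM by (rule delta_action)

text \<open>The orbit map of \<open>1 \<otimes> 1\<close>: compatibility with addition, scalars and
  letters holds by construction.\<close>

definition Delta where "Delta x = delta.act x (tt \<one>\<^bsub>S\<^esub> \<one>\<^bsub>S\<^esub>)"

lemma Delta_closed [simp]: "x \<in> carrier S \<Longrightarrow> Delta x \<in> carrier E"
  unfolding Delta_def by (intro delta.act_closed) auto

lemma Delta_map: "add_map S E Delta"
  by (rule add_mapI) (simp_all add: Delta_def delta.act_add SS.tens_closed)

lemma Delta_one: "Delta \<one>\<^bsub>S\<^esub> = tt \<one>\<^bsub>S\<^esub> \<one>\<^bsub>S\<^esub>"
  unfolding Delta_def by (intro delta.act_one) auto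

lemma Delta_sc: "\<lbrakk>\<alpha> \<in> carrier K; x \<in> carrier S\<rbrakk> \<Longrightarrow> Delta (sc \<alpha> \<otimes>\<^bsub>S\<^esub> x) = deltaK \<alpha> (Delta x)"
  using Delta_closed by (simp add: Delta_def delta.act_mult delta.act_sc SS.tens_closed)

lemma Delta_sym: "\<lbrakk>v \<in> grade M p; x \<in> carrier S\<rbrakk>
    \<Longrightarrow> Delta (sym_of K M v \<otimes>\<^bsub>S\<^esub> x) = L2 p (sym_of K M v) (Delta x)"
  using Delta_closed grade_closed by (simp add: Delta_def delta.act_mult delta.act_sym_of deltaM_grade SS.tens_closed)

lemma deltaK_rsmult:
  "\<lbrakk>\<beta> \<in> carrier K; \<alpha> \<in> carrier K; Z \<in> carrier E\<rbrakk> \<Longrightarrow> deltaK \<beta> (rsmult E Z \<alpha>) = rsmult E (deltaK \<beta> Z) \<alpha>"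
  unfolding deltaK_def by (intro tf_rsmult lin_Lm S.par_map_id) auto

text \<open>S acts by left multiplications, which commute with the right action. This yields right
  linearity of the coproduct.\<close>

lemma act_rsmult:
  assumes a: "\<alpha> \<in> carrier K" and x: "x \<in> carrier S" and Z: "Z \<in> carrier E"
  shows "delta.act x (rsmult E Z \<alpha>) = rsmult E (delta.act x Z) \<alpha>"
proof -
  note r = add_map_closed[OF SS.rsmult_E_map[OF a]] add_map_add[OF SS.rsmult_E_map[OF a]]
  show ?thesis
    using x
  proof (induction rule: S_induct)
    case one
    then show ?case using Z r by (simp add: delta.act_one)
  next
    case (sc \<beta> p X)
    then show ?case using Z r a K.grade_closed
      by (simp add: delta.act_mult delta.act_sc deltaK_rsmult)
  next
    case (sym v p X)
    have v: "sym_of K M v \<in> grade S p" "sym_of K M v \<in> carrier S" using sym grade_closed by auto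
    show ?case
      using sym Z r a grade_closed v tf_closed[OF lin_Lm[OF v(2)] S.par_map_id] tf_closed[OF S.lin_map_id par_Lm[OF v(1)]]
      by (simp add: delta.act_mult delta.act_sym_of deltaM_grade L2_def tf_rsmult lin_Lm par_Lm S.par_map_id S.lin_map_id)
  next
    case (add X Y)
    then show ?case using Z r by (simp add: delta.act_add)
  qed
qed

lemma Delta_rsmult:
  assumes "\<alpha> \<in> carrier K" "x \<in> carrier S"
  shows "Delta (x \<otimes>\<^bsub>S\<^esub> sc \<alpha>) = rsmult E (Delta x) \<alpha>"
proof -
  have "Delta (x \<otimes>\<^bsub>S\<^esub> sc \<alpha>) = delta.act x (tt (sc \<alpha>) \<one>\<^bsub>S\<^esub>)"
    using assms by (simp add: Delta_def delta.act_mult delta.act_sc deltaK_tens SS.tens_closed)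
  also have "tt (sc \<alpha>) \<one>\<^bsub>S\<^esub> = rsmult E (tt \<one>\<^bsub>S\<^esub> \<one>\<^bsub>S\<^esub>) \<alpha>"
  proof -
    have "tt (sc \<alpha>) \<one>\<^bsub>S\<^esub> = tt \<one>\<^bsub>S\<^esub> (sc \<alpha>)"
    proof (rule K.add_map_eq_grade[OF _ _ _ assms(1)])
      show "add_map K E (\<lambda>\<alpha>. tt (sc \<alpha>) \<one>\<^bsub>S\<^esub>)" "add_map K E (\<lambda>\<alpha>. tt \<one>\<^bsub>S\<^esub> (sc \<alpha>))"
        by (auto intro!: add_mapI simp: sc_add SS.tens_add_left SS.tens_add_right)
      fix d \<alpha> assume "\<alpha> \<in> grade K d"
      then show "tt (sc \<alpha>) \<one>\<^bsub>S\<^esub> = tt \<one>\<^bsub>S\<^esub> (sc \<alpha>)" using tt_sc[of \<alpha> d "\<one>\<^bsub>S\<^esub>" "\<one>\<^bsub>S\<^esub>"] K.grade_closed by simp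
    qed
    then show ?thesis using assms by (simp add: SS.rsmult_tens S_rsmult)
  qed
  finally show ?thesis using assms by (simp add: act_rsmult Delta_def SS.tens_closed)
qed

lemma Delta_grade: "x \<in> grade S d \<Longrightarrow> Delta x \<in> grade E d"
proof (induction rule: S_grade_induct)
  case one
  have "tt \<one>\<^bsub>S\<^esub> \<one>\<^bsub>S\<^esub> \<in> grade E (0 + 0)" by (intro SS.tens_grade) auto
  then show ?case by (simp add: Delta_one)
next
  case (sc \<alpha> p d X)
  have [simp]: "\<alpha> \<in> carrier K" using sc K.grade_closed by auto
  have "deltaK \<alpha> (Delta X) \<in> grade E (p + d)"
  proof (rule SS.grade_E_induct[OF sc(4) deltaK_map SS.E_abelian_group SS.grade_E_subgroup])
    fix r s v w assume "v \<in> grade S r" "w \<in> grade S s" "r + s = d"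
    then show "deltaK \<alpha> (tt v w) \<in> grade E (p + d)"
      using SS.tens_grade[of "sc \<alpha> \<otimes>\<^bsub>S\<^esub> v" "p + r" w s] S_grade_sc[OF sc(1)] S.grade_closed
      by (auto simp: deltaK_tens add.assoc)
  qed simp
  then show ?case using sc by (simp add: Delta_sc)
next
  case (sym v p d X)
  have v: "sym_of K M v \<in> grade S p" using sym by auto
  have "L2 p (sym_of K M v) (Delta X) \<in> grade E (p + d)"
  proof (rule SS.grade_E_induct[OF sym(4) L2_map[OF v] SS.E_abelian_group SS.grade_E_subgroup])
    fix r s x y assume *: "x \<in> grade S r" "y \<in> grade S s" "r + s = d"
    then have "tt (sym_of K M v \<otimes>\<^bsub>S\<^esub> x) y \<in> grade E (p + d)" "tt (tw S p x) (sym_of K M v \<otimes>\<^bsub>S\<^esub> y) \<in> grade E (p + d)"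
      using SS.tens_grade[OF S_grade_mult[OF v *(1)] *(2)] SS.tens_grade[OF S.tw_grade[OF *(1)] S_grade_mult[OF v *(2)]]
      by (auto simp: ac_simps)
    then show "L2 p (sym_of K M v) (tt x y) \<in> grade E (p + d)"
      using subgroup.m_closed[OF SS.grade_E_subgroup] * S.grade_closed by (simp add: L2_tens[OF v])
  qed
  then show ?case using sym by (simp add: Delta_sym)
next
  case (add d X Y)
  then show ?case using subgroup.m_closed[OF SS.grade_E_subgroup[of d]] by (simp add: add_map_add[OF Delta_map])
qed

end

lemma (in abelian_group) finsum_bits2:
  assumes "\<And>i j. h (i :: bit, j :: bit) \<in> carrier G"
  shows "finsum G h ({0, 1} \<times> {0, 1}) = (h (0, 0) \<oplus> h (0, 1)) \<oplus> (h (1, 0) \<oplus> h (1, 1))"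
proof -
  have e: "{0, 1 :: bit} \<times> {0, 1 :: bit} = {(0, 0), (0, 1), (1, 0), (1, 1)}" by auto
  show ?thesis unfolding e using assms by (simp add: Pi_def a_assoc)
qed

text \<open>The additive map f, with which h agrees on pure tensors, already forces h to be
  balanced. Lifts given by explicit sums over parities are identified in this way.\<close>

lemma (in tensor_pair) lift_eqI:
  assumes X: "abelian_group X" and f: "add_map E X f" and Z: "Z \<in> carrier E"
    and h: "\<And>v w. \<lbrakk>v \<in> carrier M; w \<in> carrier N\<rbrakk> \<Longrightarrow> h v w = f (tens K M N v w)"
  shows "tensor_lift (add_monoid X) h Z = f Z"
proof -
  have "balanced X h"
  proof (rule balancedI)
    fix p q r v w \<alpha> assume "v \<in> grade M r" "\<alpha> \<in> grade K p" "w \<in> grade N q" "v \<in> carrier M" "w \<in> carrier N" "\<alpha> \<in> carrier K"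
    then show "h (rsmult M v \<alpha>) w = h v (ksgn N (p * q) (rsmult N w \<alpha>))"
      using tens_balanced[of v \<alpha> p w q] by (simp add: h M.rsmult_closed N.rsmult_closed)
  qed (simp_all add: h tens_closed tens_add_left tens_add_right add_map_add[OF f] add_map_closed[OF f] del: E_fields)
  then show ?thesis
    using lift_map[OF X] lift_tens[OF X] h by (intro tensor_eqI[OF _ f Z]) auto
qed

section \<open>The product on the tensor square and uniqueness of the coproduct\<close>

context sym_base
begin

lemma tf_cong:
  assumes "lin_map K S S f" "par_map K S S p g" "lin_map K S S f'" "par_map K S S p g'" "Z \<in> carrier E"
    and "\<And>x. x \<in> carrier S \<Longrightarrow> f x = f' x" "\<And>x. x \<in> carrier S \<Longrightarrow> g x = g' x"
  shows "tf p f g Z = tf p f' g' Z"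
  by (rule E_eqI[OF tf_map tf_map assms(5)]) (simp_all add: assms tf_tens)

lemma hom_comp_par:
  assumes g0: "par_map K S S 0 g0" and g1: "par_map K S S 1 g1"
    and g: "\<And>x. x \<in> carrier S \<Longrightarrow> g x = g0 x \<oplus>\<^bsub>S\<^esub> g1 x" and w: "w \<in> carrier S"
  shows "hom_comp S S g i w = (if i = 0 then g0 w else g1 w)"
proof -
  have c: "hcomp S (i + j) (g (hcomp S j w)) = (if i = 0 then g0 (hcomp S j w) else g1 (hcomp S j w))" for j
  proof -
    have "hcomp S j w \<in> grade S j" "hcomp S j w \<in> carrier S" using w by auto
    then show ?thesis
      using par_mapD(2)[OF g0, of "hcomp S j w" j] par_mapD(2)[OF g1, of "hcomp S j w" j]
        par_mapD(4)[OF g0] par_mapD(4)[OF g1]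
      by (cases i; cases j) (simp_all add: g S.hcomp_add S.hcomp_of_grade)
  qed
  have "hom_comp S S g i w = (if i = 0 then g0 (hcomp S 0 w) \<oplus>\<^bsub>S\<^esub> g0 (hcomp S 1 w) else g1 (hcomp S 0 w) \<oplus>\<^bsub>S\<^esub> g1 (hcomp S 1 w))"
  proof -
    have "hom_comp S S g i w = (\<Oplus>\<^bsub>S\<^esub>j\<in>{0, 1}. hcomp S (i + j) (g (hcomp S j w)))"
      using w by (simp add: hom_comp_def)
    then show ?thesis
      unfolding c using w par_mapD(4)[OF g0] par_mapD(4)[OF g1] by (simp add: S.finsum_bits)
  qed
  also have "\<dots> = (if i = 0 then g0 w else g1 w)"
    using w par_mapD(5)[OF g0, of "hcomp S 0 w" "hcomp S 1 w"] par_mapD(5)[OF g1, of "hcomp S 0 w" "hcomp S 1 w"]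
    by (simp add: S.hcomp_sum)
  finally show ?thesis .
qed

text \<open>The defining sum runs over parities of the map and of the left argument. Collecting the
  latter leaves one twisted term for each parity of g.\<close>

lemma tensor_map_tf:
  assumes f: "lin_map K S S f" and g0: "par_map K S S 0 g0" and g1: "par_map K S S 1 g1"
    and g: "\<And>x. x \<in> carrier S \<Longrightarrow> g x = g0 x \<oplus>\<^bsub>S\<^esub> g1 x" and Z: "Z \<in> carrier E"
  shows "tensor_map K S S S S f g Z = tf 0 f g0 Z \<oplus>\<^bsub>E\<^esub> tf 1 f g1 Z"
proof -
  interpret f: add_hom S S f by (intro add_hom_intro S.abelian_group_axioms lin_mapD(1)[OF f])
  have "finsum E (\<lambda>(i, j). tt (ksgn S (i * j) (f (hcomp S j v))) (hom_comp S S g i w)) ({0, 1} \<times> {0, 1})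
      = tt (f v) (g0 w) \<oplus>\<^bsub>E\<^esub> tt (f (tw S 1 v)) (g1 w)" if v: "v \<in> carrier S" and w: "w \<in> carrier S" for v w
  proof -
    have "f v = f (hcomp S 0 v) \<oplus>\<^bsub>S\<^esub> f (hcomp S 1 v)" using v by (simp add: S.hcomp_sum flip: f.add)
    then show ?thesis
      using v w par_mapD(4)[OF g0] par_mapD(4)[OF g1]
      by (subst SS.E.finsum_bits2) (auto simp: hom_comp_par[OF g0 g1 g] tw_def SS.tens_add_left)
  qed
  moreover have "tt (f v) (g0 w) \<oplus>\<^bsub>E\<^esub> tt (f (tw S 1 v)) (g1 w) = tf 0 f g0 (tt v w) \<oplus>\<^bsub>E\<^esub> tf 1 f g1 (tt v w)"
    if v: "v \<in> carrier S" and w: "w \<in> carrier S" for v w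
    using v w f g0 g1 by (simp add: tf_tens)
  ultimately have "tensor_lift (add_monoid E) (\<lambda>v w. finsum E (\<lambda>(i, j). tt (ksgn S (i * j) (f (hcomp S j v))) (hom_comp S S g i w))
      ({0, 1} \<times> {0, 1})) Z = tf 0 f g0 Z \<oplus>\<^bsub>E\<^esub> tf 1 f g1 Z"
    using f g0 g1 by (intro SS.lift_eqI[OF SS.E_abelian_group _ Z] add_map_sum SS.E_abelian_group tf_map) auto
  then show ?thesis
    using Z by (simp add: tensor_map_def SS.tensor_lift_E SS.tensor_group_finprod)
qed

text \<open>Left multiplication by \<open>a \<otimes> b\<close>; only b has to be split, as its
  parity alone enters the sign.\<close>

definition mulE where "mulE a b Z = tf 0 (Lm a) (Lm (hcomp S 0 b)) Z \<oplus>\<^bsub>E\<^esub> tf 1 (Lm a) (Lm (hcomp S 1 b)) Z"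

lemma mulE_map: "\<lbrakk>a \<in> carrier S; b \<in> carrier S\<rbrakk> \<Longrightarrow> add_map E E (mulE a b)"
  unfolding mulE_def by (intro add_map_sum SS.E_abelian_group tf_map lin_Lm par_Lm S.hcomp_grade)

lemma mulE_tens:
  assumes "a \<in> carrier S" "b \<in> carrier S" "x \<in> carrier S" "y \<in> carrier S"
  shows "mulE a b (tt x y) = tt (a \<otimes>\<^bsub>S\<^esub> x) (hcomp S 0 b \<otimes>\<^bsub>S\<^esub> y) \<oplus>\<^bsub>E\<^esub> tt (a \<otimes>\<^bsub>S\<^esub> tw S 1 x) (hcomp S 1 b \<otimes>\<^bsub>S\<^esub> y)"
  using assms by (simp add: mulE_def tf_tens lin_Lm par_Lm S.hcomp_grade)

lemma mulE_tens_grade: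
  assumes "a \<in> carrier S" "b \<in> grade S q" "x \<in> carrier S" "y \<in> carrier S"
  shows "mulE a b (tt x y) = tt (a \<otimes>\<^bsub>S\<^esub> tw S q x) (b \<otimes>\<^bsub>S\<^esub> y)"
  using assms S.grade_closed
  by (cases q) (simp_all add: mulE_tens S.hcomp_of_grade SS.tens_zero SS.tens_closed)

lemma mulE_grade:
  assumes "a \<in> carrier S" "b \<in> grade S q" "Z \<in> carrier E"
  shows "mulE a b Z = tf q (Lm a) (Lm b) Z"
  using assms S.grade_closed
  by (intro E_eqI[OF mulE_map tf_map assms(3)])
    (auto simp: mulE_tens_grade tf_tens lin_Lm par_Lm)

lemma mulE_balanced:
  assumes Z: "Z \<in> carrier E" shows "SS.balanced E (\<lambda>a b. mulE a b Z)"
proof (rule SS.balancedI)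
  fix a b assume "a \<in> carrier S" "b \<in> carrier S"
  then show "mulE a b Z \<in> carrier E" by (rule add_map_closed[OF mulE_map _]) (rule Z)
next
  fix a a' b assume *: "a \<in> carrier S" "a' \<in> carrier S" "b \<in> carrier S"
  show "mulE (a \<oplus>\<^bsub>S\<^esub> a') b Z = mulE a b Z \<oplus>\<^bsub>E\<^esub> mulE a' b Z"
    by (rule E_eqI[OF _ _ Z])
      (use * in \<open>auto intro!: mulE_map add_map_sum SS.E_abelian_group
        simp: mulE_tens S.l_distr SS.tens_add_left SS.tens_closed SS.E.a_ac\<close>)
next
  fix a b b' assume *: "a \<in> carrier S" "b \<in> carrier S" "b' \<in> carrier S"
  show "mulE a (b \<oplus>\<^bsub>S\<^esub> b') Z = mulE a b Z \<oplus>\<^bsub>E\<^esub> mulE a b' Z"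
    by (rule E_eqI[OF _ _ Z])
      (use * in \<open>auto intro!: mulE_map add_map_sum SS.E_abelian_group
        simp: mulE_tens S.l_distr SS.tens_add_right SS.tens_closed SS.E.a_ac S.hcomp_add\<close>)
next
  fix p q r a b \<alpha> assume *: "a \<in> grade S r" "\<alpha> \<in> grade K p" "b \<in> grade S q" "a \<in> carrier S" "b \<in> carrier S" "\<alpha> \<in> carrier K"
  have ab: "ksgn S (p * q) (rsmult S b \<alpha>) = sc \<alpha> \<otimes>\<^bsub>S\<^esub> b"
    using * by (simp add: S_supercomm_sc[OF *(2)] S.tw_of_grade[OF *(3)] ksgn_S_mult S_rsmult)
  have g: "sc \<alpha> \<otimes>\<^bsub>S\<^esub> b \<in> grade S (p + q)" using * by (intro S_grade_mult sc_grade)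
  have "mulE (rsmult S a \<alpha>) b Z = mulE a (sc \<alpha> \<otimes>\<^bsub>S\<^esub> b) Z"
  proof (rule E_eqI[OF mulE_map mulE_map Z])
    fix s t x y assume [simp]: "x \<in> carrier S" "y \<in> carrier S"
    have "mulE (rsmult S a \<alpha>) b (tt x y) = tt (a \<otimes>\<^bsub>S\<^esub> (sc \<alpha> \<otimes>\<^bsub>S\<^esub> tw S q x)) (b \<otimes>\<^bsub>S\<^esub> y)"
      using * by (simp add: mulE_tens_grade[OF _ *(3)] S_rsmult S.m_assoc)
    also have "\<dots> = tt (a \<otimes>\<^bsub>S\<^esub> tw S (p + q) x \<otimes>\<^bsub>S\<^esub> sc \<alpha>) (b \<otimes>\<^bsub>S\<^esub> y)"
      using * by (simp add: S_supercomm_sc[OF *(2)] S.m_assoc)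
    also have "\<dots> = tt (a \<otimes>\<^bsub>S\<^esub> tw S (p + q) x) (sc \<alpha> \<otimes>\<^bsub>S\<^esub> (b \<otimes>\<^bsub>S\<^esub> y))"
      using * by (intro tt_sc) auto
    also have "\<dots> = mulE a (sc \<alpha> \<otimes>\<^bsub>S\<^esub> b) (tt x y)"
      using * by (simp add: mulE_tens_grade[OF _ g] S.m_assoc)
    finally show "mulE (rsmult S a \<alpha>) b (tt x y) = mulE a (sc \<alpha> \<otimes>\<^bsub>S\<^esub> b) (tt x y)" .
  qed (use * in \<open>auto intro: S.rsmult_closed\<close>)
  then show "mulE (rsmult S a \<alpha>) b Z = mulE a (ksgn S (p * q) (rsmult S b \<alpha>)) Z" by (simp add: ab)
qed

text \<open>The product is defined by a lift inside a lift. The inner one is additive in Z and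
  equals \<open>mulE\<close>; then \<open>mulE_balanced\<close> makes the outer one well
  defined.\<close>

lemma E_mult:
  assumes Y: "Y \<in> carrier E" and Z: "Z \<in> carrier E"
  shows "Y \<otimes>\<^bsub>E\<^esub> Z = tensor_lift (add_monoid E) (\<lambda>a b. mulE a b Z) Y"
proof -
  have g: "finsum E (\<lambda>(i, j). tt (ksgn S (i * j) (a \<otimes>\<^bsub>S\<^esub> hcomp S j c)) (hcomp S i b \<otimes>\<^bsub>S\<^esub> d)) ({0, 1} \<times> {0, 1})
      = mulE a b (tt c d)" if "a \<in> carrier S" "b \<in> carrier S" "c \<in> carrier S" "d \<in> carrier S" for a b c d
  proof -
    have "a \<otimes>\<^bsub>S\<^esub> c = a \<otimes>\<^bsub>S\<^esub> hcomp S 0 c \<oplus>\<^bsub>S\<^esub> a \<otimes>\<^bsub>S\<^esub> hcomp S 1 c"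
      using that by (simp add: S.hcomp_sum flip: S.r_distr)
    then show ?thesis
      using that by (subst SS.E.finsum_bits2) (auto simp: mulE_tens tw_def SS.tens_add_left S.r_distr ksgn_S_mult)
  qed
  have inner: "tensor_lift (add_monoid E) (\<lambda>c d. finsum E (\<lambda>(i, j). tt (ksgn S (i * j) (a \<otimes>\<^bsub>S\<^esub> hcomp S j c)) (hcomp S i b \<otimes>\<^bsub>S\<^esub> d))
      ({0, 1} \<times> {0, 1})) Z = mulE a b Z" if "a \<in> carrier S" "b \<in> carrier S" for a b
    by (rule SS.lift_eqI[OF SS.E_abelian_group mulE_map Z]) (use that g in auto)
  have "Y \<otimes>\<^bsub>E\<^esub> Z = tensor_lift (add_monoid E) (\<lambda>a b. tensor_lift (add_monoid E) (\<lambda>c d.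
      finsum E (\<lambda>(i, j). tt (ksgn S (i * j) (a \<otimes>\<^bsub>S\<^esub> hcomp S j c)) (hcomp S i b \<otimes>\<^bsub>S\<^esub> d)) ({0, 1} \<times> {0, 1})) Z) Y"
    by (subst tensor_def) (simp add: SS.tensor_lift_E SS.tensor_group_finprod)
  also have "\<dots> = tensor_lift (add_monoid E) (\<lambda>a b. mulE a b Z) Y"
    by (rule SS.lift_eqI[OF SS.E_abelian_group SS.lift_map[OF SS.E_abelian_group mulE_balanced[OF Z]] Y])
      (simp only: inner SS.lift_tens[OF SS.E_abelian_group mulE_balanced[OF Z]])
  finally show ?thesis .
qed

lemma E_mult_map: "Z \<in> carrier E \<Longrightarrow> add_map E E (\<lambda>Y. Y \<otimes>\<^bsub>E\<^esub> Z)"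
  by (rule add_map_cong[OF SS.lift_map[OF SS.E_abelian_group mulE_balanced] SS.E_abelian_group]) (simp_all add: E_mult)

lemma E_mult_tens:
  "\<lbrakk>a \<in> carrier S; b \<in> grade S q; Z \<in> carrier E\<rbrakk> \<Longrightarrow> tt a b \<otimes>\<^bsub>E\<^esub> Z = tf q (Lm a) (Lm b) Z"
  using S.grade_closed
  by (simp add: E_mult SS.tens_closed SS.lift_tens[OF SS.E_abelian_group mulE_balanced] mulE_grade)

lemma deltaK_mult:
  assumes "\<alpha> \<in> carrier K" "Y \<in> carrier E" "Z \<in> carrier E"
  shows "deltaK \<alpha> Y \<otimes>\<^bsub>E\<^esub> Z = deltaK \<alpha> (Y \<otimes>\<^bsub>E\<^esub> Z)"
proof (rule E_eqI[OF _ _ assms(2)])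
  show "add_map E E (\<lambda>Y. deltaK \<alpha> Y \<otimes>\<^bsub>E\<^esub> Z)" by (rule add_map_comp[OF deltaK_map E_mult_map]) (use assms in auto)
  show "add_map E E (\<lambda>Y. deltaK \<alpha> (Y \<otimes>\<^bsub>E\<^esub> Z))" by (rule add_map_comp[OF E_mult_map deltaK_map]) (use assms in auto)
  fix p q a b assume *: "a \<in> grade S p" "b \<in> grade S q" "a \<in> carrier S" "b \<in> carrier S"
  have l: "lin_map K S S (Lm a)" "lin_map K S S (Lm (sc \<alpha> \<otimes>\<^bsub>S\<^esub> a))" "par_map K S S q (Lm b)"
    using * assms by (auto intro!: lin_Lm par_Lm)
  have "tf q (Lm (sc \<alpha> \<otimes>\<^bsub>S\<^esub> a)) (Lm b) Z = deltaK \<alpha> (tf q (Lm a) (Lm b) Z)"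
    by (rule E_eqI[OF tf_map[OF l(2,3)] add_map_comp[OF tf_map[OF l(1,3)] deltaK_map[OF assms(1)]] assms(3)])
      (use * assms in \<open>simp add: tf_tens l deltaK_tens S.m_assoc\<close>)
  then show "deltaK \<alpha> (tt a b) \<otimes>\<^bsub>E\<^esub> Z = deltaK \<alpha> (tt a b \<otimes>\<^bsub>E\<^esub> Z)"
    using * assms by (simp add: deltaK_tens E_mult_tens)
qed

text \<open>An instance of associativity: left multiplication by the coproduct of a letter commutes
  with multiplication on the right. Together with \<open>deltaK_mult\<close> it is what
  multiplicativity of the coproduct amounts to.\<close>

lemma L2_mult:
  assumes u: "u \<in> grade S p" and "Y \<in> carrier E" "Z \<in> carrier E"
  shows "L2 p u Y \<otimes>\<^bsub>E\<^esub> Z = L2 p u (Y \<otimes>\<^bsub>E\<^esub> Z)"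
proof (rule E_eqI[OF _ _ assms(2)])
  show "add_map E E (\<lambda>Y. L2 p u Y \<otimes>\<^bsub>E\<^esub> Z)" by (rule add_map_comp[OF L2_map E_mult_map]) (use assms in auto)
  show "add_map E E (\<lambda>Y. L2 p u (Y \<otimes>\<^bsub>E\<^esub> Z))" by (rule add_map_comp[OF E_mult_map L2_map]) (use assms in auto)
  fix r q a b assume *: "a \<in> grade S r" "b \<in> grade S q" "a \<in> carrier S" "b \<in> carrier S"
  have uS: "u \<in> carrier S" using u by (rule S.grade_closed)
  have ub: "u \<otimes>\<^bsub>S\<^esub> b \<in> grade S (p + q)" using u * by (intro S_grade_mult)
  have l: "lin_map K S S (Lm a)" "lin_map K S S (Lm (u \<otimes>\<^bsub>S\<^esub> a))" "par_map K S S q (Lm b)"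
     "lin_map K S S (Lm (tw S p a))" "par_map K S S (p + q) (Lm (u \<otimes>\<^bsub>S\<^esub> b))"
    using * uS ub by (auto intro!: lin_Lm par_Lm)
  have "tf q (Lm (u \<otimes>\<^bsub>S\<^esub> a)) (Lm b) Z \<oplus>\<^bsub>E\<^esub> tf (p + q) (Lm (tw S p a)) (Lm (u \<otimes>\<^bsub>S\<^esub> b)) Z = L2 p u (tf q (Lm a) (Lm b) Z)"
  proof (rule E_eqI[OF add_map_sum[OF SS.E_abelian_group tf_map[OF l(2,3)] tf_map[OF l(4,5)]]
        add_map_comp[OF tf_map[OF l(1,3)] L2_map[OF u]] assms(3)])
    fix s t x y assume "x \<in> carrier S" "y \<in> carrier S"
    then show "tf q (Lm (u \<otimes>\<^bsub>S\<^esub> a)) (Lm b) (tt x y) \<oplus>\<^bsub>E\<^esub> tf (p + q) (Lm (tw S p a)) (Lm (u \<otimes>\<^bsub>S\<^esub> b)) (tt x y)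
        = L2 p u (tf q (Lm a) (Lm b) (tt x y))"
      using * uS by (simp add: tf_tens[OF l(2,3)] tf_tens[OF l(4,5)] tf_tens[OF l(1,3)] L2_tens[OF u] S.m_assoc tw_S_mult)
  qed
  then show "L2 p u (tt a b) \<otimes>\<^bsub>E\<^esub> Z = L2 p u (tt a b \<otimes>\<^bsub>E\<^esub> Z)"
    using * uS assms
    by (simp add: L2_tens[OF u] E_mult_tens[OF _ *(2)] E_mult_tens[OF _ ub] add_map_add[OF E_mult_map] SS.tens_closed)
qed

lemma E_one: "\<one>\<^bsub>E\<^esub> = tt \<one>\<^bsub>S\<^esub> \<one>\<^bsub>S\<^esub>"
  by (simp add: tensor_def)

lemma E_l_one: "Z \<in> carrier E \<Longrightarrow> tt \<one>\<^bsub>S\<^esub> \<one>\<^bsub>S\<^esub> \<otimes>\<^bsub>E\<^esub> Z = Z"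
proof -
  assume Z: "Z \<in> carrier E"
  have l: "lin_map K S S (Lm \<one>\<^bsub>S\<^esub>)" "par_map K S S 0 (Lm \<one>\<^bsub>S\<^esub>)" by (auto intro!: lin_Lm par_Lm)
  have "tf 0 (Lm \<one>\<^bsub>S\<^esub>) (Lm \<one>\<^bsub>S\<^esub>) Z = Z"
    by (rule E_eqI[OF tf_map[OF l] _ Z]) (simp_all add: tf_tens[OF l] add_mapI)
  then show ?thesis using Z by (simp add: E_mult_tens[OF _ one_S_grade])
qed

lemma Delta_mult:
  assumes "x \<in> carrier S" "y \<in> carrier S"
  shows "Delta (x \<otimes>\<^bsub>S\<^esub> y) = Delta x \<otimes>\<^bsub>E\<^esub> Delta y"
  using assms(1)
proof (induction rule: S_induct)
  case one
  then show ?case using assms by (simp add: Delta_one E_l_one)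
next
  case (sc \<alpha> p X)
  then show ?case using assms K.grade_closed by (simp add: Delta_sc deltaK_mult S.m_assoc)
next
  case (sym v p X)
  then show ?case
    using assms grade_closed sym_of_grade by (simp add: Delta_sym L2_mult S.m_assoc)
next
  case (add X Y)
  then show ?case
    using assms by (simp add: S.l_distr add_map_add[OF Delta_map] add_map_add[OF E_mult_map])
qed

lemma L2_eq_mult:
  assumes v: "u \<in> grade S p" and Z: "Z \<in> carrier E"
  shows "L2 p u Z = (tt u \<one>\<^bsub>S\<^esub> \<oplus>\<^bsub>E\<^esub> tt \<one>\<^bsub>S\<^esub> u) \<otimes>\<^bsub>E\<^esub> Z"
proof -
  have u: "u \<in> carrier S" using v by (rule S.grade_closed)
  have 1: "tf p (Lm \<one>\<^bsub>S\<^esub>) (Lm u) Z = tf p idS (Lm u) Z" "tf 0 (Lm u) (Lm \<one>\<^bsub>S\<^esub>) Z = tf 0 (Lm u) idS Z"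
    by (rule tf_cong; use u v Z in \<open>auto intro!: lin_Lm par_Lm S.lin_map_id S.par_map_id\<close>)+
  show ?thesis
    using u Z by (simp add: add_map_add[OF E_mult_map] SS.tens_closed E_mult_tens[OF _ v] E_mult_tens[OF _ one_S_grade] L2_def 1)
qed

text \<open>Resolves the definite description. Existence is the construction above, and a morphism
  with the given values on letters is determined by multiplicativity and right linearity.\<close>

lemma sym_coprod_eq: "sym_coprod K M = (\<lambda>x\<in>carrier S. Delta x)"
  unfolding sym_coprod_def Let_def
proof (rule the_equality, intro conjI ballI)
  show "(\<lambda>x\<in>carrier S. Delta x) \<in> superalg_hom K S E"
  proof -
    have "Delta (rsmult S x \<alpha>) = rsmult E (Delta x) \<alpha>" if "x \<in> carrier S" "\<alpha> \<in> carrier K" for x \<alpha>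
      using that by (simp only: S_rsmult Delta_rsmult)
    then show ?thesis
      unfolding superalg_hom_def shom_def ring_hom_def
      using S.grade_closed Delta_grade
      by (auto simp: add_map_add[OF Delta_map] Delta_mult Delta_one E_one S.rsmult_closed)
  qed
  fix X assume X: "X \<in> carrier M"
  show "(\<lambda>x\<in>carrier S. Delta x) (sym_of K M X) = tt (sym_of K M X) \<one>\<^bsub>S\<^esub> \<oplus>\<^bsub>E\<^esub> tt \<one>\<^bsub>S\<^esub> (sym_of K M X)"
  proof -
    have "Delta (sym_of K M X) = tt (sym_of K M X) \<one>\<^bsub>S\<^esub> \<oplus>\<^bsub>E\<^esub> tt \<one>\<^bsub>S\<^esub> (sym_of K M X)"
    proof (rule add_map_eq_grade[OF _ _ _ X])
      show "add_map M E (\<lambda>X. Delta (sym_of K M X))" by (rule add_map_comp[OF add_map_sym_of Delta_map])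
      show "add_map M E (\<lambda>X. tt (sym_of K M X) \<one>\<^bsub>S\<^esub> \<oplus>\<^bsub>E\<^esub> tt \<one>\<^bsub>S\<^esub> (sym_of K M X))"
        by (auto intro!: add_mapI simp: sym_of_add SS.tens_add_left SS.tens_add_right SS.tens_closed SS.E.a_ac)
      fix d X assume X: "X \<in> grade M d"
      then have "Delta (sym_of K M X \<otimes>\<^bsub>S\<^esub> \<one>\<^bsub>S\<^esub>) = L2 d (sym_of K M X) (tt \<one>\<^bsub>S\<^esub> \<one>\<^bsub>S\<^esub>)"
        by (simp add: Delta_sym Delta_one del: S.r_one)
      then show "Delta (sym_of K M X) = tt (sym_of K M X) \<one>\<^bsub>S\<^esub> \<oplus>\<^bsub>E\<^esub> tt \<one>\<^bsub>S\<^esub> (sym_of K M X)"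
        using X grade_closed by (simp add: L2_tens[OF sym_of_grade[OF X]] S.tw_of_grade[OF one_S_grade])
    qed
    then show ?thesis using X by simp
  qed
next
  fix D assume "D \<in> superalg_hom K S E \<and> (\<forall>X\<in>carrier M. D (sym_of K M X) = tt (sym_of K M X) \<one>\<^bsub>S\<^esub> \<oplus>\<^bsub>E\<^esub> tt \<one>\<^bsub>S\<^esub> (sym_of K M X))"
  then have D: "D \<in> carrier S \<rightarrow>\<^sub>E carrier E"
    "\<And>x y. \<lbrakk>x \<in> carrier S; y \<in> carrier S\<rbrakk> \<Longrightarrow> D (x \<oplus>\<^bsub>S\<^esub> y) = D x \<oplus>\<^bsub>E\<^esub> D y"
    "\<And>x \<alpha>. \<lbrakk>x \<in> carrier S; \<alpha> \<in> carrier K\<rbrakk> \<Longrightarrow> D (rsmult S x \<alpha>) = rsmult E (D x) \<alpha>"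
    "\<And>x y. \<lbrakk>x \<in> carrier S; y \<in> carrier S\<rbrakk> \<Longrightarrow> D (x \<otimes>\<^bsub>S\<^esub> y) = D x \<otimes>\<^bsub>E\<^esub> D y"
    "D \<one>\<^bsub>S\<^esub> = \<one>\<^bsub>E\<^esub>"
    "\<And>X. X \<in> carrier M \<Longrightarrow> D (sym_of K M X) = tt (sym_of K M X) \<one>\<^bsub>S\<^esub> \<oplus>\<^bsub>E\<^esub> tt \<one>\<^bsub>S\<^esub> (sym_of K M X)"
    unfolding superalg_hom_def shom_def ring_hom_def by auto
  have "D x = Delta x" if "x \<in> carrier S" for x
    using that
  proof (induction rule: S_induct_right)
    case one
    then show ?case by (simp add: D(5) E_one Delta_one)
  next
    case (sym v p X)
    then show ?case
      using grade_closed by (simp add: D(4,6) Delta_sym L2_eq_mult[OF sym_of_grade])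
  next
    case (rsmult \<alpha> p X)
    then show ?case using D(3)[of X \<alpha>] K.grade_closed by (simp add: S_rsmult Delta_rsmult)
  next
    case (add X Y)
    then show ?case by (simp add: D(2) add_map_add[OF Delta_map])
  qed
  then show "D = (\<lambda>x\<in>carrier S. Delta x)" using D(1) by (auto intro!: extensionalityI[of _ "carrier S"] simp: PiE_def)
qed

end

section \<open>Coderivations with values in the primitive elements\<close>

lemma (in abelian_group) minus_add_cancel:
  "\<lbrakk>x \<in> carrier G; y \<in> carrier G; z \<in> carrier G\<rbrakk> \<Longrightarrow> (x \<oplus> y) \<ominus> (x \<oplus> z) = y \<ominus> z"
  using add_cancel_neg(1)[of x "y \<oplus> \<ominus> z"] by (simp add: a_minus_def minus_add a_ac)

context sym_base
begin

lemma add_hom_lin: "\<lbrakk>lin_map K S S f\<rbrakk> \<Longrightarrow> add_hom S S f"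
  by (intro add_hom_intro S.abelian_group_axioms lin_mapD(1))

lemma par_sym_of: "par_map K M S 0 (sym_of K M)"
  by (auto simp: par_map_def lin_map_def add_map_sym_of sym_of_rsmult S_rsmult)

lemma par_comp_Lm:
  assumes "par_map K S A p f" "a \<in> grade S q" shows "par_map K S A (p + q) (\<lambda>x. f (a \<otimes>\<^bsub>S\<^esub> x))"
  using par_map_comp[OF par_Lm[OF assms(2)] assms(1)] .

lemma mult_balanced: "SS.balanced S (\<lambda>x y. x \<otimes>\<^bsub>S\<^esub> y)"
proof (rule SS.balancedI)
  fix p q r x y \<alpha> assume *: "x \<in> grade S r" "\<alpha> \<in> grade K p" "y \<in> grade S q" "x \<in> carrier S" "y \<in> carrier S" "\<alpha> \<in> carrier K"
  then show "rsmult S x \<alpha> \<otimes>\<^bsub>S\<^esub> y = x \<otimes>\<^bsub>S\<^esub> ksgn S (p * q) (rsmult S y \<alpha>)"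
    by (simp add: S_rsmult S.m_assoc S_supercomm_sc[OF *(2)] S.tw_of_grade[OF *(3)] ksgn_S_mult)
qed (simp_all add: S.l_distr S.r_distr)

lemma sym_mult_map: "add_map E S (sym_mult K M)"
  by (rule add_map_cong[OF SS.lift_map[OF S.abelian_group_axioms mult_balanced] SS.E_abelian_group])
    (simp add: sym_mult_def)

lemma sym_mult_tens: "\<lbrakk>x \<in> carrier S; y \<in> carrier S\<rbrakk> \<Longrightarrow> sym_mult K M (tt x y) = x \<otimes>\<^bsub>S\<^esub> y"
  unfolding sym_mult_def using SS.lift_tens[OF S.abelian_group_axioms mult_balanced] by (simp add: SS.tens_closed)

definition Phi :: "bit \<Rightarrow> _ \<Rightarrow> (('k + 'm) fword \<Rightarrow>\<^sub>0 int) set set \<Rightarrow> (('k + 'm) fword \<Rightarrow>\<^sub>0 int) set set"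
  where "Phi p f x = sym_mult K M (tf p (\<lambda>x. x) (\<lambda>x. sym_of K M (f x)) (Delta x))"

lemma par_sym_of_comp: "par_map K S M p f \<Longrightarrow> par_map K S S p (\<lambda>x. sym_of K M (f x))"
  using par_map_comp[OF _ par_sym_of] by fastforce

text \<open>The part of \<open>Phi\<close> that follows the coproduct, defined on the whole tensor
  square so that identities can be verified on pure tensors.\<close>

definition Bf where "Bf p f Z = sym_mult K M (tf p (\<lambda>x. x) (\<lambda>x. sym_of K M (f x)) Z)"

lemma Phi_Bf: "Phi p f x = Bf p f (Delta x)"
  by (simp add: Phi_def Bf_def)

lemma Bf_map: "par_map K S M p f \<Longrightarrow> add_map E S (Bf p f)"
  unfolding Bf_def by (rule add_map_comp[OF tf_map sym_mult_map]) (auto intro: S.lin_map_id par_sym_of_comp)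

lemma Bf_tens:
  "\<lbrakk>par_map K S M p f; x \<in> carrier S; y \<in> carrier S\<rbrakk> \<Longrightarrow> Bf p f (tt x y) = tw S p x \<otimes>\<^bsub>S\<^esub> sym_of K M (f y)"
  using par_mapD(4)[of K S M p f]
  by (simp add: Bf_def tf_tens S.lin_map_id par_sym_of_comp sym_mult_tens)

lemma Phi_map: "par_map K S M p f \<Longrightarrow> add_map S S (Phi p f)"
  unfolding Phi_Bf by (rule add_map_comp[OF Delta_map Bf_map])

lemma Phi_closed [simp]: "\<lbrakk>par_map K S M p f; x \<in> carrier S\<rbrakk> \<Longrightarrow> Phi p f x \<in> carrier S"
  by (rule add_map_closed[OF Phi_map])

lemma S_eqI:
  assumes "abelian_group X" "add_map E X f" "add_map E X g" "Z \<in> carrier E"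
    and "\<And>p q x y. \<lbrakk>x \<in> grade S p; y \<in> grade S q; x \<in> carrier S; y \<in> carrier S\<rbrakk> \<Longrightarrow> f (tt x y) = g (tt x y)"
  shows "f Z = g Z"
  using SS.tensor_eqI[OF assms(2-4)] assms(5) by blast

lemma Bf_rsmult:
  assumes f: "par_map K S M p f" and "Z \<in> carrier E" "\<alpha> \<in> carrier K"
  shows "Bf p f (rsmult E Z \<alpha>) = Bf p f Z \<otimes>\<^bsub>S\<^esub> sc \<alpha>"
proof (rule S_eqI[OF S.abelian_group_axioms _ _ assms(2)])
  show "add_map E S (\<lambda>Z. Bf p f (rsmult E Z \<alpha>))"
    by (rule add_map_comp[OF SS.rsmult_E_map Bf_map]) (use assms in auto)
  show "add_map E S (\<lambda>Z. Bf p f Z \<otimes>\<^bsub>S\<^esub> sc \<alpha>)"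
    using assms(3) by (intro add_map_comp[OF Bf_map[OF f]]) (auto intro!: add_mapI simp: S.l_distr)
  fix r q x y assume "x \<in> carrier S" "y \<in> carrier S"
  then show "Bf p f (rsmult E (tt x y) \<alpha>) = Bf p f (tt x y) \<otimes>\<^bsub>S\<^esub> sc \<alpha>"
    using assms par_mapD(4,6)[OF f]
    by (simp add: SS.rsmult_tens Bf_tens S.rsmult_closed sym_of_rsmult S.m_assoc)
qed

lemma Phi_lin: "par_map K S M p f \<Longrightarrow> lin_map K S S (Phi p f)"
  by (simp add: lin_map_def Phi_map S_rsmult Phi_Bf Delta_rsmult Bf_rsmult)

lemma Phi_par:
  assumes f: "par_map K S M p f" shows "par_map K S S p (Phi p f)"
  unfolding par_map_def
proof (intro conjI allI ballI Phi_lin[OF f])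
  fix d x assume x: "x \<in> grade S d"
  have "Bf p f (Delta x) \<in> grade S (p + d)"
  proof (rule SS.grade_E_induct[OF Delta_grade[OF x] Bf_map[OF f] S.abelian_group_axioms S_grade_subgroup])
    fix r s v w assume *: "v \<in> grade S r" "w \<in> grade S s" "r + s = d"
    have "tw S p v \<otimes>\<^bsub>S\<^esub> sym_of K M (f w) \<in> grade S (r + (p + s))"
      using * par_mapD(2)[OF f *(2)] by (intro S_grade_mult sym_of_grade S.tw_grade)
    then show "Bf p f (tt v w) \<in> grade S (p + d)"
      using * S.grade_closed by (auto simp: Bf_tens[OF f] ac_simps)
  qed
  then show "Phi p f x \<in> grade S (p + d)" by (simp add: Phi_Bf)
qed

lemma Phi_one:
  assumes f: "par_map K S M p f" shows "Phi p f \<one>\<^bsub>S\<^esub> = sym_of K M (f \<one>\<^bsub>S\<^esub>)"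
  using par_mapD(4)[OF f] by (simp add: Phi_Bf Delta_one Bf_tens[OF f] S.tw_of_grade[OF one_S_grade])

lemma Bf_L2:
  assumes f: "par_map K S M p f" and u: "u \<in> grade S q" and Z: "Z \<in> carrier E"
  shows "Bf p f (L2 q u Z) = ksgn S (p * q) (u \<otimes>\<^bsub>S\<^esub> Bf p f Z) \<oplus>\<^bsub>S\<^esub> Bf (p + q) (\<lambda>x. f (u \<otimes>\<^bsub>S\<^esub> x)) Z"
proof (rule S_eqI[OF S.abelian_group_axioms _ _ Z])
  have uS: "u \<in> carrier S" using u by (rule S.grade_closed)
  note fu = par_comp_Lm[OF f u]
  show "add_map E S (\<lambda>Z. Bf p f (L2 q u Z))" by (rule add_map_comp[OF L2_map[OF u] Bf_map[OF f]])
  show "add_map E S (\<lambda>Z. ksgn S (p * q) (u \<otimes>\<^bsub>S\<^esub> Bf p f Z) \<oplus>\<^bsub>S\<^esub> Bf (p + q) (\<lambda>x. f (u \<otimes>\<^bsub>S\<^esub> x)) Z)"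
    by (intro add_map_sum add_map_ksgn S.abelian_group_axioms Bf_map[OF fu]
        add_map_comp[OF Bf_map[OF f] lin_mapD(1)[OF lin_Lm[OF uS]]])
  fix r s x y assume "x \<in> carrier S" "y \<in> carrier S"
  then show "Bf p f (L2 q u (tt x y)) = ksgn S (p * q) (u \<otimes>\<^bsub>S\<^esub> Bf p f (tt x y)) \<oplus>\<^bsub>S\<^esub> Bf (p + q) (\<lambda>x. f (u \<otimes>\<^bsub>S\<^esub> x)) (tt x y)"
    using uS par_mapD(4)[OF f]
    by (simp add: L2_tens[OF u] add_map_add[OF Bf_map[OF f]] Bf_tens[OF f] Bf_tens[OF fu] SS.tens_closed
        tw_S_mult S.tw_of_grade[OF u] ksgn_S_mult S.m_assoc)
qed

text \<open>The recursion behind the inductions below. In the coproduct of v x the primitive letter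
  v enters either the left factor, from where it is multiplied back in front, or the right factor,
  where it becomes an argument of f.\<close>

lemma Phi_sym:
  assumes f: "par_map K S M p f" and v: "v \<in> grade M q" and x: "x \<in> carrier S"
  shows "Phi p f (sym_of K M v \<otimes>\<^bsub>S\<^esub> x) = ksgn S (p * q) (sym_of K M v \<otimes>\<^bsub>S\<^esub> Phi p f x)
    \<oplus>\<^bsub>S\<^esub> Phi (p + q) (\<lambda>x. f (sym_of K M v \<otimes>\<^bsub>S\<^esub> x)) x"
  using Bf_L2[OF f sym_of_grade[OF v]] x by (simp add: Phi_Bf Delta_sym[OF v])

lemma Phi_rsmult: "\<lbrakk>par_map K S M p f; x \<in> carrier S; \<alpha> \<in> carrier K\<rbrakk> \<Longrightarrow> Phi p f (x \<otimes>\<^bsub>S\<^esub> sc \<alpha>) = Phi p f x \<otimes>\<^bsub>S\<^esub> sc \<alpha>"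
  using lin_mapD(4)[OF Phi_lin, of p f x \<alpha>] by (simp add: S_rsmult)

lemma Bf_add:
  assumes f: "par_map K S M p f" and g: "par_map K S M p g" and h: "par_map K S M p h" and Z: "Z \<in> carrier E"
    and e: "\<And>x. x \<in> carrier S \<Longrightarrow> h x = ksgn M e (f x) \<oplus> g x"
  shows "Bf p h Z = ksgn S e (Bf p f Z) \<oplus>\<^bsub>S\<^esub> Bf p g Z"
  by (rule S_eqI[OF S.abelian_group_axioms Bf_map[OF h]
      add_map_sum[OF S.abelian_group_axioms add_map_ksgn[OF S.abelian_group_axioms Bf_map[OF f]] Bf_map[OF g]] Z])
    (simp add: Bf_tens f g h e par_mapD(4)[OF f] par_mapD(4)[OF g] S.r_distr ksgn_S_mult)

lemma Phi_add:
  assumes "par_map K S M p f" "par_map K S M p g" "par_map K S M p h" "x \<in> carrier S"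
    and "\<And>x. x \<in> carrier S \<Longrightarrow> h x = ksgn M e (f x) \<oplus> g x"
  shows "Phi p h x = ksgn S e (Phi p f x) \<oplus>\<^bsub>S\<^esub> Phi p g x"
  unfolding Phi_Bf using Bf_add[OF assms(1-3) _ assms(5)] assms(4) by simp

lemma Phi_cong:
  assumes "par_map K S M p f" "par_map K S M p h" "x \<in> carrier S" "\<And>x. x \<in> carrier S \<Longrightarrow> h x = f x"
  shows "Phi p h x = Phi p f x"
proof -
  have "Bf p h Z = Bf p f Z" if "Z \<in> carrier E" for Z
    by (rule S_eqI[OF S.abelian_group_axioms Bf_map Bf_map that]) (use assms in \<open>auto simp: Bf_tens\<close>)
  then show ?thesis using assms(3) by (simp add: Phi_Bf)
qed

text \<open>The operator on the tensor square belonging to f satisfies the same recursion as f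
  itself, so the co-Leibniz rule passes from an element to its multiples by u.\<close>

lemma E_sym_coder:
  assumes f: "par_map K S S p f" and g: "par_map K S S (p + q) g" and u: "u \<in> grade S q"
    and fu: "\<And>x. x \<in> carrier S \<Longrightarrow> f (u \<otimes>\<^bsub>S\<^esub> x) = ksgn S (p * q) (u \<otimes>\<^bsub>S\<^esub> f x) \<oplus>\<^bsub>S\<^esub> g x"
    and Z: "Z \<in> carrier E"
  shows "tf 0 f (\<lambda>x. x) (L2 q u Z) \<oplus>\<^bsub>E\<^esub> tf p (\<lambda>x. x) f (L2 q u Z)
    = ksgn E (p * q) (L2 q u (tf 0 f (\<lambda>x. x) Z \<oplus>\<^bsub>E\<^esub> tf p (\<lambda>x. x) f Z))
      \<oplus>\<^bsub>E\<^esub> (tf 0 g (\<lambda>x. x) Z \<oplus>\<^bsub>E\<^esub> tf (p + q) (\<lambda>x. x) g Z)"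
proof (rule E_eqI[OF _ _ Z])
  note lf = par_mapD(1)[OF f] and lg = par_mapD(1)[OF g]
  note m = tf_map[OF lf S.par_map_id] tf_map[OF S.lin_map_id f] tf_map[OF lg S.par_map_id] tf_map[OF S.lin_map_id g]
  note t = tf_tens[OF lf S.par_map_id] tf_tens[OF S.lin_map_id f] tf_tens[OF lg S.par_map_id] tf_tens[OF S.lin_map_id g]
  have uS: "u \<in> carrier S" using u by (rule S.grade_closed)
  note L = L2_map[OF u]
  note EA = SS.E_abelian_group
  show "add_map E E (\<lambda>Z. tf 0 f (\<lambda>x. x) (L2 q u Z) \<oplus>\<^bsub>E\<^esub> tf p (\<lambda>x. x) f (L2 q u Z))"
    by (rule add_map_sum[OF EA add_map_comp[OF L m(1)] add_map_comp[OF L m(2)]])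
  show "add_map E E (\<lambda>Z. ksgn E (p * q) (L2 q u (tf 0 f (\<lambda>x. x) Z \<oplus>\<^bsub>E\<^esub> tf p (\<lambda>x. x) f Z))
      \<oplus>\<^bsub>E\<^esub> (tf 0 g (\<lambda>x. x) Z \<oplus>\<^bsub>E\<^esub> tf (p + q) (\<lambda>x. x) g Z))"
    by (rule add_map_sum[OF EA add_map_ksgn[OF EA add_map_comp[OF add_map_sum[OF EA m(1,2)] L]] add_map_sum[OF EA m(3,4)]])
  fix r s x y assume [simp]: "x \<in> carrier S" "y \<in> carrier S"
  have [simp]: "f z \<in> carrier S" "g z \<in> carrier S" if "z \<in> carrier S" for z
    using that par_mapD(4)[OF f] par_mapD(4)[OF g] by auto
  have tw: "tw S q (f x) = ksgn S (p * q) (f (tw S q x))"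
    using par_map_tw[OF S.supermodule_axioms S.supermodule_axioms f, of x q] by (simp add: mult.commute)
  have "tt (tw S q (f x)) (u \<otimes>\<^bsub>S\<^esub> y) = ksgn E (p * q) (tt (f (tw S q x)) (u \<otimes>\<^bsub>S\<^esub> y))"
    using uS by (simp add: tw SS.tens_ksgn)
  then show "tf 0 f (\<lambda>x. x) (L2 q u (tt x y)) \<oplus>\<^bsub>E\<^esub> tf p (\<lambda>x. x) f (L2 q u (tt x y))
    = ksgn E (p * q) (L2 q u (tf 0 f (\<lambda>x. x) (tt x y) \<oplus>\<^bsub>E\<^esub> tf p (\<lambda>x. x) f (tt x y)))
      \<oplus>\<^bsub>E\<^esub> (tf 0 g (\<lambda>x. x) (tt x y) \<oplus>\<^bsub>E\<^esub> tf (p + q) (\<lambda>x. x) g (tt x y))"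
    using uS
    by (simp add: L2_tens[OF u] add_map_add[OF L] add_map_add[OF m(1)] add_map_add[OF m(2)] t fu SS.tens_closed
        SS.tens_add_left SS.tens_add_right tw_S_mult S.tw_of_grade[OF u] ksgn_S_mult SS.tens_ksgn SS.E.ksgn_add SS.E.a_ac
        add.commute)
qed

text \<open>By induction on x over all f at once, since the step for v X also uses the coderivation
  of f(v -).\<close>

lemma Phi_coder:
  assumes "par_map K S M p f" "x \<in> carrier S"
  shows "Delta (Phi p f x) = tf 0 (Phi p f) (\<lambda>x. x) (Delta x) \<oplus>\<^bsub>E\<^esub> tf p (\<lambda>x. x) (Phi p f) (Delta x)"
  using assms(2,1)
proof (induction arbitrary: p f rule: S_induct_right)
  case (one p f)
  have "f \<one>\<^bsub>S\<^esub> \<in> grade M (p + 0)" using one by (intro par_mapD(2)) auto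
  then have g: "f \<one>\<^bsub>S\<^esub> \<in> grade M p" "f \<one>\<^bsub>S\<^esub> \<in> carrier M" using grade_closed by auto
  have "Delta (sym_of K M (f \<one>\<^bsub>S\<^esub>) \<otimes>\<^bsub>S\<^esub> \<one>\<^bsub>S\<^esub>) = L2 p (sym_of K M (f \<one>\<^bsub>S\<^esub>)) (tt \<one>\<^bsub>S\<^esub> \<one>\<^bsub>S\<^esub>)"
    by (subst Delta_sym[OF g(1)]) (simp_all add: Delta_one)
  then show ?case
    using g one Phi_lin[OF one] Phi_par[OF one]
    by (simp add: Phi_one Delta_one L2_tens[OF sym_of_grade[OF g(1)]] S.tw_of_grade[OF one_S_grade] tf_tens S.lin_map_id S.par_map_id)
next
  case (sym v q X p f)
  let ?u = "sym_of K M v" and ?g = "\<lambda>x. f (sym_of K M v \<otimes>\<^bsub>S\<^esub> x)"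
  have u: "?u \<in> grade S q" "?u \<in> carrier S" using sym grade_closed by auto
  have g: "par_map K S M (p + q) ?g" by (rule par_comp_Lm[OF sym(4) u(1)])
  have "Delta (Phi p f (?u \<otimes>\<^bsub>S\<^esub> X)) = ksgn E (p * q) (L2 q ?u (Delta (Phi p f X))) \<oplus>\<^bsub>E\<^esub> Delta (Phi (p + q) ?g X)"
    using sym g u add_hom.ksgn[OF add_hom_intro[OF S.abelian_group_axioms SS.E_abelian_group Delta_map]]
    by (simp add: Phi_sym[OF sym(4,1,2)] add_map_add[OF Delta_map] Delta_sym[OF sym(1)])
  also have "\<dots> = tf 0 (Phi p f) (\<lambda>x. x) (L2 q ?u (Delta X)) \<oplus>\<^bsub>E\<^esub> tf p (\<lambda>x. x) (Phi p f) (L2 q ?u (Delta X))"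
    using sym g u E_sym_coder[OF Phi_par[OF sym(4)] Phi_par[OF g] u(1) Phi_sym[OF sym(4,1)] Delta_closed[OF sym(2)]]
    by simp
  finally show ?case using sym by (simp add: Delta_sym[OF sym(1)])
next
  case (rsmult \<alpha> q X p f)
  have a: "\<alpha> \<in> carrier K" using rsmult K.grade_closed by auto
  show ?case
    using rsmult a Phi_lin[OF rsmult(4)] Phi_par[OF rsmult(4)]
    by (simp add: Phi_rsmult Delta_rsmult tf_rsmult S.lin_map_id S.par_map_id add_map_add[OF SS.rsmult_E_map])
next
  case (add X Y p f)
  note l = Phi_lin[OF add(5)] Phi_par[OF add(5)]
  show ?case
    using add l
    by (simp add: add_map_add[OF Phi_map] add_map_add[OF Delta_map]
        add_map_add[OF tf_map[OF l(1) S.par_map_id]] add_map_add[OF tf_map[OF S.lin_map_id l(2)]] SS.E.a_ac S.lin_map_id S.par_map_id)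
qed

section \<open>The augmentation and the projection to the primitive elements\<close>

sublocale dual: sym_action K M "prod_grp K M" dualK dualM by (rule dual_action)

definition eps where "eps x = fst (dual.act x (\<one>\<^bsub>K\<^esub>, \<zero>))"
definition pr where "pr x = snd (dual.act x (\<one>\<^bsub>K\<^esub>, \<zero>))"

lemma dual_closed: "x \<in> carrier S \<Longrightarrow> dual.act x (\<one>\<^bsub>K\<^esub>, \<zero>) \<in> carrier K \<times> carrier M"
  using dual.act_closed[of x "(\<one>\<^bsub>K\<^esub>, \<zero>)"] by simp

lemma eps_closed [simp]: "x \<in> carrier S \<Longrightarrow> eps x \<in> carrier K"
  using dual_closed[of x] by (auto simp: eps_def)

lemma pr_closed [simp]: "x \<in> carrier S \<Longrightarrow> pr x \<in> carrier M"
  using dual_closed[of x] by (auto simp: pr_def)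

lemma eps_one [simp]: "eps \<one>\<^bsub>S\<^esub> = \<one>\<^bsub>K\<^esub>" and pr_one [simp]: "pr \<one>\<^bsub>S\<^esub> = \<zero>"
  by (simp_all add: eps_def pr_def dual.act_one)

lemma eps_add: "\<lbrakk>x \<in> carrier S; y \<in> carrier S\<rbrakk> \<Longrightarrow> eps (x \<oplus>\<^bsub>S\<^esub> y) = eps x \<oplus>\<^bsub>K\<^esub> eps y"
  and pr_add: "\<lbrakk>x \<in> carrier S; y \<in> carrier S\<rbrakk> \<Longrightarrow> pr (x \<oplus>\<^bsub>S\<^esub> y) = pr x \<oplus> pr y"
  by (simp_all add: eps_def pr_def dual.act_add)

lemma eps_sym: "\<lbrakk>v \<in> carrier M; x \<in> carrier S\<rbrakk> \<Longrightarrow> eps (sym_of K M v \<otimes>\<^bsub>S\<^esub> x) = \<zero>\<^bsub>K\<^esub>"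
  and pr_sym: "\<lbrakk>v \<in> carrier M; x \<in> carrier S\<rbrakk> \<Longrightarrow> pr (sym_of K M v \<otimes>\<^bsub>S\<^esub> x) = rsmult M v (eps x)"
  using dual_closed[of x] by (simp_all add: eps_def pr_def dual.act_mult dual.act_sym_of dualM_def)

lemma eps_sc: "\<lbrakk>\<alpha> \<in> carrier K; x \<in> carrier S\<rbrakk> \<Longrightarrow> eps (sc \<alpha> \<otimes>\<^bsub>S\<^esub> x) = \<alpha> \<otimes>\<^bsub>K\<^esub> eps x"
  and pr_sc: "\<lbrakk>\<alpha> \<in> carrier K; x \<in> carrier S\<rbrakk> \<Longrightarrow> pr (sc \<alpha> \<otimes>\<^bsub>S\<^esub> x) = lact \<alpha> (pr x)"
  using dual_closed[of x] by (simp_all add: eps_def pr_def dual.act_mult dual.act_sc dualK_def)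

lemma lact_zero: "\<alpha> \<in> carrier K \<Longrightarrow> lact \<alpha> \<zero> = \<zero>"
  using lact_add(2)[of \<alpha> "\<zero>" "\<zero>"] by (intro idem_zero) simp_all

lemma lact_rsmult:
  assumes "\<alpha> \<in> carrier K" "\<beta> \<in> carrier K" "m \<in> carrier M"
  shows "lact \<alpha> (rsmult M m \<beta>) = rsmult M (lact \<alpha> m) \<beta>"
proof (rule K.add_map_eq_grade[OF _ _ _ assms(1)])
  show "add_map K M (\<lambda>\<alpha>. lact \<alpha> (rsmult M m \<beta>))" "add_map K M (\<lambda>\<alpha>. rsmult M (lact \<alpha> m) \<beta>)"
    using assms by (auto intro!: add_mapI simp: lact_add rsmult_closed rsmult_add_left)
  fix p \<alpha> assume a: "\<alpha> \<in> grade K p"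
  then have aK: "\<alpha> \<in> carrier K" by (rule K.grade_closed)
  show "lact \<alpha> (rsmult M m \<beta>) = rsmult M (lact \<alpha> m) \<beta>"
  proof (rule K.add_map_eq_grade[OF _ _ _ assms(2)])
    show "add_map K M (\<lambda>\<beta>. lact \<alpha> (rsmult M m \<beta>))" "add_map K M (\<lambda>\<beta>. rsmult M (lact \<alpha> m) \<beta>)"
      using assms aK by (auto intro!: add_mapI simp: lact_add rsmult_closed rsmult_add_right)
    fix q \<beta> assume b: "\<beta> \<in> grade K q"
    then have bK: "\<beta> \<in> carrier K" by (rule K.grade_closed)
    have "rsmult M (tw M p m) (\<beta> \<otimes>\<^bsub>K\<^esub> \<alpha>) = rsmult M (tw M p m) (ksgn K (p * q) (\<alpha> \<otimes>\<^bsub>K\<^esub> \<beta>))"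
      using K.supercomm[OF b a] by (simp add: mult.commute)
    then show "lact \<alpha> (rsmult M m \<beta>) = rsmult M (lact \<alpha> m) \<beta>"
      using assms a b aK bK
      by (simp add: lact_grade[OF a] rsmult_closed tw_rsmult[OF _ b] rsmult_ksgn flip: rsmult_assoc)
  qed
qed

lemma eps_rsmult_pr_rsmult:
  assumes a: "\<alpha> \<in> carrier K" and x: "x \<in> carrier S"
  shows "eps (x \<otimes>\<^bsub>S\<^esub> sc \<alpha>) = eps x \<otimes>\<^bsub>K\<^esub> \<alpha> \<and> pr (x \<otimes>\<^bsub>S\<^esub> sc \<alpha>) = rsmult M (pr x) \<alpha>"
  using x
proof (induction rule: S_induct)
  case one
  have "eps (sc \<alpha> \<otimes>\<^bsub>S\<^esub> \<one>\<^bsub>S\<^esub>) = \<alpha>" "pr (sc \<alpha> \<otimes>\<^bsub>S\<^esub> \<one>\<^bsub>S\<^esub>) = \<zero>" using a by (simp_all add: eps_sc pr_sc lact_zero del: S.r_one)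
  then show ?case using a by simp
next
  case (sc \<beta> p X)
  then show ?case using a K.grade_closed by (simp add: eps_sc pr_sc S.m_assoc K.m_assoc lact_rsmult)
next
  case (sym v p X)
  then show ?case using a grade_closed by (simp add: eps_sym pr_sym S.m_assoc rsmult_assoc)
next
  case (add X Y)
  then show ?case using a by (simp add: S.l_distr eps_add pr_add K.l_distr rsmult_add_left)
qed

lemma lact_closed_grade: "\<lbrakk>\<alpha> \<in> grade K p; m \<in> grade M d\<rbrakk> \<Longrightarrow> lact \<alpha> m \<in> grade M (p + d)"
  using rsmult_grade[OF tw_grade] grade_closed by (simp add: lact_grade add.commute)

lemma eps_pr_grade: "x \<in> grade S d \<Longrightarrow> eps x \<in> grade K d \<and> pr x \<in> grade M d"
proof (induction rule: S_grade_induct)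
  case (sc \<alpha> p d X)
  then show ?case using K.grade_closed K.grade_mult lact_closed_grade by (simp add: eps_sc pr_sc)
next
  case (sym v p d X)
  then show ?case using grade_closed rsmult_grade by (simp add: eps_sym pr_sym)
next
  case (add d X Y)
  then show ?case by (auto simp: eps_add pr_add)
qed auto

lemma pr_par: "par_map K S M 0 pr"
  unfolding par_map_def lin_map_def
  using eps_pr_grade eps_rsmult_pr_rsmult by (auto intro!: add_mapI simp: pr_add S_rsmult)

definition cst where "cst a x = rsmult M a (eps x)"

lemma cst_par: "a \<in> grade M p \<Longrightarrow> par_map K S M p (cst a)"
  unfolding par_map_def lin_map_def cst_def
  using eps_pr_grade eps_rsmult_pr_rsmult grade_closed rsmult_grade
  by (auto intro!: add_mapI simp: eps_add S_rsmult rsmult_add_right rsmult_closed rsmult_assoc)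

lemma cst_one: "a \<in> carrier M \<Longrightarrow> cst a \<one>\<^bsub>S\<^esub> = a"
  by (simp add: cst_def rsmult_one)

lemma cst_sym: "\<lbrakk>a \<in> carrier M; v \<in> carrier M; x \<in> carrier S\<rbrakk> \<Longrightarrow> cst a (sym_of K M v \<otimes>\<^bsub>S\<^esub> x) = \<zero>"
  by (simp add: cst_def eps_sym)

lemma pr_sym_cst: "\<lbrakk>v \<in> carrier M; x \<in> carrier S\<rbrakk> \<Longrightarrow> pr (sym_of K M v \<otimes>\<^bsub>S\<^esub> x) = cst v x"
  by (simp add: cst_def pr_sym)

lemma eps_ksgn: "x \<in> carrier S \<Longrightarrow> eps (ksgn S e x) = ksgn K e (eps x)"
  using add_hom.ksgn[OF add_hom_intro[OF S.abelian_group_axioms K.abelian_group_axioms add_mapI], of eps] by (simp add: eps_add)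

text \<open>By \<open>Phi_sym\<close> the values are built from multiples of letters, and the
  augmentation vanishes on these.\<close>

lemma eps_Phi: "\<lbrakk>x \<in> carrier S; par_map K S M p f\<rbrakk> \<Longrightarrow> eps (Phi p f x) = \<zero>\<^bsub>K\<^esub>"
proof (induction arbitrary: p f rule: S_induct_right)
  case one
  have "eps (sym_of K M (f \<one>\<^bsub>S\<^esub>) \<otimes>\<^bsub>S\<^esub> \<one>\<^bsub>S\<^esub>) = \<zero>\<^bsub>K\<^esub>"
    using par_mapD(4)[OF one] by (intro eps_sym) auto
  then show ?case using par_mapD(4)[OF one] by (simp add: Phi_one[OF one])
next
  case (sym v q X p f)
  have g: "par_map K S M (p + q) (\<lambda>x. f (sym_of K M v \<otimes>\<^bsub>S\<^esub> x))" by (rule par_comp_Lm[OF sym(4) sym_of_grade[OF sym(1)]])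
  then show ?case
    using sym grade_closed by (simp add: Phi_sym[OF sym(4,1,2)] eps_add eps_ksgn eps_sym)
next
  case (rsmult \<alpha> q X p f)
  then show ?case using K.grade_closed eps_rsmult_pr_rsmult by (simp add: Phi_rsmult)
next
  case (add X Y p f)
  then show ?case by (simp add: add_map_add[OF Phi_map] eps_add)
qed

text \<open>The reason why a coderivation is recovered from its map into M. In the recursion the
  summand with v in front has augmentation zero behind v, so the projection removes it, and the
  letters accumulate in the argument of f.\<close>

lemma pr_Phi: "\<lbrakk>x \<in> carrier S; par_map K S M p f\<rbrakk> \<Longrightarrow> pr (Phi p f x) = f x"
proof (induction arbitrary: p f rule: S_induct_right)
  case one
  have "pr (sym_of K M (f \<one>\<^bsub>S\<^esub>) \<otimes>\<^bsub>S\<^esub> \<one>\<^bsub>S\<^esub>) = f \<one>\<^bsub>S\<^esub>"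
    using par_mapD(4)[OF one] by (subst pr_sym_cst) (auto simp: cst_one)
  then show ?case using par_mapD(4)[OF one] by (simp add: Phi_one[OF one])
next
  case (sym v q X p f)
  have g: "par_map K S M (p + q) (\<lambda>x. f (sym_of K M v \<otimes>\<^bsub>S\<^esub> x))" by (rule par_comp_Lm[OF sym(4) sym_of_grade[OF sym(1)]])
  have [simp]: "v \<in> carrier M" using sym grade_closed by auto
  have "pr (ksgn S (p * q) (sym_of K M v \<otimes>\<^bsub>S\<^esub> Phi p f X)) = \<zero>"
    using sym add_hom.ksgn[OF add_hom_intro[OF S.abelian_group_axioms abelian_group_axioms par_mapD(3)[OF pr_par]]]
    by (simp add: pr_sym eps_Phi)
  then show ?case
    using sym g par_mapD(4)[OF sym(4)] by (simp add: Phi_sym[OF sym(4,1,2)] pr_add)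
next
  case (rsmult \<alpha> q X p f)
  then show ?case using K.grade_closed eps_rsmult_pr_rsmult par_mapD(6)[OF rsmult(4), of X \<alpha>]
    by (simp add: Phi_rsmult S_rsmult)
next
  case (add X Y p f)
  then show ?case by (simp add: add_map_add[OF Phi_map] pr_add par_mapD(5))
qed

section \<open>Commutators of coderivations\<close>

definition hbr where "hbr p q f h x = f (Phi q h x) \<ominus> ksgn M (p * q) (h (Phi p f x))"
  \<comment> \<open>the map \<open>S \<rightarrow> M\<close> belonging to the commutator of two coderivations\<close>

lemma hbr_par:
  assumes f: "par_map K S M p f" and h: "par_map K S M q h"
  shows "par_map K S M (p + q) (hbr p q f h)"
proof -
  have "par_map K S M (q + p) (\<lambda>x. ksgn M (p * q + 1) (h (Phi p f x)))"
    by (rule par_map_ksgn[OF par_map_comp[OF Phi_par[OF f] h]])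
  then have "par_map K S M (p + q) (\<lambda>x. f (Phi q h x) \<oplus> ksgn M (p * q + 1) (h (Phi p f x)))"
    by (intro par_map_add par_map_comp[OF Phi_par[OF h] f]) (simp add: add.commute)
  moreover have "hbr p q f h x = f (Phi q h x) \<oplus> ksgn M (p * q + 1) (h (Phi p f x))" if "x \<in> carrier S" for x
    using that par_mapD(4)[OF h] f by (simp add: hbr_def a_minus_def neg_ksgn)
  ultimately show ?thesis
    unfolding par_map_def lin_map_def
    using S.grade_closed S.rsmult_closed by (auto intro: add_map_cong[OF _ S.abelian_group_axioms])
qed

text \<open>Instead of showing that commutators are coderivations and that these are determined by
  their projection, both sides are shown to obey the same recursion in x, with f and h
  varying.\<close>

lemma Phi_commutator:
  assumes "x \<in> carrier S" "par_map K S M p f" "par_map K S M q h"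
  shows "Phi p f (Phi q h x) \<ominus>\<^bsub>S\<^esub> ksgn S (p * q) (Phi q h (Phi p f x)) = Phi (p + q) (hbr p q f h) x"
  using assms
proof (induction arbitrary: p q f h rule: S_induct_right)
  case (one p q f h)
  note f = one(1) and h = one(2)
  have g: "f \<one>\<^bsub>S\<^esub> \<in> grade M p" "h \<one>\<^bsub>S\<^esub> \<in> grade M q" "f \<one>\<^bsub>S\<^esub> \<in> carrier M" "h \<one>\<^bsub>S\<^esub> \<in> carrier M"
    using par_mapD(2)[OF f one_S_grade] par_mapD(2)[OF h one_S_grade] grade_closed by auto
  have P: "Phi a k (sym_of K M v) = ksgn S (a * b) (sym_of K M v \<otimes>\<^bsub>S\<^esub> sym_of K M (k \<one>\<^bsub>S\<^esub>)) \<oplus>\<^bsub>S\<^esub> sym_of K M (k (sym_of K M v))"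
    if k: "par_map K S M a k" and v: "v \<in> grade M b" for a k v b
  proof -
    have vM: "v \<in> carrier M" using v by (rule grade_closed)
    have "Phi a k (sym_of K M v \<otimes>\<^bsub>S\<^esub> \<one>\<^bsub>S\<^esub>) = ksgn S (a * b) (sym_of K M v \<otimes>\<^bsub>S\<^esub> sym_of K M (k \<one>\<^bsub>S\<^esub>))
        \<oplus>\<^bsub>S\<^esub> sym_of K M (k (sym_of K M v \<otimes>\<^bsub>S\<^esub> \<one>\<^bsub>S\<^esub>))"
      by (simp only: Phi_sym[OF k v S.one_closed] Phi_one[OF k] Phi_one[OF par_comp_Lm[OF k sym_of_grade[OF v]]])
    then show ?thesis using vM by simp
  qed
  have "Phi (p + q) (hbr p q f h) \<one>\<^bsub>S\<^esub> = sym_of K M (f (sym_of K M (h \<one>\<^bsub>S\<^esub>)) \<ominus> ksgn M (p * q) (h (sym_of K M (f \<one>\<^bsub>S\<^esub>))))"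
    by (simp add: Phi_one[OF hbr_par[OF f h]] hbr_def Phi_one[OF f] Phi_one[OF h])
  \<comment> \<open>Both orders of composition produce the product of f(1) and h(1). Written in the
    same order it cancels in the commutator.\<close>
  moreover have "Phi p f (Phi q h \<one>\<^bsub>S\<^esub>) = sym_of K M (f \<one>\<^bsub>S\<^esub>) \<otimes>\<^bsub>S\<^esub> sym_of K M (h \<one>\<^bsub>S\<^esub>) \<oplus>\<^bsub>S\<^esub> sym_of K M (f (sym_of K M (h \<one>\<^bsub>S\<^esub>)))"
    using sym_of_comm[OF g(1,2)] g by (simp add: Phi_one[OF h] P[OF f g(2)])
  moreover have "ksgn S (p * q) (Phi q h (Phi p f \<one>\<^bsub>S\<^esub>)) = sym_of K M (f \<one>\<^bsub>S\<^esub>) \<otimes>\<^bsub>S\<^esub> sym_of K M (h \<one>\<^bsub>S\<^esub>)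
      \<oplus>\<^bsub>S\<^esub> ksgn S (p * q) (sym_of K M (h (sym_of K M (f \<one>\<^bsub>S\<^esub>))))"
    using g par_mapD(4)[OF h] by (simp add: Phi_one[OF f] P[OF h g(1)] S.ksgn_add mult.commute)
  ultimately show ?case
    using g par_mapD(4)[OF f] par_mapD(4)[OF h] by (simp add: S.minus_add_cancel sym_of.minus sym_of.ksgn)
next
  case (sym v r X p q f h)
  note f = sym(4) and h = sym(5)
  let ?u = "sym_of K M v"
  have u: "?u \<in> grade S r" "?u \<in> carrier S" using sym grade_closed by auto
  have fu: "par_map K S M (p + r) (\<lambda>x. f (?u \<otimes>\<^bsub>S\<^esub> x))" (is "par_map _ _ _ _ ?fu") by (rule par_comp_Lm[OF f u(1)])
  have hu: "par_map K S M (q + r) (\<lambda>x. h (?u \<otimes>\<^bsub>S\<^esub> x))" (is "par_map _ _ _ _ ?hu") by (rule par_comp_Lm[OF h u(1)])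
  have cu: "par_map K S M (p + q + r) (\<lambda>x. hbr p q f h (?u \<otimes>\<^bsub>S\<^esub> x))" by (rule par_comp_Lm[OF hbr_par[OF f h] u(1)])
  \<comment> \<open>A letter in front of the argument is absorbed either by f or by h, so
    \<open>hbr\<close> obeys a Leibniz rule.\<close>
  have ex: "hbr p q f h (?u \<otimes>\<^bsub>S\<^esub> x) = ksgn M (q * r) (hbr (p + r) q ?fu h x) \<oplus> hbr p (q + r) f ?hu x"
    if x: "x \<in> carrier S" for x
  proof -
    interpret f: add_hom S M f by (intro add_hom_intro S.abelian_group_axioms abelian_group_axioms par_mapD(3)[OF f])
    interpret h: add_hom S M h by (intro add_hom_intro S.abelian_group_axioms abelian_group_axioms par_mapD(3)[OF h])
    show ?thesis
      unfolding hbr_def Phi_sym[OF f sym(1) x] Phi_sym[OF h sym(1) x]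
      using x u f h fu hu
      by (cases p; cases q; cases r) (simp_all add: a_minus_def ksgn_1 minus_add a_ac)
  qed
  have c1: "par_map K S M (p + q + r) (hbr (p + r) q ?fu h)" "par_map K S M (p + q + r) (hbr p (q + r) f ?hu)"
    using hbr_par[OF fu h] hbr_par[OF f hu] by (simp_all add: ac_simps)
  have "Phi (p + q) (hbr p q f h) (?u \<otimes>\<^bsub>S\<^esub> X) = ksgn S ((p + q) * r) (?u \<otimes>\<^bsub>S\<^esub> Phi (p + q) (hbr p q f h) X)
      \<oplus>\<^bsub>S\<^esub> (ksgn S (q * r) (Phi (p + q + r) (hbr (p + r) q ?fu h) X) \<oplus>\<^bsub>S\<^esub> Phi (p + q + r) (hbr p (q + r) f ?hu) X)"
    by (simp only: Phi_sym[OF hbr_par[OF f h] sym(1,2)] Phi_add[OF c1 cu sym(2) ex])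
  also have "Phi (p + q + r) (hbr (p + r) q ?fu h) X = Phi (p + r) ?fu (Phi q h X) \<ominus>\<^bsub>S\<^esub> ksgn S ((p + r) * q) (Phi q h (Phi (p + r) ?fu X))"
    using sym(3)[OF fu h] by (simp add: ac_simps)
  also have "Phi (p + q + r) (hbr p (q + r) f ?hu) X = Phi p f (Phi (q + r) ?hu X) \<ominus>\<^bsub>S\<^esub> ksgn S (p * (q + r)) (Phi (q + r) ?hu (Phi p f X))"
    using sym(3)[OF f hu] by (simp add: ac_simps)
  also have "Phi (p + q) (hbr p q f h) X = Phi p f (Phi q h X) \<ominus>\<^bsub>S\<^esub> ksgn S (p * q) (Phi q h (Phi p f X))"
    using sym(3)[OF f h] by simp
  also note R = calculation
  have exp: "Phi p f (Phi q h (?u \<otimes>\<^bsub>S\<^esub> X))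
      = ksgn S (q * r) (ksgn S (p * r) (?u \<otimes>\<^bsub>S\<^esub> Phi p f (Phi q h X)) \<oplus>\<^bsub>S\<^esub> Phi (p + r) (\<lambda>x. f (?u \<otimes>\<^bsub>S\<^esub> x)) (Phi q h X))
        \<oplus>\<^bsub>S\<^esub> Phi p f (Phi (q + r) (\<lambda>x. h (?u \<otimes>\<^bsub>S\<^esub> x)) X)"
    if f: "par_map K S M p f" and h: "par_map K S M q h" for p q f h
  proof -
    note hu = par_comp_Lm[OF h u(1)]
    show ?thesis
      using u sym(2) h hu f add_hom.ksgn[OF add_hom_lin[OF Phi_lin[OF f]]]
      by (simp add: Phi_sym[OF h sym(1,2)] add_map_add[OF Phi_map[OF f]] Phi_sym[OF f sym(1)])
  qed
  \<comment> \<open>The summands are made abstract, and the eight parity patterns replace a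
    calculation with exponents of -1.\<close>
  have "\<lbrakk>a \<in> carrier S; b \<in> carrier S; c \<in> carrier S; d \<in> carrier S; e \<in> carrier S; g \<in> carrier S\<rbrakk> \<Longrightarrow>
      (ksgn S (q * r) (ksgn S (p * r) a \<oplus>\<^bsub>S\<^esub> c) \<oplus>\<^bsub>S\<^esub> e) \<ominus>\<^bsub>S\<^esub> ksgn S (p * q) (ksgn S (p * r) (ksgn S (q * r) b \<oplus>\<^bsub>S\<^esub> g) \<oplus>\<^bsub>S\<^esub> d)
      = ksgn S ((p + q) * r) (a \<ominus>\<^bsub>S\<^esub> ksgn S (p * q) b) \<oplus>\<^bsub>S\<^esub>
        (ksgn S (q * r) (c \<ominus>\<^bsub>S\<^esub> ksgn S ((p + r) * q) d) \<oplus>\<^bsub>S\<^esub> (e \<ominus>\<^bsub>S\<^esub> ksgn S (p * (q + r)) g))" for a b c d e g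
    by (cases p; cases q; cases r) (simp_all add: a_minus_def ksgn_1 S.minus_add S.a_ac)
  note alg = this
  have dist: "?u \<otimes>\<^bsub>S\<^esub> (Phi p f (Phi q h X) \<ominus>\<^bsub>S\<^esub> ksgn S (p * q) (Phi q h (Phi p f X)))
      = ?u \<otimes>\<^bsub>S\<^esub> Phi p f (Phi q h X) \<ominus>\<^bsub>S\<^esub> ksgn S (p * q) (?u \<otimes>\<^bsub>S\<^esub> Phi q h (Phi p f X))"
    using u f h sym(2) by (simp add: a_minus_def S.r_distr S.r_minus ksgn_S_mult)
  show ?case
    unfolding R exp[OF f h] exp[OF h f] dist
    by (rule alg) (use u f h fu hu sym(2) in simp_all)
next
  case (rsmult \<alpha> r X p q f h)
  have a: "\<alpha> \<in> carrier K" using rsmult K.grade_closed by auto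
  note c = hbr_par[OF rsmult(4,5)]
  have "Phi (p + q) (hbr p q f h) (X \<otimes>\<^bsub>S\<^esub> sc \<alpha>)
      = (Phi p f (Phi q h X) \<ominus>\<^bsub>S\<^esub> ksgn S (p * q) (Phi q h (Phi p f X))) \<otimes>\<^bsub>S\<^esub> sc \<alpha>"
    unfolding rsmult(3)[OF rsmult(4,5)] using rsmult(2) a by (intro Phi_rsmult c)
  then show ?case
    using rsmult(2,4,5) a by (simp add: Phi_rsmult ksgn_S_mult S.l_minus S.l_distr a_minus_def)
next
  case (add X Y p q f h)
  note c = hbr_par[OF add(5,6)]
  have "Phi (p + q) (hbr p q f h) (X \<oplus>\<^bsub>S\<^esub> Y)
      = (Phi p f (Phi q h X) \<ominus>\<^bsub>S\<^esub> ksgn S (p * q) (Phi q h (Phi p f X)))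
        \<oplus>\<^bsub>S\<^esub> (Phi p f (Phi q h Y) \<ominus>\<^bsub>S\<^esub> ksgn S (p * q) (Phi q h (Phi p f Y)))"
    unfolding add(3)[OF add(5,6)] add(4)[OF add(5,6)] using add(1,2) by (intro add_map_add[OF Phi_map[OF c]])
  then show ?case
    using add(1,2,5,6)
    by (simp add: add_map_add[OF Phi_map] S.ksgn_add a_minus_def S.minus_add S.a_ac)
qed

end

section \<open>The convolution Lie superalgebra of maps from \<open>S(\<gg>)\<close> to \<open>\<gg>\<close>\<close>

context abelian_group
begin

lemma finsum_lessThan_Suc_shift:
  assumes "f \<in> {..<Suc n} \<rightarrow> carrier G"
  shows "finsum G f {..<Suc n} = f 0 \<oplus> finsum G (\<lambda>i. f (Suc i)) {..<n}"
proof -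
  have "{..<Suc n} = insert 0 (Suc ` {..<n})" by (auto simp: image_iff less_Suc_eq_0_disj)
  then have "finsum G f {..<Suc n} = f 0 \<oplus> finsum G f (Suc ` {..<n})"
    using assms by (simp add: Pi_def)
  also have "finsum G f (Suc ` {..<n}) = finsum G (\<lambda>i. f (Suc i)) {..<n}"
    using assms by (intro finsum_reindex) (auto simp: Pi_def)
  finally show ?thesis .
qed

end

locale lie_sym = lie_superalgebra K M + sym_base K M
  for K :: "'k superring" and M :: "('k, 'm, 'x) lie_super_scheme" (structure)
begin

abbreviation br where "br \<equiv> bracket M"

lemma br_map: "X \<in> carrier M \<Longrightarrow> add_map M M (br X)" "Y \<in> carrier M \<Longrightarrow> add_map M M (\<lambda>X. br X Y)"
  by (simp_all add: add_mapI bracket_closed bracket_add_left bracket_add_right)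

lemma br_hom: "X \<in> carrier M \<Longrightarrow> add_hom M M (br X)" "Y \<in> carrier M \<Longrightarrow> add_hom M M (\<lambda>X. br X Y)"
  by (intro add_hom_intro abelian_group_axioms br_map; assumption)+

lemma br_zero [simp]: "X \<in> carrier M \<Longrightarrow> br X \<zero> = \<zero>" "X \<in> carrier M \<Longrightarrow> br \<zero> X = \<zero>"
  using add_hom.zero[OF br_hom(1)] add_hom.zero[OF br_hom(2)] by auto

lemma br_ksgn:
  "\<lbrakk>X \<in> carrier M; Y \<in> carrier M\<rbrakk> \<Longrightarrow> br X (ksgn M e Y) = ksgn M e (br X Y)"
  "\<lbrakk>X \<in> carrier M; Y \<in> carrier M\<rbrakk> \<Longrightarrow> br (ksgn M e X) Y = ksgn M e (br X Y)"
  using add_hom.ksgn[OF br_hom(1)] add_hom.ksgn[OF br_hom(2)] by auto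

lemma br_rsmult_even:
  assumes "X \<in> carrier M" "Y \<in> carrier M" "\<alpha> \<in> grade K 0"
  shows "br (rsmult M X \<alpha>) Y = rsmult M (br X Y) \<alpha>"
proof (rule add_map_eq_grade[OF _ _ _ assms(2)])
  have a: "\<alpha> \<in> carrier K" using assms K.grade_closed by blast
  show "add_map M M (br (rsmult M X \<alpha>))" using assms a by (intro br_map rsmult_closed)
  show "add_map M M (\<lambda>Y. rsmult M (br X Y) \<alpha>)"
    by (rule add_map_comp[OF br_map(1)[OF assms(1)] add_map_rsmult(1)[OF a]])
  fix d Y assume Y: "Y \<in> grade M d"
  then show "br (rsmult M X \<alpha>) Y = rsmult M (br X Y) \<alpha>"
    using bracket_rsmult_left[OF assms(1,3) Y] bracket_rsmult_right[of X Y \<alpha>] assms a grade_closed by simp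
qed

definition Cv where "Cv r f h Z = tensor_lift (add_monoid M) (\<lambda>x y. br (f (tw S r x)) (h y)) Z"

definition conv where "conv r f h x = Cv r f h (Delta x)"
  \<comment> \<open>the convolution bracket of \<open>f\<close> with a map \<open>h\<close> of parity \<open>r\<close>\<close>

lemma Cv_balanced:
  assumes f: "par_map K S M p f" and h: "par_map K S M r h"
  shows "SS.balanced M (\<lambda>x y. br (f (tw S r x)) (h y))"
proof (rule SS.balancedI)
  fix a q s x y \<alpha> assume *: "x \<in> grade S s" "\<alpha> \<in> grade K a" "y \<in> grade S q" "x \<in> carrier S" "y \<in> carrier S" "\<alpha> \<in> carrier K"
  note c = par_mapD(4)[OF f] par_mapD(4)[OF h]
  interpret f: add_hom S M f by (intro add_hom_intro S.abelian_group_axioms abelian_group_axioms par_mapD(3)[OF f])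
  interpret h: add_hom S M h by (intro add_hom_intro S.abelian_group_axioms abelian_group_axioms par_mapD(3)[OF h])
  have "br (f (tw S r (rsmult S x \<alpha>))) (h y) = ksgn M (r * a) (br (rsmult M (f (tw S r x)) \<alpha>) (h y))"
    using * c par_mapD(6)[OF f] by (simp add: S.tw_rsmult S.rsmult_closed br_ksgn rsmult_closed del: f.closed h.closed)
  also have "\<dots> = ksgn M (r * a) (br (f (tw S r x)) (ksgn M (a * (r + q)) (rsmult M (h y) \<alpha>)))"
    using * c by (subst bracket_rsmult_left[OF _ *(2) par_mapD(2)[OF h *(3)]]) auto
  also have "\<dots> = br (f (tw S r x)) (h (ksgn S (a * q) (rsmult S y \<alpha>)))"
    using * c par_mapD(6)[OF h]
    by (simp add: S.rsmult_closed br_ksgn rsmult_closed bracket_closed distrib_left mult.commute flip: add.assoc)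
  finally show "br (f (tw S r (rsmult S x \<alpha>))) (h y) = br (f (tw S r x)) (h (ksgn S (a * q) (rsmult S y \<alpha>)))" .
qed (simp_all add: par_mapD[OF f] par_mapD[OF h] S.tw_add bracket_closed bracket_add_left bracket_add_right)

lemma Cv_map: "\<lbrakk>par_map K S M p f; par_map K S M r h\<rbrakk> \<Longrightarrow> add_map E M (Cv r f h)"
  unfolding Cv_def by (rule SS.lift_map[OF abelian_group_axioms Cv_balanced])

lemma Cv_tens: "\<lbrakk>par_map K S M p f; par_map K S M r h; x \<in> carrier S; y \<in> carrier S\<rbrakk>
    \<Longrightarrow> Cv r f h (tt x y) = br (f (tw S r x)) (h y)"
  unfolding Cv_def by (rule SS.lift_tens[OF abelian_group_axioms Cv_balanced])

lemma Cv_eqI: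
  assumes "add_map E M f" "add_map E M g" "Z \<in> carrier E"
    and "\<And>p q x y. \<lbrakk>x \<in> grade S p; y \<in> grade S q; x \<in> carrier S; y \<in> carrier S\<rbrakk> \<Longrightarrow> f (tt x y) = g (tt x y)"
  shows "f Z = g Z"
  using S_eqI[OF abelian_group_axioms assms] .

lemma conv_map: "\<lbrakk>par_map K S M p f; par_map K S M r h\<rbrakk> \<Longrightarrow> add_map S M (conv r f h)"
  unfolding conv_def by (rule add_map_comp[OF Delta_map Cv_map])

lemma conv_closed [simp]: "\<lbrakk>par_map K S M p f; par_map K S M r h; x \<in> carrier S\<rbrakk> \<Longrightarrow> conv r f h x \<in> carrier M"
  by (rule add_map_closed[OF conv_map])

lemma conv_one: "\<lbrakk>par_map K S M p f; par_map K S M r h\<rbrakk> \<Longrightarrow> conv r f h \<one>\<^bsub>S\<^esub> = br (f \<one>\<^bsub>S\<^esub>) (h \<one>\<^bsub>S\<^esub>)"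
  by (simp add: conv_def Delta_one Cv_tens S.tw_of_grade[OF one_S_grade])

lemma conv_par:
  assumes f: "par_map K S M p f" and h: "par_map K S M r h"
  shows "par_map K S M (p + r) (conv r f h)"
  unfolding par_map_def lin_map_def
proof (intro conjI ballI allI conv_map[OF f h])
  fix x \<alpha> assume x: "x \<in> carrier S" and a: "\<alpha> \<in> carrier K"
  have "Cv r f h (rsmult E Z \<alpha>) = rsmult M (Cv r f h Z) \<alpha>" if "Z \<in> carrier E" for Z
  proof (rule Cv_eqI[OF add_map_comp[OF SS.rsmult_E_map[OF a] Cv_map[OF f h]] add_map_comp[OF Cv_map[OF f h] add_map_rsmult(1)[OF a]] that])
    fix p q x y assume "x \<in> carrier S" "y \<in> carrier S"
    then show "Cv r f h (rsmult E (tt x y) \<alpha>) = rsmult M (Cv r f h (tt x y)) \<alpha>"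
      using a par_mapD(4,6)[OF h] par_mapD(4)[OF f]
      by (simp add: SS.rsmult_tens Cv_tens[OF f h] S.rsmult_closed bracket_rsmult_right)
  qed
  then show "conv r f h (rsmult S x \<alpha>) = rsmult M (conv r f h x) \<alpha>"
    using x a by (simp add: S_rsmult conv_def Delta_rsmult)
next
  fix d x assume x: "x \<in> grade S d"
  show "conv r f h x \<in> grade M (p + r + d)"
    unfolding conv_def
  proof (rule SS.grade_E_induct[OF Delta_grade[OF x] Cv_map[OF f h] abelian_group_axioms grade_subgroup])
    fix s t v w assume *: "v \<in> grade S s" "w \<in> grade S t" "s + t = d"
    have "br (f (tw S r v)) (h w) \<in> grade M ((p + s) + (r + t))"
      using * by (intro bracket_even par_mapD(2)[OF f] par_mapD(2)[OF h] S.tw_grade)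
    then show "Cv r f h (tt v w) \<in> grade M (p + r + d)"
      using * S.grade_closed by (auto simp: Cv_tens[OF f h] ac_simps)
  qed
qed

text \<open>Composition with g is a derivation of the convolution bracket. The co-Leibniz rule is a
  hypothesis on g so that one statement covers both left multiplication by a letter and the maps
  \<open>Phi\<close>.\<close>

lemma conv_coder:
  assumes f: "par_map K S M p f" and h: "par_map K S M r h" and g: "par_map K S S q g"
    and x: "x \<in> carrier S" and d: "Delta (g x) = tf 0 g (\<lambda>x. x) (Delta x) \<oplus>\<^bsub>E\<^esub> tf q (\<lambda>x. x) g (Delta x)"
  shows "conv r f h (g x) = ksgn M (q * r) (conv r (\<lambda>x. f (g x)) h x) \<oplus> conv (r + q) f (\<lambda>x. h (g x)) x"
proof -
  note fg = par_map_comp[OF g f] and hg = par_map_comp[OF g h]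
  note m1 = tf_map[OF par_mapD(1)[OF g] S.par_map_id] and m2 = tf_map[OF S.lin_map_id g]
  have "Cv r f h (tf 0 g (\<lambda>x. x) Z \<oplus>\<^bsub>E\<^esub> tf q (\<lambda>x. x) g Z)
      = ksgn M (q * r) (Cv r (\<lambda>x. f (g x)) h Z) \<oplus> Cv (r + q) f (\<lambda>x. h (g x)) Z" if Z: "Z \<in> carrier E" for Z
  proof (rule Cv_eqI[OF _ _ Z])
    show "add_map E M (\<lambda>Z. Cv r f h (tf 0 g (\<lambda>x. x) Z \<oplus>\<^bsub>E\<^esub> tf q (\<lambda>x. x) g Z))"
      by (rule add_map_comp[OF add_map_sum[OF SS.E_abelian_group m1 m2] Cv_map[OF f h]])
    show "add_map E M (\<lambda>Z. ksgn M (q * r) (Cv r (\<lambda>x. f (g x)) h Z) \<oplus> Cv (r + q) f (\<lambda>x. h (g x)) Z)"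
      by (rule add_map_sum[OF abelian_group_axioms add_map_ksgn[OF abelian_group_axioms Cv_map[OF fg h]] Cv_map[OF f hg]])
    fix s t x y assume [simp]: "x \<in> carrier S" "y \<in> carrier S"
    interpret f: add_hom S M f by (intro add_hom_intro S.abelian_group_axioms abelian_group_axioms par_mapD(3)[OF f])
    have gc: "g z \<in> carrier S" if "z \<in> carrier S" for z using that par_mapD(4)[OF g] by auto
    have tw: "tw S r (g x) = ksgn S (q * r) (g (tw S r x))"
      using par_map_tw[OF S.supermodule_axioms S.supermodule_axioms g, of x r] by (simp add: mult.commute)
    show "Cv r f h (tf 0 g (\<lambda>x. x) (tt x y) \<oplus>\<^bsub>E\<^esub> tf q (\<lambda>x. x) g (tt x y))
      = ksgn M (q * r) (Cv r (\<lambda>x. f (g x)) h (tt x y)) \<oplus> Cv (r + q) f (\<lambda>x. h (g x)) (tt x y)"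
      unfolding Cv_tens[OF f hg \<open>x \<in> carrier S\<close> \<open>y \<in> carrier S\<close>] using gc par_mapD(4)[OF f] par_mapD(4)[OF h]
      by (simp add: tf_tens[OF par_mapD(1)[OF g] S.par_map_id] tf_tens[OF S.lin_map_id g] add_map_add[OF Cv_map[OF f h]]
          SS.tens_closed Cv_tens[OF f h] Cv_tens[OF fg h] tw br_ksgn)
  qed
  from this[OF Delta_closed[OF x]] show ?thesis unfolding conv_def d .
qed

lemma conv_sym:
  assumes f: "par_map K S M p f" and h: "par_map K S M r h" and v: "v \<in> grade M q" and x: "x \<in> carrier S"
  shows "conv r f h (sym_of K M v \<otimes>\<^bsub>S\<^esub> x) = ksgn M (q * r) (conv r (\<lambda>x. f (sym_of K M v \<otimes>\<^bsub>S\<^esub> x)) h x)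
    \<oplus> conv (r + q) f (\<lambda>x. h (sym_of K M v \<otimes>\<^bsub>S\<^esub> x)) x"
  by (rule conv_coder[OF f h par_Lm[OF sym_of_grade[OF v]] x]) (simp add: Delta_sym[OF v x] L2_def)

lemma conv_Phi:
  assumes f: "par_map K S M p f" and h: "par_map K S M r h" and g: "par_map K S M q g" and x: "x \<in> carrier S"
  shows "conv r f h (Phi q g x) = ksgn M (q * r) (conv r (\<lambda>x. f (Phi q g x)) h x) \<oplus> conv (r + q) f (\<lambda>x. h (Phi q g x)) x"
  by (rule conv_coder[OF f h Phi_par[OF g] x Phi_coder[OF g x]])

lemma conv_cong:
  assumes "par_map K S M p f" "par_map K S M r h" "par_map K S M p f'" "par_map K S M r h'" "x \<in> carrier S"
    and "\<And>x. x \<in> carrier S \<Longrightarrow> f x = f' x" "\<And>x. x \<in> carrier S \<Longrightarrow> h x = h' x"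
  shows "conv r f h x = conv r f' h' x"
proof -
  have "Cv r f h Z = Cv r f' h' Z" if "Z \<in> carrier E" for Z
    by (rule Cv_eqI[OF Cv_map[OF assms(1,2)] Cv_map[OF assms(3,4)] that])
      (simp add: Cv_tens[OF assms(1,2)] Cv_tens[OF assms(3,4)] assms(6,7))
  then show ?thesis using assms(5) by (simp add: conv_def)
qed

lemma conv_add_right:
  assumes f: "par_map K S M p f" and g: "par_map K S M r g" and h: "par_map K S M r h" and k: "par_map K S M r k"
    and x: "x \<in> carrier S" and e: "\<And>x. x \<in> carrier S \<Longrightarrow> k x = ksgn M e (g x) \<oplus> h x"
  shows "conv r f k x = ksgn M e (conv r f g x) \<oplus> conv r f h x"
proof -
  have "Cv r f k Z = ksgn M e (Cv r f g Z) \<oplus> Cv r f h Z" if "Z \<in> carrier E" for Z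
    by (rule Cv_eqI[OF Cv_map[OF f k] add_map_sum[OF abelian_group_axioms add_map_ksgn[OF abelian_group_axioms Cv_map[OF f g]] Cv_map[OF f h]] that])
      (simp add: Cv_tens[OF f g] Cv_tens[OF f h] Cv_tens[OF f k] e bracket_add_right br_ksgn par_mapD(4)[OF f] par_mapD(4)[OF g] par_mapD(4)[OF h])
  then show ?thesis using x by (simp add: conv_def)
qed

lemma conv_add_left:
  assumes f: "par_map K S M p f" and g: "par_map K S M p g" and k: "par_map K S M p k" and h: "par_map K S M r h"
    and x: "x \<in> carrier S" and e: "\<And>x. x \<in> carrier S \<Longrightarrow> k x = ksgn M e (f x) \<oplus> g x"
  shows "conv r k h x = ksgn M e (conv r f h x) \<oplus> conv r g h x"
proof -
  have "Cv r k h Z = ksgn M e (Cv r f h Z) \<oplus> Cv r g h Z" if "Z \<in> carrier E" for Z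
    by (rule Cv_eqI[OF Cv_map[OF k h] add_map_sum[OF abelian_group_axioms add_map_ksgn[OF abelian_group_axioms Cv_map[OF f h]] Cv_map[OF g h]] that])
      (simp add: Cv_tens[OF f h] Cv_tens[OF g h] Cv_tens[OF k h] e bracket_add_left br_ksgn par_mapD(4)[OF f] par_mapD(4)[OF g] par_mapD(4)[OF h])
  then show ?thesis using x by (simp add: conv_def)
qed

text \<open>An even scalar commutes with every scalar, which keeps the scaled map right
  linear.\<close>

lemma par_rsmult:
  assumes f: "par_map K S M p f" and c: "c \<in> grade K 0"
  shows "par_map K S M p (\<lambda>x. rsmult M (f x) c)"
proof -
  have cK: "c \<in> carrier K" using c by (rule K.grade_closed)
  have "rsmult M (rsmult M m \<alpha>) c = rsmult M (rsmult M m c) \<alpha>" if "m \<in> carrier M" "\<alpha> \<in> carrier K" for m \<alpha>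
  proof -
    have "\<alpha> \<otimes>\<^bsub>K\<^esub> c = c \<otimes>\<^bsub>K\<^esub> \<alpha>"
    proof (rule K.add_map_eq_grade[OF _ _ _ that(2)])
      show "add_map K K (\<lambda>\<alpha>. \<alpha> \<otimes>\<^bsub>K\<^esub> c)" "add_map K K (\<lambda>\<alpha>. c \<otimes>\<^bsub>K\<^esub> \<alpha>)"
        using cK by (auto intro!: add_mapI simp: K.l_distr K.r_distr)
      fix d \<alpha> assume "\<alpha> \<in> grade K d" then show "\<alpha> \<otimes>\<^bsub>K\<^esub> c = c \<otimes>\<^bsub>K\<^esub> \<alpha>" using K.supercomm[OF _ c] by simp
    qed
    then show ?thesis using that cK by (simp flip: rsmult_assoc)
  qed
  moreover have "rsmult M (f x) c \<in> grade M (p + d)" if "x \<in> grade S d" for x d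
    using rsmult_grade[OF par_mapD(2)[OF f that] c] by simp
  ultimately show ?thesis
    unfolding par_map_def lin_map_def using par_mapD[OF f] cK
    by (auto intro!: add_map_comp[OF _ add_map_rsmult(1)])
qed

lemma conv_scale_right:
  assumes f: "par_map K S M p f" and h: "par_map K S M r h" and c: "c \<in> grade K 0" and x: "x \<in> carrier S"
  shows "conv r f (\<lambda>x. rsmult M (h x) c) x = rsmult M (conv r f h x) c"
proof -
  have cK: "c \<in> carrier K" using c by (rule K.grade_closed)
  note hc = par_rsmult[OF h c]
  have "Cv r f (\<lambda>x. rsmult M (h x) c) Z = rsmult M (Cv r f h Z) c" if "Z \<in> carrier E" for Z
    by (rule Cv_eqI[OF Cv_map[OF f hc] add_map_comp[OF Cv_map[OF f h] add_map_rsmult(1)[OF cK]] that])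
      (simp add: Cv_tens[OF f h] Cv_tens[OF f hc] bracket_rsmult_right par_mapD(4)[OF f] par_mapD(4)[OF h] cK)
  then show ?thesis using x by (simp add: conv_def)
qed

lemma conv_scale_left:
  assumes f: "par_map K S M p f" and h: "par_map K S M r h" and c: "c \<in> grade K 0" and x: "x \<in> carrier S"
  shows "conv r (\<lambda>x. rsmult M (f x) c) h x = rsmult M (conv r f h x) c"
proof -
  have cK: "c \<in> carrier K" using c by (rule K.grade_closed)
  note fc = par_rsmult[OF f c]
  have "Cv r (\<lambda>x. rsmult M (f x) c) h Z = rsmult M (Cv r f h Z) c" if "Z \<in> carrier E" for Z
    by (rule Cv_eqI[OF Cv_map[OF fc h] add_map_comp[OF Cv_map[OF f h] add_map_rsmult(1)[OF cK]] that])
      (simp add: Cv_tens[OF f h] Cv_tens[OF fc h] br_rsmult_even par_mapD(4)[OF f] par_mapD(4)[OF h] c)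
  then show ?thesis using x by (simp add: conv_def)
qed

lemma conv_zero:
  "\<lbrakk>par_map K S M p f; x \<in> carrier S\<rbrakk> \<Longrightarrow> conv r f (\<lambda>x. \<zero>) x = \<zero>"
  "\<lbrakk>par_map K S M r f; x \<in> carrier S\<rbrakk> \<Longrightarrow> conv r (\<lambda>x. \<zero>) f x = \<zero>"
proof -
  assume f: "par_map K S M p f" and x: "x \<in> carrier S"
  note z = par_map_zero[of S r]
  show "conv r f (\<lambda>x. \<zero>) x = \<zero>"
    using conv_add_right[OF f z z z x, of 0] conv_closed[OF f z x] by (intro idem_zero) simp_all
next
  assume f: "par_map K S M r f" and x: "x \<in> carrier S"
  note z = par_map_zero[of S 0]
  show "conv r (\<lambda>x. \<zero>) f x = \<zero>"
    using conv_add_left[OF z z z f x, of 0] conv_closed[OF z f x] by (intro idem_zero) simp_all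
qed

text \<open>At 1 it is the antisymmetry of the bracket. By \<open>conv_sym\<close> both sides
  satisfy the same recursion for a letter in front, with roles of the two summands
  exchanged.\<close>

lemma conv_antisym:
  assumes "x \<in> carrier S" "par_map K S M p f" "par_map K S M r h"
  shows "conv r f h x = \<ominus> ksgn M (p * r) (conv p h f x)"
  using assms
proof (induction arbitrary: p r f h rule: S_induct_right)
  case (one p r f h)
  have "f \<one>\<^bsub>S\<^esub> \<in> grade M p" "h \<one>\<^bsub>S\<^esub> \<in> grade M r"
    using par_mapD(2)[OF one(1) one_S_grade] par_mapD(2)[OF one(2) one_S_grade] by auto
  from super_antisym[OF this] show ?case by (simp only: conv_one[OF one] conv_one[OF one(2,1)])
next
  case (sym v q X p r f h)
  note f = sym(4) and h = sym(5)
  note fv = par_comp_Lm[OF f sym_of_grade[OF sym(1)]] and hv = par_comp_Lm[OF h sym_of_grade[OF sym(1)]]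
  have "conv r (\<lambda>x. f (sym_of K M v \<otimes>\<^bsub>S\<^esub> x)) h X = \<ominus> ksgn M ((p + q) * r) (conv (p + q) h (\<lambda>x. f (sym_of K M v \<otimes>\<^bsub>S\<^esub> x)) X)"
    by (rule sym(3)[OF fv h])
  moreover have "conv (r + q) f (\<lambda>x. h (sym_of K M v \<otimes>\<^bsub>S\<^esub> x)) X = \<ominus> ksgn M (p * (r + q)) (conv p (\<lambda>x. h (sym_of K M v \<otimes>\<^bsub>S\<^esub> x)) f X)"
    by (rule sym(3)[OF f hv])
  moreover have "\<lbrakk>a \<in> carrier M; b \<in> carrier M\<rbrakk> \<Longrightarrow>
      ksgn M (q * r) (\<ominus> ksgn M ((p + q) * r) a) \<oplus> \<ominus> ksgn M (p * (r + q)) b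
      = \<ominus> ksgn M (p * r) (ksgn M (q * p) b \<oplus> a)" for a b
    by (cases p; cases q; cases r) (simp_all add: ksgn_1 minus_add a_ac)
  ultimately show ?case
    using sym(2) f h fv hv by (simp add: conv_sym[OF f h sym(1,2)] conv_sym[OF h f sym(1,2)])
next
  case (rsmult \<alpha> q X p r f h)
  note c = conv_par[OF rsmult(4,5)] conv_par[OF rsmult(5,4)]
  have a: "\<alpha> \<in> carrier K" using rsmult(1) by (rule K.grade_closed)
  have "conv r f h (rsmult S X \<alpha>) = rsmult M (\<ominus> ksgn M (p * r) (conv p h f X)) \<alpha>"
    using par_mapD(6)[OF c(1) rsmult(2) a] unfolding rsmult(3)[OF rsmult(4,5)] .
  also have "\<dots> = \<ominus> ksgn M (p * r) (conv p h f (rsmult S X \<alpha>))"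
    using par_mapD(4)[OF c(2) rsmult(2)] a
    by (simp add: par_mapD(6)[OF c(2) rsmult(2) a] neg_ksgn rsmult_ksgn rsmult_closed)
  finally show ?case using a by (simp add: S_rsmult)
next
  case (add X Y p r f h)
  note c = conv_par[OF add(5,6)] conv_par[OF add(6,5)]
  have "conv r f h (X \<oplus>\<^bsub>S\<^esub> Y) = \<ominus> ksgn M (p * r) (conv p h f X) \<oplus> \<ominus> ksgn M (p * r) (conv p h f Y)"
    unfolding par_mapD(5)[OF c(1) add(1,2)] add(3)[OF add(5,6)] add(4)[OF add(5,6)] ..
  also have "\<dots> = \<ominus> ksgn M (p * r) (conv p h f (X \<oplus>\<^bsub>S\<^esub> Y))"
    using par_mapD(4)[OF c(2)] add(1,2) by (simp add: par_mapD(5)[OF c(2) add(1,2)] ksgn_add minus_add)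
  finally show ?case .
qed

text \<open>At 1 it is the Jacobi identity of the Lie superalgebra. A letter in front is given to
  one of f, g and h in each term, and the three resulting identities are instances of the induction
  hypothesis.\<close>

lemma conv_jacobi:
  assumes "x \<in> carrier S" "par_map K S M p f" "par_map K S M r g" "par_map K S M s h"
  shows "conv s (conv r f g) h x = conv (r + s) f (conv s g h) x \<ominus> ksgn M (p * r) (conv (p + s) g (conv s f h) x)"
  using assms
proof (induction arbitrary: p r s f g h rule: S_induct_right)
  case (one p r s f g h)
  note f = one(1) and g = one(2) and h = one(3)
  have "f \<one>\<^bsub>S\<^esub> \<in> grade M p" "g \<one>\<^bsub>S\<^esub> \<in> grade M r" "h \<one>\<^bsub>S\<^esub> \<in> carrier M"
    using par_mapD(2)[OF f one_S_grade] par_mapD(2)[OF g one_S_grade] par_mapD(4)[OF h] by auto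
  then show ?case
    by (simp add: conv_one[OF f g] conv_one[OF g h] conv_one[OF f h] conv_one[OF conv_par[OF f g] h]
        conv_one[OF f conv_par[OF g h]] conv_one[OF g conv_par[OF f h]] super_jacobi)
next
  case (sym v q X p r s f g h)
  note f = sym(4) and g = sym(5) and h = sym(6) and v = sym(1) and X = sym(2)
  let ?u = "sym_of K M v"
  have u: "?u \<in> grade S q" "?u \<in> carrier S" using v sym_of_grade grade_closed by auto
  let ?f = "\<lambda>x. f (?u \<otimes>\<^bsub>S\<^esub> x)" and ?g = "\<lambda>x. g (?u \<otimes>\<^bsub>S\<^esub> x)" and ?h = "\<lambda>x. h (?u \<otimes>\<^bsub>S\<^esub> x)"
  note fv = par_comp_Lm[OF f u(1)] and gv = par_comp_Lm[OF g u(1)] and hv = par_comp_Lm[OF h u(1)]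
  have ext: "conv s (conv r f g) h (?u \<otimes>\<^bsub>S\<^esub> X) = ksgn M (q * s) (ksgn M (q * r) (conv s (conv r (\<lambda>x. f (?u \<otimes>\<^bsub>S\<^esub> x)) g) h X) \<oplus> conv s (conv (r + q) f (\<lambda>x. g (?u \<otimes>\<^bsub>S\<^esub> x))) h X)
      \<oplus> conv (s + q) (conv r f g) (\<lambda>x. h (?u \<otimes>\<^bsub>S\<^esub> x)) X"
    if f: "par_map K S M p f" and g: "par_map K S M r g" and h: "par_map K S M s h" for p r s f g h
  proof -
    let ?f = "\<lambda>x. f (?u \<otimes>\<^bsub>S\<^esub> x)" and ?g = "\<lambda>x. g (?u \<otimes>\<^bsub>S\<^esub> x)" and ?h = "\<lambda>x. h (?u \<otimes>\<^bsub>S\<^esub> x)"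
    note fv = par_comp_Lm[OF f u(1)] and gv = par_comp_Lm[OF g u(1)] and hv = par_comp_Lm[OF h u(1)]
    note c = conv_par[OF fv g] and d = conv_par[OF f gv] and e = par_comp_Lm[OF conv_par[OF f g] u(1)]
    have "conv s (\<lambda>x. conv r f g (?u \<otimes>\<^bsub>S\<^esub> x)) h X = ksgn M (q * r) (conv s (conv r ?f g) h X) \<oplus> conv s (conv (r + q) f ?g) h X"
      by (rule conv_add_left[where p = "p + r + q", OF _ _ e h X conv_sym[OF f g v]]) (use c d in \<open>simp_all add: ac_simps\<close>)
    then show ?thesis by (simp only: conv_sym[OF conv_par[OF f g] h v X])
  qed
  have ext2: "conv (r + s) f (conv s g h) (?u \<otimes>\<^bsub>S\<^esub> X) = ksgn M (q * (r + s)) (conv (r + s) (\<lambda>x. f (?u \<otimes>\<^bsub>S\<^esub> x)) (conv s g h) X)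
      \<oplus> (ksgn M (q * s) (conv (r + s + q) f (conv s (\<lambda>x. g (?u \<otimes>\<^bsub>S\<^esub> x)) h) X)
        \<oplus> conv (r + s + q) f (conv (s + q) g (\<lambda>x. h (?u \<otimes>\<^bsub>S\<^esub> x))) X)"
    if f: "par_map K S M p f" and g: "par_map K S M r g" and h: "par_map K S M s h" for p r s f g h
  proof -
    let ?f = "\<lambda>x. f (?u \<otimes>\<^bsub>S\<^esub> x)" and ?g = "\<lambda>x. g (?u \<otimes>\<^bsub>S\<^esub> x)" and ?h = "\<lambda>x. h (?u \<otimes>\<^bsub>S\<^esub> x)"
    note fv = par_comp_Lm[OF f u(1)] and gv = par_comp_Lm[OF g u(1)] and hv = par_comp_Lm[OF h u(1)]
    note c = conv_par[OF gv h] and d = conv_par[OF g hv] and e = par_comp_Lm[OF conv_par[OF g h] u(1)]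
    have "conv (r + s + q) f (\<lambda>x. conv s g h (?u \<otimes>\<^bsub>S\<^esub> x)) X
        = ksgn M (q * s) (conv (r + s + q) f (conv s ?g h) X) \<oplus> conv (r + s + q) f (conv (s + q) g ?h) X"
      by (rule conv_add_right[OF f _ _ e X conv_sym[OF g h v]]) (use c d in \<open>simp_all add: ac_simps\<close>)
    then show ?thesis by (simp only: conv_sym[OF f conv_par[OF g h] v X])
  qed
  have alg: "\<lbrakk>a \<in> carrier M; b \<in> carrier M; c \<in> carrier M; d \<in> carrier M; e \<in> carrier M; k \<in> carrier M\<rbrakk> \<Longrightarrow>
      ksgn M (q * s) (ksgn M (q * r) (a \<ominus> ksgn M ((p + q) * r) b) \<oplus> (c \<ominus> ksgn M (p * (r + q)) d)) \<oplus> (e \<ominus> ksgn M (p * r) k)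
      = (ksgn M (q * (r + s)) a \<oplus> (ksgn M (q * s) c \<oplus> e)) \<ominus> ksgn M (p * r) (ksgn M (q * (p + s)) d \<oplus> (ksgn M (q * s) b \<oplus> k))"
    for a b c d e k
    by (cases p; cases q; cases r; cases s) (simp_all add: a_minus_def ksgn_1 minus_add a_ac)
  have i: "conv s (conv r ?f g) h X = conv (r + s) ?f (conv s g h) X \<ominus> ksgn M ((p + q) * r) (conv (p + s + q) g (conv s ?f h) X)"
    "conv s (conv (r + q) f ?g) h X = conv (r + s + q) f (conv s ?g h) X \<ominus> ksgn M (p * (r + q)) (conv (p + s) ?g (conv s f h) X)"
    "conv (s + q) (conv r f g) ?h X = conv (r + s + q) f (conv (s + q) g ?h) X \<ominus> ksgn M (p * r) (conv (p + s + q) g (conv (s + q) f ?h) X)"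
    using sym(3)[OF fv g h] sym(3)[OF f gv h] sym(3)[OF f g hv] by (simp_all add: ac_simps)
  have P: "par_map K S M (r + s + q) (conv s ?g h)" "par_map K S M (p + s + q) (conv s ?f h)"
    "par_map K S M (r + s + q) (conv (s + q) g ?h)" "par_map K S M (p + s + q) (conv (s + q) f ?h)"
    using conv_par[OF gv h] conv_par[OF fv h] conv_par[OF g hv] conv_par[OF f hv] by (simp_all add: ac_simps)
  show ?case
    unfolding ext[OF f g h] ext2[OF f g h] ext2[OF g f h] i
    by (rule alg)
      (rule conv_closed[OF fv conv_par[OF g h] X] conv_closed[OF g P(2) X] conv_closed[OF f P(1) X]
        conv_closed[OF gv conv_par[OF f h] X] conv_closed[OF f P(3) X] conv_closed[OF g P(4) X])+
next
  case (rsmult \<alpha> q X p r s f g h)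
  note f = rsmult(4) and g = rsmult(5) and h = rsmult(6)
  note c = conv_par[OF conv_par[OF f g] h] conv_par[OF f conv_par[OF g h]] conv_par[OF g conv_par[OF f h]]
  have a: "\<alpha> \<in> carrier K" using rsmult K.grade_closed by blast
  show ?case
    using rsmult(2) a rsmult(3)[OF f g h] par_mapD(6)[OF c(1), of X \<alpha>] par_mapD(6)[OF c(2), of X \<alpha>] par_mapD(6)[OF c(3), of X \<alpha>]
      par_mapD(4)[OF c(2)] par_mapD(4)[OF c(3)]
    by (simp add: S_rsmult a_minus_def neg_ksgn rsmult_add_left rsmult_ksgn rsmult_closed)
next
  case (add X Y p r s f g h)
  note f = add(5) and g = add(6) and h = add(7)
  note c = conv_par[OF conv_par[OF f g] h] conv_par[OF f conv_par[OF g h]] conv_par[OF g conv_par[OF f h]]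
  show ?case
    using add(1,2) add(3)[OF f g h] add(4)[OF f g h] par_mapD(4)[OF c(2)] par_mapD(4)[OF c(3)]
    by (simp add: par_mapD(5)[OF c(1)] par_mapD(5)[OF c(2)] par_mapD(5)[OF c(3)] a_minus_def ksgn_add minus_add a_ac)
qed

text \<open>The augmentation kills every letter that reaches the left factor, so only the summand
  \<open>1 \<otimes> x\<close> of the coproduct contributes.\<close>

lemma conv_cst:
  assumes "x \<in> carrier S" "a \<in> grade M p" "par_map K S M r h"
  shows "conv r (cst a) h x = br a (h x)"
  using assms(1,3)
proof (induction arbitrary: r h rule: S_induct_right)
  case (one r h)
  then show ?case using assms(2) grade_closed by (simp add: conv_one[OF cst_par[OF assms(2)] one] cst_one)
next
  case (sym v q X r h)
  note c = cst_par[OF assms(2)] and aM = grade_closed[OF assms(2)] and vM = grade_closed[OF sym(1)]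
  note hv = par_comp_Lm[OF sym(4) sym_of_grade[OF sym(1)]]
  have "conv r (\<lambda>x. cst a (sym_of K M v \<otimes>\<^bsub>S\<^esub> x)) h X = conv r (\<lambda>x. \<zero>) h X"
    by (rule conv_cong[OF par_comp_Lm[OF c sym_of_grade[OF sym(1)]] sym(4) par_map_zero sym(4) sym(2)])
      (simp_all add: cst_sym aM vM)
  then have "conv r (\<lambda>x. cst a (sym_of K M v \<otimes>\<^bsub>S\<^esub> x)) h X = \<zero>" using conv_zero(2)[OF sym(4,2)] by simp
  moreover have "br a (h (sym_of K M v \<otimes>\<^bsub>S\<^esub> X)) \<in> carrier M"
    using aM vM sym(2) par_mapD(4)[OF sym(4)] by (intro bracket_closed) auto
  ultimately show ?case
    using sym(3)[OF hv] by (simp add: conv_sym[OF c sym(4,1,2)])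
next
  case (rsmult \<alpha> q X r h)
  then show ?case
    using par_mapD(6)[OF conv_par[OF cst_par[OF assms(2)] rsmult(4)], of X \<alpha>] par_mapD(4,6)[OF rsmult(4)] K.grade_closed grade_closed[OF assms(2)]
    by (simp add: S_rsmult bracket_rsmult_right)
next
  case (add X Y r h)
  then show ?case
    using par_mapD(4,5)[OF add(5)] grade_closed[OF assms(2)]
    by (simp add: add_map_add[OF conv_map[OF cst_par[OF assms(2)] add(5)]] bracket_add_right)
qed

section \<open>Powers of ad \<pi> and the lower central series\<close>

fun adpow :: "bit \<Rightarrow> 'm \<Rightarrow> nat \<Rightarrow> (('k + 'm) fword \<Rightarrow>\<^sub>0 int) set set \<Rightarrow> 'm" where
  "adpow p a 0 = cst a"
| "adpow p a (Suc n) = conv p pr (adpow p a n)"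
  \<comment> \<open>\<open>(ad \<pi>)\<^sup>n (a \<epsilon>)\<close> for the projection \<open>\<pi> : S(\<gg>) \<rightarrow> \<gg>\<close>; it equals \<open>(t\<^sup>n)\<^sup>a\<close>\<close>

lemma adpow_par: "a \<in> grade M p \<Longrightarrow> par_map K S M p (adpow p a n)"
proof (induction n)
  case (Suc n)
  then show ?case using conv_par[OF pr_par Suc.IH] by simp
qed (simp add: cst_par)

definition Vm where "Vm p q a b i j = conv q (adpow p a i) (adpow q b j)"

lemma Vm_par: "\<lbrakk>a \<in> grade M p; b \<in> grade M q\<rbrakk> \<Longrightarrow> par_map K S M (p + q) (Vm p q a b i j)"
  unfolding Vm_def by (rule conv_par[OF adpow_par adpow_par])

lemma Vm_zero: "\<lbrakk>a \<in> grade M p; b \<in> grade M q; x \<in> carrier S\<rbrakk> \<Longrightarrow> Vm p q a b 0 j x = br a (adpow q b j x)"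
  by (simp add: Vm_def conv_cst[OF _ _ adpow_par])

text \<open>The Jacobi identity for \<pi> and the two powers, solved for the outer bracket.\<close>

lemma Vm_ad:
  assumes "a \<in> grade M p" "b \<in> grade M q" "x \<in> carrier S"
  shows "conv (p + q) pr (Vm p q a b i j) x = Vm p q a b (Suc i) j x \<oplus> Vm p q a b i (Suc j) x"
proof -
  note A = adpow_par[OF assms(1), of i] and B = adpow_par[OF assms(2), of j]
  have "Vm p q a b (Suc i) j x = conv (p + q) pr (Vm p q a b i j) x \<ominus> Vm p q a b i (Suc j) x"
    using conv_jacobi[OF assms(3) pr_par A B] by (simp add: Vm_def)
  moreover have "conv (p + q) pr (Vm p q a b i j) x \<in> carrier M" "Vm p q a b i (Suc j) x \<in> carrier M"
    using conv_closed[OF pr_par Vm_par[OF assms(1,2)] assms(3)] par_mapD(4)[OF Vm_par[OF assms(1,2)] assms(3)] by auto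
  ultimately show ?thesis by (simp add: a_minus_def a_assoc l_neg)
qed

inductive_set LC :: "nat \<Rightarrow> 'm set" for n where
  fold: "\<lbrakk>set Xs \<subseteq> carrier M; length Xs = n; Y \<in> carrier M\<rbrakk> \<Longrightarrow> foldr br Xs Y \<in> LC n"
| zero: "\<zero> \<in> LC n"
| add: "\<lbrakk>x \<in> LC n; y \<in> LC n\<rbrakk> \<Longrightarrow> x \<oplus> y \<in> LC n"
| neg: "x \<in> LC n \<Longrightarrow> \<ominus> x \<in> LC n"
  \<comment> \<open>the lower central series\<close>

lemma foldr_br_closed: "\<lbrakk>set Xs \<subseteq> carrier M; Y \<in> carrier M\<rbrakk> \<Longrightarrow> foldr br Xs Y \<in> carrier M"
  by (induction Xs) (simp_all add: bracket_closed)

lemma foldr_br_zero: "set Xs \<subseteq> carrier M \<Longrightarrow> foldr br Xs \<zero> = \<zero>"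
  by (induction Xs) simp_all

lemma LC_carrier: "x \<in> LC n \<Longrightarrow> x \<in> carrier M"
  by (induction rule: LC.induct) (simp_all add: foldr_br_closed)

lemma LC_br:
  assumes "X \<in> carrier M" "y \<in> LC n" shows "br X y \<in> LC (Suc n)"
  using assms(2)
proof (induction rule: LC.induct)
  case (fold Xs Y)
  then show ?case using LC.fold[of "X # Xs" "Suc n" Y] assms(1) by simp
next
  case zero
  then show ?case using assms(1) by (simp add: LC.zero)
next
  case (add x y)
  then show ?case using assms(1) LC_carrier by (simp add: bracket_add_right LC.add)
next
  case (neg x)
  then show ?case using assms(1) LC_carrier add_hom.neg[OF br_hom(1)] by (simp add: LC.neg)
qed

lemma LC_nilpotent:
  assumes "lie_nilpotent N M" "x \<in> LC n" "N \<le> n" shows "x = \<zero>"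
  using assms(2)
proof (induction rule: LC.induct)
  case (fold Xs Y)
  let ?As = "take (n - N) Xs" and ?Bs = "drop (n - N) Xs"
  have "foldr br Xs Y = foldr br ?As (foldr br ?Bs Y)"
    by (subst append_take_drop_id[of "n - N" Xs, symmetric]) (simp only: foldr_append)
  also have "foldr br ?Bs Y = \<zero>"
    using assms(1,3) fold set_drop_subset[of "n - N" Xs] unfolding lie_nilpotent_def by auto
  also have "foldr br ?As \<zero> = \<zero>"
  proof -
    have "set ?As \<subseteq> carrier M" using fold set_take_subset[of "n - N" Xs] by auto
    then show ?thesis by (rule foldr_br_zero)
  qed
  finally show ?case .
qed simp_all

lemma conv_pr_LC:
  assumes h: "par_map K S M r h" and H: "\<And>x. x \<in> carrier S \<Longrightarrow> h x \<in> LC n" and x: "x \<in> carrier S"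
  shows "conv r pr h x \<in> LC (Suc n)"
  unfolding conv_def using Delta_closed[OF x]
proof (induction rule: SS.tensor_induct)
  case (tens p q v w)
  then show ?case using H by (simp add: Cv_tens[OF pr_par h] LC_br)
next
  case (add Y Z)
  then show ?case by (simp add: add_map_add[OF Cv_map[OF pr_par h]] LC.add)
qed

lemma adpow_LC: "\<lbrakk>a \<in> grade M p; x \<in> carrier S\<rbrakk> \<Longrightarrow> adpow p a n x \<in> LC n"
proof (induction n arbitrary: x)
  case 0
  then show ?case using LC.fold[of "[]" 0 "cst a x"] par_mapD(4)[OF cst_par] by simp
next
  case (Suc n)
  then show ?case using conv_pr_LC[OF adpow_par] by simp
qed

text \<open>Brackets between two members of the lower central series are avoided:
  \<open>Vm_ad\<close> trades i for j until the left entry is a itself, and a bracket with a is one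
  application of ad. The \<open>Suc\<close> counts this application.\<close>

lemma Vm_LC: "\<lbrakk>a \<in> grade M p; b \<in> grade M q; x \<in> carrier S\<rbrakk> \<Longrightarrow> Vm p q a b i j x \<in> LC (Suc (i + j))"
proof (induction i arbitrary: j x)
  case 0
  then show ?case using LC_br[OF grade_closed] adpow_LC by (simp add: Vm_zero)
next
  case (Suc i)
  have c: "conv (p + q) pr (Vm p q a b i j) x \<in> LC (Suc (Suc (i + j)))"
    by (rule conv_pr_LC[OF Vm_par]) (use Suc in auto)
  have d: "Vm p q a b i (Suc j) x \<in> LC (Suc (Suc (i + j)))" using Suc.IH[of x "Suc j"] Suc.prems by simp
  have "Vm p q a b (Suc i) j x = conv (p + q) pr (Vm p q a b i j) x \<oplus> \<ominus> Vm p q a b i (Suc j) x"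
    using Vm_ad[OF Suc.prems, of i j] par_mapD(4)[OF Vm_par[OF Suc.prems(1,2)] Suc.prems(3)]
    by (simp add: a_assoc r_neg)
  then show ?case using c d by (simp add: LC.add LC.neg)
qed

lemma Vm_nilpotent:
  "\<lbrakk>lie_nilpotent N M; a \<in> grade M p; b \<in> grade M q; x \<in> carrier S; N \<le> Suc (i + j)\<rbrakk> \<Longrightarrow> Vm p q a b i j x = \<zero>"
  by (rule LC_nilpotent[OF _ Vm_LC])

end

section \<open>The maps \<open>\<phi>\<^sup>a\<close> as polynomials in an inner derivation\<close>

definition rm :: "nat \<Rightarrow> 'a list \<Rightarrow> 'a list"
  where "rm i xs = take i xs @ drop (Suc i) xs"

lemma length_rm [simp]: "i < length xs \<Longrightarrow> length (rm i xs) = length xs - 1"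
  by (simp add: rm_def)

lemma rm_Cons [simp]: "rm 0 (x # xs) = xs" "rm (Suc i) (x # xs) = x # rm i xs"
  by (simp_all add: rm_def)

lemma list_all2_rm: "list_all2 P xs ys \<Longrightarrow> list_all2 P (rm i xs) (rm i ys)"
  unfolding rm_def by (intro list_all2_appendI list_all2_takeI list_all2_dropI)

lemma sum_list_rm: "i < length ps \<Longrightarrow> sum_list ps = ps ! i + sum_list (rm i (ps :: bit list))"
proof (induction ps arbitrary: i)
  case (Cons p ps)
  then show ?case by (cases i) (auto simp: ac_simps)
qed simp

text \<open>The increasing bijection onto the numbers different from i; it re-indexes a list from
  which the i-th entry has been removed.\<close>

definition skip :: "nat \<Rightarrow> nat \<Rightarrow> nat"
  where "skip i m = (if m < i then m else Suc m)"

lemma skip_less_iff [simp]: "skip i m < skip i n \<longleftrightarrow> m < n"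
  by (auto simp: skip_def)

lemma skip_less_self [simp]: "skip i m < i \<longleftrightarrow> m < i"
  by (auto simp: skip_def)

lemma skip_neq [simp]: "skip i m \<noteq> i" "i \<noteq> skip i m"
  by (auto simp: skip_def)

lemma skip_inj [simp]: "skip i m = skip i n \<longleftrightarrow> m = n"
  by (auto simp: skip_def split: if_splits)

lemma nth_rm: "\<lbrakk>i < length xs; m < length xs - 1\<rbrakk> \<Longrightarrow> rm i xs ! m = xs ! skip i m"
  by (auto simp: rm_def skip_def nth_append min_def)

text \<open>A permutation of n + 1 places is its first value together with the order of the
  remaining entries. The first value is singled out because its letter is the outermost ad.\<close>

definition perm_ext :: "nat \<Rightarrow> (nat \<Rightarrow> nat) \<Rightarrow> nat \<Rightarrow> nat"
  where "perm_ext i s k = (case k of 0 \<Rightarrow> i | Suc k \<Rightarrow> skip i (s k))"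

lemma perm_ext_simps [simp]: "perm_ext i s 0 = i" "perm_ext i s (Suc k) = skip i (s k)"
  by (simp_all add: perm_ext_def)

lemma perm_ext_permutes:
  assumes s: "s permutes {..<n}" and i: "i < Suc n"
  shows "perm_ext i s permutes {..<Suc n}"
proof (rule bij_imp_permutes)
  have inj: "inj_on (perm_ext i s) {..<Suc n}"
  proof (rule inj_onI)
    fix x y assume "perm_ext i s x = perm_ext i s y"
    then show "x = y" using permutes_inj[OF s] by (cases x; cases y) (auto dest: injD)
  qed
  moreover have "perm_ext i s ` {..<Suc n} \<subseteq> {..<Suc n}"
  proof (rule image_subsetI)
    fix x assume "x \<in> {..<Suc n}"
    then show "perm_ext i s x \<in> {..<Suc n}"
      using i permutes_in_image[OF s] by (cases x) (auto simp: skip_def)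
  qed
  ultimately show "bij_betw (perm_ext i s) {..<Suc n} {..<Suc n}"
    by (simp add: bij_betw_def endo_inj_surj)
  fix x assume x: "x \<notin> {..<Suc n}"
  then obtain k where "x = Suc k" "n \<le> k" by (cases x) auto
  then show "perm_ext i s x = x" using i permutes_not_in[OF s, of k] by (simp add: skip_def)
qed

lemma perm_ext_inj: "perm_ext i s = perm_ext i s' \<Longrightarrow> s = s'"
proof
  fix k assume "perm_ext i s = perm_ext i s'"
  then have "perm_ext i s (Suc k) = perm_ext i s' (Suc k)" by simp
  then show "s k = s' k" by simp
qed

text \<open>One inclusion and a count suffice: the images are disjoint for different first values,
  and (n + 1) n! = (n + 1)!.\<close>

lemma permutes_Suc_eq:
  "{s. s permutes {..<Suc n}} = (\<Union>i\<in>{..<Suc n}. perm_ext i ` {s. s permutes {..<n}})"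
proof (rule card_subset_eq[symmetric])
  let ?P = "{s. s permutes {..<n}}"
  show "finite {s. s permutes {..<Suc n}}" by (intro finite_permutations) simp
  show "(\<Union>i\<in>{..<Suc n}. perm_ext i ` ?P) \<subseteq> {s. s permutes {..<Suc n}}"
    using perm_ext_permutes by auto
  have fin: "finite ?P" by (intro finite_permutations) simp
  have "card (\<Union>i\<in>{..<Suc n}. perm_ext i ` ?P) = (\<Sum>i\<in>{..<Suc n}. card (perm_ext i ` ?P))"
  proof (rule card_UN_disjoint)
    show "\<forall>i\<in>{..<Suc n}. \<forall>j\<in>{..<Suc n}. i \<noteq> j \<longrightarrow> perm_ext i ` ?P \<inter> perm_ext j ` ?P = {}"
    proof (intro ballI impI)
      fix i j :: nat assume "i \<noteq> j"
      then have "perm_ext i s \<noteq> perm_ext j s'" for s s'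
        using perm_ext_simps(1)[of i s] perm_ext_simps(1)[of j s'] by metis
      then show "perm_ext i ` ?P \<inter> perm_ext j ` ?P = {}" by blast
    qed
  qed (use fin in auto)
  also have "\<dots> = (\<Sum>i\<in>{..<Suc n}. fact n)"
  proof (rule sum.cong[OF refl])
    fix i
    have "inj_on (perm_ext i) ?P" by (rule inj_onI) (rule perm_ext_inj)
    then show "card (perm_ext i ` ?P) = fact n"
      using card_permutations[of "{..<n}" n] by (simp add: card_image)
  qed
  also have "\<dots> = card {s. s permutes {..<Suc n}}"
    using card_permutations[of "{..<Suc n}" "Suc n"] by simp
  finally show "card (\<Union>i\<in>{..<Suc n}. perm_ext i ` ?P) = card {s. s permutes {..<Suc n}}" .
qed

text \<open>Inversions that involve the first position (the set A) are the crossings of letter i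
  with the letters before it. The others (the set B) are the inversions of s, shifted by one
  place.\<close>

lemma koszul_perm_ext:
  fixes ps :: "bit list"
  assumes s: "s permutes {..<n}" and l: "length ps = Suc n" and i: "i < Suc n"
  shows "koszul ps (perm_ext i s) = ps ! i * sum_list (take i ps) + koszul (rm i ps) s"
proof -
  let ?s = "perm_ext i s"
  define A where "A = (\<lambda>j. (0 :: nat, Suc j)) ` {j. j < n \<and> s j < i}"
  define B where "B = map_prod Suc Suc ` {(j, k). j < k \<and> k < n \<and> s k < s j}"
  have sl: "s j < n \<longleftrightarrow> j < n" for j using permutes_in_image[OF s, of j] by simp
  have set: "{(j, k). j < k \<and> k < length ps \<and> ?s k < ?s j} = A \<union> B"
  proof (intro equalityI subsetI)
    fix x assume "x \<in> {(j, k). j < k \<and> k < length ps \<and> ?s k < ?s j}"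
    then obtain j k where x: "x = (j, k)" "j < k" "k < Suc n" "?s k < ?s j" by (auto simp: l)
    then obtain k' where k: "k = Suc k'" by (cases k) auto
    show "x \<in> A \<union> B"
    proof (cases j)
      case 0
      then show ?thesis using x k by (auto simp: A_def)
    next
      case (Suc j')
      then have "x = map_prod Suc Suc (j', k')" "(j', k') \<in> {(j, k). j < k \<and> k < n \<and> s k < s j}" using x k by auto
      then show ?thesis unfolding B_def by blast
    qed
  qed (auto simp: A_def B_def l)
  have fin: "finite {(j, k). j < k \<and> k < n \<and> s k < s j}"
    by (rule finite_subset[of _ "{..<n} \<times> {..<n}"]) auto
  have "koszul ps ?s = (\<Sum>(j, k)\<in>A. ps ! ?s j * ps ! ?s k) + (\<Sum>(j, k)\<in>B. ps ! ?s j * ps ! ?s k)"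
    unfolding koszul_def set by (rule sum.union_disjoint) (use fin in \<open>auto simp: A_def B_def\<close>)
  also have "(\<Sum>(j, k)\<in>A. ps ! ?s j * ps ! ?s k) = (\<Sum>j\<in>{j. j < n \<and> s j < i}. ps ! i * ps ! s j)"
    unfolding A_def by (subst sum.reindex) (auto simp: inj_on_def skip_def)
  also have "\<dots> = (\<Sum>m\<in>{..<i}. ps ! i * ps ! m)"
  proof (rule sum.reindex_bij_betw[where h = s])
    have "s ` {j. j < n \<and> s j < i} = {..<i}"
    proof (intro equalityI subsetI)
      fix m assume m: "m \<in> {..<i}"
      obtain j where "s j = m" using permutes_surj[OF s] by (metis surjD)
      then show "m \<in> s ` {j. j < n \<and> s j < i}" using m i sl[of j] by auto
    qed auto
    then show "bij_betw s {j. j < n \<and> s j < i} {..<i}"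
      using permutes_inj[OF s] by (auto simp: bij_betw_def intro: inj_on_subset)
  qed
  also have "\<dots> = ps ! i * sum_list (take i ps)"
    using i l by (simp add: sum_list_sum_nth sum_distrib_left min_def atLeast0LessThan)
  also have "(\<Sum>(j, k)\<in>B. ps ! ?s j * ps ! ?s k) = (\<Sum>(j, k)\<in>{(j, k). j < k \<and> k < n \<and> s k < s j}. ps ! skip i (s j) * ps ! skip i (s k))"
    unfolding B_def by (subst sum.reindex) (auto simp: inj_on_def intro!: sum.cong)
  also have "\<dots> = koszul (rm i ps) s"
    unfolding koszul_def using l i
    by (intro sum.cong) (auto simp: nth_rm sl)
  finally show ?thesis .
qed

section \<open>Values of the powers of ad \<pi> on products of letters\<close>

context lie_sym
begin

definition homs :: "'m list \<Rightarrow> bit list \<Rightarrow> bool"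
  where "homs Xs ps \<longleftrightarrow> list_all2 (\<lambda>X p. X \<in> grade M p) Xs ps"

lemma homs_simps [simp]: "homs [] ps \<longleftrightarrow> ps = []" "homs Xs [] \<longleftrightarrow> Xs = []"
  "homs (X # Xs) (p # ps) \<longleftrightarrow> X \<in> grade M p \<and> homs Xs ps"
  by (auto simp: homs_def)

lemma homs_rm: "homs Xs ps \<Longrightarrow> homs (rm i Xs) (rm i ps)"
  unfolding homs_def by (rule list_all2_rm)

lemma homs_length: "homs Xs ps \<Longrightarrow> length ps = length Xs"
  unfolding homs_def by (simp add: list_all2_lengthD)

lemma homs_carrier: "homs Xs ps \<Longrightarrow> set Xs \<subseteq> carrier M"
  unfolding homs_def by (induction rule: list_all2_induct) (auto dest: grade_closed)

abbreviation prodS where "prodS \<equiv> sym_prod K M"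

lemma prodS_simps [simp]: "prodS [] = \<one>\<^bsub>S\<^esub>" "prodS (X # Xs) = sym_of K M X \<otimes>\<^bsub>S\<^esub> prodS Xs"
  by (simp_all add: sym_prod_def)

lemma prodS_closed [simp]: "set Xs \<subseteq> carrier M \<Longrightarrow> prodS Xs \<in> carrier S"
  by (induction Xs) simp_all

lemma prodS_append: "\<lbrakk>set Xs \<subseteq> carrier M; set Ys \<subseteq> carrier M\<rbrakk> \<Longrightarrow> prodS (Xs @ Ys) = prodS Xs \<otimes>\<^bsub>S\<^esub> prodS Ys"
  by (induction Xs) (simp_all add: S.m_assoc)

lemma rm_carrier: "set Xs \<subseteq> carrier M \<Longrightarrow> set (rm i Xs) \<subseteq> carrier M"
  unfolding rm_def using set_take_subset[of i Xs] set_drop_subset[of "Suc i" Xs] by auto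

text \<open>The projection sees single letters only, so the coproduct contributes the terms with one
  letter in the left factor. The sign moves this letter to the front and past h.\<close>

lemma conv_pr_prodS:
  assumes "homs Xs ps" "par_map K S M r h"
  shows "conv r pr h (prodS Xs) = (\<Oplus>i\<in>{..<length Xs}. ksgn M (ps ! i * (sum_list (take i ps) + r)) (br (Xs ! i) (h (prodS (rm i Xs)))))"
  using assms
proof (induction Xs arbitrary: ps r h)
  case Nil
  then show ?case using par_mapD(4)[OF Nil(2)] by (simp add: conv_one[OF pr_par Nil(2)])
next
  case (Cons X Xs ps r h)
  obtain q qs where ps: "ps = q # qs" using Cons(2) by (cases ps) auto
  then have X: "X \<in> grade M q" and Xs: "homs Xs qs" using Cons(2) by auto
  note h = Cons(3)
  have c: "X \<in> carrier M" "set Xs \<subseteq> carrier M" "prodS Xs \<in> carrier S"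
    using X Xs grade_closed homs_carrier by auto
  let ?h = "\<lambda>x. h (sym_of K M X \<otimes>\<^bsub>S\<^esub> x)"
  note hX = par_comp_Lm[OF h sym_of_grade[OF X]]
  have "conv r (\<lambda>x. pr (sym_of K M X \<otimes>\<^bsub>S\<^esub> x)) h (prodS Xs) = conv r (cst X) h (prodS Xs)"
    by (rule conv_cong[OF _ h cst_par[OF X] h c(3)])
      (use par_comp_Lm[OF pr_par sym_of_grade[OF X]] c in \<open>simp_all add: pr_sym_cst\<close>)
  then have 1: "conv r (\<lambda>x. pr (sym_of K M X \<otimes>\<^bsub>S\<^esub> x)) h (prodS Xs) = br X (h (prodS Xs))"
    using conv_cst[OF c(3) X h] by simp
  have cl: "br ((X # Xs) ! i) (h (prodS (rm i (X # Xs)))) \<in> carrier M" if "i < Suc (length Xs)" for i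
  proof -
    have "set (X # Xs) \<subseteq> carrier M" using c by simp
    then have "(X # Xs) ! i \<in> carrier M" "set (rm i (X # Xs)) \<subseteq> carrier M"
      using that nth_mem[of i "X # Xs"] rm_carrier by (auto simp del: nth_Cons_Suc)
    then show ?thesis using par_mapD(4)[OF h] by (intro bracket_closed) auto
  qed
  have "conv r pr h (prodS (X # Xs)) = ksgn M (q * r) (br X (h (prodS Xs))) \<oplus> conv (r + q) pr ?h (prodS Xs)"
    using conv_sym[OF pr_par h X c(3)] 1 by simp
  also have "conv (r + q) pr ?h (prodS Xs)
      = (\<Oplus>i\<in>{..<length Xs}. ksgn M (qs ! i * (sum_list (take i qs) + (r + q))) (br (Xs ! i) (?h (prodS (rm i Xs)))))"
    by (rule Cons.IH[OF Xs hX])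
  also have "ksgn M (q * r) (br X (h (prodS Xs))) \<oplus> \<dots> = (\<Oplus>i\<in>{..<Suc (length Xs)}.
      ksgn M (ps ! i * (sum_list (take i ps) + r)) (br ((X # Xs) ! i) (h (prodS (rm i (X # Xs))))))"
    using cl by (subst finsum_lessThan_Suc_shift) (auto simp: ps ac_simps)
  finally show ?case by simp
qed

text \<open>The sum over permutations from the definition of \<open>phi_map\<close>, without the
  coefficient and without the sign of a.\<close>

definition psum :: "'m list \<Rightarrow> bit list \<Rightarrow> 'm \<Rightarrow> 'm"
  where "psum Xs ps a = (\<Oplus>s\<in>{s. s permutes {..<length Xs}}.
    ksgn M (koszul ps s) (foldr br (map (\<lambda>k. Xs ! s k) [0..<length Xs]) a))"

lemma foldr_perm_closed:
  assumes "set Xs \<subseteq> carrier M" "s permutes {..<length Xs}" "a \<in> carrier M"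
  shows "foldr br (map (\<lambda>k. Xs ! s k) [0..<length Xs]) a \<in> carrier M"
  using assms permutes_in_image[OF assms(2)] by (intro foldr_br_closed) (auto intro: nth_mem)

lemma psum_closed: "\<lbrakk>set Xs \<subseteq> carrier M; a \<in> carrier M\<rbrakk> \<Longrightarrow> psum Xs ps a \<in> carrier M"
  unfolding psum_def using foldr_perm_closed by (intro finsum_closed) auto

lemma psum_Nil: "a \<in> carrier M \<Longrightarrow> psum [] [] a = a"
  by (simp add: psum_def koszul_def finsum_insert)

text \<open>Permutations are grouped by the letter of the outermost ad.\<close>

lemma psum_rec:
  assumes X: "set Xs \<subseteq> carrier M" and l: "length Xs = Suc n" "length ps = Suc n" and a: "a \<in> carrier M"
  shows "psum Xs ps a = (\<Oplus>i\<in>{..<Suc n}. ksgn M (ps ! i * sum_list (take i ps)) (br (Xs ! i) (psum (rm i Xs) (rm i ps) a)))"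
proof -
  let ?P = "{s. s permutes {..<n}}"
  let ?f = "\<lambda>s. ksgn M (koszul ps s) (foldr br (map (\<lambda>k. Xs ! s k) [0..<Suc n]) a)"
  have fin: "finite ?P" by (intro finite_permutations) simp
  have cl: "?f s \<in> carrier M" if "s permutes {..<Suc n}" for s
    using foldr_perm_closed[OF X _ a, of s] that l by (auto simp del: upt_Suc)
  have "psum Xs ps a = finsum M ?f (\<Union>i\<in>{..<Suc n}. perm_ext i ` ?P)"
    unfolding psum_def l permutes_Suc_eq ..
  also have "\<dots> = (\<Oplus>i\<in>{..<Suc n}. finsum M ?f (perm_ext i ` ?P))"
  proof (rule add.finprod_UN_disjoint)
    show "pairwise (\<lambda>i j. disjnt (perm_ext i ` ?P) (perm_ext j ` ?P)) {..<Suc n}"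
    proof (rule pairwiseI)
      fix i j :: nat assume "i \<noteq> j"
      then have "perm_ext i s \<noteq> perm_ext j s'" for s s'
        using perm_ext_simps(1)[of i s] perm_ext_simps(1)[of j s'] by metis
      then show "disjnt (perm_ext i ` ?P) (perm_ext j ` ?P)" unfolding disjnt_def by blast
    qed
    show "\<And>i x. i \<in> {..<Suc n} \<Longrightarrow> x \<in> perm_ext i ` ?P \<Longrightarrow> ?f x \<in> carrier M"
      using cl perm_ext_permutes by auto
  qed (use fin in auto)
  also have "\<dots> = (\<Oplus>i\<in>{..<Suc n}. ksgn M (ps ! i * sum_list (take i ps)) (br (Xs ! i) (psum (rm i Xs) (rm i ps) a)))"
  proof (rule finsum_cong'[OF refl])
    show "(\<lambda>i. ksgn M (ps ! i * sum_list (take i ps)) (br (Xs ! i) (psum (rm i Xs) (rm i ps) a))) \<in> {..<Suc n} \<rightarrow> carrier M"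
      using X l a rm_carrier[OF X] psum_closed by (auto intro!: ksgn_closed bracket_closed nth_mem)
    fix i assume i: "i \<in> {..<Suc n}"
    have Xi: "Xs ! i \<in> carrier M" using X i l nth_mem[of i Xs] by auto
    interpret b: add_hom M M "br (Xs ! i)" by (rule br_hom(1)[OF Xi])
    have li: "length (rm i Xs) = n" using l i by simp
    have fc: "foldr br (map (\<lambda>k. rm i Xs ! s k) [0..<n]) a \<in> carrier M" if "s permutes {..<n}" for s
      using foldr_perm_closed[OF rm_carrier[OF X] _ a, of s i] that li by simp
    have "finsum M ?f (perm_ext i ` ?P) = finsum M (\<lambda>s. ?f (perm_ext i s)) ?P"
      using cl perm_ext_permutes i
      by (intro finsum_reindex) (auto intro!: inj_onI dest: perm_ext_inj simp del: upt_Suc)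
    also have "\<dots> = finsum M (\<lambda>s. ksgn M (ps ! i * sum_list (take i ps))
        (br (Xs ! i) (ksgn M (koszul (rm i ps) s) (foldr br (map (\<lambda>k. rm i Xs ! s k) [0..<n]) a)))) ?P"
    proof (rule finsum_cong'[OF refl])
      fix s assume "s \<in> ?P"
      then have s: "s permutes {..<n}" by simp
      have "map (\<lambda>k. Xs ! perm_ext i s k) [0..<Suc n] = Xs ! i # map (\<lambda>k. Xs ! skip i (s k)) [0..<n]"
        by (subst upt_conv_Cons) (simp_all del: upt_Suc add: map_Suc_upt[symmetric] comp_def)
      also have "map (\<lambda>k. Xs ! skip i (s k)) [0..<n] = map (\<lambda>k. rm i Xs ! s k) [0..<n]"
        using i l permutes_in_image[OF s] by (auto simp: nth_rm)
      finally show "?f (perm_ext i s) = ksgn M (ps ! i * sum_list (take i ps))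
          (br (Xs ! i) (ksgn M (koszul (rm i ps) s) (foldr br (map (\<lambda>k. rm i Xs ! s k) [0..<n]) a)))"
        using koszul_perm_ext[OF s l(2)] i fc[OF s] Xi by (simp add: bracket_closed)
    qed (use fc Xi in \<open>auto intro!: bracket_closed ksgn_closed\<close>)
    also have "\<dots> = ksgn M (ps ! i * sum_list (take i ps)) (br (Xs ! i)
        (finsum M (\<lambda>s. ksgn M (koszul (rm i ps) s) (foldr br (map (\<lambda>k. rm i Xs ! s k) [0..<n]) a)) ?P))"
    proof -
      let ?g = "\<lambda>s. ksgn M (koszul (rm i ps) s) (foldr br (map (\<lambda>k. rm i Xs ! s k) [0..<n]) a)"
      interpret k: add_hom M M "\<lambda>y. ksgn M (ps ! i * sum_list (take i ps)) (br (Xs ! i) y)"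
        by (intro add_hom_intro abelian_group_axioms add_map_ksgn b.add_map)
      show ?thesis by (rule k.finsum[symmetric]) (use fc in auto)
    qed
    finally show "finsum M ?f (perm_ext i ` ?P) = ksgn M (ps ! i * sum_list (take i ps)) (br (Xs ! i) (psum (rm i Xs) (rm i ps) a))"
      using li by (simp add: psum_def)
  qed
  finally show ?thesis .
qed

text \<open>Both sides satisfy the same recursion over the outermost letter, by
  \<open>conv_pr_prodS\<close> and \<open>psum_rec\<close>. Thus the explicit sum with Koszul signs
  is an iterated inner derivation.\<close>

lemma adpow_prodS:
  assumes "homs Xs ps" "a \<in> grade M r"
  shows "adpow r a (length Xs) (prodS Xs) = ksgn M (r * sum_list ps) (psum Xs ps a)"
  using assms(1)
proof (induction "length Xs" arbitrary: Xs ps)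
  case 0
  then show ?case using grade_closed[OF assms(2)] by (simp add: cst_one psum_Nil)
next
  case (Suc n)
  have l: "length Xs = Suc n" "length ps = Suc n" using Suc homs_length by auto
  have X: "set Xs \<subseteq> carrier M" using Suc homs_carrier by blast
  note aM = grade_closed[OF assms(2)]
  have "adpow r a (Suc n) (prodS Xs)
      = (\<Oplus>i\<in>{..<Suc n}. ksgn M (ps ! i * (sum_list (take i ps) + r)) (br (Xs ! i) (adpow r a n (prodS (rm i Xs)))))"
    using conv_pr_prodS[OF Suc(3) adpow_par[OF assms(2)], of n] l by simp
  also have "\<dots> = (\<Oplus>i\<in>{..<Suc n}. ksgn M (r * sum_list ps) (ksgn M (ps ! i * sum_list (take i ps)) (br (Xs ! i) (psum (rm i Xs) (rm i ps) a))))"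
  proof (rule finsum_cong'[OF refl])
    show "(\<lambda>i. ksgn M (r * sum_list ps) (ksgn M (ps ! i * sum_list (take i ps)) (br (Xs ! i) (psum (rm i Xs) (rm i ps) a)))) \<in> {..<Suc n} \<rightarrow> carrier M"
      using X l aM rm_carrier[OF X] psum_closed by (auto intro!: ksgn_closed bracket_closed nth_mem)
    fix i assume i: "i \<in> {..<Suc n}"
    have Xi: "Xs ! i \<in> carrier M" using X i l nth_mem[of i Xs] by auto
    have "adpow r a n (prodS (rm i Xs)) = ksgn M (r * sum_list (rm i ps)) (psum (rm i Xs) (rm i ps) a)"
      using Suc(1)[OF _ homs_rm[OF Suc(3)], of i] l i by simp
    moreover have "ps ! i * (sum_list (take i ps) + r) + r * sum_list (rm i ps) = r * sum_list ps + ps ! i * sum_list (take i ps)"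
      using sum_list_rm[of i ps] i l by (simp add: distrib_left ac_simps)
    ultimately show "ksgn M (ps ! i * (sum_list (take i ps) + r)) (br (Xs ! i) (adpow r a n (prodS (rm i Xs))))
        = ksgn M (r * sum_list ps) (ksgn M (ps ! i * sum_list (take i ps)) (br (Xs ! i) (psum (rm i Xs) (rm i ps) a)))"
      using Xi aM rm_carrier[OF X] psum_closed by (simp add: br_ksgn bracket_closed)
  qed
  also have "\<dots> = ksgn M (r * sum_list ps) (psum Xs ps a)"
  proof -
    interpret k: add_hom M M "ksgn M (r * sum_list ps)"
      by (intro add_hom_intro abelian_group_axioms add_mapI) (auto simp: ksgn_add)
    show ?thesis
      unfolding psum_rec[OF X l aM]
      by (rule k.finsum[symmetric]) (use X l aM rm_carrier[OF X] psum_closed in \<open>auto intro!: ksgn_closed bracket_closed nth_mem\<close>)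
  qed
  finally show ?case using Suc(2) by simp
qed

text \<open>Every ad \<pi> consumes exactly one letter, and the augmentation at the end accepts
  none.\<close>

lemma adpow_prodS_zero:
  "\<lbrakk>homs Xs ps; a \<in> grade M r; length Xs \<noteq> n\<rbrakk> \<Longrightarrow> adpow r a n (prodS Xs) = \<zero>"
proof (induction n arbitrary: Xs ps)
  case 0
  then obtain Y Ys where "Xs = Y # Ys" by (cases Xs) auto
  then show ?case using 0 homs_carrier[OF 0(1)] grade_closed by (simp add: cst_sym)
next
  case (Suc n)
  have X: "set Xs \<subseteq> carrier M" using Suc homs_carrier by blast
  have "br (Xs ! i) (adpow r a n (prodS (rm i Xs))) = \<zero>" if "i < length Xs" for i
  proof -
    have "adpow r a n (prodS (rm i Xs)) = \<zero>"
      using Suc(1)[OF homs_rm[OF Suc(2)] Suc(3), of i] that Suc(4) by simp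
    then show ?thesis using X nth_mem[OF that] by (simp add: subset_iff)
  qed
  then show ?case
    using conv_pr_prodS[OF Suc(2) adpow_par[OF Suc(3)], of n] by (simp, intro add.finprod_one_eqI) simp
qed

text \<open>The definition of \<open>phi_map\<close> demands vanishing on long products of arbitrary
  elements. They are split into homogeneous components one at a time, and Hs collects the factors
  already treated.\<close>

lemma adpow_long:
  assumes a: "a \<in> grade M r"
  shows "\<lbrakk>set Xs \<subseteq> carrier M; homs Hs hs; n < length Hs + length Xs\<rbrakk> \<Longrightarrow> adpow r a n (prodS (Hs @ Xs)) = \<zero>"
proof (induction Xs arbitrary: Hs hs)
  case Nil
  then show ?case using adpow_prodS_zero[OF _ a] by simp
next
  case (Cons X Xs)
  note f = adpow_par[OF a, of n]
  have H: "set Hs \<subseteq> carrier M" using Cons homs_carrier by blast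
  have "X \<in> carrier M" using Cons by simp
  then obtain x y where xy: "x \<in> grade M 0" "y \<in> grade M (0 + 1)" "X = x \<oplus> y" by (rule grade_decomp)
  then have c: "x \<in> carrier M" "y \<in> carrier M" using grade_closed by auto
  have Z: "adpow r a n (prodS (Hs @ z # Xs)) = \<zero>" if "z \<in> grade M d" for z d
    using Cons.IH[of "Hs @ [z]" "hs @ [d]"] Cons.prems that by (simp add: homs_def list_all2_appendI)
  have "prodS (Hs @ X # Xs) = prodS (Hs @ x # Xs) \<oplus>\<^bsub>S\<^esub> prodS (Hs @ y # Xs)"
    using H c Cons by (simp add: prodS_append xy sym_of_add S.l_distr S.r_distr)
  then show ?case
    using Z[OF xy(1)] Z[OF xy(2)] H c Cons by (simp add: par_mapD(5)[OF f])
qed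

text \<open>Sums of maps by recursion on the length, so that linearity and parity are inherited
  summand by summand.\<close>

fun fsum where
  "fsum h 0 = (\<lambda>x. \<zero>)"
| "fsum h (Suc n) = (\<lambda>x. fsum h n x \<oplus> h n x)"

lemma fsum_par: "(\<And>i. i < n \<Longrightarrow> par_map K S M p (h i)) \<Longrightarrow> par_map K S M p (fsum h n)"
  by (induction n) (simp_all add: par_map_zero par_map_add)

lemma fsum_zero: "(\<And>i. i < n \<Longrightarrow> h i x = \<zero>) \<Longrightarrow> fsum h n x = \<zero>"
  by (induction n) simp_all

lemma fsum_single: "\<lbrakk>\<And>i. i < n \<Longrightarrow> i \<noteq> k \<Longrightarrow> h i x = \<zero>; k < n; h k x \<in> carrier M\<rbrakk> \<Longrightarrow> fsum h n x = h k x"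
proof (induction n)
  case (Suc n)
  show ?case
  proof (cases "k = n")
    case True
    then show ?thesis using Suc fsum_zero[of n h x] by simp
  next
    case False
    then show ?thesis using Suc by simp
  qed
qed simp

section \<open>Truncated polynomials in ad \<pi> and the coderivations of the statement\<close>

definition phiS :: "(nat \<Rightarrow> 'k) \<Rightarrow> nat \<Rightarrow> bit \<Rightarrow> 'm \<Rightarrow> _ \<Rightarrow> 'm"
  where "phiS c N p a = fsum (\<lambda>n x. rsmult M (adpow p a n x) (c n)) N"

lemma phiS_par: "\<lbrakk>\<And>n. n < N \<Longrightarrow> c n \<in> grade K 0; a \<in> grade M p\<rbrakk> \<Longrightarrow> par_map K S M p (phiS c N p a)"
  unfolding phiS_def by (intro fsum_par par_rsmult adpow_par)

text \<open>Products of homogeneous letters span S over the right scalars. The induction carries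
  such a product in front of x and appends the next letter to it.\<close>

lemma S_map_eqI:
  assumes f: "lin_map K S M f" and g: "lin_map K S M g" and x: "x \<in> carrier S"
    and e: "\<And>Xs ps. homs Xs ps \<Longrightarrow> f (prodS Xs) = g (prodS Xs)"
  shows "f x = g x"
proof -
  have "homs Xs ps \<Longrightarrow> f (prodS Xs \<otimes>\<^bsub>S\<^esub> x) = g (prodS Xs \<otimes>\<^bsub>S\<^esub> x)" for Xs ps
    using x
  proof (induction arbitrary: Xs ps rule: S_induct_right)
    case one
    then show ?case using e homs_carrier by simp
  next
    case (sym v p X Xs ps)
    have v: "v \<in> carrier M" using sym grade_closed by blast
    have X: "set Xs \<subseteq> carrier M" using sym homs_carrier by blast
    have "homs (Xs @ [v]) (ps @ [p])" using sym by (simp add: homs_def list_all2_appendI)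
    from sym(3)[OF this] show ?case using sym v X by (simp add: prodS_append S.m_assoc)
  next
    case (rsmult \<alpha> p X Xs ps)
    have X: "set Xs \<subseteq> carrier M" using rsmult homs_carrier by blast
    have a: "\<alpha> \<in> carrier K" using rsmult K.grade_closed by blast
    have "f (rsmult S (prodS Xs \<otimes>\<^bsub>S\<^esub> X) \<alpha>) = g (rsmult S (prodS Xs \<otimes>\<^bsub>S\<^esub> X) \<alpha>)"
      using lin_mapD(4)[OF f _ a] lin_mapD(4)[OF g _ a] rsmult X by simp
    then show ?case using rsmult a X by (simp add: S_rsmult S.m_assoc)
  next
    case (add X Y Xs ps)
    have X: "set Xs \<subseteq> carrier M" using add homs_carrier by blast
    then show ?case using add by (simp add: S.r_distr lin_mapD(3)[OF f] lin_mapD(3)[OF g])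
  qed
  from this[of "[]" "[]"] show ?thesis using x by simp
qed

lemma phiS_prodS:
  assumes c: "\<And>n. n < N \<Longrightarrow> c n \<in> grade K 0" and a: "a \<in> grade M p" and X: "homs Xs ps"
  shows "phiS c N p a (prodS Xs) = (if length Xs < N then ksgn M (p * sum_list ps) (rsmult M (psum Xs ps a) (c (length Xs))) else \<zero>)"
proof -
  have cK: "c n \<in> carrier K" if "n < N" for n using c[OF that] by (rule K.grade_closed)
  have XM: "set Xs \<subseteq> carrier M" using X homs_carrier by blast
  have z: "rsmult M (adpow p a n (prodS Xs)) (c n) = \<zero>" if "n < N" "n \<noteq> length Xs" for n
    using adpow_prodS_zero[OF X a, of n] that cK by simp
  show ?thesis
  proof (cases "length Xs < N")
    case True
    then have "phiS c N p a (prodS Xs) = rsmult M (adpow p a (length Xs) (prodS Xs)) (c (length Xs))"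
      unfolding phiS_def using z XM cK par_mapD(4)[OF adpow_par[OF a]] by (intro fsum_single) (auto intro: rsmult_closed)
    then show ?thesis using True cK psum_closed[OF XM grade_closed[OF a]] by (simp add: adpow_prodS[OF X a] rsmult_ksgn)
  next
    case False
    then show ?thesis unfolding phiS_def using z by (simp add: fsum_zero)
  qed
qed

lemma phiS_long:
  assumes "\<And>n. n < N \<Longrightarrow> c n \<in> grade K 0" "a \<in> grade M p" "set Xs \<subseteq> carrier M" "N \<le> length Xs"
  shows "phiS c N p a (prodS Xs) = \<zero>"
  unfolding phiS_def
proof (rule fsum_zero)
  fix n assume n: "n < N"
  have "c n \<in> carrier K" using assms(1)[OF n] by (rule K.grade_closed)
  then show "rsmult M (adpow p a n (prodS Xs)) (c n) = \<zero>"
    using adpow_long[OF assms(2,3), of "[]" "[]"] n assms(4) by simp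
qed

lemma psum_alt: "psum Xs ps a = (\<Oplus>s\<in>{s. s permutes {..<length Xs}}.
    ksgn M (koszul ps s) (foldr br (map (\<lambda>k. Xs ! s k) [0..<length Xs]) a))"
  by (simp add: psum_def)

text \<open>Resolves the definite description. Existence, that is, compatibility of the explicit
  formula with the relations of S, is supplied by the convolution powers, which are maps on S from
  the outset; uniqueness is \<open>S_map_eqI\<close>.\<close>

lemma phi_map_eq:
  assumes c: "\<And>n. n < N \<Longrightarrow> c n \<in> grade K 0" and N: "1 \<le> N" and a: "a \<in> carrier M"
  shows "phi_map K M N c a = (\<lambda>x\<in>carrier S. phiS c N 0 (hcomp M 0 a) x \<oplus> phiS c N 1 (hcomp M 1 a) x)"
proof -
  let ?f = "\<lambda>x. phiS c N 0 (hcomp M 0 a) x \<oplus> phiS c N 1 (hcomp M 1 a) x"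
  let ?F = "\<lambda>Xs ps. \<Oplus>i\<in>{0, 1}. ksgn M (i * sum_list ps) (rsmult M (psum Xs ps (hcomp M i a)) (c (length Xs)))"
  have cK: "c n \<in> carrier K" if "n < N" for n using c[OF that] by (rule K.grade_closed)
  have h: "hcomp M 0 a \<in> grade M 0" "hcomp M 1 a \<in> grade M 1" using a by auto
  note p = phiS_par[OF c h(1)] phiS_par[OF c h(2)]
  have lf: "lin_map K S M ?f" using par_mapD(1)[OF p(1)] par_mapD(1)[OF p(2)] by (intro lin_map_add) auto
  have F: "?f (prodS Xs) = ?F Xs ps" if "homs Xs ps" "length Xs < N" for Xs ps
    using that h a cK[OF that(2)] psum_closed[OF homs_carrier[OF that(1)]]
    by (subst finsum_bits) (auto simp: phiS_prodS[OF c _ that(1)] rsmult_closed)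
  have F1: "?f \<one>\<^bsub>S\<^esub> = rsmult M a (c 0)"
  proof -
    have "?f (prodS []) = ?F [] []" using N by (intro F) auto
    also have "\<dots> = rsmult M (hcomp M 0 a) (c 0) \<oplus> rsmult M (hcomp M 1 a) (c 0)"
      using a N cK by (subst finsum_bits) (auto simp: psum_Nil rsmult_closed)
    also have "\<dots> = rsmult M (hcomp M 0 a \<oplus> hcomp M 1 a) (c 0)"
      using a N cK by (simp add: rsmult_add_left)
    also have "\<dots> = rsmult M a (c 0)" using a by (simp add: hcomp_sum)
    finally show ?thesis by simp
  qed
  have FN: "?f (prodS Xs) = \<zero>" if "set Xs \<subseteq> carrier M" "N \<le> length Xs" for Xs
    using phiS_long[OF c h(1) that] phiS_long[OF c h(2) that] by simp
  show ?thesis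
    unfolding phi_map_def
  proof (rule the_equality, intro conjI allI impI)
    show "(\<lambda>x\<in>carrier S. ?f x) \<in> shom K S M"
      unfolding shom_def using lin_mapD[OF lf] by (auto simp: S.rsmult_closed)
    show "(\<lambda>x\<in>carrier S. ?f x) \<one>\<^bsub>S\<^esub> = rsmult M a (c 0)" using F1 by simp
    fix Xs ps assume *: "list_all2 (\<lambda>X p. X \<in> grade M p) Xs ps \<and> 1 \<le> length Xs \<and> length Xs < N"
    then show "(\<lambda>x\<in>carrier S. ?f x) (prodS Xs) = (\<Oplus>i\<in>{0, 1}. ksgn M (i * sum_list ps) (rsmult M
            (\<Oplus>s\<in>{s. s permutes {..<length Xs}}. ksgn M (koszul ps s)
                 (foldr br (map (\<lambda>k. Xs ! s k) [0..<length Xs]) (hcomp M i a))) (c (length Xs))))"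
      using F[of Xs ps] homs_carrier[of Xs ps] unfolding homs_def psum_alt by simp
  next
    fix Xs assume "set Xs \<subseteq> carrier M \<and> N \<le> length Xs"
    then show "(\<lambda>x\<in>carrier S. ?f x) (prodS Xs) = \<zero>" using FN by simp
  next
    fix g assume g: "g \<in> shom K S M \<and> g \<one>\<^bsub>S\<^esub> = rsmult M a (c 0) \<and>
      (\<forall>Xs ps. list_all2 (\<lambda>X p. X \<in> grade M p) Xs ps \<and> 1 \<le> length Xs \<and> length Xs < N \<longrightarrow>
       g (prodS Xs) = (\<Oplus>i\<in>{0, 1}. ksgn M (i * sum_list ps) (rsmult M
            (\<Oplus>s\<in>{s. s permutes {..<length Xs}}. ksgn M (koszul ps s)
                 (foldr br (map (\<lambda>k. Xs ! s k) [0..<length Xs]) (hcomp M i a))) (c (length Xs))))) \<and>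
      (\<forall>Xs. set Xs \<subseteq> carrier M \<and> N \<le> length Xs \<longrightarrow> g (prodS Xs) = \<zero>)"
    then have gs: "g \<in> carrier S \<rightarrow>\<^sub>E carrier M" and lg: "lin_map K S M g"
      by (auto simp: shom_def lin_map_def intro!: add_mapI)
    have "g x = ?f x" if "x \<in> carrier S" for x
    proof (rule S_map_eqI[OF lg lf that])
      fix Xs ps assume X: "homs Xs ps"
      consider "Xs = []" | "1 \<le> length Xs" "length Xs < N" | "N \<le> length Xs"
        by (cases Xs; cases "length Xs < N") (auto simp: not_less)
      then show "g (prodS Xs) = ?f (prodS Xs)"
      proof cases
        case 1
        then show ?thesis using g F1 by simp
      next
        case 2
        then show ?thesis using g X F[OF X 2(2)] unfolding homs_def psum_alt by simp
      next
        case 3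
        then show ?thesis using g FN[OF homs_carrier[OF X] 3] homs_carrier[OF X] by simp
      qed
    qed
    then show "g = (\<lambda>x\<in>carrier S. ?f x)"
      using gs by (auto intro!: extensionalityI[of _ "carrier S"] simp: PiE_def)
  qed
qed

lemma Phi_map_eq:
  assumes c: "\<And>n. n < N \<Longrightarrow> c n \<in> grade K 0" and N: "1 \<le> N" and a: "a \<in> carrier M"
  shows "Phi_map K M N c a = (\<lambda>x\<in>carrier S. Phi 0 (phiS c N 0 (hcomp M 0 a)) x \<oplus>\<^bsub>S\<^esub> Phi 1 (phiS c N 1 (hcomp M 1 a)) x)"
proof
  fix x
  have h: "hcomp M 0 a \<in> grade M 0" "hcomp M 1 a \<in> grade M 1" using a by auto
  note p = phiS_par[OF c h(1), of N] phiS_par[OF c h(2), of N]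
  let ?i = "\<lambda>x\<in>carrier S. x"
  let ?g = "compose (carrier S) (sym_of K M) (phi_map K M N c a)"
  have li: "lin_map K S S ?i" by (simp add: lin_map_def add_mapI S.rsmult_closed)
  note g0 = par_sym_of_comp[OF p(1)] and g1 = par_sym_of_comp[OF p(2)]
  have gg: "?g y = sym_of K M (phiS c N 0 (hcomp M 0 a) y) \<oplus>\<^bsub>S\<^esub> sym_of K M (phiS c N 1 (hcomp M 1 a) y)"
    if "y \<in> carrier S" for y
    using that par_mapD(4)[OF p(1)] par_mapD(4)[OF p(2)] by (simp add: compose_def phi_map_eq[OF c N a] sym_of_add)
  show "Phi_map K M N c a x = (\<lambda>x\<in>carrier S. Phi 0 (phiS c N 0 (hcomp M 0 a)) x \<oplus>\<^bsub>S\<^esub> Phi 1 (phiS c N 1 (hcomp M 1 a)) x) x"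
  proof (cases "x \<in> carrier S")
    case True
    have e: "tf 0 ?i (\<lambda>x. sym_of K M (phiS c N 0 (hcomp M 0 a) x)) (Delta x) = tf 0 (\<lambda>x. x) (\<lambda>x. sym_of K M (phiS c N 0 (hcomp M 0 a) x)) (Delta x)"
      "tf 1 ?i (\<lambda>x. sym_of K M (phiS c N 1 (hcomp M 1 a) x)) (Delta x) = tf 1 (\<lambda>x. x) (\<lambda>x. sym_of K M (phiS c N 1 (hcomp M 1 a) x)) (Delta x)"
      by (rule tf_cong[OF li g0 S.lin_map_id g0] tf_cong[OF li g1 S.lin_map_id g1]; use True in simp)+
    have "Phi_map K M N c a x = sym_mult K M (tensor_map K S S S S ?i ?g (Delta x))"
      using True by (simp add: Phi_map_def Let_def compose_def sym_coprod_eq)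
    also have "\<dots> = sym_mult K M (tf 0 (\<lambda>x. x) (\<lambda>x. sym_of K M (phiS c N 0 (hcomp M 0 a) x)) (Delta x)
        \<oplus>\<^bsub>E\<^esub> tf 1 (\<lambda>x. x) (\<lambda>x. sym_of K M (phiS c N 1 (hcomp M 1 a) x)) (Delta x))"
      using True by (simp only: tensor_map_tf[OF li g0 g1 gg Delta_closed] e)
    also have "\<dots> = Phi 0 (phiS c N 0 (hcomp M 0 a)) x \<oplus>\<^bsub>S\<^esub> Phi 1 (phiS c N 1 (hcomp M 1 a)) x"
      unfolding Phi_def using True
      by (intro add_map_add[OF sym_mult_map] tf_closed S.lin_map_id g0 g1 Delta_closed)
    finally show ?thesis using True by simp
  qed (simp add: Phi_map_def Let_def compose_def)
qed

end

section \<open>The commutator of two of the coderivations\<close>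

text \<open>
  A polynomial in \<open>t\<close> and \<open>u\<close> is evaluated by replacing \<open>t\<^sup>r u\<^sup>s\<close> with the convolution bracket of
  \<open>(ad \<pi>)\<^sup>r (a \<epsilon>)\<close> and \<open>(ad \<pi>)\<^sup>s (b \<epsilon>)\<close>. By the Leibniz rule \<open>ad \<pi>\<close> becomes multiplication by \<open>t + u\<close>.
\<close>

definition arr_up :: "('k, 'x) ring_scheme \<Rightarrow> (nat \<Rightarrow> nat \<Rightarrow> 'k) \<Rightarrow> nat \<Rightarrow> nat \<Rightarrow> 'k"
  where "arr_up K A s r = (if r = 0 then \<zero>\<^bsub>K\<^esub> else A s (r - 1)) \<oplus>\<^bsub>K\<^esub> (if s = 0 then \<zero>\<^bsub>K\<^esub> else A (s - 1) r)"

text \<open>Multiplication by t + u followed by adding \<open>B n\<close>. In \<open>A s r\<close>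
  the exponent s of u comes first, as for polynomials in u over polynomials in t. Start 0 and
  \<phi>(u) t^n as \<open>B n\<close> give \<phi>(u) ((t+u)^n - t^n)/u; start 1 and zero increments
  give (t+u)^n.\<close>

fun arr_rec :: "('k, 'x) ring_scheme \<Rightarrow> (nat \<Rightarrow> nat \<Rightarrow> 'k) \<Rightarrow> (nat \<Rightarrow> nat \<Rightarrow> nat \<Rightarrow> 'k) \<Rightarrow> nat \<Rightarrow> nat \<Rightarrow> nat \<Rightarrow> 'k" where
  "arr_rec K A B 0 = A"
| "arr_rec K A B (Suc n) = (\<lambda>s r. arr_up K (arr_rec K A B n) s r \<oplus>\<^bsub>K\<^esub> B n s r)"

fun arr_sum :: "('k, 'x) ring_scheme \<Rightarrow> (nat \<Rightarrow> 'k) \<Rightarrow> (nat \<Rightarrow> nat \<Rightarrow> nat \<Rightarrow> 'k) \<Rightarrow> nat \<Rightarrow> nat \<Rightarrow> nat \<Rightarrow> 'k" where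
  "arr_sum K c A 0 = (\<lambda>s r. \<zero>\<^bsub>K\<^esub>)"
| "arr_sum K c A (Suc n) = (\<lambda>s r. arr_sum K c A n s r \<oplus>\<^bsub>K\<^esub> c n \<otimes>\<^bsub>K\<^esub> A n s r)"

text \<open>The array of \<phi>(u) t^n; the next one is that of \<phi>(t) u^n.\<close>

definition arr_row where "arr_row K c n s r = (if r = n then c s else \<zero>\<^bsub>K\<^esub>)"
definition arr_col where "arr_col K c n s r = (if s = n then c r else \<zero>\<^bsub>K\<^esub>)"
definition arr_unit where "arr_unit K s r = (if s = 0 \<and> r = (0 :: nat) then \<one>\<^bsub>K\<^esub> else \<zero>\<^bsub>K\<^esub>)" for s :: nat
definition arr_zero where "arr_zero K s r = \<zero>\<^bsub>K\<^esub>" for s r :: nat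

text \<open>Coefficients of \<phi>(u) (\<phi>(t+u) - \<phi>(t))/u + \<phi>(t) (\<phi>(t+u) -
  \<phi>(u))/t + \<phi>(t+u), where the outer sums over powers are cut off at N.\<close>

definition arr_total where "arr_total K c N s r =
  (arr_sum K c (arr_rec K (arr_zero K) (arr_row K c)) N s r
    \<oplus>\<^bsub>K\<^esub> arr_sum K c (arr_rec K (arr_zero K) (arr_col K c)) N s r)
    \<oplus>\<^bsub>K\<^esub> arr_sum K c (arr_rec K (arr_unit K) (\<lambda>n. arr_zero K)) N s r"

context lie_sym
begin

lemma fsum_cong: "(\<And>i. i < n \<Longrightarrow> h i x = k i x) \<Longrightarrow> fsum h n x = fsum k n x"
  by (induction n) simp_all

lemma fsum_closed: "(\<And>i. i < n \<Longrightarrow> h i x \<in> carrier M) \<Longrightarrow> fsum h n x \<in> carrier M"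
  by (induction n) simp_all

lemma fsum_add:
  "(\<And>i. i < n \<Longrightarrow> h i x \<in> carrier M \<and> k i x \<in> carrier M) \<Longrightarrow> fsum (\<lambda>i x. h i x \<oplus> k i x) n x = fsum h n x \<oplus> fsum k n x"
proof (induction n)
  case (Suc n)
  then have "fsum h n x \<in> carrier M" "fsum k n x \<in> carrier M" by (auto intro!: fsum_closed)
  then show ?case using Suc by (simp add: a_ac)
qed simp

lemma fsum_rsmult:
  "\<lbrakk>\<And>i. i < n \<Longrightarrow> h i x \<in> carrier M; c \<in> carrier K\<rbrakk> \<Longrightarrow> rsmult M (fsum h n x) c = fsum (\<lambda>i x. rsmult M (h i x) c) n x"
proof (induction n)
  case (Suc n)
  then have "fsum h n x \<in> carrier M" by (auto intro!: fsum_closed)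
  then show ?case using Suc by (simp add: rsmult_add_left)
qed simp

lemma fsum_neg:
  "(\<And>i. i < n \<Longrightarrow> h i x \<in> carrier M) \<Longrightarrow> \<ominus> fsum h n x = fsum (\<lambda>i x. \<ominus> h i x) n x"
proof (induction n)
  case (Suc n)
  then have "fsum h n x \<in> carrier M" by (auto intro!: fsum_closed)
  then show ?case using Suc by (simp add: minus_add)
qed simp

lemma fsum_shift:
  "(\<And>i. i \<le> n \<Longrightarrow> h i x \<in> carrier M) \<Longrightarrow> fsum h n x \<oplus> h n x = h 0 x \<oplus> fsum (\<lambda>i. h (Suc i)) n x"
proof (induction n)
  case (Suc n)
  then have "fsum (\<lambda>i. h (Suc i)) n x \<in> carrier M" by (auto intro!: fsum_closed)
  then show ?case using Suc by (simp add: a_assoc)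
qed simp

lemma fsum_shift_zero:
  "\<lbrakk>\<And>i. i \<le> n \<Longrightarrow> h i x \<in> carrier M; h 0 x = \<zero>; h n x = \<zero>\<rbrakk> \<Longrightarrow> fsum (\<lambda>i. h (Suc i)) n x = fsum h n x"
  using fsum_shift[of n h x] fsum_closed[of n h x] fsum_closed[of n "\<lambda>i. h (Suc i)" x] by simp

lemma conv_fsum_right:
  assumes f: "par_map K S M p f" and h: "\<And>i. i < n \<Longrightarrow> par_map K S M r (h i)" and x: "x \<in> carrier S"
  shows "conv r f (fsum h n) x = fsum (\<lambda>i. conv r f (h i)) n x"
  using h
proof (induction n)
  case 0
  then show ?case using conv_zero(1)[OF f x] by simp
next
  case (Suc n)
  have n: "par_map K S M r (fsum h n)" "par_map K S M r (h n)" using Suc by (auto intro!: fsum_par)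
  have "conv r f (fsum h (Suc n)) x = ksgn M 0 (conv r f (fsum h n) x) \<oplus> conv r f (h n) x"
    by (rule conv_add_right[OF f n par_map_add[OF n, folded fsum.simps(2)] x]) simp
  then show ?case using Suc by simp
qed

lemma conv_fsum_left:
  assumes f: "par_map K S M r f" and h: "\<And>i. i < n \<Longrightarrow> par_map K S M p (h i)" and x: "x \<in> carrier S"
  shows "conv r (fsum h n) f x = fsum (\<lambda>i. conv r (h i) f) n x"
  using h
proof (induction n)
  case 0
  then show ?case using conv_zero(2)[OF f x] by simp
next
  case (Suc n)
  have n: "par_map K S M p (fsum h n)" "par_map K S M p (h n)" using Suc by (auto intro!: fsum_par)
  have "conv r (fsum h (Suc n)) f x = ksgn M 0 (conv r (fsum h n) f x) \<oplus> conv r (h n) f x"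
    by (rule conv_add_left[OF n par_map_add[OF n, folded fsum.simps(2)] f x]) simp
  then show ?case using Suc by simp
qed

end

section \<open>Evaluation of coefficient arrays on a pair of elements\<close>

locale lie_pair = lie_sym K M
  for K :: "'k superring" and M :: "('k, 'm, 'x) lie_super_scheme" (structure) +
  fixes N :: nat and p q :: bit and a b :: 'm and c :: "nat \<Rightarrow> 'k"
  assumes nil: "lie_nilpotent N M" and a: "a \<in> grade M p" and b: "b \<in> grade M q"
    and c: "\<And>n. c n \<in> grade K 0" and N: "1 \<le> N"
begin

abbreviation V where "V \<equiv> Vm p q a b"

definition arr :: "(nat \<Rightarrow> nat \<Rightarrow> 'k) \<Rightarrow> bool" where "arr A \<longleftrightarrow> (\<forall>s r. A s r \<in> grade K 0)"

lemma arr_closed: "arr A \<Longrightarrow> A s r \<in> carrier K"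
  unfolding arr_def using K.grade_closed by blast

lemma cK [simp]: "c n \<in> carrier K"
  using c by (rule K.grade_closed)

lemma arr_up_arr: "arr A \<Longrightarrow> arr (arr_up K A)"
  by (auto simp: arr_def arr_up_def)

lemma arr_rec_arr: "\<lbrakk>arr A; \<And>n. arr (B n)\<rbrakk> \<Longrightarrow> arr (arr_rec K A B n)"
  by (induction n) (use arr_up_arr in \<open>auto simp: arr_def\<close>)

lemma arr_sum_arr: "(\<And>n. arr (A n)) \<Longrightarrow> arr (arr_sum K c A n)"
proof (induction n)
  case (Suc n)
  have "c n \<otimes>\<^bsub>K\<^esub> A n s r \<in> grade K (0 + 0)" for s r
    using Suc(2) by (intro K.grade_mult c) (simp add: arr_def)
  then show ?case using Suc by (auto simp: arr_def)
qed (simp add: arr_def)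

lemma arr_basic: "arr (arr_row K c n)" "arr (arr_col K c n)" "arr (arr_unit K)" "arr (arr_zero K)"
  using c by (auto simp: arr_def arr_row_def arr_col_def arr_unit_def arr_zero_def)

lemma VM [simp]: "x \<in> carrier S \<Longrightarrow> V r s x \<in> carrier M"
  by (rule par_mapD(4)[OF Vm_par[OF a b]])

lemma V_nil: "\<lbrakk>x \<in> carrier S; N \<le> Suc (r + s)\<rbrakk> \<Longrightarrow> V r s x = \<zero>"
  by (rule Vm_nilpotent[OF nil a b])

definition lam1 :: "(nat \<Rightarrow> nat \<Rightarrow> 'k) \<Rightarrow> nat \<Rightarrow> _ \<Rightarrow> 'm"
  where "lam1 A s = fsum (\<lambda>r x. rsmult M (V r s x) (A s r)) N"

text \<open>Restricting both exponents to values below N loses nothing, because the brackets left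
  out vanish by nilpotency.\<close>

definition lam :: "(nat \<Rightarrow> nat \<Rightarrow> 'k) \<Rightarrow> _ \<Rightarrow> 'm"
  where "lam A = fsum (lam1 A) N"

lemma lam1_closed [simp]: "\<lbrakk>arr A; x \<in> carrier S\<rbrakk> \<Longrightarrow> lam1 A s x \<in> carrier M"
  unfolding lam1_def by (intro fsum_closed rsmult_closed VM arr_closed)

lemma lam_closed [simp]: "\<lbrakk>arr A; x \<in> carrier S\<rbrakk> \<Longrightarrow> lam A x \<in> carrier M"
  unfolding lam_def by (intro fsum_closed lam1_closed)

lemma term_par: "arr A \<Longrightarrow> par_map K S M (p + q) (\<lambda>x. rsmult M (V r s x) (A s' r'))"
  by (rule par_rsmult[OF Vm_par[OF a b]]) (simp add: arr_def)

lemma lam1_par: "arr A \<Longrightarrow> par_map K S M (p + q) (lam1 A s)"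
  unfolding lam1_def by (intro fsum_par term_par)

lemma lam_par: "arr A \<Longrightarrow> par_map K S M (p + q) (lam A)"
  unfolding lam_def by (intro fsum_par lam1_par)

text \<open>Evaluation only depends on the coefficients modulo the truncation ideal: the remaining
  brackets vanish by \<open>V_nil\<close>.\<close>

lemma lam_cong:
  assumes "\<And>r s. Suc (r + s) < N \<Longrightarrow> A s r = B s r" "arr A" "arr B" "x \<in> carrier S"
  shows "lam A x = lam B x"
  unfolding lam_def lam1_def
proof (intro fsum_cong)
  fix s r
  show "rsmult M (V r s x) (A s r) = rsmult M (V r s x) (B s r)"
    using assms V_nil[of x r s] by (cases "Suc (r + s) < N") (auto simp: not_less arr_closed)
qed

lemma lam_add:
  assumes "arr A" "arr B" "x \<in> carrier S" shows "lam (\<lambda>s r. A s r \<oplus>\<^bsub>K\<^esub> B s r) x = lam A x \<oplus> lam B x"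
proof -
  have "lam1 (\<lambda>s r. A s r \<oplus>\<^bsub>K\<^esub> B s r) s x = lam1 A s x \<oplus> lam1 B s x" for s
    unfolding lam1_def using assms
    by (subst fsum_add[symmetric]) (auto intro!: fsum_cong simp: rsmult_add_right arr_closed rsmult_closed)
  then show ?thesis
    unfolding lam_def using assms by (subst fsum_add[symmetric]) (auto intro!: fsum_cong)
qed

lemma lam_scale:
  assumes "arr A" "d \<in> grade K 0" "x \<in> carrier S" shows "lam (\<lambda>s r. d \<otimes>\<^bsub>K\<^esub> A s r) x = rsmult M (lam A x) d"
proof -
  have d: "d \<in> carrier K" using assms K.grade_closed by blast
  have "d \<otimes>\<^bsub>K\<^esub> A s r = A s r \<otimes>\<^bsub>K\<^esub> d" for s r
    using K.supercomm[OF assms(2), of "A s r" 0] assms(1) by (simp add: arr_def)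
  then have "lam1 (\<lambda>s r. d \<otimes>\<^bsub>K\<^esub> A s r) s x = rsmult M (lam1 A s x) d" for s
    unfolding lam1_def using assms d
    by (subst fsum_rsmult) (auto intro!: fsum_cong simp: rsmult_assoc arr_closed rsmult_closed)
  then show ?thesis
    unfolding lam_def using assms d by (subst fsum_rsmult) (auto intro!: fsum_cong)
qed

lemma lam_zero: "x \<in> carrier S \<Longrightarrow> lam (arr_zero K) x = \<zero>"
  unfolding lam_def lam1_def arr_zero_def by (intro fsum_zero) simp

lemma lam1_single:
  assumes "arr A" "x \<in> carrier S" "\<And>r. r < N \<Longrightarrow> r \<noteq> n \<Longrightarrow> A s r = \<zero>\<^bsub>K\<^esub>" "n < N"
  shows "lam1 A s x = rsmult M (V n s x) (A s n)"
  unfolding lam1_def using assms by (intro fsum_single) (auto intro!: rsmult_closed arr_closed)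

text \<open>By \<open>Vm_ad\<close> one of the two exponents is raised; re-indexing transfers this
  to the coefficients. The boundary terms at exponent N vanish by nilpotency.\<close>

lemma lam_up:
  assumes A: "arr A" and x: "x \<in> carrier S"
  shows "conv (p + q) pr (lam A) x = lam (arr_up K A) x"
proof -
  \<comment> \<open>Multiplication of the array by t; \<open>Au\<close> below is multiplication by
    u.\<close>
  define At where "At s r = (if r = 0 then \<zero>\<^bsub>K\<^esub> else A s (r - 1))" for s r
  define Au where "Au s r = (if s = 0 then \<zero>\<^bsub>K\<^esub> else A (s - 1) r)" for s r
  have At: "arr At" and Au: "arr Au" using A by (auto simp: arr_def At_def Au_def)
  have AK: "A s r \<in> carrier K" for s r using A by (rule arr_closed)
  have "conv (p + q) pr (lam A) x = fsum (\<lambda>s. conv (p + q) pr (lam1 A s)) N x"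
    unfolding lam_def by (rule conv_fsum_right[OF pr_par lam1_par[OF A] x])
  also have "\<dots> = fsum (\<lambda>s x. fsum (\<lambda>r x. rsmult M (V (Suc r) s x) (A s r)) N x
      \<oplus> fsum (\<lambda>r x. rsmult M (V r (Suc s) x) (A s r)) N x) N x"
  proof (rule fsum_cong)
    fix s
    have "conv (p + q) pr (lam1 A s) x = fsum (\<lambda>r. conv (p + q) pr (\<lambda>x. rsmult M (V r s x) (A s r))) N x"
      unfolding lam1_def by (rule conv_fsum_right[OF pr_par term_par[OF A] x])
    also have "\<dots> = fsum (\<lambda>r x. rsmult M (V (Suc r) s x) (A s r) \<oplus> rsmult M (V r (Suc s) x) (A s r)) N x"
    proof (rule fsum_cong)
      fix r
      have "conv (p + q) pr (\<lambda>x. rsmult M (V r s x) (A s r)) x = rsmult M (conv (p + q) pr (V r s) x) (A s r)"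
        by (rule conv_scale_right[OF pr_par Vm_par[OF a b] _ x]) (use A in \<open>simp add: arr_def\<close>)
      then show "conv (p + q) pr (\<lambda>x. rsmult M (V r s x) (A s r)) x = rsmult M (V (Suc r) s x) (A s r) \<oplus> rsmult M (V r (Suc s) x) (A s r)"
        using x AK by (simp add: Vm_ad[OF a b] rsmult_add_left)
    qed
    also have "\<dots> = fsum (\<lambda>r x. rsmult M (V (Suc r) s x) (A s r)) N x \<oplus> fsum (\<lambda>r x. rsmult M (V r (Suc s) x) (A s r)) N x"
      using x AK by (intro fsum_add) (simp add: rsmult_closed)
    finally show "conv (p + q) pr (lam1 A s) x = fsum (\<lambda>r x. rsmult M (V (Suc r) s x) (A s r)) N x
      \<oplus> fsum (\<lambda>r x. rsmult M (V r (Suc s) x) (A s r)) N x" .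
  qed
  also have "\<dots> = fsum (\<lambda>s. fsum (\<lambda>r x. rsmult M (V (Suc r) s x) (A s r)) N) N x
      \<oplus> fsum (\<lambda>s. fsum (\<lambda>r x. rsmult M (V r (Suc s) x) (A s r)) N) N x"
    using x AK by (intro fsum_add) (auto intro!: fsum_closed rsmult_closed)
  also have "fsum (\<lambda>s. fsum (\<lambda>r x. rsmult M (V (Suc r) s x) (A s r)) N) N x = lam At x"
    unfolding lam_def
  proof (rule fsum_cong)
    fix s
    have "fsum (\<lambda>r. (\<lambda>r x. rsmult M (V r s x) (At s r)) (Suc r)) N x = fsum (\<lambda>r x. rsmult M (V r s x) (At s r)) N x"
      by (rule fsum_shift_zero) (use x arr_closed[OF At] AK V_nil in \<open>auto simp: At_def intro!: rsmult_closed\<close>)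
    then show "fsum (\<lambda>r x. rsmult M (V (Suc r) s x) (A s r)) N x = lam1 At s x"
      by (simp add: lam1_def At_def)
  qed
  also have "fsum (\<lambda>s. fsum (\<lambda>r x. rsmult M (V r (Suc s) x) (A s r)) N) N x = lam Au x"
  proof -
    have "fsum (\<lambda>s. lam1 Au (Suc s)) N x = fsum (lam1 Au) N x"
    proof (rule fsum_shift_zero)
      show "lam1 Au 0 x = \<zero>" unfolding lam1_def by (rule fsum_zero) (use x in \<open>simp add: Au_def\<close>)
      show "lam1 Au N x = \<zero>" unfolding lam1_def by (rule fsum_zero) (use x arr_closed[OF Au] V_nil in simp)
    qed (use x Au in simp)
    then show ?thesis by (simp add: lam_def lam1_def Au_def)
  qed
  also have "lam At x \<oplus> lam Au x = lam (arr_up K A) x"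
    unfolding lam_add[OF At Au x, symmetric] by (intro arg_cong[where f = "\<lambda>A. lam A x"] ext) (simp add: arr_up_def At_def Au_def)
  finally show ?thesis .
qed

abbreviation "phA \<equiv> phiS c N p a"
abbreviation "phB \<equiv> phiS c N q b"

lemma phA_par: "par_map K S M p phA" and phB_par: "par_map K S M q phB"
  using c by (auto intro!: phiS_par a b)

lemma conv_phB:
  assumes "n < N" "x \<in> carrier S"
  shows "conv q (adpow p a n) phB x = lam (arr_row K c n) x"
proof -
  have "conv q (adpow p a n) phB x = fsum (\<lambda>s. conv q (adpow p a n) (\<lambda>x. rsmult M (adpow q b s x) (c s))) N x"
    unfolding phiS_def by (rule conv_fsum_right[OF adpow_par[OF a] par_rsmult[OF adpow_par[OF b] c] assms(2)])
  also have "\<dots> = fsum (lam1 (arr_row K c n)) N x"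
    using conv_scale_right[OF adpow_par[OF a] adpow_par[OF b] c assms(2)] lam1_single[OF arr_basic(1) assms(2), of n n] assms(1)
    by (intro fsum_cong) (simp add: arr_row_def Vm_def)
  finally show ?thesis by (simp add: lam_def)
qed

lemma conv_phA:
  assumes "n < N" "x \<in> carrier S"
  shows "conv q phA (adpow q b n) x = lam (arr_col K c n) x"
proof -
  have "conv q phA (adpow q b n) x = fsum (\<lambda>r. conv q (\<lambda>x. rsmult M (adpow p a r x) (c r)) (adpow q b n)) N x"
    unfolding phiS_def by (rule conv_fsum_left[OF adpow_par[OF b] par_rsmult[OF adpow_par[OF a] c] assms(2)])
  also have "\<dots> = lam1 (arr_col K c n) n x"
    unfolding lam1_def using conv_scale_left[OF adpow_par[OF a] adpow_par[OF b] c assms(2)]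
    by (intro fsum_cong) (simp add: arr_col_def Vm_def)
  also have "\<dots> = fsum (lam1 (arr_col K c n)) N x"
  proof (rule fsum_single[symmetric])
    fix s assume "s < N" "s \<noteq> n"
    then show "lam1 (arr_col K c n) s x = \<zero>"
      unfolding lam1_def using assms by (intro fsum_zero) (simp add: arr_col_def)
  qed (use assms arr_basic in auto)
  finally show ?thesis by (simp add: lam_def)
qed

lemma cst_Phi: "\<lbrakk>par_map K S M r g; x \<in> carrier S; d \<in> carrier M\<rbrakk> \<Longrightarrow> cst d (Phi r g x) = \<zero>"
  by (simp add: cst_def eps_Phi)

text \<open>In the bracket of \<pi> with the n-th power, the coderivation of b hits either \<pi>,
  which becomes the map of b by \<open>pr_Phi\<close>, or the power, which is the induction
  hypothesis. Antisymmetry turns the first term into -\<phi>(u) t^n. The recursion starts at zero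
  since the augmentation vanishes on values of coderivations.\<close>

lemma adpow_PhiB:
  "\<lbrakk>n \<le> N; x \<in> carrier S\<rbrakk> \<Longrightarrow> adpow p a n (Phi q phB x) = \<ominus> lam (arr_rec K (arr_zero K) (arr_row K c) n) x"
proof (induction n arbitrary: x)
  case 0
  have z: "\<ominus> \<zero> = \<zero>" by (rule minus_equality) simp_all
  from 0 show ?case using phB_par grade_closed[OF a]
    by (simp add: cst_Phi lam_zero) (rule z[symmetric])
next
  case (Suc n)
  let ?A = "arr_rec K (arr_zero K) (arr_row K c) n"
  have A: "arr ?A" "arr (arr_up K ?A)" by (intro arr_up_arr arr_rec_arr arr_basic)+
  have x: "x \<in> carrier S" using Suc by simp
  note f = adpow_par[OF a, of n] and g = phB_par
  have fg: "par_map K S M (p + q) (\<lambda>x. adpow p a n (Phi q phB x))"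
    by (rule par_map_comp[OF Phi_par[OF g] f])
  have "adpow p a (Suc n) (Phi q phB x) = ksgn M (q * p) (conv p (\<lambda>x. pr (Phi q phB x)) (adpow p a n) x)
      \<oplus> conv (p + q) pr (\<lambda>x. adpow p a n (Phi q phB x)) x"
    using conv_Phi[OF pr_par f g x] by simp
  also have "conv p (\<lambda>x. pr (Phi q phB x)) (adpow p a n) x = conv p phB (adpow p a n) x"
    by (rule conv_cong[OF _ f g f x]) (use par_map_comp[OF Phi_par[OF g] pr_par] g in \<open>simp_all add: pr_Phi\<close>)
  also have "\<dots> = \<ominus> ksgn M (q * p) (lam (arr_row K c n) x)"
    using conv_antisym[OF x g f] conv_phB[of n x] Suc by simp
  also have "ksgn M (q * p) \<dots> = \<ominus> lam (arr_row K c n) x"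
    using x arr_basic by (simp add: neg_ksgn ksgn_1 flip: add.assoc)
  also have "conv (p + q) pr (\<lambda>x. adpow p a n (Phi q phB x)) x = ksgn M 1 (conv (p + q) pr (lam ?A) x) \<oplus> conv (p + q) pr (\<lambda>x. \<zero>) x"
    by (rule conv_add_right[OF pr_par lam_par[OF A(1)] par_map_zero fg x]) (use Suc A in \<open>simp add: ksgn_1\<close>)
  also have "\<dots> = \<ominus> lam (arr_up K ?A) x"
    using conv_zero(1)[OF pr_par x] x A by (simp add: lam_up ksgn_1)
  finally show ?case
    using x A arr_basic by (simp add: lam_add minus_add a_comm)
qed

text \<open>The mirror image: the map of a already stands on the left of the bracket, so there is no
  minus sign, only the sign for exchanging a and b.\<close>

lemma adpow_PhiA:
  "\<lbrakk>n \<le> N; x \<in> carrier S\<rbrakk> \<Longrightarrow> adpow q b n (Phi p phA x) = ksgn M (p * q) (lam (arr_rec K (arr_zero K) (arr_col K c) n) x)"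
proof (induction n arbitrary: x)
  case 0
  then show ?case using phA_par grade_closed[OF b] by (simp add: cst_Phi lam_zero)
next
  case (Suc n)
  let ?A = "arr_rec K (arr_zero K) (arr_col K c) n"
  have A: "arr ?A" "arr (arr_up K ?A)" by (intro arr_up_arr arr_rec_arr arr_basic)+
  have x: "x \<in> carrier S" using Suc by simp
  note f = adpow_par[OF b, of n] and g = phA_par
  have fg: "par_map K S M (q + p) (\<lambda>x. adpow q b n (Phi p phA x))"
    by (rule par_map_comp[OF Phi_par[OF g] f])
  have lA: "par_map K S M (q + p) (lam ?A)" using lam_par[OF A(1)] by (simp add: add.commute)
  have "adpow q b (Suc n) (Phi p phA x) = ksgn M (p * q) (conv q (\<lambda>x. pr (Phi p phA x)) (adpow q b n) x)
      \<oplus> conv (q + p) pr (\<lambda>x. adpow q b n (Phi p phA x)) x"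
    using conv_Phi[OF pr_par f g x] by simp
  also have "conv q (\<lambda>x. pr (Phi p phA x)) (adpow q b n) x = conv q phA (adpow q b n) x"
    by (rule conv_cong[OF _ f g f x]) (use par_map_comp[OF Phi_par[OF g] pr_par] g in \<open>simp_all add: pr_Phi\<close>)
  also have "\<dots> = lam (arr_col K c n) x"
    using conv_phA[of n x] Suc by simp
  also have "conv (q + p) pr (\<lambda>x. adpow q b n (Phi p phA x)) x = ksgn M (p * q) (conv (q + p) pr (lam ?A) x) \<oplus> conv (q + p) pr (\<lambda>x. \<zero>) x"
    by (rule conv_add_right[OF pr_par lA par_map_zero fg x]) (use Suc A in simp)
  also have "\<dots> = ksgn M (p * q) (lam (arr_up K ?A) x)"
    using conv_zero(1)[OF pr_par x] x A lam_up[OF A(1) x] by (simp add: add.commute)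
  finally show ?case
    using x A arr_basic by (simp add: lam_add ksgn_add a_comm)
qed

text \<open>The constant map of [a, b] is the bracket of the constant maps of a and b, which is the
  monomial 1; each ad \<pi> multiplies by t + u.\<close>

lemma adpow_br:
  "x \<in> carrier S \<Longrightarrow> adpow (p + q) (br a b) n x = lam (arr_rec K (arr_unit K) (\<lambda>n. arr_zero K) n) x"
proof (induction n arbitrary: x)
  case 0
  note g = grade_closed[OF a] grade_closed[OF b]
  have "cst (br a b) x = V 0 0 x"
    using 0 g by (simp add: Vm_zero[OF a b] cst_def bracket_rsmult_right)
  also have "\<dots> = lam1 (arr_unit K) 0 x"
    using lam1_single[OF arr_basic(3) 0, of 0 0] N 0 by (simp add: arr_unit_def rsmult_one)
  also have "\<dots> = lam (arr_unit K) x"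
    unfolding lam_def
  proof (rule fsum_single[symmetric])
    fix s assume "s < N" "s \<noteq> 0"
    then show "lam1 (arr_unit K) s x = \<zero>"
      unfolding lam1_def using 0 by (intro fsum_zero) (simp add: arr_unit_def)
  qed (use 0 N arr_basic in auto)
  finally show ?case by simp
next
  case (Suc n)
  let ?A = "arr_rec K (arr_unit K) (\<lambda>n. arr_zero K) n"
  have A: "arr ?A" "arr (arr_up K ?A)" by (intro arr_up_arr arr_rec_arr arr_basic)+
  have "adpow (p + q) (br a b) (Suc n) x = conv (p + q) pr (lam ?A) x"
    using Suc by (simp, intro conv_cong[OF pr_par adpow_par[OF bracket_even[OF a b]] pr_par lam_par[OF A(1)]]) auto
  then show ?case using Suc A arr_basic by (simp add: lam_up lam_add lam_zero)
qed

lemma lam_sum: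
  assumes A: "\<And>n. arr (A n)" and x: "x \<in> carrier S"
  shows "lam (arr_sum K c A n) x = fsum (\<lambda>n x. rsmult M (lam (A n) x) (c n)) n x"
proof (induction n)
  case 0
  show ?case using lam_zero[OF x] by (simp add: arr_zero_def[abs_def])
next
  case (Suc n)
  have "arr (\<lambda>s r. c n \<otimes>\<^bsub>K\<^esub> A n s r)"
    using K.grade_mult[OF c, of "A n s r" 0 n for s r] A by (simp add: arr_def)
  then show ?case using Suc lam_add[OF arr_sum_arr[OF A]] lam_scale[OF A c x] x by simp
qed

text \<open>Combines the three evaluations. The minus signs of \<open>adpow_PhiB\<close> and of the
  commutator make all three terms enter the defect with a plus.\<close>

lemma commutator_defect:
  assumes x: "x \<in> carrier S"
  shows "phiS c N (p + q) (br a b) x \<ominus> hbr p q phA phB x = lam (arr_total K c N) x"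
proof -
  let ?G = "arr_rec K (arr_zero K) (arr_row K c)" and ?H = "arr_rec K (arr_zero K) (arr_col K c)"
    and ?P = "arr_rec K (arr_unit K) (\<lambda>n. arr_zero K)"
  have A: "arr (?G n)" "arr (?H n)" "arr (?P n)" for n by (intro arr_rec_arr arr_basic)+
  have s: "arr (arr_sum K c ?G N)" "arr (arr_sum K c ?H N)" "arr (arr_sum K c ?P N)" by (intro arr_sum_arr A)+
  note g = phA_par phB_par
  have 1: "phA (Phi q phB x) = \<ominus> lam (arr_sum K c ?G N) x"
  proof -
    have "phA (Phi q phB x) = fsum (\<lambda>n x. \<ominus> rsmult M (lam (?G n) x) (c n)) N x"
      unfolding phiS_def[of c N p a]
    proof -
      have "fsum (\<lambda>n x. rsmult M (adpow p a n x) (c n)) n (Phi q phB x) = fsum (\<lambda>n x. \<ominus> rsmult M (lam (?G n) x) (c n)) n x"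
        if "n \<le> N" for n
        using that
      proof (induction n)
        case (Suc n)
        have "rsmult M (\<ominus> lam (?G n) x) (c n) = \<ominus> rsmult M (lam (?G n) x) (c n)"
          using rsmult_ksgn(1)[of "lam (?G n) x" "c n" 1] x A by (simp add: ksgn_1)
        then show ?case using Suc adpow_PhiB[of n x] x by simp
      qed simp
      then show "fsum (\<lambda>n x. rsmult M (adpow p a n x) (c n)) N (Phi q phB x) = fsum (\<lambda>n x. \<ominus> rsmult M (lam (?G n) x) (c n)) N x" by simp
    qed
    also have "\<dots> = \<ominus> fsum (\<lambda>n x. rsmult M (lam (?G n) x) (c n)) N x"
      using x A by (intro fsum_neg[symmetric]) (simp add: rsmult_closed)
    finally show ?thesis using lam_sum[OF A(1) x] by simp
  qed
  have 2: "ksgn M (p * q) (phB (Phi p phA x)) = lam (arr_sum K c ?H N) x"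
  proof -
    have "fsum (\<lambda>n x. rsmult M (adpow q b n x) (c n)) n (Phi p phA x) = ksgn M (p * q) (fsum (\<lambda>n x. rsmult M (lam (?H n) x) (c n)) n x)"
      if "n \<le> N" for n
      using that
    proof (induction n)
      case (Suc n)
      have "fsum (\<lambda>n x. rsmult M (lam (?H n) x) (c n)) n x \<in> carrier M"
        using x A by (intro fsum_closed) (simp add: rsmult_closed)
      then show ?case using Suc adpow_PhiA[of n x] x A by (simp add: rsmult_ksgn ksgn_add rsmult_closed)
    qed simp
    moreover have "fsum (\<lambda>n x. rsmult M (lam (?H n) x) (c n)) N x \<in> carrier M"
      using x A by (intro fsum_closed) (simp add: rsmult_closed)
    ultimately show ?thesis using lam_sum[OF A(2) x] by (simp add: phiS_def[of c N q b])
  qed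
  have 3: "phiS c N (p + q) (br a b) x = lam (arr_sum K c ?P N) x"
    unfolding lam_sum[OF A(3) x] phiS_def by (rule fsum_cong) (simp add: adpow_br[OF x])
  have GH: "arr (\<lambda>s r. arr_sum K c ?G N s r \<oplus>\<^bsub>K\<^esub> arr_sum K c ?H N s r)"
    using s by (auto simp: arr_def)
  have "lam (arr_total K c N) x = (lam (arr_sum K c ?G N) x \<oplus> lam (arr_sum K c ?H N) x) \<oplus> lam (arr_sum K c ?P N) x"
    unfolding arr_total_def lam_add[OF s(1,2) x, symmetric] lam_add[OF GH s(3) x, symmetric] ..
  then show ?thesis
    using s x unfolding hbr_def 1 2 3 by (simp add: a_minus_def minus_add a_ac)
qed

lemma arr_total_arr: "arr (arr_total K c N)"
proof -
  have "arr (arr_sum K c (arr_rec K (arr_zero K) (arr_row K c)) N)" "arr (arr_sum K c (arr_rec K (arr_zero K) (arr_col K c)) N)"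
    "arr (arr_sum K c (arr_rec K (arr_unit K) (\<lambda>n. arr_zero K)) N)"
    by (intro arr_sum_arr arr_rec_arr arr_basic)+
  then show ?thesis by (auto simp: arr_def arr_total_def intro!: K.grade_add)
qed

end

section \<open>The functional equation implies the commutation relations\<close>

context lie_sym
begin

lemma adpow_add:
  assumes "a \<in> grade M p" "b \<in> grade M p" "x \<in> carrier S"
  shows "adpow p (a \<oplus> b) n x = adpow p a n x \<oplus> adpow p b n x"
  using assms(3)
proof (induction n arbitrary: x)
  case 0
  then show ?case using assms(1,2)[THEN grade_closed] by (simp add: cst_def rsmult_add_left)
next
  case (Suc n)
  have "conv p pr (adpow p (a \<oplus> b) n) x = ksgn M 0 (conv p pr (adpow p a n) x) \<oplus> conv p pr (adpow p b n) x"
    by (rule conv_add_right[OF pr_par]) (use assms(1,2) Suc in \<open>auto intro!: adpow_par grade_add\<close>)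
  then show ?case by simp
qed

lemma phiS_add:
  assumes c: "\<And>n. c n \<in> grade K 0" and "a \<in> grade M p" "b \<in> grade M p" "x \<in> carrier S"
  shows "phiS c N p (a \<oplus> b) x = phiS c N p a x \<oplus> phiS c N p b x"
proof -
  have m: "adpow p a n x \<in> carrier M" "adpow p b n x \<in> carrier M" for n
    using par_mapD(4)[OF adpow_par[OF assms(2)] assms(4)] par_mapD(4)[OF adpow_par[OF assms(3)] assms(4)] by simp_all
  have k: "c n \<in> carrier K" for n using c by (rule K.grade_closed)
  show ?thesis
    unfolding phiS_def using m k assms
    by (subst fsum_add[symmetric]) (auto intro!: fsum_cong simp: adpow_add rsmult_add_left rsmult_closed)
qed

lemma phiS_zero:
  assumes c: "\<And>n. c n \<in> grade K 0" and x: "x \<in> carrier S"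
  shows "phiS c N p \<zero> x = \<zero>"
  using phiS_add[OF c grade_zero grade_zero x, where N = N and p = p]
    par_mapD(4)[OF phiS_par[OF c grade_zero] x] by simp

end

locale lie_rep = lie_sym K M
  for K :: "'k superring" and M :: "('k, 'm, 'x) lie_super_scheme" (structure) +
  fixes N :: nat and c :: "nat \<Rightarrow> 'k"
  assumes nil: "lie_nilpotent N M" and c: "\<And>n. c n \<in> grade K 0" and N: "1 \<le> N"
begin

abbreviation ph where "ph i a \<equiv> phiS c N i (hcomp M i a)"
abbreviation R where "R \<equiv> Phi_map K M N c"

lemma ph_par: "a \<in> carrier M \<Longrightarrow> par_map K S M i (ph i a)"
  using c by (auto intro!: phiS_par)

lemma R_eq: "a \<in> carrier M \<Longrightarrow> R a = (\<lambda>x\<in>carrier S. Phi 0 (ph 0 a) x \<oplus>\<^bsub>S\<^esub> Phi 1 (ph 1 a) x)"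
  using Phi_map_eq[OF c N] .

text \<open>The homogeneous parts are coderivations by \<open>Phi_coder\<close>; it remains to
  express \<open>tensor_map\<close>, applied to their sum, by the operators
  \<open>tf\<close>.\<close>

lemma R_coderivation:
  assumes a: "a \<in> carrier M"
  shows "coderivation K M (R a)"
proof -
  note p = ph_par[OF a, THEN Phi_par]
  have R: "R a x = Phi 0 (ph 0 a) x \<oplus>\<^bsub>S\<^esub> Phi 1 (ph 1 a) x" if "x \<in> carrier S" for x
    using that by (simp add: R_eq[OF a])
  have l: "lin_map K S S (\<lambda>x. Phi 0 (ph 0 a) x \<oplus>\<^bsub>S\<^esub> Phi 1 (ph 1 a) x)"
    using p by (intro S.lin_map_add) (auto dest: par_mapD(1))
  then have lR: "lin_map K S S (R a)"
    unfolding lin_map_def add_map_def using R by (auto simp: S.rsmult_closed)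
  let ?i = "\<lambda>x\<in>carrier S. x"
  have li: "lin_map K S S ?i" by (simp add: lin_map_def add_mapI S.rsmult_closed)
  have pi: "par_map K S S 0 ?i" by (simp add: par_map_def li S.grade_closed)
  have "Delta (R a x) = tensor_map K S S S S (R a) ?i (Delta x) \<oplus>\<^bsub>E\<^esub> tensor_map K S S S S ?i (R a) (Delta x)"
    if x: "x \<in> carrier S" for x
  proof -
    let ?Z = "Delta x"
    have Z: "?Z \<in> carrier E" using x by simp
    \<comment> \<open>The identity is even, so its odd part is the zero map.\<close>
    have 1: "tensor_map K S S S S (R a) ?i ?Z = tf 0 (R a) ?i ?Z \<oplus>\<^bsub>E\<^esub> tf 1 (R a) (\<lambda>x. \<zero>\<^bsub>S\<^esub>) ?Z"
      by (rule tensor_map_tf[OF lR pi S.par_map_zero _ Z]) simp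
    have 2: "tensor_map K S S S S ?i (R a) ?Z = tf 0 ?i (Phi 0 (ph 0 a)) ?Z \<oplus>\<^bsub>E\<^esub> tf 1 ?i (Phi 1 (ph 1 a)) ?Z"
      by (rule tensor_map_tf[OF li p p R Z])
    have 3: "tf 1 (R a) (\<lambda>x. \<zero>\<^bsub>S\<^esub>) ?Z = \<zero>\<^bsub>E\<^esub>"
      by (rule E_eqI[OF tf_map[OF lR S.par_map_zero] add_map_zero[OF SS.E_abelian_group] Z])
        (simp add: tf_tens lR S.par_map_zero lin_mapD(2)[OF lR] SS.tens_zero)
    have 4: "tf 0 (R a) ?i ?Z = tf 0 (Phi 0 (ph 0 a)) (\<lambda>x. x) ?Z \<oplus>\<^bsub>E\<^esub> tf 0 (Phi 1 (ph 1 a)) (\<lambda>x. x) ?Z"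
      by (rule E_eqI[OF tf_map[OF lR pi] _ Z])
        (auto intro!: add_map_sum SS.E_abelian_group tf_map p[THEN par_mapD(1)] S.par_map_id
          simp: tf_tens lR pi p[THEN par_mapD(1)] S.par_map_id R SS.tens_add_left par_mapD(4)[OF p])
    have 5: "tf 0 ?i (Phi 0 (ph 0 a)) ?Z = tf 0 (\<lambda>x. x) (Phi 0 (ph 0 a)) ?Z"
      "tf 1 ?i (Phi 1 (ph 1 a)) ?Z = tf 1 (\<lambda>x. x) (Phi 1 (ph 1 a)) ?Z"
      by (rule tf_cong[OF li p(1) S.lin_map_id p(1) Z]; simp) (rule tf_cong[OF li p(1) S.lin_map_id p(1) Z]; simp)
    have c: "tf i (\<lambda>x. x) (Phi i (ph i a)) ?Z \<in> carrier E" "tf 0 (Phi i (ph i a)) (\<lambda>x. x) ?Z \<in> carrier E" for i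
      by (intro tf_closed S.lin_map_id p Z S.par_map_id p[THEN par_mapD(1)])+
    have "Delta (R a x) = Delta (Phi 0 (ph 0 a) x) \<oplus>\<^bsub>E\<^esub> Delta (Phi 1 (ph 1 a) x)"
      using x par_mapD(4)[OF p] by (simp add: R add_map_add[OF Delta_map])
    also have "\<dots> = tensor_map K S S S S (R a) ?i ?Z \<oplus>\<^bsub>E\<^esub> tensor_map K S S S S ?i (R a) ?Z"
      unfolding 1 2 3 4 5 Phi_coder[OF ph_par[OF a] x] using c by (simp add: SS.E.a_ac)
    finally show ?thesis .
  qed
  moreover have "R a \<in> shom K S S"
    using lin_mapD[OF lR] by (auto simp: shom_def R_eq[OF a])
  ultimately show ?thesis
    unfolding coderivation_def Let_def sym_coprod_eq using lin_mapD(2)[OF lR] by simp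
qed

lemma scomm_R:
  assumes a: "a \<in> carrier M" and b: "b \<in> carrier M" and x: "x \<in> carrier S"
  shows "scomm S (R a) (R b) x =
    (Phi 0 (hbr 0 0 (ph 0 a) (ph 0 b)) x \<oplus>\<^bsub>S\<^esub> Phi 1 (hbr 0 1 (ph 0 a) (ph 1 b)) x)
    \<oplus>\<^bsub>S\<^esub> (Phi 1 (hbr 1 0 (ph 1 a) (ph 0 b)) x \<oplus>\<^bsub>S\<^esub> Phi 0 (hbr 1 1 (ph 1 a) (ph 1 b)) x)"
proof -
  have h: "hom_comp S S (R d) i w = Phi i (ph i d) w" if d: "d \<in> carrier M" and w: "w \<in> carrier S" for d i w
    using hom_comp_par[OF ph_par[OF d, THEN Phi_par] ph_par[OF d, THEN Phi_par], of "R d" w i] w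
    by (cases i) (simp_all add: R_eq[OF d])
  note pa = ph_par[OF a] and pb = ph_par[OF b]
  have t: "hom_comp S S (R a) i (hom_comp S S (R b) j x) \<ominus>\<^bsub>S\<^esub> ksgn S (i * j) (hom_comp S S (R b) j (hom_comp S S (R a) i x))
      = Phi (i + j) (hbr i j (ph i a) (ph j b)) x" for i j
    using x pa pb Phi_commutator[OF x pa pb] by (simp add: h a b)
  have c: "Phi (i + j) (hbr i j (ph i a) (ph j b)) x \<in> carrier S" for i j
    using x by (intro Phi_closed hbr_par pa pb)
  have "scomm S (R a) (R b) x = (\<Oplus>\<^bsub>S\<^esub>i\<in>{0, 1}. \<Oplus>\<^bsub>S\<^esub>j\<in>{0, 1}. Phi (i + j) (hbr i j (ph i a) (ph j b)) x)"
    unfolding scomm_def restrict_apply' [OF x] t ..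
  then show ?thesis
    using c[of 0 0] c[of 0 1] c[of 1 0] c[of 1 1] by (simp add: S.finsum_bits)
qed

lemma lie_pair: "\<lbrakk>a \<in> grade M p; b \<in> grade M q\<rbrakk> \<Longrightarrow> lie_pair K M N p q a b c"
  by unfold_locales (use nil c N in auto)

text \<open>For each pair of homogeneous components of a and b the defect is an evaluation of
  \<open>arr_total\<close>, whose entries of degree below N - 1 are zero by hypothesis.\<close>

lemma R_bracket:
  assumes z: "\<And>r s. Suc (r + s) < N \<Longrightarrow> arr_total K c N s r = \<zero>\<^bsub>K\<^esub>"
    and a: "a \<in> carrier M" and b: "b \<in> carrier M"
  shows "scomm S (R a) (R b) = R (br a b)"
proof
  fix x
  show "scomm S (R a) (R b) x = R (br a b) x"
  proof (cases "x \<in> carrier S")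
    case x: True
    note g = hcomp_grade[OF a] hcomp_grade[OF b]
    have ab: "br a b \<in> carrier M" using a b by (rule bracket_closed)
    let ?t = "\<lambda>i j. phiS c N (i + j) (br (hcomp M i a) (hcomp M j b))"
    have tp: "par_map K S M (i + j) (?t i j)" for i j
      by (intro phiS_par c bracket_even g)
    have hb: "hbr i j (ph i a) (ph j b) y = ?t i j y" if y: "y \<in> carrier S" for i j y
    proof -
      interpret pair: lie_pair K M N i j "hcomp M i a" "hcomp M j b" c by (intro lie_pair g)
      have "?t i j y \<ominus> hbr i j (ph i a) (ph j b) y = pair.lam (arr_zero K) y"
        unfolding pair.commutator_defect[OF y]
        by (rule pair.lam_cong[OF _ pair.arr_total_arr _ y]) (use z in \<open>auto simp: arr_zero_def pair.arr_def\<close>)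
      then have "?t i j y \<ominus> hbr i j (ph i a) (ph j b) y = \<zero>" using y by (simp add: pair.lam_zero)
      then show ?thesis
        using par_mapD(4)[OF tp y] par_mapD(4)[OF hbr_par[OF ph_par[OF a] ph_par[OF b]] y] minus_eq_zero_iff by metis
    qed
    have P: "Phi (i + j) (hbr i j (ph i a) (ph j b)) x = Phi (i + j) (?t i j) x" for i j
      by (rule Phi_cong[OF tp hbr_par[OF ph_par[OF a] ph_par[OF b]] x hb])
    have br: "br (hcomp M i a) (hcomp M j b) \<in> grade M (i + j)" for i j by (intro bracket_even g)
    have e: "br a b = (br (hcomp M 0 a) (hcomp M 0 b) \<oplus> br (hcomp M 1 a) (hcomp M 1 b))
        \<oplus> (br (hcomp M 0 a) (hcomp M 1 b) \<oplus> br (hcomp M 1 a) (hcomp M 0 b))"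
    proof -
      have "br a b = br (hcomp M 0 a \<oplus> hcomp M 1 a) (hcomp M 0 b \<oplus> hcomp M 1 b)" using a b by (simp add: hcomp_sum)
      then show ?thesis using a b by (simp add: bracket_add_left bracket_add_right bracket_closed a_ac)
    qed
    have gg: "br (hcomp M 0 a) (hcomp M 0 b) \<oplus> br (hcomp M 1 a) (hcomp M 1 b) \<in> grade M 0"
      "br (hcomp M 0 a) (hcomp M 1 b) \<oplus> br (hcomp M 1 a) (hcomp M 0 b) \<in> grade M 1"
      using br[of 0 0] br[of 1 1] br[of 0 1] br[of 1 0] by (auto intro!: grade_add)
    have h: "hcomp M 0 (br a b) = br (hcomp M 0 a) (hcomp M 0 b) \<oplus> br (hcomp M 1 a) (hcomp M 1 b)"
      "hcomp M 1 (br a b) = br (hcomp M 0 a) (hcomp M 1 b) \<oplus> br (hcomp M 1 a) (hcomp M 0 b)"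
      unfolding e using hcomp_sum_grades[OF gg(1), of "br (hcomp M 0 a) (hcomp M 1 b) \<oplus> br (hcomp M 1 a) (hcomp M 0 b)"]
        hcomp_sum_grades[OF gg(2), of "br (hcomp M 0 a) (hcomp M 0 b) \<oplus> br (hcomp M 1 a) (hcomp M 1 b)"]
        gg a_comm[OF gg[THEN grade_closed]] by simp_all
    have 0: "Phi 0 (ph 0 (br a b)) x = ksgn S 0 (Phi 0 (?t 0 0) x) \<oplus>\<^bsub>S\<^esub> Phi 0 (?t 1 1) x"
      by (rule Phi_add[OF _ _ ph_par[OF ab] x])
        (use tp[of 0 0] tp[of 1 1] br[of 0 0] br[of 1 1] in \<open>simp_all add: h phiS_add[OF c]\<close>)
    have 1: "Phi 1 (ph 1 (br a b)) x = ksgn S 0 (Phi 1 (?t 0 1) x) \<oplus>\<^bsub>S\<^esub> Phi 1 (?t 1 0) x"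
      by (rule Phi_add[OF _ _ ph_par[OF ab] x])
        (use tp[of 0 1] tp[of 1 0] br[of 0 1] br[of 1 0] in \<open>simp_all add: h phiS_add[OF c]\<close>)
    have cl: "Phi (i + j) (?t i j) x \<in> carrier S" for i j using tp x by (rule Phi_closed)
    show ?thesis
      using x P[of 0 0] P[of 0 1] P[of 1 0] P[of 1 1] 0 1 cl[of 0 0] cl[of 0 1] cl[of 1 0] cl[of 1 1]
      by (simp add: scomm_R[OF a b x] R_eq[OF ab] S.a_ac)
  qed (simp add: scomm_def R_eq[OF bracket_closed[OF a b]])
qed

lemma R_rep:
  assumes "\<And>r s. Suc (r + s) < N \<Longrightarrow> arr_total K c N s r = \<zero>\<^bsub>K\<^esub>"
  shows "rep_by_coderivations K M R"
  unfolding rep_by_coderivations_def using R_coderivation R_bracket[OF assms] by blast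

text \<open>The projection applied to the commutation relation recovers the maps into M, and
  \<open>commutator_defect\<close> turns it into a vanishing evaluation. Even a and b are what the
  matrix units below provide.\<close>

lemma rep_defect:
  assumes R: "rep_by_coderivations K M R" and a: "a \<in> grade M 0" and b: "b \<in> grade M 0" and x: "x \<in> carrier S"
  shows "lie_pair.lam K M N 0 0 a b (arr_total K c N) x = \<zero>"
proof -
  interpret pair: lie_pair K M N 0 0 a b c by (intro lie_pair a b)
  have aM: "a \<in> carrier M" and bM: "b \<in> carrier M" using a b by (auto dest: grade_closed)
  have h: "hcomp M 0 a = a" "hcomp M 1 a = \<zero>" "hcomp M 0 b = b" "hcomp M 1 b = \<zero>"
    using a b by (simp_all add: hcomp_of_grade)
  have abg: "br a b \<in> grade M 0" using bracket_even[OF a b] by simp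
  then have hab: "hcomp M 0 (br a b) = br a b" "hcomp M 1 (br a b) = \<zero>" by (simp_all add: hcomp_of_grade)
  note pa = ph_par[OF aM] and pb = ph_par[OF bM] and pc = ph_par[OF grade_closed[OF abg]]
  have z: "phiS c N p \<zero> y = \<zero>" if "y \<in> carrier S" for p y using that by (rule phiS_zero[OF c])
  have zm: "f \<zero>\<^bsub>S\<^esub> = \<zero>" if "par_map K S M p f" for p f
    by (rule add_hom.zero[OF add_hom_intro[OF S.abelian_group_axioms abelian_group_axioms par_mapD(3)[OF that]]])
  have Pz: "Phi i (phiS c N i \<zero>) x = \<zero>\<^bsub>S\<^esub>" for i
  proof -
    have p: "par_map K S M i (phiS c N i \<zero>)" by (intro phiS_par c grade_zero)
    have "Phi i (phiS c N i \<zero>) x = ksgn S 0 (Phi i (phiS c N i \<zero>) x) \<oplus>\<^bsub>S\<^esub> Phi i (phiS c N i \<zero>) x"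
      by (rule Phi_add[OF p p p x]) (simp add: z)
    then show ?thesis using Phi_closed[OF p x] by simp
  qed
  \<comment> \<open>The odd components of a and b are zero, which leaves one of the four terms of
    \<open>scomm_R\<close>.\<close>
  have hz: "hbr i j (ph i a) (ph j b) x = \<zero>" if "i = 1 \<or> j = 1" for i j
    using that x zm[OF pa[of i]] zm[OF pb[of j]] Phi_closed[OF pa[of i] x] Phi_closed[OF pb[of j] x]
      z[OF Phi_closed[OF pa[of i] x], of j] z[OF Phi_closed[OF pb[of j] x], of i] Pz[of i] Pz[of j]
    by (cases i; cases j) (simp_all add: hbr_def h a_minus_def)
  have cl: "Phi (i + j) (hbr i j (ph i a) (ph j b)) x \<in> carrier S" for i j
    using x by (intro Phi_closed hbr_par pa pb)
  have prc: "pr (Phi (i + j) (hbr i j (ph i a) (ph j b)) x) = hbr i j (ph i a) (ph j b) x" for i j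
    by (rule pr_Phi[OF x hbr_par[OF pa pb]])
  have hc: "hbr 0 0 (ph 0 a) (ph 0 b) x \<in> carrier M"
    using par_mapD(4)[OF hbr_par[OF pa pb] x] .
  have "scomm S (R a) (R b) x = R (br a b) x"
    using R aM bM unfolding rep_by_coderivations_def by simp
  then have "pr (scomm S (R a) (R b) x) = pr (R (br a b) x)" by simp
  moreover have "pr (scomm S (R a) (R b) x) = hbr 0 0 (ph 0 a) (ph 0 b) x"
    unfolding scomm_R[OF aM bM x]
    using cl[of 0 0] cl[of 0 1] cl[of 1 0] cl[of 1 1] prc[of 0 0] prc[of 0 1] prc[of 1 0] prc[of 1 1] hz hc
    by (simp add: par_mapD(5)[OF pr_par])
  moreover have "pr (R (br a b) x) = ph 0 (br a b) x \<oplus> ph 1 (br a b) x"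
    unfolding R_eq[OF grade_closed[OF abg]] restrict_apply'[OF x]
      par_mapD(5)[OF pr_par Phi_closed[OF pc x] Phi_closed[OF pc x]] pr_Phi[OF x pc] ..
  then have "pr (R (br a b) x) = phiS c N 0 (br a b) x"
    using par_mapD(4)[OF pc[of 0] x] by (simp add: hab z[OF x])
  ultimately have "phiS c N 0 (br a b) x = hbr 0 0 (phiS c N 0 a) (phiS c N 0 b) x" by (simp add: h)
  then have "phiS c N (0 + 0) (br a b) x \<ominus> hbr 0 0 (phiS c N 0 a) (phiS c N 0 b) x = \<zero>"
    using hc by (simp add: h r_neg a_minus_def)
  then show ?thesis unfolding pair.commutator_defect[OF x] .
qed

end

section \<open>The functional equation in coefficients\<close>

lemma (in UP_ring) coeff_monom_mult_eq:
  assumes a: "a \<in> carrier R" and p: "p \<in> carrier P"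
  shows "coeff P (monom P a k \<otimes>\<^bsub>P\<^esub> p) n = (if k \<le> n then a \<otimes> coeff P p (n - k) else \<zero>)"
proof -
  have "coeff P (monom P a k \<otimes>\<^bsub>P\<^esub> p) n = (\<Oplus>i\<in>{..n}. if k = i then a \<otimes> coeff P p (n - i) else \<zero>)"
    using a p by (auto intro!: R.finsum_cong')
  also have "\<dots> = (if k \<le> n then a \<otimes> coeff P p (n - k) else \<zero>)"
  proof (cases "k \<le> n")
    case True
    then show ?thesis using a p by (subst R.finsum_singleton[of k "{..n}" "\<lambda>i. a \<otimes> coeff P p (n - i)"]) auto
  next
    case False
    then have "(\<Oplus>i\<in>{..n}. if k = i then a \<otimes> coeff P p (n - i) else \<zero>) = (\<Oplus>i\<in>{..n}. \<zero>)"
      using a p by (intro R.finsum_cong') auto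
    then show ?thesis using False by simp
  qed
  finally show ?thesis .
qed

text \<open>The step in the recursion for divided differences, with (x + y)^n for Z and x^n for
  X.\<close>

lemma (in cring) divdiff_step:
  assumes "x \<in> carrier R" "y \<in> carrier R" "X \<in> carrier R" "Z \<in> carrier R"
  shows "(x \<oplus> y) \<otimes> (Z \<ominus> X) \<oplus> y \<otimes> X = Z \<otimes> (x \<oplus> y) \<ominus> X \<otimes> x"
proof -
  have "(x \<oplus> y) \<otimes> (Z \<ominus> X) = Z \<otimes> (x \<oplus> y) \<ominus> (X \<otimes> x \<oplus> y \<otimes> X)"
    using assms by (simp add: a_minus_def r_distr l_distr r_minus minus_add m_comm)
  then show ?thesis using assms by (simp add: a_minus_def minus_add a_assoc l_neg)
qed

section \<open>Polynomials in two variables over the even part and their coefficients\<close>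

locale superpoly = comm_superring K for K :: "'k superring"
begin

abbreviation "R0 \<equiv> even_ring K"
abbreviation "U \<equiv> UP R0"
abbreviation "B \<equiv> poly2 K"

lemma even_ring_fields [simp]:
  "carrier R0 = grade K 0" "monoid.mult R0 = monoid.mult K" "one R0 = one K" "ring.zero R0 = ring.zero K" "ring.add R0 = ring.add K"
  by (simp_all add: even_ring_def)

lemma even_ring_cring: "cring R0"
proof (rule cringI)
  show "abelian_group R0"
  proof (rule abelian_groupI)
    fix x assume x: "x \<in> carrier R0"
    then show "\<exists>y\<in>carrier R0. y \<oplus>\<^bsub>R0\<^esub> x = \<zero>\<^bsub>R0\<^esub>"
      using grade_neg[of x 0] grade_closed[of x 0] l_neg by auto
  qed (simp_all add: grade_closed[of _ 0] grade_add a_assoc, blast intro: a_comm grade_closed)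
  show "comm_monoid R0"
  proof (rule comm_monoidI)
    fix x y assume "x \<in> carrier R0" "y \<in> carrier R0"
    then show "x \<otimes>\<^bsub>R0\<^esub> y \<in> carrier R0" "x \<otimes>\<^bsub>R0\<^esub> y = y \<otimes>\<^bsub>R0\<^esub> x"
      using grade_mult[of x 0 y 0] supercomm[of x 0 y 0] by simp_all
  qed (simp_all add: one_even grade_closed[of _ 0] m_assoc)
  fix x y z assume "x \<in> carrier R0" "y \<in> carrier R0" "z \<in> carrier R0"
  then show "(x \<oplus>\<^bsub>R0\<^esub> y) \<otimes>\<^bsub>R0\<^esub> z = x \<otimes>\<^bsub>R0\<^esub> z \<oplus>\<^bsub>R0\<^esub> y \<otimes>\<^bsub>R0\<^esub> z"
    by (simp add: grade_closed[of _ 0] l_distr)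
qed

sublocale R0: cring R0 by (rule even_ring_cring)

sublocale U: UP_cring R0 U
  by unfold_locales simp

sublocale B: UP_cring U B
  by unfold_locales (simp add: poly2_def)

abbreviation mulB (infixl "*B" 70) where "p *B q \<equiv> p \<otimes>\<^bsub>B\<^esub> q"
abbreviation addB (infixl "+B" 65) where "p +B q \<equiv> p \<oplus>\<^bsub>B\<^esub> q"
abbreviation "tv \<equiv> var_t K"
abbreviation "uv \<equiv> var_u K"

definition ent :: "(nat \<Rightarrow> nat \<Rightarrow> 'k) \<Rightarrow> nat \<Rightarrow> nat \<Rightarrow> 'k"
  where "ent p s r = coeff U (coeff B p s) r"
    \<comment> \<open>the coefficient of \<open>t\<^sup>r u\<^sup>s\<close>\<close>

lemma ent_eqI: "\<lbrakk>p \<in> carrier B; q \<in> carrier B; \<And>s r. ent p s r = ent q s r\<rbrakk> \<Longrightarrow> p = q"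
  by (intro B.up_eqI U.up_eqI) (auto simp: ent_def)

lemma ent_grade: "p \<in> carrier B \<Longrightarrow> ent p s r \<in> grade K 0"
  using U.coeff_closed[of "coeff B p s" r] by (simp add: ent_def)

lemma ent_zero [simp]: "ent \<zero>\<^bsub>B\<^esub> s r = \<zero>\<^bsub>K\<^esub>"
  by (simp add: ent_def)

lemma ent_one: "ent \<one>\<^bsub>B\<^esub> = arr_unit K"
  by (intro ext) (simp add: ent_def arr_unit_def)

lemma ent_add [simp]: "\<lbrakk>p \<in> carrier B; q \<in> carrier B\<rbrakk> \<Longrightarrow> ent (p +B q) s r = ent p s r \<oplus>\<^bsub>K\<^esub> ent q s r"
  by (simp add: ent_def)

lemma const2_closed [simp]: "c \<in> grade K 0 \<Longrightarrow> const2 K c \<in> carrier B"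
  by (simp add: const2_def)

lemma tv_closed [simp]: "tv \<in> carrier B" and uv_closed [simp]: "uv \<in> carrier B"
  using one_even by (simp_all add: var_t_def var_u_def)

lemma ent_const [simp]: "\<lbrakk>c \<in> grade K 0; p \<in> carrier B\<rbrakk> \<Longrightarrow> ent (const2 K c *B p) s r = c \<otimes>\<^bsub>K\<^esub> ent p s r"
  by (simp add: const2_def ent_def B.coeff_monom_mult_eq U.coeff_monom_mult_eq del: B.coeff_mult U.coeff_mult)

lemma ent_t [simp]: "p \<in> carrier B \<Longrightarrow> ent (tv *B p) s r = (if r = 0 then \<zero>\<^bsub>K\<^esub> else ent p s (r - 1))"
  using one_even grade_closed ent_grade[of p s "r - 1"]
  by (simp add: var_t_def ent_def B.coeff_monom_mult_eq U.coeff_monom_mult_eq del: B.coeff_mult U.coeff_mult)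

lemma ent_u [simp]: "p \<in> carrier B \<Longrightarrow> ent (uv *B p) s r = (if s = 0 then \<zero>\<^bsub>K\<^esub> else ent p (s - 1) r)"
  by (simp add: var_u_def ent_def B.coeff_monom_mult_eq del: B.coeff_mult)

lemma ent_up: "p \<in> carrier B \<Longrightarrow> ent ((tv +B uv) *B p) = arr_up K (ent p)"
  by (intro ext) (simp add: B.P.l_distr arr_up_def)

lemma ent_t_pow: "p \<in> carrier B \<Longrightarrow> ent (tv [^]\<^bsub>B\<^esub> n *B p) s r = (if r < n then \<zero>\<^bsub>K\<^esub> else ent p s (r - n))"
proof (induction n arbitrary: r)
  case (Suc n)
  have "tv [^]\<^bsub>B\<^esub> Suc n *B p = tv *B (tv [^]\<^bsub>B\<^esub> n *B p)"
    using Suc by (simp add: B.P.m_ac)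
  then show ?case using Suc by (cases r) simp_all
qed simp

lemma ent_u_pow: "p \<in> carrier B \<Longrightarrow> ent (uv [^]\<^bsub>B\<^esub> n *B p) s r = (if s < n then \<zero>\<^bsub>K\<^esub> else ent p (s - n) r)"
proof (induction n arbitrary: s)
  case (Suc n)
  have "uv [^]\<^bsub>B\<^esub> Suc n *B p = uv *B (uv [^]\<^bsub>B\<^esub> n *B p)"
    using Suc by (simp add: B.P.m_ac)
  then show ?case using Suc by (cases s) simp_all
qed simp

text \<open>Multiplication by a variable only shifts coefficients, so it is injective even in the
  presence of zero divisors. This makes the exact quotients unique.\<close>

lemma cancel_t: "\<lbrakk>p \<in> carrier B; q \<in> carrier B; tv *B p = tv *B q\<rbrakk> \<Longrightarrow> p = q"
  by (rule ent_eqI, assumption+) (metis ent_t diff_Suc_1 nat.distinct(1))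

lemma cancel_u: "\<lbrakk>p \<in> carrier B; q \<in> carrier B; uv *B p = uv *B q\<rbrakk> \<Longrightarrow> p = q"
  by (rule ent_eqI, assumption+) (metis ent_u diff_Suc_1 nat.distinct(1))

text \<open>The value of a polynomial with the powers of the variable replaced by g; the recursion
  is the one of \<open>arr_sum\<close>.\<close>

fun psm :: "(nat \<Rightarrow> 'k) \<Rightarrow> (nat \<Rightarrow> nat \<Rightarrow> nat \<Rightarrow> 'k) \<Rightarrow> nat \<Rightarrow> nat \<Rightarrow> nat \<Rightarrow> 'k" where
  "psm c g 0 = \<zero>\<^bsub>B\<^esub>"
| "psm c g (Suc n) = psm c g n +B const2 K (c n) *B g n"

context
  fixes c :: "nat \<Rightarrow> 'k" assumes c: "\<And>n. c n \<in> grade K 0"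
begin

lemma psm_closed [simp]: "(\<And>n. g n \<in> carrier B) \<Longrightarrow> psm c g n \<in> carrier B"
  by (induction n) (simp_all add: c)

lemma ent_psm: "(\<And>n. g n \<in> carrier B) \<Longrightarrow> ent (psm c g n) = arr_sum K c (\<lambda>n. ent (g n)) n"
  by (induction n) (auto simp: c fun_eq_iff)

lemma psm_mult:
  "\<lbrakk>\<And>n. g n \<in> carrier B; p \<in> carrier B\<rbrakk> \<Longrightarrow> p *B psm c g n = psm c (\<lambda>n. p *B g n) n"
proof (induction n)
  case (Suc n)
  then show ?case using c[of n] by (simp add: B.P.r_distr B.P.m_lcomm)
qed simp

lemma psm_minus:
  "\<lbrakk>\<And>n. g n \<in> carrier B; \<And>n. h n \<in> carrier B\<rbrakk> \<Longrightarrow> psm c (\<lambda>n. g n \<ominus>\<^bsub>B\<^esub> h n) n = psm c g n \<ominus>\<^bsub>B\<^esub> psm c h n"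
proof (induction n)
  case (Suc n)
  then show ?case using c[of n] by (simp add: B.P.r_distr B.P.minus_eq B.P.minus_add B.P.r_minus B.P.a_ac)
qed (simp add: B.P.minus_eq)

lemma psm_stable:
  assumes g: "\<And>n. g n \<in> carrier B" and z: "\<And>n. m \<le> n \<Longrightarrow> c n = \<zero>\<^bsub>K\<^esub>" and "m \<le> n"
  shows "psm c g n = psm c g m"
  using \<open>m \<le> n\<close>
proof (induction n rule: dec_induct)
  case (step n)
  have "const2 K (c n) *B g n = \<zero>\<^bsub>B\<^esub>"
    by (rule ent_eqI) (use c[of n] z[of n] step g ent_grade[OF g, THEN grade_closed] in auto)
  then show ?case using step g by simp
qed simp

lemma psm_eq_finsum: "(\<And>n. g n \<in> carrier B) \<Longrightarrow> psm c g n = (\<Oplus>\<^bsub>B\<^esub>i\<in>{..<n}. const2 K (c i) *B g i)"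
  by (induction n) (simp_all add: c lessThan_Suc B.P.finsum_insert B.P.a_comm)

end

section \<open>Divided differences and their coefficients\<close>

fun divdiff :: "(nat \<Rightarrow> nat \<Rightarrow> 'k) \<Rightarrow> nat \<Rightarrow> nat \<Rightarrow> nat \<Rightarrow> 'k" where
  "divdiff x 0 = \<zero>\<^bsub>B\<^esub>"
| "divdiff x (Suc n) = (tv +B uv) *B divdiff x n +B x [^]\<^bsub>B\<^esub> n"

lemma divdiff_closed [simp]: "x \<in> carrier B \<Longrightarrow> divdiff x n \<in> carrier B"
  by (induction n) simp_all

text \<open>Used with x = t, y = u and with x = u, y = t. It identifies the recursion of
  \<open>arr_rec\<close> with the quotient of (t+u)^n - x^n by y.\<close>

lemma divdiff:
  assumes x: "x \<in> carrier B" and y: "y \<in> carrier B" and xy: "tv +B uv = x +B y"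
  shows "y *B divdiff x n = (tv +B uv) [^]\<^bsub>B\<^esub> n \<ominus>\<^bsub>B\<^esub> x [^]\<^bsub>B\<^esub> n"
proof (induction n)
  case 0
  then show ?case using y by (simp add: B.P.r_neg B.P.minus_eq)
next
  case (Suc n)
  let ?z = "tv +B uv"
  have z: "?z \<in> carrier B" by simp
  have "y *B divdiff x (Suc n) = ?z *B (y *B divdiff x n) +B y *B x [^]\<^bsub>B\<^esub> n"
    using x y z by (simp add: B.P.r_distr B.P.m_lcomm)
  also have "\<dots> = ?z *B (?z [^]\<^bsub>B\<^esub> n \<ominus>\<^bsub>B\<^esub> x [^]\<^bsub>B\<^esub> n) +B y *B x [^]\<^bsub>B\<^esub> n" by (simp only: Suc)
  also have "\<dots> = ?z [^]\<^bsub>B\<^esub> n *B ?z \<ominus>\<^bsub>B\<^esub> x [^]\<^bsub>B\<^esub> n *B x"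
    unfolding xy using x y by (intro B.P.divdiff_step) simp_all
  finally show ?case by simp
qed

lemma ent_divdiff:
  assumes x: "x \<in> carrier B" and f: "f \<in> carrier B" and A: "\<And>n. ent (f *B x [^]\<^bsub>B\<^esub> n) = A n"
  shows "ent (f *B divdiff x n) = arr_rec K (arr_zero K) A n"
proof (induction n)
  case 0
  then show ?case using f by (simp add: arr_zero_def fun_eq_iff)
next
  case (Suc n)
  have "f *B divdiff x (Suc n) = (tv +B uv) *B (f *B divdiff x n) +B f *B x [^]\<^bsub>B\<^esub> n"
    using x f by (simp add: B.P.r_distr B.P.m_lcomm)
  then have "ent (f *B divdiff x (Suc n)) s r = ent ((tv +B uv) *B (f *B divdiff x n)) s r \<oplus>\<^bsub>K\<^esub> ent (f *B x [^]\<^bsub>B\<^esub> n) s r" for s r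
    using x f by simp
  then show ?case using x f unfolding A by (intro ext) (simp add: ent_up Suc)
qed

lemma ent_sum_pow: "ent ((tv +B uv) [^]\<^bsub>B\<^esub> n) = arr_rec K (arr_unit K) (\<lambda>n. arr_zero K) n"
proof (induction n)
  case (Suc n)
  have "(tv +B uv) [^]\<^bsub>B\<^esub> Suc n = (tv +B uv) *B (tv +B uv) [^]\<^bsub>B\<^esub> n" by (simp add: B.P.m_comm)
  then have "ent ((tv +B uv) [^]\<^bsub>B\<^esub> Suc n) s r = arr_up K (ent ((tv +B uv) [^]\<^bsub>B\<^esub> n)) s r" for s r
    by (simp only: ent_up[OF B.P.nat_pow_closed] B.P.a_closed tv_closed uv_closed)
  moreover have "arr_up K (ent ((tv +B uv) [^]\<^bsub>B\<^esub> n)) s r \<in> carrier K" for s r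
    using ent_grade[of "(tv +B uv) [^]\<^bsub>B\<^esub> n", THEN grade_closed] by (simp add: arr_up_def)
  ultimately show ?case using Suc by (simp add: arr_zero_def fun_eq_iff)
qed (simp add: ent_one)

text \<open>A degree count: each step multiplies by t + u and adds terms of degree at least n, so
  the n-th array has no terms of degree below n - 1. Indices n with N \<le> n therefore do not reach
  degrees below N - 1.\<close>

lemma arr_rec_zero:
  assumes "\<And>n s r. r + s < n \<Longrightarrow> C n s r = \<zero>\<^bsub>K\<^esub>"
  shows "Suc (r + s) < n \<Longrightarrow> arr_rec K A C n s r = \<zero>\<^bsub>K\<^esub>"
proof (induction n arbitrary: r s)
  case (Suc n)
  then show ?case using assms[of r s n] by (cases r; cases s) (simp_all add: arr_up_def)
qed simp

lemma arr_sum_truncate: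
  assumes c: "\<And>n. c n \<in> grade K 0" and "\<And>n. n < N \<Longrightarrow> A n s r \<in> carrier K"
    and "\<And>n. N \<le> n \<Longrightarrow> A n s r = \<zero>\<^bsub>K\<^esub>" and "N \<le> m"
  shows "arr_sum K c A m s r = arr_sum K c A N s r"
proof -
  have *: "n \<le> N \<Longrightarrow> arr_sum K c A n s r \<in> carrier K" for n
    using assms(2) c[THEN grade_closed] by (induction n) auto
  show ?thesis
    using \<open>N \<le> m\<close> by (induction m rule: dec_induct) (use *[of N] assms(3) c[THEN grade_closed] in auto)
qed

end

lemma (in ideal) finsum_mem: "(\<And>i. i \<in> A \<Longrightarrow> f i \<in> I) \<Longrightarrow> finsum R f A \<in> I"
proof (induction A rule: infinite_finite_induct)
  case (insert x A)
  then show ?case by (auto simp: a_subset[THEN subsetD] Pi_def)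
qed simp_all

section \<open>The truncation ideal and the functional equation in coefficients\<close>

context superpoly
begin

definition low_zero :: "nat \<Rightarrow> (nat \<Rightarrow> nat \<Rightarrow> 'k) set"
  where "low_zero N = {p \<in> carrier B. \<forall>r s. r + s < N - 1 \<longrightarrow> ent p s r = \<zero>\<^bsub>K\<^esub>}"

text \<open>Every summand of the coefficient contains a coefficient of p whose exponents are not
  larger, hence still of low degree.\<close>

lemma ent_mult_low:
  assumes p: "p \<in> low_zero N" and x: "x \<in> carrier B" and rs: "r + s < N - 1"
  shows "ent (x *B p) s r = \<zero>\<^bsub>K\<^esub>"
proof -
  have pB: "p \<in> carrier B" using p by (simp add: low_zero_def)
  have "ent (x *B p) s r = (\<Oplus>\<^bsub>R0\<^esub>i\<in>{..s}. coeff U (coeff B x i \<otimes>\<^bsub>U\<^esub> coeff B p (s - i)) r)"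
    using x pB by (simp add: ent_def U.coeff_finsum Pi_def del: U.coeff_mult)
  also have "\<dots> = \<zero>\<^bsub>R0\<^esub>"
  proof (rule R0.add.finprod_one_eqI)
    fix i assume "i \<in> {..s}"
    have "coeff U (coeff B x i) j \<otimes>\<^bsub>R0\<^esub> coeff U (coeff B p (s - i)) (r - j) = \<zero>\<^bsub>R0\<^esub>" for j
    proof -
      have "ent p (s - i) (r - j) = \<zero>\<^bsub>K\<^esub>" using p rs by (simp add: low_zero_def)
      then show ?thesis
        using U.coeff_closed[OF B.coeff_closed[OF x], of i j] by (simp add: ent_def grade_closed[of _ 0])
    qed
    then show "coeff U (coeff B x i \<otimes>\<^bsub>U\<^esub> coeff B p (s - i)) r = \<zero>\<^bsub>R0\<^esub>"
      unfolding U.coeff_mult[OF B.coeff_closed[OF x] B.coeff_closed[OF pB]] by (intro R0.add.finprod_one_eqI)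
  qed
  finally show ?thesis by simp
qed

lemma low_zero_ideal: "ideal (low_zero N) B"
proof (rule idealI)
  show "subgroup (low_zero N) (add_monoid B)"
  proof (rule subgroup.intro)
    fix x assume x: "x \<in> low_zero N"
    then have "ent (\<ominus>\<^bsub>B\<^esub> x) s r = \<zero>\<^bsub>K\<^esub>" if "r + s < N - 1" for r s
    proof -
      have "coeff U (coeff B x s) r = \<zero>\<^bsub>R0\<^esub>" using x that by (simp add: low_zero_def ent_def)
      then show ?thesis using x R0.minus_zero by (simp add: low_zero_def ent_def)
    qed
    then show "inv\<^bsub>add_monoid B\<^esub> x \<in> low_zero N"
      using x by (simp add: low_zero_def flip: a_inv_def)
  qed (auto simp: low_zero_def)
next
  fix p x assume "p \<in> low_zero N" "x \<in> carrier B"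
  then show "x *B p \<in> low_zero N" "p *B x \<in> low_zero N"
    using ent_mult_low B.P.m_comm[of p x] by (auto simp: low_zero_def)
qed (rule B.P.ring_axioms)

text \<open>In the coefficient of u^s all powers of t below N - 1 - s are missing, so the monomial
  with exponents N - 1 - s and s can be split off. The cofactor is obtained by shifting
  coefficients.\<close>

lemma monom_mem_trunc:
  assumes p: "p \<in> low_zero N"
  shows "monom B (coeff B p s) s \<in> trunc_ideal K N"
proof -
  \<comment> \<open>With natural subtraction this is 0 for s \<ge> N - 1, where u^s alone is already
    in the ideal.\<close>
  define k where "k = N - 1 - s"
  let ?q = "coeff B p s" and ?k = k
  let ?g = "\<lambda>r. coeff U ?q (r + ?k)"
  have pB: "p \<in> carrier B" using p by (simp add: low_zero_def)
  have q: "?q \<in> carrier U" using pB by simp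
  have "bound \<zero>\<^bsub>R0\<^esub> (deg R0 ?q) ?g" using U.deg_aboveD[OF _ q] by (intro bound.intro) simp
  then have gu: "?g \<in> up R0" using U.coeff_closed[OF q] by (intro mem_upI exI)
  then have g: "?g \<in> carrier U" and gc: "coeff U ?g = ?g" by (simp_all add: UP_def)
  let ?G = "monom B ?g 0"
  have G: "?G \<in> carrier B" using g by simp
  have e: "ent (monom B h j) i r = (if i = j then coeff U h r else \<zero>\<^bsub>K\<^esub>)" if "h \<in> carrier U" for h i j r
    using that by (simp add: ent_def)
  have "monom B ?q s = (tv [^]\<^bsub>B\<^esub> ?k *B uv [^]\<^bsub>B\<^esub> s) *B ?G"
  proof (rule ent_eqI)
    fix i r
    have "coeff U ?q r = \<zero>\<^bsub>K\<^esub>" if "r < ?k"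
      using p that by (simp add: low_zero_def ent_def k_def)
    then show "ent (monom B ?q s) i r = ent ((tv [^]\<^bsub>B\<^esub> ?k *B uv [^]\<^bsub>B\<^esub> s) *B ?G) i r"
      using G q by (simp add: B.P.m_assoc ent_t_pow ent_u_pow e[OF q] e[OF g] gc)
  qed (use q G in simp_all)
  moreover have gens: "{tv [^]\<^bsub>B\<^esub> i *B uv [^]\<^bsub>B\<^esub> j |i j :: nat. i + j \<ge> N - 1} \<subseteq> carrier B" by auto
  have "tv [^]\<^bsub>B\<^esub> ?k *B uv [^]\<^bsub>B\<^esub> s \<in> {tv [^]\<^bsub>B\<^esub> i *B uv [^]\<^bsub>B\<^esub> j |i j :: nat. i + j \<ge> N - 1}"
    by (intro CollectI exI[of _ ?k] exI[of _ s]) (simp add: k_def)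
  then have "tv [^]\<^bsub>B\<^esub> ?k *B uv [^]\<^bsub>B\<^esub> s \<in> trunc_ideal K N"
    unfolding trunc_ideal_def using B.P.genideal_self[OF gens] by blast
  then have "(tv [^]\<^bsub>B\<^esub> ?k *B uv [^]\<^bsub>B\<^esub> s) *B ?G \<in> trunc_ideal K N"
    using ideal.I_r_closed[OF B.P.genideal_ideal[OF gens] _ G] by (simp add: trunc_ideal_def)
  ultimately show ?thesis by simp
qed

lemma trunc_ideal_ideal: "ideal (trunc_ideal K N) B"
  unfolding trunc_ideal_def by (rule B.P.genideal_ideal) auto

lemma trunc_ideal_eq: "trunc_ideal K N = low_zero N"
proof
  show "trunc_ideal K N \<subseteq> low_zero N"
    unfolding trunc_ideal_def
  proof (rule B.P.genideal_minimal[OF low_zero_ideal])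
    have "tv [^]\<^bsub>B\<^esub> i *B uv [^]\<^bsub>B\<^esub> j \<in> low_zero N" if "N - 1 \<le> i + j" for i j :: nat
      using that ent_u_pow[OF B.P.one_closed, of j] by (simp add: low_zero_def ent_t_pow)
    then show "{tv [^]\<^bsub>B\<^esub> i *B uv [^]\<^bsub>B\<^esub> j |i j :: nat. i + j \<ge> N - 1} \<subseteq> low_zero N" by blast
  qed
  show "low_zero N \<subseteq> trunc_ideal K N"
  proof
    fix p assume p: "p \<in> low_zero N"
    then have pB: "p \<in> carrier B" by (simp add: low_zero_def)

    have "finsum B (\<lambda>i. monom B (coeff B p i) i) {..deg U p} \<in> trunc_ideal K N"
      by (rule ideal.finsum_mem[OF trunc_ideal_ideal monom_mem_trunc[OF p]])
    then show "p \<in> trunc_ideal K N" by (simp only: B.up_repr[OF pB])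
  qed
qed

lemma exact_quot_eq:
  assumes "q \<in> carrier B" "x *B q = p" "\<And>q'. \<lbrakk>q' \<in> carrier B; x *B q' = x *B q\<rbrakk> \<Longrightarrow> q' = q"
  shows "exact_quot B p x = q"
  unfolding exact_quot_def by (rule the_equality) (use assms(1,2) in simp, rule assms(3), simp_all add: assms(2))

text \<open>The exact quotients are sums of divided differences. After this the equation modulo the
  ideal is a comparison of coefficients of degree below N - 1 with the array from the
  commutator.\<close>

theorem functional_equation_iff:
  assumes P: "P \<in> carrier U"
  shows "functional_equation K N P \<longleftrightarrow> (\<forall>r s. r + s < N - 1 \<longrightarrow> arr_total K (coeff U P) N s r = \<zero>\<^bsub>K\<^esub>)"
proof -
  define c where "c = coeff U P"
  \<comment> \<open>P is any representative and may have degree N or more. Sums up to m evaluate it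
    exactly and can be cut back to N at the end.\<close>
  define m where "m = max N (Suc (deg R0 P))"
  have c: "c n \<in> grade K 0" for n using U.coeff_closed[OF P] by (simp add: c_def)
  have cz: "c n = \<zero>\<^bsub>K\<^esub>" if "Suc (deg R0 P) \<le> n" for n
    using U.deg_aboveD[OF _ P, of n] that by (simp add: c_def)
  note psm = psm_closed[OF c]
  have sub: "subst2 K P x = psm c (\<lambda>n. x [^]\<^bsub>B\<^esub> n) m" if x: "x \<in> carrier B" for x
  proof -
    have "subst2 K P x = psm c (\<lambda>n. x [^]\<^bsub>B\<^esub> n) (Suc (deg R0 P))"
      unfolding subst2_def U.eval_on_carrier[OF P] lessThan_Suc_atMost[symmetric] c_def[symmetric]
      apply (rule psm_eq_finsum[OF c, symmetric])
      using x by simp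
    also have "\<dots> = psm c (\<lambda>n. x [^]\<^bsub>B\<^esub> n) m"
      apply (rule psm_stable[OF c, where m = "Suc (deg R0 P)", symmetric])
      subgoal using x by simp
      subgoal by (rule cz)
      subgoal unfolding m_def by simp
      done
    finally show ?thesis .
  qed
  let ?w = "tv +B uv"
  let ?ft = "psm c (\<lambda>n. tv [^]\<^bsub>B\<^esub> n) m" and ?fu = "psm c (\<lambda>n. uv [^]\<^bsub>B\<^esub> n) m" and ?fw = "psm c (\<lambda>n. ?w [^]\<^bsub>B\<^esub> n) m"
  have f: "?ft \<in> carrier B" "?fu \<in> carrier B" "?fw \<in> carrier B" by (intro psm; simp)+
  have cK: "c n \<in> carrier K" for n using c grade_closed by blast
  have single: "arr_sum K c (\<lambda>n s r. if n = i then \<one>\<^bsub>K\<^esub> else \<zero>\<^bsub>K\<^esub>) n s r = (if i < n then c i else \<zero>\<^bsub>K\<^esub>)" for i n s r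
    using cK by (induction n) (auto simp: less_Suc_eq)
  have cut: "(if i < m then c i else \<zero>\<^bsub>K\<^esub>) = c i" for i using cz[of i] by (simp add: m_def)
  have sum0: "arr_sum K c (\<lambda>n s r. \<zero>\<^bsub>K\<^esub>) n s r = \<zero>\<^bsub>K\<^esub>" for n s r using cK by (induction n) auto
  have cong: "arr_sum K c A n s r = arr_sum K c C n s r" if "\<And>n. A n s r = C n s r" for A C n s r
    using that by (induction n) simp_all
  have pt: "ent (tv [^]\<^bsub>B\<^esub> n) s r = (if s = 0 \<and> n = r then \<one>\<^bsub>K\<^esub> else \<zero>\<^bsub>K\<^esub>)" for n s r
    using ent_t_pow[OF B.P.one_closed, of n s r] by (auto simp: ent_one arr_unit_def)
  have pu: "ent (uv [^]\<^bsub>B\<^esub> n) s r = (if r = 0 \<and> n = s then \<one>\<^bsub>K\<^esub> else \<zero>\<^bsub>K\<^esub>)" for n s r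
    using ent_u_pow[OF B.P.one_closed, of n s r] by (auto simp: ent_one arr_unit_def)
  have et: "ent ?ft s r = (if s = 0 then c r else \<zero>\<^bsub>K\<^esub>)" for s r
  proof -
    have "ent ?ft s r = arr_sum K c (\<lambda>n s' r'. if s = 0 \<and> n = r then \<one>\<^bsub>K\<^esub> else \<zero>\<^bsub>K\<^esub>) m s r"
      by (subst ent_psm[OF c]) (simp, rule cong, simp add: pt)
    then show ?thesis by (cases "s = 0") (simp_all add: single cut sum0)
  qed
  have eu: "ent ?fu s r = (if r = 0 then c s else \<zero>\<^bsub>K\<^esub>)" for s r
  proof -
    have "ent ?fu s r = arr_sum K c (\<lambda>n s' r'. if r = 0 \<and> n = s then \<one>\<^bsub>K\<^esub> else \<zero>\<^bsub>K\<^esub>) m s r"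
      by (subst ent_psm[OF c]) (simp, rule cong, simp add: pu)
    then show ?thesis by (cases "r = 0") (simp_all add: single cut sum0)
  qed
  have row: "ent (?fu *B tv [^]\<^bsub>B\<^esub> n) = arr_row K c n" for n
    using f by (intro ext) (auto simp: B.P.m_comm[of ?fu] ent_t_pow eu arr_row_def)
  have col: "ent (?ft *B uv [^]\<^bsub>B\<^esub> n) = arr_col K c n" for n
    using f by (intro ext) (auto simp: B.P.m_comm[of ?ft] ent_u_pow et arr_col_def)
  let ?qt = "psm c (divdiff tv) m" and ?qu = "psm c (divdiff uv) m"
  have q: "?qt \<in> carrier B" "?qu \<in> carrier B" by (intro psm; simp)+
  have "uv *B ?qt = ?fw \<ominus>\<^bsub>B\<^esub> ?ft"
    by (subst psm_mult[OF c]) (simp_all add: divdiff[OF tv_closed uv_closed] psm_minus[OF c])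
  then have qt: "exact_quot B (?fw \<ominus>\<^bsub>B\<^esub> ?ft) uv = ?qt"
    using q cancel_u by (intro exact_quot_eq) auto
  have "tv *B ?qu = ?fw \<ominus>\<^bsub>B\<^esub> ?fu"
    by (subst psm_mult[OF c]) (simp_all add: divdiff[OF uv_closed tv_closed B.P.a_comm] psm_minus[OF c])
  then have qu: "exact_quot B (?fw \<ominus>\<^bsub>B\<^esub> ?fu) tv = ?qu"
    using q cancel_t by (intro exact_quot_eq) auto
  let ?X = "?fu *B ?qt +B ?ft *B ?qu"
  have X: "?X \<in> carrier B" using f q by simp
  have "functional_equation K N P \<longleftrightarrow> trunc_ideal K N +>\<^bsub>B\<^esub> ?X = trunc_ideal K N +>\<^bsub>B\<^esub> (\<ominus>\<^bsub>B\<^esub> ?fw)"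
    unfolding functional_equation_def Let_def by (simp add: sub qt qu)
  also have "\<dots> \<longleftrightarrow> ?X \<ominus>\<^bsub>B\<^esub> (\<ominus>\<^bsub>B\<^esub> ?fw) \<in> trunc_ideal K N"
    using B.P.quotient_eq_iff_same_a_r_cos[OF trunc_ideal_ideal X B.P.a_inv_closed[OF f(3)]] ..
  also have "\<dots> \<longleftrightarrow> (\<forall>r s. r + s < N - 1 \<longrightarrow> ent (?X +B ?fw) s r = \<zero>\<^bsub>K\<^esub>)"
  proof -
    have "?X \<ominus>\<^bsub>B\<^esub> (\<ominus>\<^bsub>B\<^esub> ?fw) = ?X +B ?fw" using f by (simp add: B.P.minus_eq)
    then show ?thesis using B.P.a_closed[OF X f(3)] by (simp add: trunc_ideal_eq low_zero_def del: ent_add)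
  qed
  also have "\<dots> \<longleftrightarrow> (\<forall>r s. r + s < N - 1 \<longrightarrow> arr_total K c N s r = \<zero>\<^bsub>K\<^esub>)"
  proof -
    have "ent (?X +B ?fw) s r = arr_total K c N s r" if rs: "r + s < N - 1" for r s
    proof -
      have 1: "ent (?fu *B ?qt) s r = arr_sum K c (arr_rec K (arr_zero K) (arr_row K c)) m s r"
        using f by (subst psm_mult[OF c]) (simp_all add: ent_psm[OF c] ent_divdiff[OF tv_closed _ row])
      have 2: "ent (?ft *B ?qu) s r = arr_sum K c (arr_rec K (arr_zero K) (arr_col K c)) m s r"
        using f by (subst psm_mult[OF c]) (simp_all add: ent_psm[OF c] ent_divdiff[OF uv_closed _ col])
      have 3: "ent ?fw s r = arr_sum K c (arr_rec K (arr_unit K) (\<lambda>n. arr_zero K)) m s r"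
        by (subst ent_psm[OF c]) (simp_all add: ent_sum_pow)
      have g: "ent p s r \<in> carrier K" if "p \<in> carrier B" for p using ent_grade[OF that] grade_closed by blast
      \<comment> \<open>Summands with N \<le> n have no coefficients of degree below N - 1, which
        brings the bound from m down to N.\<close>
      have tr: "arr_sum K c (arr_rec K A C) m s r = arr_sum K c (arr_rec K A C) N s r"
        if "\<And>n. arr_rec K A C n s r \<in> carrier K" "\<And>n s r. r + s < n \<Longrightarrow> C n s r = \<zero>\<^bsub>K\<^esub>" for A C
        by (rule arr_sum_truncate[OF c]) (use that(1) arr_rec_zero[of C r s, OF that(2)] rs in \<open>auto simp: m_def\<close>)
      have 4: "arr_rec K (arr_zero K) (arr_row K c) n s r \<in> carrier K" for n
        using g[of "?fu *B divdiff tv n"] f by (simp add: ent_divdiff[OF tv_closed _ row])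
      have 5: "arr_rec K (arr_zero K) (arr_col K c) n s r \<in> carrier K" for n
        using g[of "?ft *B divdiff uv n"] f by (simp add: ent_divdiff[OF uv_closed _ col])
      have 6: "arr_rec K (arr_unit K) (\<lambda>n. arr_zero K) n s r \<in> carrier K" for n
        using g[of "?w [^]\<^bsub>B\<^esub> n"] by (simp add: ent_sum_pow)
      have "ent (?X +B ?fw) s r = (ent (?fu *B ?qt) s r \<oplus>\<^bsub>K\<^esub> ent (?ft *B ?qu) s r) \<oplus>\<^bsub>K\<^esub> ent ?fw s r"
        using f q X by simp
      then show ?thesis
        unfolding arr_total_def 1 2 3 using tr[OF 4] tr[OF 5] tr[OF 6] by (simp add: arr_row_def arr_col_def arr_zero_def)
    qed
    then show ?thesis by auto
  qed
  finally show ?thesis unfolding c_def .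
qed

lemma representative_closed:
  assumes "\<phi> \<in> carrier (truncated_poly_ring K N)" "P \<in> \<phi>"
  shows "P \<in> carrier U"
proof -
  let ?I = "Idl\<^bsub>U\<^esub> {monom U \<one>\<^bsub>K\<^esub> N}"
  have I: "ideal ?I U" using one_even by (intro U.P.genideal_ideal) simp
  obtain x where "x \<in> carrier U" "\<phi> = ?I +>\<^bsub>U\<^esub> x"
    using assms(1) by (auto simp: truncated_poly_ring_def FactRing_def A_RCOSETS_def')
  then show ?thesis using assms(2) additive_subgroup.a_Hcarr[OF ideal.axioms(1)[OF I]] by (auto simp: a_r_coset_def')
qed

end

section \<open>Strictly upper triangular matrices\<close>

lemma (in abelian_monoid) finsum_swap:
  "\<lbrakk>finite A; finite B; \<And>i j. f i j \<in> carrier G\<rbrakk> \<Longrightarrow> (\<Oplus>i\<in>A. \<Oplus>j\<in>B. f i j) = (\<Oplus>j\<in>B. \<Oplus>i\<in>A. f i j)"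
proof (induction A rule: finite_induct)
  case (insert x A)
  then show ?case by (simp add: finsum_addf Pi_def)
qed simp

lemma (in graded_group) finsum_grade: "(\<And>i. i \<in> A \<Longrightarrow> f i \<in> grade M d) \<Longrightarrow> finsum M f A \<in> grade M d"
proof (induction A rule: infinite_finite_induct)
  case (insert x A)
  then have "f \<in> A \<rightarrow> carrier M" "f x \<in> carrier M" by (auto intro: grade_closed)
  then show ?case using insert by (simp add: grade_add)
qed simp_all

text \<open>
  The Lie superalgebra of strictly upper triangular matrices over \<open>\<K>\<close> with rows and columns \<open>0, \<dots>, N\<close>.
  By supercommutativity \<open>(-1)\<^bsup>p(x)p(y)\<^esup> y\<^sub>i\<^sub>k x\<^sub>k\<^sub>j = x\<^sub>k\<^sub>j y\<^sub>i\<^sub>k\<close>, so the bracket can be written without signs.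
\<close>

locale matrix_lie = comm_superring K for K :: "'k superring" (structure) +
  fixes N :: nat
begin

text \<open>Positions are coded by numbers because the test algebra has to live on the type
  \<open>nat \<Rightarrow> 'k\<close> of the statement.\<close>

definition upper :: "nat \<Rightarrow> bool"
  where "upper n \<longleftrightarrow> (case prod_decode n of (i, j) \<Rightarrow> i < j \<and> j \<le> N)"

definition dec :: "(nat \<Rightarrow> 'k) \<Rightarrow> nat \<Rightarrow> nat \<Rightarrow> 'k" where "dec x i j = x (prod_encode (i, j))"

definition enc :: "(nat \<Rightarrow> nat \<Rightarrow> 'k) \<Rightarrow> nat \<Rightarrow> 'k" where "enc f n = (case prod_decode n of (i, j) \<Rightarrow> f i j)"

definition mm where "mm f g i j = (\<Oplus>k\<in>{..N}. f i k \<otimes> g k j)" for i j :: nat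
text \<open>The product of g with f, but with the scalar factors of each summand in the order f, g.
  For homogeneous matrices it agrees with that product up to the exchange sign, see
  \<open>mm_mt\<close>.\<close>

definition mt where "mt f g i j = (\<Oplus>k\<in>{..N}. f k j \<otimes> g i k)" for i j :: nat

definition mat_lie :: "('k, nat \<Rightarrow> 'k) lie_super"
  where "mat_lie = \<lparr>
    carrier = {x. \<forall>n. x n \<in> carrier K \<and> (\<not> upper n \<longrightarrow> x n = \<zero>)},
    monoid.mult = (\<lambda>x y. x), one = (\<lambda>n. \<zero>), ring.zero = (\<lambda>n. \<zero>), ring.add = (\<lambda>x y n. x n \<oplus> y n),
    grade = (\<lambda>d. {x. \<forall>n. x n \<in> grade K d \<and> (\<not> upper n \<longrightarrow> x n = \<zero>)}),
    rsmult = (\<lambda>x \<alpha> n. x n \<otimes> \<alpha>),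
    bracket = (\<lambda>x y. enc (\<lambda>i j. mm (dec x) (dec y) i j \<ominus> mt (dec x) (dec y) i j))\<rparr>"

abbreviation "L \<equiv> mat_lie"

lemma L_simps [simp]:
  "x \<in> carrier L \<longleftrightarrow> (\<forall>n. x n \<in> carrier K \<and> (\<not> upper n \<longrightarrow> x n = \<zero>))"
  "\<zero>\<^bsub>L\<^esub> = (\<lambda>n. \<zero>)" "x \<oplus>\<^bsub>L\<^esub> y = (\<lambda>n. x n \<oplus> y n)"
  "x \<in> grade L d \<longleftrightarrow> (\<forall>n. x n \<in> grade K d \<and> (\<not> upper n \<longrightarrow> x n = \<zero>))"
  "rsmult L x \<alpha> = (\<lambda>n. x n \<otimes> \<alpha>)"
  by (simp_all add: mat_lie_def)

lemma upper_encode [simp]: "upper (prod_encode (i, j)) \<longleftrightarrow> i < j \<and> j \<le> N"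
  by (simp add: upper_def)

lemma dec_enc [simp]: "dec (enc f) = f"
  by (intro ext) (simp add: dec_def enc_def)

lemma dec_zero [simp]: "dec (\<lambda>n. \<zero>) i j = \<zero>"
  by (simp add: dec_def)

lemma dec_eqI: "(\<And>i j. dec x i j = dec y i j) \<Longrightarrow> x = y"
proof
  fix n assume "\<And>i j. dec x i j = dec y i j"
  then show "x n = y n" by (cases "prod_decode n") (metis dec_def prod_decode_inverse)
qed

lemma all_dec: "(\<forall>n. Q n (x n)) \<longleftrightarrow> (\<forall>i j. Q (prod_encode (i, j)) (dec x i j))"
  unfolding dec_def by (metis prod_decode_inverse surj_pair)

definition umat :: "(nat \<Rightarrow> nat \<Rightarrow> 'k) \<Rightarrow> bool"
  where "umat f \<longleftrightarrow> (\<forall>i j. f i j \<in> carrier K \<and> (\<not> (i < j \<and> j \<le> N) \<longrightarrow> f i j = \<zero>))"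

lemma L_carrier: "x \<in> carrier L \<longleftrightarrow> umat (dec x)"
  unfolding L_simps umat_def all_dec[of "\<lambda>n y. y \<in> carrier K \<and> (\<not> upper n \<longrightarrow> y = \<zero>)"] by simp

definition gmat :: "bit \<Rightarrow> (nat \<Rightarrow> nat \<Rightarrow> 'k) \<Rightarrow> bool"
  where "gmat d f \<longleftrightarrow> (\<forall>i j. f i j \<in> grade K d)"

lemma L_grade: "x \<in> grade L d \<longleftrightarrow> umat (dec x) \<and> gmat d (dec x)"
proof -
  have "x \<in> grade L d \<longleftrightarrow> (\<forall>i j. dec x i j \<in> grade K d \<and> (\<not> (i < j \<and> j \<le> N) \<longrightarrow> dec x i j = \<zero>))"
    unfolding L_simps all_dec[of "\<lambda>n y. y \<in> grade K d \<and> (\<not> upper n \<longrightarrow> y = \<zero>)"] by simp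
  then show ?thesis using grade_closed[of _ d] unfolding umat_def gmat_def by blast
qed

lemma L_abelian_group: "abelian_group L"
proof (rule abelian_groupI)
  fix x y z assume x: "x \<in> carrier L" and y: "y \<in> carrier L" and z: "z \<in> carrier L"
  show "x \<oplus>\<^bsub>L\<^esub> y \<in> carrier L" "x \<oplus>\<^bsub>L\<^esub> y \<oplus>\<^bsub>L\<^esub> z = x \<oplus>\<^bsub>L\<^esub> (y \<oplus>\<^bsub>L\<^esub> z)"
    "x \<oplus>\<^bsub>L\<^esub> y = y \<oplus>\<^bsub>L\<^esub> x" "\<zero>\<^bsub>L\<^esub> \<oplus>\<^bsub>L\<^esub> x = x"
    using x y z by (auto simp: a_ac)
  show "\<exists>y\<in>carrier L. y \<oplus>\<^bsub>L\<^esub> x = \<zero>\<^bsub>L\<^esub>"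
    using x by (intro bexI[of _ "\<lambda>n. \<ominus> x n"]) (auto simp: l_neg)
qed simp

sublocale L: abelian_group L by (rule L_abelian_group)

lemma L_neg [simp]: "x \<in> carrier L \<Longrightarrow> \<ominus>\<^bsub>L\<^esub> x = (\<lambda>n. \<ominus> x n)"
  by (rule L.minus_equality) (auto simp: l_neg)

lemma L_ksgn: "x \<in> carrier L \<Longrightarrow> ksgn L e x = (\<lambda>n. ksgn K e (x n))"
  by (auto simp: ksgn_def simp del: L_simps)

lemma hcomp_zero [simp]: "hcomp K d \<zero> = \<zero>"
  using hcomp_of_grade[OF grade_zero[of 0]] by simp

lemma L_graded_group: "graded_group L"
proof (intro graded_group.intro L_abelian_group graded_group_axioms.intro)
  fix d
  show "subgroup (grade L d) (add_monoid L)"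
  proof (rule subgroup.intro)
    fix x assume x: "x \<in> grade L d"
    then have "x \<in> carrier L" by (auto dest: grade_closed)
    then have "inv\<^bsub>add_monoid L\<^esub> x = (\<lambda>n. \<ominus> x n)" by (simp add: L_neg flip: a_inv_def del: L_simps)
    then show "inv\<^bsub>add_monoid L\<^esub> x \<in> grade L d" using x by auto
  qed (use grade_closed[of _ d] in auto)
next
  show "carrier L = grade L 0 <+>\<^bsub>L\<^esub> grade L 1"
  proof
    show "carrier L \<subseteq> grade L 0 <+>\<^bsub>L\<^esub> grade L 1"
    proof
      fix x assume x: "x \<in> carrier L"
      have h: "(\<lambda>n. hcomp K 0 (x n)) \<in> grade L 0" "(\<lambda>n. hcomp K 1 (x n)) \<in> grade L 1" using x by auto
      have s: "hcomp K 0 (x n) \<oplus> hcomp K 1 (x n) = x n" for n using x by (simp add: hcomp_sum)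
      show "x \<in> grade L 0 <+>\<^bsub>L\<^esub> grade L 1"
        unfolding set_add_def set_mult_def by (rule UN_I[OF h(1) UN_I[OF h(2)]]) (simp add: s)
    qed
  qed (use grade_closed[of _ 0] grade_closed[of _ 1] in \<open>auto simp: set_add_defs\<close>)
  show "grade L 0 \<inter> grade L 1 = {\<zero>\<^bsub>L\<^esub>}"
    by (auto simp: fun_eq_iff intro!: grade_disjoint[of _ 0])
qed

lemma L_supermodule: "supermodule K L"
proof (intro supermodule.intro supermodule_axioms.intro L_graded_group comm_superring_axioms)
  fix m p \<alpha> q assume "m \<in> grade L p" "\<alpha> \<in> grade K q"
  then show "rsmult L m \<alpha> \<in> grade L (p + q)"
    using grade_mult[of "m n" p \<alpha> q for n] grade_closed[of \<alpha> q] by simp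
qed (auto simp: l_distr r_distr m_assoc)

section \<open>Products and brackets of matrices\<close>

definition lb :: "(nat \<Rightarrow> nat \<Rightarrow> 'k) \<Rightarrow> (nat \<Rightarrow> nat \<Rightarrow> 'k) \<Rightarrow> nat \<Rightarrow> nat \<Rightarrow> 'k"
  where "lb f g i j = mm f g i j \<ominus> mt f g i j"

lemma dec_bracket: "dec (bracket L x y) = lb (dec x) (dec y)"
  by (simp add: mat_lie_def lb_def[abs_def])

lemma umatD [simp]: "umat f \<Longrightarrow> f i j \<in> carrier K"
  by (simp add: umat_def)

lemma umat_zero: "\<lbrakk>umat f; \<not> (i < j \<and> j \<le> N)\<rbrakk> \<Longrightarrow> f i j = \<zero>"
  by (simp add: umat_def)

lemma mm_closed [simp]: "\<lbrakk>umat f; umat g\<rbrakk> \<Longrightarrow> mm f g i j \<in> carrier K"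
  and mt_closed [simp]: "\<lbrakk>umat f; umat g\<rbrakk> \<Longrightarrow> mt f g i j \<in> carrier K"
  by (simp_all add: mm_def mt_def Pi_def)

lemma mm_umat [simp]: "\<lbrakk>umat f; umat g\<rbrakk> \<Longrightarrow> umat (mm f g)"
proof -
  assume f: "umat f" and g: "umat g"
  have "mm f g i j = \<zero>" if "\<not> (i < j \<and> j \<le> N)" for i j
  proof -
    have "f i k \<otimes> g k j = \<zero>" for k
    proof (cases "i < k \<and> k \<le> N")
      case True
      then have "g k j = \<zero>" using that by (intro umat_zero[OF g]) auto
      then show ?thesis using f by simp
    next
      case False
      then have "f i k = \<zero>" by (rule umat_zero[OF f])
      then show ?thesis using g by simp
    qed
    then show ?thesis by (simp add: mm_def)
  qed
  then show ?thesis using f g by (simp add: umat_def[of "mm f g"])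
qed

lemma mt_umat [simp]: "\<lbrakk>umat f; umat g\<rbrakk> \<Longrightarrow> umat (mt f g)"
proof -
  assume f: "umat f" and g: "umat g"
  have "mt f g i j = \<zero>" if "\<not> (i < j \<and> j \<le> N)" for i j
  proof -
    have "f k j \<otimes> g i k = \<zero>" for k
    proof (cases "i < k \<and> k \<le> N")
      case True
      then have "f k j = \<zero>" using that by (intro umat_zero[OF f]) auto
      then show ?thesis using g by simp
    next
      case False
      then have "g i k = \<zero>" by (rule umat_zero[OF g])
      then show ?thesis using f by simp
    qed
    then show ?thesis by (simp add: mt_def)
  qed
  then show ?thesis using f g by (simp add: umat_def[of "mt f g"])
qed

lemma lb_umat [simp]: "\<lbrakk>umat f; umat g\<rbrakk> \<Longrightarrow> umat (lb f g)"
  using mm_umat[of f g] mt_umat[of f g] unfolding lb_def umat_def by (simp add: a_minus_def)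

definition madd where "madd f g i j = f i j \<oplus> g i j" for i j :: nat
definition mneg where "mneg f i j = \<ominus> f i j" for i j :: nat

lemma madd_umat [simp]: "\<lbrakk>umat f; umat g\<rbrakk> \<Longrightarrow> umat (madd f g)"
  and mneg_umat [simp]: "umat f \<Longrightarrow> umat (mneg f)"
  unfolding umat_def madd_def mneg_def by simp_all

lemma lb_eq: "\<lbrakk>umat f; umat g\<rbrakk> \<Longrightarrow> lb f g = madd (mm f g) (mneg (mt f g))"
  by (intro ext) (simp add: lb_def madd_def mneg_def a_minus_def)

lemma prod_add:
  assumes "umat f" "umat g" "umat h"
  shows "mm (madd f g) h = madd (mm f h) (mm g h)" "mm h (madd f g) = madd (mm h f) (mm h g)"
    "mt (madd f g) h = madd (mt f h) (mt g h)" "mt h (madd f g) = madd (mt h f) (mt h g)"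
  using assms by (auto simp: fun_eq_iff mm_def mt_def madd_def l_distr r_distr finsum_addf Pi_def)

lemma finsum_neg: "(\<And>k. u k \<in> carrier K) \<Longrightarrow> finite A \<Longrightarrow> (\<Oplus>k\<in>A. \<ominus> u k) = \<ominus> (\<Oplus>k\<in>A. u k)"
proof (induction A rule: infinite_finite_induct)
  case (insert x A)
  then show ?case by (simp add: Pi_def minus_add)
qed simp_all

lemma prod_neg:
  assumes "umat f" "umat h"
  shows "mm (mneg f) h = mneg (mm f h)" "mm h (mneg f) = mneg (mm h f)"
    "mt (mneg f) h = mneg (mt f h)" "mt h (mneg f) = mneg (mt h f)"
  using assms by (auto simp: fun_eq_iff mm_def mt_def mneg_def l_minus r_minus finsum_neg)

definition msgn where "msgn e f i j = ksgn K e (f i j)" for i j :: nat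

lemma msgn_0 [simp]: "msgn 0 f = f" and msgn_1 [simp]: "msgn 1 f = mneg f"
  by (intro ext; simp add: msgn_def mneg_def ksgn_1)+

lemma finsum_ksgn: "(\<And>k. u k \<in> carrier K) \<Longrightarrow> finite A \<Longrightarrow> (\<Oplus>k\<in>A. ksgn K e (u k)) = ksgn K e (\<Oplus>k\<in>A. u k)"
  by (cases e) (simp_all add: ksgn_1 finsum_neg)

lemma gmat_comm: "\<lbrakk>gmat p f; gmat q g\<rbrakk> \<Longrightarrow> f i j \<otimes> g k l = ksgn K (p * q) (g k l \<otimes> f i j)"
  unfolding gmat_def by (simp add: supercomm[of _ p _ q])

lemma mm_mt:
  assumes "umat f" "umat g" "gmat p f" "gmat q g"
  shows "mm f g = msgn (p * q) (mt g f)"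
  using assms(1,2) by (intro ext) (simp add: mm_def mt_def msgn_def gmat_comm[OF assms(3,4)] finsum_ksgn)

lemma double_sum:
  assumes "\<And>k l. u k l \<in> carrier K" "\<And>k. v k \<in> carrier K"
  shows "(\<Oplus>k\<in>{..N}. (\<Oplus>l\<in>{..N}. u k l) \<otimes> v k) = (\<Oplus>k\<in>{..N}. \<Oplus>l\<in>{..N}. u k l \<otimes> v k)"
    "(\<Oplus>k\<in>{..N}. v k \<otimes> (\<Oplus>l\<in>{..N}. u k l)) = (\<Oplus>k\<in>{..N}. \<Oplus>l\<in>{..N}. v k \<otimes> u k l)"
  using assms by (simp_all add: finsum_ldistr finsum_rdistr Pi_def)

lemma prod_assoc:
  assumes f: "umat f" and g: "umat g" and h: "umat h"
  shows "mm (mm f g) h = mm f (mm g h)" "mt (mt f g) h = mt f (mt g h)"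
proof -
  show "mm (mm f g) h = mm f (mm g h)"
  proof (intro ext)
    fix i j
    have "mm (mm f g) h i j = (\<Oplus>k\<in>{..N}. \<Oplus>l\<in>{..N}. (f i l \<otimes> g l k) \<otimes> h k j)"
      using f g h by (simp add: mm_def double_sum)
    also have "\<dots> = (\<Oplus>l\<in>{..N}. \<Oplus>k\<in>{..N}. (f i l \<otimes> g l k) \<otimes> h k j)"
      using f g h by (intro finsum_swap) simp_all
    also have "\<dots> = mm f (mm g h) i j"
      using f g h by (simp add: mm_def double_sum m_assoc)
    finally show "mm (mm f g) h i j = mm f (mm g h) i j" .
  qed
  show "mt (mt f g) h = mt f (mt g h)"
  proof (intro ext)
    fix i j
    have "mt (mt f g) h i j = (\<Oplus>k\<in>{..N}. \<Oplus>l\<in>{..N}. (f l j \<otimes> g k l) \<otimes> h i k)"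
      using f g h by (simp add: mt_def double_sum)
    also have "\<dots> = (\<Oplus>l\<in>{..N}. \<Oplus>k\<in>{..N}. (f l j \<otimes> g k l) \<otimes> h i k)"
      using f g h by (intro finsum_swap) simp_all
    also have "\<dots> = mt f (mt g h) i j"
      using f g h by (simp add: mt_def double_sum m_assoc)
    finally show "mt (mt f g) h i j = mt f (mt g h) i j" .
  qed
qed

lemma ksgn_mult: "\<lbrakk>x \<in> carrier K; y \<in> carrier K\<rbrakk> \<Longrightarrow> ksgn K e x \<otimes> y = ksgn K e (x \<otimes> y)"
  by (cases e) (simp_all add: ksgn_1 l_minus)

lemma triple_comm:
  assumes "gmat p f" "gmat q g" "umat f" "umat g" "umat h"
  shows "f a b \<otimes> g c d \<otimes> h i j = ksgn K (p * q) (g c d \<otimes> (f a b \<otimes> h i j))"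
  using assms(3-5) by (simp add: gmat_comm[OF assms(1,2)] ksgn_mult m_assoc)

text \<open>Exchanging the scalar factors of f and g makes g the outermost factor of every mixed
  product. The factor of h stays last throughout, which is why h may be inhomogeneous.\<close>

lemma prod_mixed:
  assumes f: "umat f" and g: "umat g" and h: "umat h" and fp: "gmat p f" and gq: "gmat q g"
  shows "mm (mt f g) h = msgn (p * q) (mm g (mm f h))" "mt (mm f g) h = msgn (p * q) (mt g (mt f h))"
    "mm f (mt g h) = msgn (p * q) (mt g (mm f h))"
proof -
  note c = triple_comm[OF fp gq f g h]
  show "mm (mt f g) h = msgn (p * q) (mm g (mm f h))"
  proof (intro ext)
    fix i j
    have "mm (mt f g) h i j = (\<Oplus>k\<in>{..N}. \<Oplus>l\<in>{..N}. (f l k \<otimes> g i l) \<otimes> h k j)"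
      using f g h by (simp add: mm_def mt_def double_sum)
    also have "\<dots> = (\<Oplus>l\<in>{..N}. \<Oplus>k\<in>{..N}. (f l k \<otimes> g i l) \<otimes> h k j)"
      using f g h by (intro finsum_swap) simp_all
    also have "\<dots> = msgn (p * q) (mm g (mm f h)) i j"
      using f g h by (simp add: mm_def msgn_def double_sum c finsum_ksgn)
    finally show "mm (mt f g) h i j = msgn (p * q) (mm g (mm f h)) i j" .
  qed
  show "mt (mm f g) h = msgn (p * q) (mt g (mt f h))"
  proof (intro ext)
    fix i j
    have "mt (mm f g) h i j = (\<Oplus>k\<in>{..N}. \<Oplus>l\<in>{..N}. (f k l \<otimes> g l j) \<otimes> h i k)"
      using f g h by (simp add: mm_def mt_def double_sum)
    also have "\<dots> = (\<Oplus>l\<in>{..N}. \<Oplus>k\<in>{..N}. (f k l \<otimes> g l j) \<otimes> h i k)"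
      using f g h by (intro finsum_swap) simp_all
    also have "\<dots> = msgn (p * q) (mt g (mt f h)) i j"
      using f g h by (simp add: mt_def msgn_def double_sum c finsum_ksgn)
    finally show "mt (mm f g) h i j = msgn (p * q) (mt g (mt f h)) i j" .
  qed
  show "mm f (mt g h) = msgn (p * q) (mt g (mm f h))"
  proof (intro ext)
    fix i j
    have "mm f (mt g h) i j = (\<Oplus>k\<in>{..N}. \<Oplus>l\<in>{..N}. (f i k \<otimes> g l j) \<otimes> h k l)"
      using f g h by (simp add: mm_def mt_def double_sum m_assoc)
    also have "\<dots> = (\<Oplus>l\<in>{..N}. \<Oplus>k\<in>{..N}. (f i k \<otimes> g l j) \<otimes> h k l)"
      using f g h by (intro finsum_swap) simp_all
    also have "\<dots> = msgn (p * q) (mt g (mm f h)) i j"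
      using f g h by (simp add: mm_def mt_def msgn_def double_sum c finsum_ksgn)
    finally show "mm f (mt g h) i j = msgn (p * q) (mt g (mm f h)) i j" .
  qed
qed

lemma L_lie: "lie_superalgebra K L"
proof (intro lie_superalgebra.intro lie_superalgebra_axioms.intro L_supermodule)
  show "bracket L X Y \<in> carrier L" if "X \<in> carrier L" "Y \<in> carrier L" for X Y
    using that unfolding L_carrier dec_bracket by simp
  show "bracket L X Y \<in> grade L (p + q)" if "X \<in> grade L p" "Y \<in> grade L q" for X Y p q
  proof -
    have "gmat (p + q) (lb (dec X) (dec Y))"
      using that grade_mult[of _ p _ q] grade_mult[of _ q _ p]
      unfolding L_grade gmat_def lb_def mm_def mt_def by (auto intro!: grade_minus finsum_grade simp: add.commute)
    then show ?thesis using that unfolding L_grade dec_bracket by simp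
  qed
  have dadd: "dec (X \<oplus>\<^bsub>L\<^esub> Y) = madd (dec X) (dec Y)" for X Y
    by (intro ext) (simp add: dec_def madd_def)
  have dneg: "dec (\<ominus>\<^bsub>L\<^esub> X) = mneg (dec X)" if "X \<in> carrier L" for X
    using that by (intro ext) (simp add: dec_def mneg_def del: L_simps)
  have dsgn: "dec (ksgn L e X) = msgn e (dec X)" if "X \<in> carrier L" for e X
    using that by (intro ext) (simp add: dec_def msgn_def L_ksgn del: L_simps)
  show "bracket L (X \<oplus>\<^bsub>L\<^esub> X') Y = bracket L X Y \<oplus>\<^bsub>L\<^esub> bracket L X' Y"
    if "X \<in> carrier L" "X' \<in> carrier L" "Y \<in> carrier L" for X X' Y
    using that unfolding L_carrier
    by (intro dec_eqI, unfold dadd dec_bracket) (simp add: lb_eq prod_add prod_neg, simp add: madd_def mneg_def a_ac minus_add)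
  show "bracket L X (Y \<oplus>\<^bsub>L\<^esub> Y') = bracket L X Y \<oplus>\<^bsub>L\<^esub> bracket L X Y'"
    if "X \<in> carrier L" "Y \<in> carrier L" "Y' \<in> carrier L" for X Y Y'
    using that unfolding L_carrier
    by (intro dec_eqI, unfold dadd dec_bracket) (simp add: lb_eq prod_add prod_neg, simp add: madd_def mneg_def a_ac minus_add)
  show "bracket L (rsmult L X \<alpha>) Y = bracket L X (ksgn L (p * q) (rsmult L Y \<alpha>))"
    if X: "X \<in> carrier L" and a: "\<alpha> \<in> grade K p" and Y: "Y \<in> grade L q" for X Y \<alpha> p q
  proof (rule dec_eqI)
    fix i j
    have aK: "\<alpha> \<in> carrier K" using a by (rule grade_closed)
    have u: "umat (dec X)" "umat (dec Y)" "gmat q (dec Y)" using X Y unfolding L_carrier L_grade by auto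
    have "rsmult L Y \<alpha> \<in> carrier L" using Y aK grade_closed[of _ q] by auto
    then have d: "dec (ksgn L (p * q) (rsmult L Y \<alpha>)) k l = ksgn K (p * q) (dec Y k l \<otimes> \<alpha>)" for k l
      by (simp add: dsgn msgn_def del: L_simps(1)) (simp add: dec_def)
    have e: "dec (rsmult L X \<alpha>) k l = dec X k l \<otimes> \<alpha>" for k l by (simp add: dec_def)
    have "dec X k l \<otimes> \<alpha> \<otimes> dec Y m n = dec X k l \<otimes> ksgn K (p * q) (dec Y m n \<otimes> \<alpha>)" for k l m n
      using u a aK supercomm[of \<alpha> p "dec Y m n" q] by (simp add: gmat_def m_assoc)
    then show "dec (bracket L (rsmult L X \<alpha>) Y) i j = dec (bracket L X (ksgn L (p * q) (rsmult L Y \<alpha>))) i j"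
      by (simp only: dec_bracket lb_def mm_def mt_def d e)
  qed
  show "bracket L X (rsmult L Y \<alpha>) = rsmult L (bracket L X Y) \<alpha>"
    if X: "X \<in> carrier L" and Y: "Y \<in> carrier L" and a: "\<alpha> \<in> carrier K" for X Y \<alpha>
  proof (rule dec_eqI)
    fix i j
    have u: "umat (dec X)" "umat (dec Y)" using X Y unfolding L_carrier by auto
    have e: "dec (rsmult L Z \<alpha>) k l = dec Z k l \<otimes> \<alpha>" for Z k l by (simp add: dec_def)
    have "mm (dec X) (dec Y) i j \<otimes> \<alpha> = (\<Oplus>k\<in>{..N}. dec X i k \<otimes> (dec Y k j \<otimes> \<alpha>))"
      "mt (dec X) (dec Y) i j \<otimes> \<alpha> = (\<Oplus>k\<in>{..N}. dec X k j \<otimes> (dec Y i k \<otimes> \<alpha>))"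
      using u a by (simp_all add: mm_def mt_def finsum_ldistr Pi_def m_assoc)
    then show "dec (bracket L X (rsmult L Y \<alpha>)) i j = dec (rsmult L (bracket L X Y) \<alpha>) i j"
      using u a unfolding e dec_bracket lb_def
      by (simp add: a_minus_def l_distr l_minus) (simp add: mm_def mt_def e)
  qed
  have hom: "umat (dec X)" "gmat p (dec X)" if "X \<in> grade L p" for X p
    using that unfolding L_grade by auto
  show "bracket L X Y = \<ominus>\<^bsub>L\<^esub> ksgn L (p * q) (bracket L Y X)" if X: "X \<in> grade L p" and Y: "Y \<in> grade L q" for X Y p q
  proof (rule dec_eqI)
    fix i j
    note u = hom[OF X] hom[OF Y]
    have c: "bracket L Y X \<in> carrier L" using u by (simp add: L_carrier dec_bracket del: L_simps)
    have m: "mm (dec X) (dec Y) i j = ksgn K (p * q) (mt (dec Y) (dec X) i j)"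
      "mm (dec Y) (dec X) i j = ksgn K (p * q) (mt (dec X) (dec Y) i j)"
      using mm_mt[OF u(1,3,2,4)] mm_mt[OF u(3,1,4,2)] by (simp_all add: msgn_def mult.commute)
    have alg: "ksgn K e A \<ominus> C = \<ominus> ksgn K e (ksgn K e C \<ominus> A)" if "A \<in> carrier K" "C \<in> carrier K" for e A C
      using that by (cases e) (simp_all add: ksgn_1 a_minus_def minus_add a_comm)
    show "dec (bracket L X Y) i j = dec (\<ominus>\<^bsub>L\<^esub> ksgn L (p * q) (bracket L Y X)) i j"
      unfolding dneg[OF L.ksgn_closed[OF c]] dsgn[OF c] dec_bracket mneg_def msgn_def lb_def m
      using u by (intro alg) simp_all
  qed
  show "bracket L X X = \<zero>\<^bsub>L\<^esub>" if X: "X \<in> grade L 0" for X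
  proof (rule dec_eqI)
    fix i j
    show "dec (bracket L X X) i j = dec \<zero>\<^bsub>L\<^esub> i j"
      using hom[OF X] mm_mt[OF hom(1)[OF X] hom(1)[OF X] hom(2)[OF X] hom(2)[OF X]] by (simp add: dec_bracket lb_def r_neg a_minus_def)
  qed
  show "bracket L (bracket L X Y) Z = bracket L X (bracket L Y Z) \<ominus>\<^bsub>L\<^esub> ksgn L (p * q) (bracket L Y (bracket L X Z))"
    if X: "X \<in> grade L p" and Y: "Y \<in> grade L q" and Z: "Z \<in> carrier L" for X Y Z p q
  proof (rule dec_eqI)
    fix i j
    define x y z where "x = dec X" and "y = dec Y" and "z = dec Z"
    have u: "umat x" "umat y" "umat z" "gmat p x" "gmat q y"
      using hom[OF X] hom[OF Y] Z by (auto simp: x_def y_def z_def L_carrier simp del: L_simps)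
    have c: "bracket L Y (bracket L X Z) \<in> carrier L"
      using u by (simp add: L_carrier dec_bracket x_def y_def z_def del: L_simps)
    have m: "mm (mt x y) z i j = ksgn K (p * q) (mm y (mm x z) i j)" "mt (mm x y) z i j = ksgn K (p * q) (mt y (mt x z) i j)"
      "mm x (mt y z) i j = ksgn K (p * q) (mt y (mm x z) i j)" "mt x (mm y z) i j = ksgn K (p * q) (mm y (mt x z) i j)"
      "mm (mm x y) z = mm x (mm y z)" "mt (mt x y) z = mt x (mt y z)"
      using prod_mixed[OF u] prod_mixed(3)[OF u(2,1,3,5,4)] prod_assoc[OF u(1-3)] u
      by (simp_all add: msgn_def mult.commute)
    have 1: "lb (lb x y) z i j = (mm x (mm y z) i j \<ominus> ksgn K (p * q) (mm y (mm x z) i j))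
        \<ominus> (ksgn K (p * q) (mt y (mt x z) i j) \<ominus> mt x (mt y z) i j)"
      using u by (simp add: lb_eq prod_add prod_neg) (simp add: madd_def mneg_def m a_minus_def)
    have 2: "lb x (lb y z) i j = (mm x (mm y z) i j \<ominus> ksgn K (p * q) (mt y (mm x z) i j))
        \<ominus> (ksgn K (p * q) (mm y (mt x z) i j) \<ominus> mt x (mt y z) i j)"
      using u by (simp add: lb_eq prod_add prod_neg) (simp add: madd_def mneg_def m a_minus_def)
    have 3: "lb y (lb x z) i j = (mm y (mm x z) i j \<ominus> mm y (mt x z) i j) \<ominus> (mt y (mm x z) i j \<ominus> mt y (mt x z) i j)"
      using u by (simp add: lb_eq prod_add prod_neg) (simp add: madd_def mneg_def a_minus_def)
    \<comment> \<open>After \<open>prod_mixed\<close> only six triple products are left. The mixed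
      ones E and G occur twice with opposite signs.\<close>
    have alg: "(A \<ominus> ksgn K e B) \<ominus> (ksgn K e C \<ominus> D) = ((A \<ominus> ksgn K e E) \<ominus> (ksgn K e G \<ominus> D)) \<ominus> ksgn K e ((B \<ominus> G) \<ominus> (E \<ominus> C))"
      if "A \<in> carrier K" "B \<in> carrier K" "C \<in> carrier K" "D \<in> carrier K" "E \<in> carrier K" "G \<in> carrier K" for A B C D E G e
    proof -
      have n: "\<ominus> E \<in> carrier K" "\<ominus> G \<in> carrier K" "\<ominus> B \<in> carrier K" "\<ominus> C \<in> carrier K" using that by simp_all
      have "E \<oplus> (G \<oplus> (\<ominus> E \<oplus> \<ominus> G)) = (E \<oplus> \<ominus> E) \<oplus> (G \<oplus> \<ominus> G)"
        "E \<oplus> (G \<oplus> (\<ominus> B \<oplus> (\<ominus> C \<oplus> (\<ominus> E \<oplus> \<ominus> G)))) = (\<ominus> B \<oplus> \<ominus> C) \<oplus> ((E \<oplus> \<ominus> E) \<oplus> (G \<oplus> \<ominus> G))"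
        using that n by (simp_all only: a_ac a_closed)
      then have "E \<oplus> (G \<oplus> (\<ominus> E \<oplus> \<ominus> G)) = \<zero>"
        "E \<oplus> (G \<oplus> (\<ominus> B \<oplus> (\<ominus> C \<oplus> (\<ominus> E \<oplus> \<ominus> G)))) = \<ominus> B \<oplus> \<ominus> C"
        using that n by (simp_all add: r_neg)
      then show ?thesis
        using that by (cases e) (simp_all add: ksgn_1 a_minus_def minus_add a_ac)
    qed
    have "dec (bracket L (bracket L X Y) Z) i j = lb (lb x y) z i j"
      by (simp add: dec_bracket x_def y_def z_def)
    also have "\<dots> = lb x (lb y z) i j \<ominus> ksgn K (p * q) (lb y (lb x z) i j)"
      unfolding 1 2 3 using u by (intro alg) simp_all
    also have "\<dots> = dec (bracket L X (bracket L Y Z) \<ominus>\<^bsub>L\<^esub> ksgn L (p * q) (bracket L Y (bracket L X Z))) i j"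
      unfolding a_minus_def dadd dneg[OF L.ksgn_closed[OF c]] dsgn[OF c] dec_bracket madd_def mneg_def msgn_def x_def y_def z_def ..
    finally show "dec (bracket L (bracket L X Y) Z) i j
      = dec (bracket L X (bracket L Y Z) \<ominus>\<^bsub>L\<^esub> ksgn L (p * q) (bracket L Y (bracket L X Z))) i j" .
  qed
  show "bracket L Y (bracket L Y Y) = \<zero>\<^bsub>L\<^esub>" if Y: "Y \<in> grade L 1" for Y
  proof (rule dec_eqI)
    fix i j
    define y where "y = dec Y"
    have u: "umat y" "gmat 1 y" using hom[OF Y] by (auto simp: y_def)
    \<comment> \<open>For odd y the exchange costs a sign, so [y, y] is twice the square of y. The
      square is even, so exchanging it with y costs none, and the outer bracket vanishes.\<close>
    have s: "mt y y = mneg (mm y y)"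
      using mm_mt[OF u(1,1,2,2)] u by (intro ext) (simp add: mneg_def)
    have m: "mt y (mm y y) = mm y (mm y y)"
    proof -
      have n: "mneg (mneg f) = f" if "umat f" for f using that by (intro ext) (simp add: mneg_def)
      have "mneg (mm y (mm y y)) = mneg (mt y (mm y y))"
        using prod_mixed(3)[OF u(1,1,1,2,2)] u by (simp add: s prod_neg)
      then have "mneg (mneg (mm y (mm y y))) = mneg (mneg (mt y (mm y y)))" by simp
      then show ?thesis using u by (simp add: n)
    qed
    have "lb y (lb y y) i j = \<zero>"
      using u by (simp add: lb_eq prod_add prod_neg s m) (simp add: madd_def mneg_def r_neg flip: minus_add)
    then show "dec (bracket L Y (bracket L Y Y)) i j = dec \<zero>\<^bsub>L\<^esub> i j"
      by (simp add: dec_bracket y_def)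
  qed
qed

text \<open>Each bracket with a strictly upper triangular matrix moves the nonzero entries at least
  one diagonal away from the main one.\<close>

lemma foldr_bracket:
  "\<lbrakk>set Xs \<subseteq> carrier L; Y \<in> carrier L\<rbrakk> \<Longrightarrow> foldr (bracket L) Xs Y \<in> carrier L \<and>
    (\<forall>i j. j \<le> i + length Xs \<longrightarrow> dec (foldr (bracket L) Xs Y) i j = \<zero>)"
proof (induction Xs)
  case Nil
  then show ?case unfolding L_carrier by (auto simp: umat_zero)
next
  case (Cons X Xs)
  let ?Z = "foldr (bracket L) Xs Y"
  have X: "umat (dec X)" and Z: "umat (dec ?Z)" using Cons unfolding L_carrier[symmetric] by auto
  have z: "dec ?Z i j = \<zero>" if "j \<le> i + length Xs" for i j using Cons that by auto
  have "lb (dec X) (dec ?Z) i j = \<zero>" if "j \<le> i + Suc (length Xs)" for i j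
  proof -
    have "dec X i k \<otimes> dec ?Z k j = \<zero>" "dec X k j \<otimes> dec ?Z i k = \<zero>" for k
    proof -
      show "dec X i k \<otimes> dec ?Z k j = \<zero>"
      proof (cases "i < k")
        case True
        then show ?thesis using z[of j k] that X by simp
      next
        case False
        then show ?thesis using umat_zero[OF X, of i k] Z by simp
      qed
      show "dec X k j \<otimes> dec ?Z i k = \<zero>"
      proof (cases "k < j")
        case True
        then show ?thesis using z[of k i] that X by simp
      next
        case False
        then show ?thesis using umat_zero[OF X, of k j] Z by simp
      qed
    qed
    then show ?thesis by (simp add: lb_def mm_def mt_def a_minus_def)
  qed
  moreover have "bracket L X ?Z \<in> carrier L" using X Z unfolding L_carrier dec_bracket by simp
  ultimately show ?case by (simp add: dec_bracket del: L_simps)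
qed

text \<open>Y itself is off the main diagonal, so after N brackets only entries with j > i + N could
  remain, and the indices 0 to N contain none. Hence the size N + 1.\<close>

lemma L_nilpotent: "lie_nilpotent N L"
  unfolding lie_nilpotent_def
proof (intro allI impI)
  fix Xs Y assume a: "set Xs \<subseteq> carrier L \<and> length Xs = N \<and> Y \<in> carrier L"
  show "foldr (bracket L) Xs Y = \<zero>\<^bsub>L\<^esub>"
  proof (rule dec_eqI)
    fix i j
    have c: "umat (dec (foldr (bracket L) Xs Y))" using foldr_bracket[of Xs Y] a unfolding L_carrier by blast
    show "dec (foldr (bracket L) Xs Y) i j = dec \<zero>\<^bsub>L\<^esub> i j"
      using foldr_bracket[of Xs Y] a umat_zero[OF c, of i j]
      by (cases "j \<le> i + length Xs") (simp_all del: L_simps(1,4))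
  qed
qed

end

section \<open>The commutation relations imply the functional equation\<close>

lemma rm_map: "rm t (map f xs) = map f (rm t xs)"
  by (simp add: rm_def take_map drop_map)

lemma set_rm: "\<lbrakk>distinct xs; t < length xs\<rbrakk> \<Longrightarrow> set (rm t xs) = set xs - {xs ! t}"
  and distinct_rm: "\<lbrakk>distinct xs; t < length xs\<rbrakk> \<Longrightarrow> distinct (rm t xs)"
proof -
  assume d: "distinct xs" and t: "t < length xs"
  have xs: "xs = take t xs @ xs ! t # drop (Suc t) xs" using t by (simp add: id_take_nth_drop)
  have "distinct (take t xs @ xs ! t # drop (Suc t) xs)" using d xs by simp
  then show "distinct (rm t xs)" by (auto simp: rm_def)
  have "set xs = set (take t xs @ xs ! t # drop (Suc t) xs)" using xs by simp
  with \<open>distinct (take t xs @ xs ! t # drop (Suc t) xs)\<close> show "set (rm t xs) = set xs - {xs ! t}"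
    by (auto simp: rm_def)
qed

text \<open>
  Abstract matrix units \<open>e\<^sub>i\<^sub>j\<close>. On a product of elements \<open>e\<^sub>k\<^sub>,\<^sub>k\<^sub>+\<^sub>1\<close> the commutators of
  \<open>a = e\<^sub>i\<^sub>,\<^sub>i\<^sub>+\<^sub>1\<close> and \<open>b = e\<^sub>i\<^sub>+\<^sub>1\<^sub>,\<^sub>i\<^sub>+\<^sub>2\<close> single out one monomial \<open>t\<^sup>i u\<^sup>j\<close>, since \<open>a\<close> can be extended
  only to the left and \<open>b\<close> only to the right.
\<close>

locale lie_chain = lie_rep K M N c
  for K :: "'k superring" and M :: "('k, 'm, 'x) lie_super_scheme" (structure) and N c +
  fixes e :: "nat \<Rightarrow> nat \<Rightarrow> 'm"
  assumes e_even: "e i j \<in> grade M 0"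
    and e_left: "\<lbrakk>Suc k < b; k < N\<rbrakk> \<Longrightarrow> bracket M (e k (Suc k)) (e (Suc k) b) = e k b"
    and e_right: "\<lbrakk>a < k; k < N\<rbrakk> \<Longrightarrow> bracket M (e k (Suc k)) (e a k) = \<ominus> e a (Suc k)"
    and e_none: "\<lbrakk>a < b; k < N; Suc k \<noteq> a; k \<noteq> b\<rbrakk> \<Longrightarrow> bracket M (e k (Suc k)) (e a b) = \<zero>"
begin

abbreviation "e1 k \<equiv> e k (Suc k)"
definition "pe ks = prodS (map e1 ks)"

lemma e_closed [simp]: "e i j \<in> carrier M"
  using e_even by (rule grade_closed)

lemma homs_e: "homs (map e1 ks) (replicate (length ks) 0)"
  by (induction ks) (simp_all add: e_even)

lemma pe_closed [simp]: "pe ks \<in> carrier S"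
  unfolding pe_def by (rule prodS_closed) auto

lemma conv_pe:
  assumes "par_map K S M 0 h"
  shows "conv 0 pr h (pe ks) = (\<Oplus>t\<in>{..<length ks}. br (e1 (ks ! t)) (h (pe (rm t ks))))"
proof -
  have "h (pe ys) \<in> carrier M" for ys by (rule par_mapD(4)[OF assms]) simp
  then show ?thesis
    unfolding pe_def conv_pr_prodS[OF homs_e assms]
    by (intro finsum_cong') (auto simp: rm_map pe_def intro!: bracket_closed)
qed

text \<open>In a list without repetitions at most one position holds w, so the sum over the removed
  letter has at most one term.\<close>

lemma finsum_pick:
  assumes d: "distinct ks" and w: "w \<notin> D" and v: "v \<in> carrier M"
  shows "(\<Oplus>t\<in>{..<length ks}. if ks ! t = w \<and> set (rm t ks) = D then v else \<zero>) = (if set ks = insert w D then v else \<zero>)"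
proof (cases "set ks = insert w D")
  case True
  then obtain t0 where t0: "t0 < length ks" "ks ! t0 = w" by (metis in_set_conv_nth insertI1)
  have "(if ks ! t = w \<and> set (rm t ks) = D then v else \<zero>) = (if t0 = t then v else \<zero>)" if "t < length ks" for t
    using that t0 d w True by (auto simp: set_rm nth_eq_iff_index_eq)
  then have "(\<Oplus>t\<in>{..<length ks}. if ks ! t = w \<and> set (rm t ks) = D then v else \<zero>) = (\<Oplus>t\<in>{..<length ks}. if t0 = t then v else \<zero>)"
    using v by (intro finsum_cong') auto
  also have "\<dots> = v" using finsum_singleton[of t0 "{..<length ks}" "\<lambda>_. v"] t0 v by simp
  finally show ?thesis using True by simp
next
  case False
  then have "\<not> (ks ! t = w \<and> set (rm t ks) = D)" if "t < length ks" for t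
    using that d nth_mem[OF that] by (auto simp: set_rm)
  then have "(\<Oplus>t\<in>{..<length ks}. if ks ! t = w \<and> set (rm t ks) = D then v else \<zero>) = (\<Oplus>t\<in>{..<length ks}. \<zero>)"
    by (intro finsum_cong') auto
  then show ?thesis using False by simp
qed

text \<open>No letter ends at m, because \<open>Suc k \<noteq> m\<close>, so \<open>e1 m\<close>
  grows only to the right, by the letters m + 1, m + 2 and so on from the inside out. Every
  extension changes the sign, which gives the parity \<open>of_nat n\<close>.\<close>

lemma adpow_pe:
  "\<lbrakk>distinct ks; \<And>k. k \<in> set ks \<Longrightarrow> k < N \<and> Suc k \<noteq> m\<rbrakk> \<Longrightarrow>
    adpow 0 (e1 m) n (pe ks) = (if set ks = {Suc m..<Suc m + n} then ksgn M (of_nat n) (e m (Suc m + n)) else \<zero>)"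
proof (induction n arbitrary: ks)
  case 0
  then show ?case
  proof (cases ks)
    case (Cons k ks')
    have "cst (e1 m) (pe (k # ks')) = \<zero>"
      unfolding pe_def list.map prodS_simps by (rule cst_sym) (auto intro!: prodS_closed)
    then show ?thesis using Cons by simp
  qed (simp add: pe_def cst_one)
next
  case (Suc n)
  let ?D = "{Suc m..<Suc m + n}"
  have "adpow 0 (e1 m) (Suc n) (pe ks) = (\<Oplus>t\<in>{..<length ks}. br (e1 (ks ! t)) (adpow 0 (e1 m) n (pe (rm t ks))))"
    using conv_pe[OF adpow_par[OF e_even]] by simp
  also have "\<dots> = (\<Oplus>t\<in>{..<length ks}. if ks ! t = Suc m + n \<and> set (rm t ks) = ?D
      then ksgn M (of_nat (Suc n)) (e m (Suc m + Suc n)) else \<zero>)"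
  proof (rule finsum_cong')
    fix t assume "t \<in> {..<length ks}"
    then have t: "t < length ks" by simp
    have k: "ks ! t < N" "Suc (ks ! t) \<noteq> m" using Suc.prems(2)[OF nth_mem[OF t]] by auto
    have "adpow 0 (e1 m) n (pe (rm t ks)) = (if set (rm t ks) = ?D then ksgn M (of_nat n) (e m (Suc m + n)) else \<zero>)"
      by (rule Suc.IH) (use Suc.prems t in \<open>auto simp: set_rm distinct_rm\<close>)
    then show "br (e1 (ks ! t)) (adpow 0 (e1 m) n (pe (rm t ks))) = (if ks ! t = Suc m + n \<and> set (rm t ks) = ?D
      then ksgn M (of_nat (Suc n)) (e m (Suc m + Suc n)) else \<zero>)"
      using k e_right[of m "Suc m + n"] e_none[of m "Suc m + n" "ks ! t"]
      by (auto simp: br_ksgn br_zero ksgn_neg ksgn_1 simp flip: ksgn_ksgn[of _ 1])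
  qed auto
  also have "\<dots> = (if set ks = insert (Suc m + n) ?D then ksgn M (of_nat (Suc n)) (e m (Suc m + Suc n)) else \<zero>)"
    by (rule finsum_pick[OF Suc.prems(1)]) auto
  finally show ?case by (simp add: atLeastLessThanSuc)
qed

definition "block i r s = {i - r..<i} \<union> {Suc (Suc i)..<Suc (Suc i) + s}"

text \<open>The letters i and i + 1 are absent, so the ends of the chain grow independently:
  leftward steps count r, rightward steps count s. In the induction step \<open>Vm_ad\<close> yields
  the sum of the brackets with r or s raised, and cancelling the known one leaves the other.\<close>

lemma Vm_pe:
  assumes i: "Suc i < N"
  shows "\<lbrakk>distinct ks; \<And>k. k \<in> set ks \<Longrightarrow> k < N \<and> k \<noteq> i \<and> k \<noteq> Suc i\<rbrakk> \<Longrightarrow>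
    Vm 0 0 (e1 i) (e1 (Suc i)) r s (pe ks)
      = (if r \<le> i \<and> set ks = block i r s then ksgn M (of_nat s) (e (i - r) (Suc (Suc i) + s)) else \<zero>)"
proof (induction r arbitrary: s ks)
  case 0
  have "Vm 0 0 (e1 i) (e1 (Suc i)) 0 s (pe ks) = br (e1 i) (adpow 0 (e1 (Suc i)) s (pe ks))"
    by (rule Vm_zero[OF e_even e_even pe_closed])
  also have "adpow 0 (e1 (Suc i)) s (pe ks)
      = (if set ks = {Suc (Suc i)..<Suc (Suc i) + s} then ksgn M (of_nat s) (e (Suc i) (Suc (Suc i) + s)) else \<zero>)"
    by (rule adpow_pe) (use 0 in auto)
  finally show ?case
    using i e_left[of i "Suc (Suc i) + s"] by (simp add: block_def br_ksgn br_zero)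
next
  case (Suc r)
  let ?V = "Vm 0 0 (e1 i) (e1 (Suc i))"
  let ?v = "if Suc r \<le> i then ksgn M (of_nat s) (e (i - Suc r) (Suc (Suc i) + s)) else \<zero>"
  let ?w = "if r \<le> i then ksgn M (of_nat (Suc s)) (e (i - r) (Suc (Suc i) + Suc s)) else \<zero>"
  \<comment> \<open>If r \<ge> i, no extension to the left exists. The dummy i lies outside the
    block and carries the value zero, so \<open>finsum_pick\<close> still applies.\<close>
  let ?k = "if Suc r \<le> i then i - Suc r else i"
  have par: "par_map K S M 0 (?V r s)" for r s using Vm_par[OF e_even e_even] by simp
  have "?V (Suc r) s (pe ks) \<oplus> ?V r (Suc s) (pe ks) = conv 0 pr (?V r s) (pe ks)"
    using Vm_ad[OF e_even e_even pe_closed] by simp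
  also have "\<dots> = (\<Oplus>t\<in>{..<length ks}. br (e1 (ks ! t)) (?V r s (pe (rm t ks))))"
    by (rule conv_pe[OF par])
  also have "\<dots> = (\<Oplus>t\<in>{..<length ks}. (if ks ! t = ?k \<and> set (rm t ks) = block i r s then ?v else \<zero>)
      \<oplus> (if ks ! t = Suc (Suc i) + s \<and> set (rm t ks) = block i r s then ?w else \<zero>))"
  proof (rule finsum_cong')
    fix t assume "t \<in> {..<length ks}"
    then have t: "t < length ks" by simp
    have k: "ks ! t < N" "ks ! t \<noteq> i" "ks ! t \<noteq> Suc i" using Suc.prems(2)[OF nth_mem[OF t]] by auto
    have V: "?V r s (pe (rm t ks)) = (if r \<le> i \<and> set (rm t ks) = block i r s
        then ksgn M (of_nat s) (e (i - r) (Suc (Suc i) + s)) else \<zero>)"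
      by (rule Suc.IH) (use Suc.prems t in \<open>auto simp: set_rm distinct_rm\<close>)
    have left: "br (e1 (ks ! t)) (e (i - r) (Suc (Suc i) + s)) = e (i - Suc r) (Suc (Suc i) + s)" if "Suc (ks ! t) = i - r"
    proof -
      have "ks ! t = i - Suc r" using that by simp
      then show ?thesis using e_left[of "ks ! t" "Suc (Suc i) + s"] that k by simp
    qed
    have right: "br (e1 (ks ! t)) (e (i - r) (Suc (Suc i) + s)) = \<ominus> e (i - r) (Suc (Suc i) + Suc s)" if "ks ! t = Suc (Suc i) + s"
      using e_right[of "i - r" "ks ! t"] that k by simp
    have none: "br (e1 (ks ! t)) (e (i - r) (Suc (Suc i) + s)) = \<zero>" if "Suc (ks ! t) \<noteq> i - r" "ks ! t \<noteq> Suc (Suc i) + s"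
      using e_none[of "i - r" "Suc (Suc i) + s" "ks ! t"] that k by simp
    have kk: "Suc (ks ! t) = i - r \<longleftrightarrow> Suc r \<le> i \<and> ks ! t = ?k" "Suc r \<le> i \<Longrightarrow> ?k \<noteq> Suc (Suc i) + s" by auto
    show "br (e1 (ks ! t)) (?V r s (pe (rm t ks))) = (if ks ! t = ?k \<and> set (rm t ks) = block i r s then ?v else \<zero>)
      \<oplus> (if ks ! t = Suc (Suc i) + s \<and> set (rm t ks) = block i r s then ?w else \<zero>)"
    proof (cases "r \<le> i \<and> set (rm t ks) = block i r s")
      case True
      consider "Suc (ks ! t) = i - r" | "ks ! t = Suc (Suc i) + s" | "Suc (ks ! t) \<noteq> i - r" "ks ! t \<noteq> Suc (Suc i) + s" by blast
      then show ?thesis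
      proof cases
        case 1
        then show ?thesis using True kk left unfolding V by (auto simp: br_ksgn)
      next
        case 2
        then show ?thesis using True k right unfolding V
          by (auto simp: br_ksgn ksgn_neg ksgn_1 simp flip: ksgn_ksgn[of _ 1])
      next
        case 3
        then show ?thesis using True kk k none unfolding V by (auto simp: br_ksgn)
      qed
    qed (use V in \<open>auto simp: br_zero\<close>)
  qed auto
  also have "\<dots> = (if set ks = insert ?k (block i r s) then ?v else \<zero>) \<oplus> (if set ks = insert (Suc (Suc i) + s) (block i r s) then ?w else \<zero>)"
    by (subst finsum_addf, force, force, intro arg_cong2[where f = "add M"] finsum_pick[OF Suc.prems(1)])
      (auto simp: block_def)
  also have "(if set ks = insert ?k (block i r s) then ?v else \<zero>)
      = (if Suc r \<le> i \<and> set ks = block i (Suc r) s then ksgn M (of_nat s) (e (i - Suc r) (Suc (Suc i) + s)) else \<zero>)"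
  proof -
    have "insert (i - Suc r) (block i r s) = block i (Suc r) s" if "Suc r \<le> i"
      unfolding block_def using that by auto
    then show ?thesis by auto
  qed
  also have "(if set ks = insert (Suc (Suc i) + s) (block i r s) then ?w else \<zero>) = ?V r (Suc s) (pe ks)"
  proof -
    have "insert (Suc (Suc i) + s) (block i r s) = block i r (Suc s)" by (auto simp: block_def)
    then show ?thesis using Suc.IH[OF Suc.prems, of "Suc s"] by auto
  qed
  finally show ?case
    using add.right_cancel[OF par_mapD(4)[OF par pe_closed] par_mapD(4)[OF par pe_closed]] by simp
qed

text \<open>The test element is the product of the letters 0 to i + j + 1 without i and i + 1. Among
  all monomials only t^i u^j uses up exactly these letters, so the evaluation reduces to a single
  coefficient times a matrix unit, up to sign.\<close>

theorem chain_defect: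
  assumes R: "rep_by_coderivations K M R" and ij: "Suc (Suc (i + j)) \<le> N"
  shows "rsmult M (e 0 (Suc (Suc (i + j)))) (arr_total K c N j i) = \<zero>"
proof -
  let ?a = "e1 i" and ?b = "e1 (Suc i)"
  interpret pair: lie_pair K M N 0 0 ?a ?b c by (intro lie_pair e_even)
  let ?A = "arr_total K c N"
  define ks where "ks = [0..<i] @ [Suc (Suc i)..<Suc (Suc i) + j]"
  have V: "Vm 0 0 ?a ?b r s (pe ks) = (if r \<le> i \<and> block i i j = block i r s then ksgn M (of_nat s) (e (i - r) (Suc (Suc i) + s)) else \<zero>)" for r s
  proof -
    have "set ks = block i i j" by (auto simp: ks_def block_def)
    moreover have "Vm 0 0 ?a ?b r s (pe ks) = (if r \<le> i \<and> set ks = block i r s then ksgn M (of_nat s) (e (i - r) (Suc (Suc i) + s)) else \<zero>)"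
      by (rule Vm_pe) (use ij in \<open>auto simp: ks_def\<close>)
    ultimately show ?thesis by simp
  qed
  \<comment> \<open>If r < i, the letter i - r - 1 belongs to the first block only; if s and j
    differ, the letter just past the shorter right end tells the blocks apart.\<close>
  have block: "r = i \<and> s = j" if "r \<le> i" "block i i j = block i r s" for r s
  proof -
    have k: "k \<in> block i i j \<longleftrightarrow> k \<in> block i r s" for k using that(2) by simp
    have "r = i" using k[of "i - Suc r"] k[of 0] that(1) by (cases "r = i") (auto simp: block_def)
    moreover have "\<not> s < j" using k[of "Suc (Suc i) + s"] by (auto simp: block_def)
    moreover have "\<not> j < s" using k[of "Suc (Suc i) + j"] by (auto simp: block_def)
    ultimately show ?thesis by simp
  qed
  have z: "Vm 0 0 ?a ?b r s (pe ks) = \<zero>" if "r \<noteq> i \<or> s \<noteq> j" for r s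
    unfolding V using block[of r s] that by auto
  have A: "?A s r \<in> carrier K" for s r by (rule pair.arr_closed[OF pair.arr_total_arr])
  have "\<zero> = pair.lam ?A (pe ks)" using rep_defect[OF R e_even e_even pe_closed] by simp
  also have "\<dots> = pair.lam1 ?A j (pe ks)"
    unfolding pair.lam_def
  proof (rule fsum_single)
    fix s assume "s \<noteq> j"
    then show "pair.lam1 ?A s (pe ks) = \<zero>" unfolding pair.lam1_def using A z by (intro fsum_zero) simp
  qed (use ij pair.arr_total_arr in auto)
  also have "\<dots> = rsmult M (Vm 0 0 ?a ?b i j (pe ks)) (?A j i)"
    unfolding pair.lam1_def
  proof (rule fsum_single)
    fix r assume "r \<noteq> i"
    then show "rsmult M (Vm 0 0 ?a ?b r j (pe ks)) (?A j r) = \<zero>" using A z by simp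
  qed (use ij A V in \<open>auto intro!: rsmult_closed\<close>)
  also have "\<dots> = ksgn M (of_nat j) (rsmult M (e 0 (Suc (Suc (i + j)))) (?A j i))"
    using A by (simp add: V rsmult_ksgn)
  finally have "ksgn M (of_nat j) \<zero> = ksgn M (of_nat j) (ksgn M (of_nat j) (rsmult M (e 0 (Suc (Suc (i + j)))) (?A j i)))" by simp
  then show ?thesis using A by (simp add: rsmult_closed)
qed

end

section \<open>Matrix units and the coefficients they detect\<close>

context matrix_lie
begin

text \<open>Zero for positions outside the strict upper triangle, so that every pair of indices
  gives an element of the algebra.\<close>

definition unitm :: "nat \<Rightarrow> nat \<Rightarrow> nat \<Rightarrow> 'k"
  where "unitm i j = enc (\<lambda>r s. if r = i \<and> s = j \<and> i < j \<and> j \<le> N then \<one> else \<zero>)"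

lemma unitm_even: "unitm i j \<in> grade L 0"
  unfolding L_grade unitm_def using one_even by (auto simp: umat_def gmat_def)

text \<open>From the left the unit at (k, k + 1) moves row k + 1 to row k, from the right it moves
  column k to column k + 1. All its entries are 0 or 1, so no signs occur.\<close>

lemma bracket_unitm:
  assumes k: "k < N" and y: "y \<in> carrier L"
  shows "dec (bracket L (unitm k (Suc k)) y) r s
    = (if r = k then dec y (Suc k) s else \<zero>) \<ominus> (if s = Suc k then dec y r k else \<zero>)"
proof -
  have Y: "umat (dec y)" using y unfolding L_carrier .
  have "mm (dec (unitm k (Suc k))) (dec y) r s = (\<Oplus>l\<in>{..N}. if Suc k = l then if r = k then dec y l s else \<zero> else \<zero>)"
    unfolding mm_def using k Y by (intro finsum_cong') (auto simp: unitm_def)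
  also have "\<dots> = (if r = k then dec y (Suc k) s else \<zero>)"
    using finsum_singleton[of "Suc k" "{..N}" "\<lambda>l. if r = k then dec y l s else \<zero>"] k Y by simp
  finally have 1: "mm (dec (unitm k (Suc k))) (dec y) r s = (if r = k then dec y (Suc k) s else \<zero>)" .
  have "mt (dec (unitm k (Suc k))) (dec y) r s = (\<Oplus>l\<in>{..N}. if k = l then if s = Suc k then dec y r l else \<zero> else \<zero>)"
    unfolding mt_def using k Y by (intro finsum_cong') (auto simp: unitm_def)
  also have "\<dots> = (if s = Suc k then dec y r k else \<zero>)"
    using finsum_singleton[of k "{..N}" "\<lambda>l. if s = Suc k then dec y r l else \<zero>"] k Y by simp
  finally have 2: "mt (dec (unitm k (Suc k))) (dec y) r s = (if s = Suc k then dec y r k else \<zero>)" .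
  show ?thesis unfolding dec_bracket lb_def 1 2 ..
qed

lemma unitm_brackets:
  "\<lbrakk>Suc k < b; k < N\<rbrakk> \<Longrightarrow> bracket L (unitm k (Suc k)) (unitm (Suc k) b) = unitm k b"
  "\<lbrakk>a < k; k < N\<rbrakk> \<Longrightarrow> bracket L (unitm k (Suc k)) (unitm a k) = \<ominus>\<^bsub>L\<^esub> unitm a (Suc k)"
  "\<lbrakk>a < b; k < N; Suc k \<noteq> a; k \<noteq> b\<rbrakk> \<Longrightarrow> bracket L (unitm k (Suc k)) (unitm a b) = \<zero>\<^bsub>L\<^esub>"
proof -
  have c: "unitm i j \<in> carrier L" for i j using graded_group.grade_closed[OF L_graded_group unitm_even] .
  have u: "dec (unitm i j) r s = (if r = i \<and> s = j \<and> i < j \<and> j \<le> N then \<one> else \<zero>)" for i j r s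
    by (simp add: unitm_def)
  have n: "dec (\<ominus>\<^bsub>L\<^esub> unitm i j) r s = \<ominus> dec (unitm i j) r s" for i j r s
    unfolding L_neg[OF c] by (simp add: dec_def)
  show "bracket L (unitm k (Suc k)) (unitm (Suc k) b) = unitm k b" if "Suc k < b" "k < N"
    by (rule dec_eqI) (use that in \<open>simp only: bracket_unitm[OF that(2) c] u, auto simp: a_minus_def\<close>)
  show "bracket L (unitm k (Suc k)) (unitm a k) = \<ominus>\<^bsub>L\<^esub> unitm a (Suc k)" if "a < k" "k < N"
    by (rule dec_eqI) (use that in \<open>simp only: bracket_unitm[OF that(2) c] n u, auto simp: a_minus_def\<close>)
  show "bracket L (unitm k (Suc k)) (unitm a b) = \<zero>\<^bsub>L\<^esub>" if "a < b" "k < N" "Suc k \<noteq> a" "k \<noteq> b"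
    by (rule dec_eqI) (use that in \<open>simp only: bracket_unitm[OF that(2) c] u L_simps(2) dec_zero, auto simp: a_minus_def\<close>)
qed

text \<open>The relation of \<open>chain_defect\<close> is read off at the entry (0, i + j + 2),
  which is the coefficient itself. The bound on i + j says that this position exists in size N +
  1.\<close>

theorem matrix_defect:
  assumes R: "rep_by_coderivations K L (Phi_map K L N c)" and c: "\<And>n. c n \<in> grade K 0" and ij: "i + j < N - 1"
  shows "arr_total K c N j i = \<zero>"
proof -
  have lc: "lie_chain K L N c unitm"
    using L_lie L_nilpotent c ij unitm_even unitm_brackets
    by (intro lie_chain.intro lie_rep.intro lie_sym.intro sym_base.intro L_supermodule lie_rep_axioms.intro lie_chain_axioms.intro) simp_all
  interpret ch: lie_chain K L N c unitm by (rule lc)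
  \<comment> \<open>The choice of the pair is arbitrary; it provides that the coefficients lie in
    the ground ring.\<close>
  interpret pair: lie_pair K L N 0 0 "unitm 0 1" "unitm 0 1" c by (intro ch.lie_pair unitm_even)
  have A: "arr_total K c N j i \<in> carrier K" by (rule pair.arr_closed[OF pair.arr_total_arr])
  let ?m = "Suc (Suc (i + j))"
  have m: "?m \<le> N" using ij by simp
  have "rsmult L (unitm 0 ?m) (arr_total K c N j i) = \<zero>\<^bsub>L\<^esub>"
    by (rule ch.chain_defect[OF R m])
  then have "dec (rsmult L (unitm 0 ?m) (arr_total K c N j i)) 0 ?m = dec \<zero>\<^bsub>L\<^esub> 0 ?m" by simp
  then have "dec (unitm 0 ?m) 0 ?m \<otimes> arr_total K c N j i = \<zero>" by (simp add: dec_def)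
  then show ?thesis using m A by (simp add: unitm_def)
qed

end

section \<open>The two directions of the equivalence\<close>

lemma (in superpoly) functional_equation_rep:
  assumes P: "P \<in> carrier U" and N: "2 \<le> N" and f: "functional_equation K N P"
    and g: "lie_superalgebra K \<gg>" "lie_nilpotent N \<gg>"
  shows "rep_by_coderivations K \<gg> (Phi_map K \<gg> N (coeff U P))"
proof -
  have "coeff U P n \<in> grade K 0" for n using U.coeff_closed[OF P] by simp
  then have "lie_rep K \<gg> N (coeff U P)"
    using g N
    by (intro lie_rep.intro lie_sym.intro sym_base.intro lie_superalgebra.axioms(1) lie_rep_axioms.intro) simp_all
  then show ?thesis
    by (rule lie_rep.R_rep) (use f in \<open>simp add: functional_equation_iff[OF P]\<close>)
qed

theorem theorem5p4:
  fixes K :: "'k superring"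
    and N :: nat
    and \<phi> :: "(nat \<Rightarrow> 'k) set"
    and P :: "nat \<Rightarrow> 'k"
  assumes "comm_superring K"
    and "2 \<le> N"
    and "\<phi> \<in> carrier (truncated_poly_ring K N)"
    and "P \<in> \<phi>"
  shows "((\<forall>\<gg> :: ('k, nat \<Rightarrow> 'k) lie_super. lie_superalgebra K \<gg> \<and> lie_nilpotent N \<gg>
              \<longrightarrow> rep_by_coderivations K \<gg> (Phi_map K \<gg> N (coeff (UP (even_ring K)) P)))
        \<and> (\<forall>\<gg> :: ('k, 'g) lie_super. lie_superalgebra K \<gg> \<and> lie_nilpotent N \<gg>
              \<longrightarrow> rep_by_coderivations K \<gg> (Phi_map K \<gg> N (coeff (UP (even_ring K)) P))))
     \<longleftrightarrow> functional_equation K N P"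
proof -
  interpret superpoly K by (rule superpoly.intro) (rule assms(1))
  let ?c = "coeff (UP (even_ring K)) P"
  have P: "P \<in> carrier (UP (even_ring K))" using assms(3,4) by (rule representative_closed)
  have c: "?c n \<in> grade K 0" for n using U.coeff_closed[OF P] by simp
  interpret mat: matrix_lie K N by (rule matrix_lie.intro) (rule assms(1))
  show ?thesis (is "?rep1 \<and> ?rep2 \<longleftrightarrow> _")
  proof
    assume "?rep1 \<and> ?rep2"
    \<comment> \<open>The matrix algebra lives on \<open>nat \<Rightarrow> 'k\<close>, so the first
      conjunct applies to it.\<close>
    then have "rep_by_coderivations K mat.L (Phi_map K mat.L N ?c)" using mat.L_lie mat.L_nilpotent by simp
    then show "functional_equation K N P"
      unfolding functional_equation_iff[OF P] by (intro allI impI mat.matrix_defect c)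
  next
    assume f: "functional_equation K N P"
    show "?rep1 \<and> ?rep2" by (intro conjI allI impI; elim conjE; rule functional_equation_rep[OF P assms(2) f])
  qed
qed

end
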